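(* Let $(\mathcal{E},\mathcal{F})$ be a regular Dirichlet form on $L^2(E;m)$. Assume that $(\mathcal{E},\mathcal{F})$ is transient, that $\mu\in\mathcal{S}$ is a smooth measure, and that its potential $R\mu$ belongs to $L^\infty(E;m)$. Let $\{F_\ell\}$ be a (compact) nest attached to $\mu$, that is, $1_{F_\ell}\mu\in\mathcal{S}_0^{(0)}$ for each $\ell\in\mathbb{N}$. Then for all compact sets $K\subset E$ and all $\ell\in\mathbb{N}$, $$\mu(K\cap F_\ell)\le\sqrt{\mathrm{Cap}_{(0)}(K)}\sqrt{\mathcal{E}(U(1_{K\cap F_\ell}\mu),U(1_{K\cap F_\ell}\mu))}$$ and $$\mathcal{E}(U(1_{K\cap F_\ell}\mu),U(1_{K\cap F_\ell}\mu))\le\|R\mu\|_\infty\,\mu(K\cap F_\ell).$$ In particular, $$\mu(K)\le\mathrm{Cap}_{(0)}(K)\,\|R\mu\|_\infty<\infty,$$ and this implies that $\mu$ is a Radon measure.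
   Context: Setting: $E$ is a locally compact separable metric space, $m$ a positive Radon measure on $E$ with full topological support, $(\mathcal{E},\mathcal{F})$ a regular symmetric Dirichlet form on $L^2(E;m)$, $\mathcal{E}_1(f,g)=\mathcal{E}(f,g)+\int_E fg\,dm$, $\mathcal{F}_e$ the extended Dirichlet space, and $X=(X_t,\mathbb{P}_x,\zeta)$ the associated $m$-symmetric Hunt process with lifetime $\zeta$. $C_c$ is the space of continuous functions with compact support. $\|\cdot\|_\infty$ is the $m$-essential supremum norm. Capacity: for open $A$, $\mathrm{Cap}(A)=\inf\{\mathcal{E}_1(u,u):u\in\mathcal{F},\,u\ge1\ m\text{-a.e. on }A\}$ ($\inf\emptyset=\infty$), and $\mathrm{Cap}(B)=\inf\{\mathrm{Cap}(A):A\supset B\text{ open}\}$ for general $B$. In the transient case the $0$-order capacity $\mathrm{Cap}_{(0)}$ is defined in the same way with $\mathcal{E}$ and $\mathcal{F}_e$ in place of $\mathcal{E}_1$ and $\mathcal{F}$. A compact nest is an increasing sequence $\{F_k\}$ of compact sets with $\mathrm{Cap}(K\setminus F_k)\to0$ for every compact $K$. A positive Borel measure $\mu$ is smooth ($\mu\in\mathcal{S}$) if it charges no set of zero capacity and there is a compact nest $\{F_k\}$ with $\mu(F_k)<\infty$ for all $k$. Each $\mu\in\mathcal{S}$ corresponds uniquely (up to equivalence) to a positive continuous additive functional (PCAF) $A^\mu$ via the Revuz correspondence $\mathbb{E}_{hm}[\int_0^\infty e^{-\alpha s}f(X_s)\,dA^\mu_s]=\int_E f\,R_\alpha h\,d\mu$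 for all nonnegative Borel $f,h$, where $R_\alpha h(x)=\mathbb{E}_x[\int_0^\infty e^{-\alpha t}h(X_t)dt]$. Put $R\mu(x)=\mathbb{E}_x[A^\mu_\zeta]$. $\mathcal{S}_0^{(0)}$ ($0$-order finite energy integrals): Radon measures $\nu$ for which there is $C>0$ with $\int|f|d\nu\le C\sqrt{\mathcal{E}(f,f)}$ for all $f\in\mathcal{F}\cap C_c$; for such $\nu$, $U\nu=U_0\nu\in\mathcal{F}_e$ is the element with $\mathcal{E}(f,U\nu)=\int\tilde f\,d\nu$ for all $f\in\mathcal{F}_e$ ($\tilde f$ a quasi-continuous version). *)

theory Defs
  imports "HOL-Probability.Probability"
begin

section \<open>Radon measures and function spaces\<close>

definition radon_measure :: "'a::topological_space measure \<Rightarrow> bool" where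
  "radon_measure \<mu> \<longleftrightarrow>
     sets \<mu> = sets borel \<and>
     (\<forall>K. compact K \<longrightarrow> emeasure \<mu> K < \<infinity>) \<and>
     (\<forall>B\<in>sets borel. emeasure \<mu> B = (SUP K\<in>{K. compact K \<and> K \<subseteq> B}. emeasure \<mu> K))"

definition full_support :: "'a::topological_space measure \<Rightarrow> bool" where
  "full_support m \<longleftrightarrow> (\<forall>U. open U \<longrightarrow> U \<noteq> {} \<longrightarrow> 0 < emeasure m U)"

text \<open>Elements of function spaces are functions, not equivalence classes modulo null sets.\<close>

definition L2 :: "'a measure \<Rightarrow> ('a \<Rightarrow> real) set" where
  "L2 m = {f \<in> borel_measurable m. integrable m (\<lambda>x. (f x)\<^sup>2)}"

definition Cc :: "('a::topological_space \<Rightarrow> real) set" where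
  "Cc = {f. continuous_on UNIV f \<and> compact (closure {x. f x \<noteq> 0})}"

definition ennreal_sqrt :: "ennreal \<Rightarrow> ennreal" where
  "ennreal_sqrt c = (if c = \<infinity> then \<infinity> else ennreal (sqrt (enn2real c)))"

section \<open>Symmetric Dirichlet forms\<close>

definition form_alpha ::
    "'a measure \<Rightarrow> (('a \<Rightarrow> real) \<Rightarrow> ('a \<Rightarrow> real) \<Rightarrow> real) \<Rightarrow> real \<Rightarrow> ('a \<Rightarrow> real) \<Rightarrow> ('a \<Rightarrow> real) \<Rightarrow> real"
  where "form_alpha m \<E> \<alpha> f g = \<E> f g + \<alpha> * (\<integral>x. f x * g x \<partial>m)"

definition form_Cauchy ::
    "(('a \<Rightarrow> real) \<Rightarrow> ('a \<Rightarrow> real) \<Rightarrow> real) \<Rightarrow> (nat \<Rightarrow> 'a \<Rightarrow> real) \<Rightarrow> bool" where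
  "form_Cauchy Q u \<longleftrightarrow>
     (\<forall>e>0. \<exists>N. \<forall>i\<ge>N. \<forall>j\<ge>N. Q (\<lambda>x. u i x - u j x) (\<lambda>x. u i x - u j x) < e)"

text \<open>The assumptions \<open>dom_AE\<close> and \<open>form_AE\<close> say that domain and form
  live on the quotient modulo equality \<open>m\<close>-a.e.\<close>

locale dirichlet_form =
  fixes m :: "'a::topological_space measure"
    and \<F> :: "('a \<Rightarrow> real) set"
    and \<E> :: "('a \<Rightarrow> real) \<Rightarrow> ('a \<Rightarrow> real) \<Rightarrow> real"
  assumes dom_L2: "\<F> \<subseteq> L2 m"
    and dom_AE: "\<lbrakk>f \<in> \<F>; g \<in> borel_measurable m; AE x in m. f x = g x\<rbrakk> \<Longrightarrow> g \<in> \<F>"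
    and form_AE: "\<lbrakk>f \<in> \<F>; g \<in> \<F>; h \<in> \<F>; AE x in m. f x = g x\<rbrakk> \<Longrightarrow> \<E> f h = \<E> g h"
    and dom_zero: "(\<lambda>_. 0) \<in> \<F>"
    and dom_add: "\<lbrakk>f \<in> \<F>; g \<in> \<F>\<rbrakk> \<Longrightarrow> (\<lambda>x. f x + g x) \<in> \<F>"
    and dom_scale: "f \<in> \<F> \<Longrightarrow> (\<lambda>x. c * f x) \<in> \<F>"
    and dom_dense: "\<lbrakk>f \<in> L2 m; e > 0\<rbrakk> \<Longrightarrow> \<exists>g\<in>\<F>. (\<integral>x. (f x - g x)\<^sup>2 \<partial>m) < e"
    and form_sym: "\<lbrakk>f \<in> \<F>; g \<in> \<F>\<rbrakk> \<Longrightarrow> \<E> f g = \<E> g f"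
    and form_add: "\<lbrakk>f \<in> \<F>; g \<in> \<F>; h \<in> \<F>\<rbrakk> \<Longrightarrow> \<E> (\<lambda>x. f x + g x) h = \<E> f h + \<E> g h"
    and form_scale: "\<lbrakk>f \<in> \<F>; g \<in> \<F>\<rbrakk> \<Longrightarrow> \<E> (\<lambda>x. c * f x) g = c * \<E> f g"
    and form_nonneg: "f \<in> \<F> \<Longrightarrow> 0 \<le> \<E> f f"
    and form_closed: "\<lbrakk>\<And>n. u n \<in> \<F>; form_Cauchy (form_alpha m \<E> 1) u\<rbrakk> \<Longrightarrow>
          \<exists>v\<in>\<F>. (\<lambda>n. form_alpha m \<E> 1 (\<lambda>x. u n x - v x) (\<lambda>x. u n x - v x)) \<longlonglongrightarrow> 0"
    and unit_contraction: "f \<in> \<F> \<Longrightarrow> (\<lambda>x. min 1 (max 0 (f x))) \<in> \<F> \<and>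
          \<E> (\<lambda>x. min 1 (max 0 (f x))) (\<lambda>x. min 1 (max 0 (f x))) \<le> \<E> f f"

locale regular_dirichlet_form = dirichlet_form +
  assumes core_dense_dom: "\<lbrakk>f \<in> \<F>; e > 0\<rbrakk> \<Longrightarrow>
          \<exists>g\<in>\<F> \<inter> Cc. form_alpha m \<E> 1 (\<lambda>x. f x - g x) (\<lambda>x. f x - g x) < e"
    and core_dense_Cc: "\<lbrakk>f \<in> Cc; e > 0\<rbrakk> \<Longrightarrow> \<exists>g\<in>\<F> \<inter> Cc. \<forall>x. \<bar>f x - g x\<bar> < e"

text \<open>Transience is the existence of a reference function.\<close>

definition transient_form ::
    "'a measure \<Rightarrow> ('a \<Rightarrow> real) set \<Rightarrow> (('a \<Rightarrow> real) \<Rightarrow> ('a \<Rightarrow> real) \<Rightarrow> real) \<Rightarrow> bool" where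
  "transient_form m \<F> \<E> \<longleftrightarrow>
     (\<exists>g. integrable m g \<and> bounded (range g) \<and> (AE x in m. 0 < g x) \<and>
        (\<forall>u\<in>\<F>. (\<integral>\<^sup>+x. ennreal (\<bar>u x\<bar> * g x) \<partial>m) \<le> ennreal (sqrt (\<E> u u))))"

subsection \<open>The extended Dirichlet space\<close>

definition approximating ::
    "'a measure \<Rightarrow> ('a \<Rightarrow> real) set \<Rightarrow> (('a \<Rightarrow> real) \<Rightarrow> ('a \<Rightarrow> real) \<Rightarrow> real) \<Rightarrow>
     (nat \<Rightarrow> 'a \<Rightarrow> real) \<Rightarrow> ('a \<Rightarrow> real) \<Rightarrow> bool" where
  "approximating m \<F> \<E> u f \<longleftrightarrow>
     (\<forall>n. u n \<in> \<F>) \<and> form_Cauchy \<E> u \<and> (AE x in m. (\<lambda>n. u n x) \<longlonglongrightarrow> f x)"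

definition ext_dom ::
    "'a measure \<Rightarrow> ('a \<Rightarrow> real) set \<Rightarrow> (('a \<Rightarrow> real) \<Rightarrow> ('a \<Rightarrow> real) \<Rightarrow> real) \<Rightarrow> ('a \<Rightarrow> real) set" where
  "ext_dom m \<F> \<E> = {f \<in> borel_measurable m. \<exists>u. approximating m \<F> \<E> u f}"

definition ext_form ::
    "'a measure \<Rightarrow> ('a \<Rightarrow> real) set \<Rightarrow> (('a \<Rightarrow> real) \<Rightarrow> ('a \<Rightarrow> real) \<Rightarrow> real) \<Rightarrow>
     ('a \<Rightarrow> real) \<Rightarrow> ('a \<Rightarrow> real) \<Rightarrow> real" where
  "ext_form m \<F> \<E> f g =
     (THE c. \<forall>u v. approximating m \<F> \<E> u f \<longrightarrow> approximating m \<F> \<E> v g \<longrightarrow>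
        (\<lambda>n. \<E> (u n) (v n)) \<longlonglongrightarrow> c)"

subsection \<open>Capacity and quasi-continuity\<close>

definition capacity ::
    "'a::topological_space measure \<Rightarrow> ('a \<Rightarrow> real) set \<Rightarrow> (('a \<Rightarrow> real) \<Rightarrow> ('a \<Rightarrow> real) \<Rightarrow> real) \<Rightarrow>
     'a set \<Rightarrow> ennreal" where
  "capacity m V Q B =
     (INF A\<in>{A. open A \<and> B \<subseteq> A}.
        INF u\<in>{u \<in> V. AE x in m. x \<in> A \<longrightarrow> 1 \<le> u x}. ennreal (Q u u))"

definition Cap ::
    "'a::topological_space measure \<Rightarrow> ('a \<Rightarrow> real) set \<Rightarrow> (('a \<Rightarrow> real) \<Rightarrow> ('a \<Rightarrow> real) \<Rightarrow> real) \<Rightarrow>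
     'a set \<Rightarrow> ennreal" where
  "Cap m \<F> \<E> = capacity m \<F> (form_alpha m \<E> 1)"

definition Cap0 ::
    "'a::topological_space measure \<Rightarrow> ('a \<Rightarrow> real) set \<Rightarrow> (('a \<Rightarrow> real) \<Rightarrow> ('a \<Rightarrow> real) \<Rightarrow> real) \<Rightarrow>
     'a set \<Rightarrow> ennreal" where
  "Cap0 m \<F> \<E> = capacity m (ext_dom m \<F> \<E>) (ext_form m \<F> \<E>)"

definition quasi_continuous ::
    "'a::topological_space measure \<Rightarrow> ('a \<Rightarrow> real) set \<Rightarrow> (('a \<Rightarrow> real) \<Rightarrow> ('a \<Rightarrow> real) \<Rightarrow> real) \<Rightarrow>
     ('a \<Rightarrow> real) \<Rightarrow> bool" where
  "quasi_continuous m \<F> \<E> g \<longleftrightarrow>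
     (\<forall>e>0. \<exists>G. open G \<and> Cap m \<F> \<E> G < ennreal e \<and> continuous_on (- G) g)"

text \<open>Versions are taken Borel measurable, so that their integrals with respect to Borel measures
  are not affected by the convention that non-measurable functions have integral 0.\<close>

definition qc_version ::
    "'a::topological_space measure \<Rightarrow> ('a \<Rightarrow> real) set \<Rightarrow> (('a \<Rightarrow> real) \<Rightarrow> ('a \<Rightarrow> real) \<Rightarrow> real) \<Rightarrow>
     ('a \<Rightarrow> real) \<Rightarrow> ('a \<Rightarrow> real) \<Rightarrow> bool" where
  "qc_version m \<F> \<E> f g \<longleftrightarrow>
     g \<in> borel_measurable borel \<and> quasi_continuous m \<F> \<E> g \<and> (AE x in m. g x = f x)"

subsection \<open>Smooth measures, measures of finite energy and their potentials\<close>

definition compact_nest ::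
    "'a::topological_space measure \<Rightarrow> ('a \<Rightarrow> real) set \<Rightarrow> (('a \<Rightarrow> real) \<Rightarrow> ('a \<Rightarrow> real) \<Rightarrow> real) \<Rightarrow>
     (nat \<Rightarrow> 'a set) \<Rightarrow> bool" where
  "compact_nest m \<F> \<E> F \<longleftrightarrow>
     incseq F \<and> (\<forall>k. compact (F k)) \<and>
     (\<forall>K. compact K \<longrightarrow> (\<lambda>k. Cap m \<F> \<E> (K - F k)) \<longlonglongrightarrow> 0)"

definition smooth_measure ::
    "'a::topological_space measure \<Rightarrow> ('a \<Rightarrow> real) set \<Rightarrow> (('a \<Rightarrow> real) \<Rightarrow> ('a \<Rightarrow> real) \<Rightarrow> real) \<Rightarrow>
     'a measure \<Rightarrow> bool" where
  "smooth_measure m \<F> \<E> \<mu> \<longleftrightarrow>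
     sets \<mu> = sets borel \<and>
     (\<forall>B\<in>sets borel. Cap m \<F> \<E> B = 0 \<longrightarrow> emeasure \<mu> B = 0) \<and>
     (\<exists>F. compact_nest m \<F> \<E> F \<and> (\<forall>k. emeasure \<mu> (F k) < \<infinity>))"

definition finite_energy0 ::
    "('a::topological_space \<Rightarrow> real) set \<Rightarrow> (('a \<Rightarrow> real) \<Rightarrow> ('a \<Rightarrow> real) \<Rightarrow> real) \<Rightarrow> 'a measure \<Rightarrow> bool" where
  "finite_energy0 \<F> \<E> \<nu> \<longleftrightarrow>
     radon_measure \<nu> \<and>
     (\<exists>C>0. \<forall>f\<in>\<F> \<inter> Cc. (\<integral>\<^sup>+x. ennreal \<bar>f x\<bar> \<partial>\<nu>) \<le> ennreal (C * sqrt (\<E> f f)))"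

definition potential0 ::
    "'a::topological_space measure \<Rightarrow> ('a \<Rightarrow> real) set \<Rightarrow> (('a \<Rightarrow> real) \<Rightarrow> ('a \<Rightarrow> real) \<Rightarrow> real) \<Rightarrow>
     'a measure \<Rightarrow> 'a \<Rightarrow> real" where
  "potential0 m \<F> \<E> \<nu> =
     (SOME u. u \<in> ext_dom m \<F> \<E> \<and>
        (\<forall>f\<in>ext_dom m \<F> \<E>. \<forall>g. qc_version m \<F> \<E> f g \<longrightarrow>
           integrable \<nu> g \<and> ext_form m \<F> \<E> f u = (\<integral>x. g x \<partial>\<nu>)))"

abbreviation restrict_to :: "'a set \<Rightarrow> 'a measure \<Rightarrow> 'a measure" where
  "restrict_to B \<mu> \<equiv> density \<mu> (indicator B)"

section \<open>Hunt processes\<close>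

text \<open>The cemetery is \<open>None\<close>, and the time set is \<open>[0,\<infinity>]\<close>, with
  \<open>X\<^sub>\<infinity> = None\<close>. The one-point compactification of the state space is
  \<open>Alexandroff_compactification euclidean\<close>; when the state space is compact, \<open>None\<close> is an
  isolated point of it.\<close>

definition borel_cem :: "'a::topological_space option measure" where
  "borel_cem = sigma UNIV {B. Some -` B \<in> sets borel}"

definition history :: "'w measure \<Rightarrow> (ennreal \<Rightarrow> 'w \<Rightarrow> 'a::topological_space option) \<Rightarrow> ennreal \<Rightarrow> 'w measure"
  where "history M X t =
     sigma (space M) {X s -` B \<inter> space M | s B. s \<le> t \<and> B \<in> sets borel_cem}"

definition initial_laws :: "'a::topological_space option measure set" where
  "initial_laws = {\<nu>. prob_space \<nu> \<and> sets \<nu> = sets borel_cem}"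

definition law ::
    "'w measure \<Rightarrow> ('a option \<Rightarrow> 'w measure) \<Rightarrow> (ennreal \<Rightarrow> 'w \<Rightarrow> 'a::topological_space option) \<Rightarrow>
     'a option measure \<Rightarrow> 'w measure" where
  "law M P X \<nu> =
     measure_of (space M) (sets (history M X \<infinity>)) (\<lambda>\<Lambda>. \<integral>\<^sup>+x. emeasure (P x) \<Lambda> \<partial>\<nu>)"

text \<open>The minimum completed admissible filtration: \<open>\<Lambda>\<close> belongs to it at time \<open>t\<close> if, for every
  initial law, it differs from an event of the history up to \<open>t\<close> by a null set of the full
  history.\<close>

definition completed_filtration ::
    "'w measure \<Rightarrow> ('a option \<Rightarrow> 'w measure) \<Rightarrow> (ennreal \<Rightarrow> 'w \<Rightarrow> 'a::topological_space option) \<Rightarrow>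
     ennreal \<Rightarrow> 'w measure" where
  "completed_filtration M P X t =
     sigma (space M)
       {\<Lambda>. \<Lambda> \<subseteq> space M \<and>
          (\<forall>\<nu>\<in>initial_laws. \<exists>\<Lambda>'\<in>sets (history M X t). \<exists>N\<in>null_sets (law M P X \<nu>).
             (\<Lambda> - \<Lambda>') \<union> (\<Lambda>' - \<Lambda>) \<subseteq> N)}"

definition lifetime :: "(ennreal \<Rightarrow> 'w \<Rightarrow> 'a option) \<Rightarrow> 'w \<Rightarrow> ennreal" where
  "lifetime X \<omega> = Inf {t. X t \<omega> = None}"

locale hunt_process =
  fixes M :: "'w measure"
    and P :: "'a::topological_space option \<Rightarrow> 'w measure"
    and X :: "ennreal \<Rightarrow> 'w \<Rightarrow> 'a option"
    and \<theta> :: "ennreal \<Rightarrow> 'w \<Rightarrow> 'w"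
  assumes prob_P: "prob_space (P x)"
    and sets_P: "sets (P x) = sets M"
    and measurable_X: "X t \<in> M \<rightarrow>\<^sub>M borel_cem"
    and kernel: "B \<in> sets borel_cem \<Longrightarrow>
          (\<lambda>x. emeasure (P x) (X t -` B \<inter> space M)) \<in> borel_measurable borel_cem"
    and normal: "AE \<omega> in P x. X 0 \<omega> = x"
    and cemetery: "AE \<omega> in P None. X t \<omega> = None"
    and at_infinity: "\<omega> \<in> space M \<Longrightarrow> X \<infinity> \<omega> = None"
    and absorbed: "\<lbrakk>\<omega> \<in> space M; lifetime X \<omega> \<le> t\<rbrakk> \<Longrightarrow> X t \<omega> = None"
    and shift_space: "\<omega> \<in> space M \<Longrightarrow> \<theta> t \<omega> \<in> space M"
    and shift: "\<omega> \<in> space M \<Longrightarrow> X s (\<theta> t \<omega>) = X (s + t) \<omega>"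
    and right_continuous: "\<lbrakk>\<omega> \<in> space M; t < \<infinity>\<rbrakk> \<Longrightarrow>
          limitin (Alexandroff_compactification euclidean) (\<lambda>s. X s \<omega>) (X t \<omega>) (at_right t)"
    and left_limits: "\<lbrakk>\<omega> \<in> space M; 0 < t; t < \<infinity>\<rbrakk> \<Longrightarrow>
          \<exists>l. limitin (Alexandroff_compactification euclidean) (\<lambda>s. X s \<omega>) l (at_left t)"
    and filtration_right_continuous: "t < \<infinity> \<Longrightarrow>
          sets (completed_filtration M P X t) = (\<Inter>s\<in>{t<..}. sets (completed_filtration M P X s))"
    and strong_Markov:
      "\<lbrakk>\<nu> \<in> initial_laws; stopping_time (completed_filtration M P X) \<sigma>;
        \<Lambda> \<in> sets (filtration.pre_sigma (space M) (completed_filtration M P X) \<sigma>);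
        B \<in> sets borel_cem\<rbrakk> \<Longrightarrow>
          emeasure (completion (law M P X \<nu>)) {\<omega>\<in>\<Lambda>. X (\<sigma> \<omega> + s) \<omega> \<in> B} =
          (\<integral>\<^sup>+\<omega>\<in>\<Lambda>. emeasure (P (X (\<sigma> \<omega>) \<omega>)) (X s -` B \<inter> space M) \<partial>completion (law M P X \<nu>))"
    and quasi_left_continuous:
      "\<lbrakk>\<nu> \<in> initial_laws; \<And>n. stopping_time (completed_filtration M P X) (\<tau> n);
        \<And>\<omega>. \<omega> \<in> space M \<Longrightarrow> incseq (\<lambda>n. \<tau> n \<omega>)\<rbrakk> \<Longrightarrow>
          AE \<omega> in law M P X \<nu>. (SUP n. \<tau> n \<omega>) < \<infinity> \<longrightarrow>
            limitin (Alexandroff_compactification euclidean) (\<lambda>n. X (\<tau> n \<omega>) \<omega>)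
              (X (SUP n. \<tau> n \<omega>) \<omega>) sequentially"

text \<open>Functions on the state space are extended by 0 to the cemetery.\<close>

definition ext_cem :: "('a \<Rightarrow> ennreal) \<Rightarrow> 'a option \<Rightarrow> ennreal" where
  "ext_cem f z = (case z of None \<Rightarrow> 0 | Some x \<Rightarrow> f x)"

definition transition ::
    "('a option \<Rightarrow> 'w measure) \<Rightarrow> (ennreal \<Rightarrow> 'w \<Rightarrow> 'a option) \<Rightarrow> ennreal \<Rightarrow>
     ('a \<Rightarrow> ennreal) \<Rightarrow> 'a \<Rightarrow> ennreal" where
  "transition P X t f x = (\<integral>\<^sup>+\<omega>. ext_cem f (X t \<omega>) \<partial>P (Some x))"

definition resolvent ::
    "('a option \<Rightarrow> 'w measure) \<Rightarrow> (ennreal \<Rightarrow> 'w \<Rightarrow> 'a option) \<Rightarrow> real \<Rightarrow>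
     ('a \<Rightarrow> ennreal) \<Rightarrow> 'a \<Rightarrow> ennreal" where
  "resolvent P X \<alpha> h x =
     (\<integral>\<^sup>+\<omega>. (\<integral>\<^sup>+t\<in>{0..}. ennreal (exp (- \<alpha> * t)) * ext_cem h (X (ennreal t) \<omega>) \<partial>lborel) \<partial>P (Some x))"

definition symmetric_process ::
    "'a::topological_space measure \<Rightarrow> ('a option \<Rightarrow> 'w measure) \<Rightarrow> (ennreal \<Rightarrow> 'w \<Rightarrow> 'a option) \<Rightarrow> bool" where
  "symmetric_process m P X \<longleftrightarrow>
     (\<forall>t<\<infinity>. \<forall>f\<in>borel_measurable borel. \<forall>g\<in>borel_measurable borel.
        (\<integral>\<^sup>+x. f x * transition P X t g x \<partial>m) = (\<integral>\<^sup>+x. transition P X t f x * g x \<partial>m))"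

text \<open>A process is associated with the form if its resolvent is a version of the \<open>L\<^sup>2\<close>-resolvent
  \<open>G\<^sub>\<alpha>\<close> of the form, the latter being determined by \<open>\<E>\<^sub>\<alpha>(G\<^sub>\<alpha> f, g) = (f, g)\<close> for all \<open>g\<close> in
  the domain. By linearity it suffices to consider nonnegative \<open>f\<close>.\<close>

definition associated_process ::
    "'a::topological_space measure \<Rightarrow> ('a \<Rightarrow> real) set \<Rightarrow> (('a \<Rightarrow> real) \<Rightarrow> ('a \<Rightarrow> real) \<Rightarrow> real) \<Rightarrow>
     ('a option \<Rightarrow> 'w measure) \<Rightarrow> (ennreal \<Rightarrow> 'w \<Rightarrow> 'a option) \<Rightarrow> bool" where
  "associated_process m \<F> \<E> P X \<longleftrightarrow>
     (\<forall>\<alpha>>0. \<forall>f\<in>L2 m. (\<forall>x. 0 \<le> f x) \<longrightarrow>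
        (\<exists>u\<in>\<F>. (\<forall>g\<in>\<F>. form_alpha m \<E> \<alpha> u g = (\<integral>x. f x * g x \<partial>m)) \<and>
           (AE x in m. resolvent P X \<alpha> (\<lambda>y. ennreal (f y)) x = ennreal (u x))))"

section \<open>Positive continuous additive functionals and the Revuz correspondence\<close>

text \<open>Continuity is required on \<open>[0,\<infinity>]\<close> with values in \<open>[0,\<infinity>]\<close>. At time
  \<open>\<infinity>\<close> this is the convention that \<open>A\<^sub>\<infinity>\<close> is the limit of \<open>A\<^sub>t\<close>.\<close>

definition pcaf ::
    "'a::topological_space measure \<Rightarrow> ('a \<Rightarrow> real) set \<Rightarrow> (('a \<Rightarrow> real) \<Rightarrow> ('a \<Rightarrow> real) \<Rightarrow> real) \<Rightarrow>
     'w measure \<Rightarrow> ('a option \<Rightarrow> 'w measure) \<Rightarrow> (ennreal \<Rightarrow> 'w \<Rightarrow> 'a option) \<Rightarrow> (ennreal \<Rightarrow> 'w \<Rightarrow> 'w) \<Rightarrow>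
     (ennreal \<Rightarrow> 'w \<Rightarrow> ennreal) \<Rightarrow> bool" where
  "pcaf m \<F> \<E> M P X \<theta> A \<longleftrightarrow>
     (\<forall>t. A t \<in> completed_filtration M P X t \<rightarrow>\<^sub>M borel) \<and>
     (\<exists>\<Lambda>\<in>sets (completed_filtration M P X \<infinity>). \<exists>N.
        Cap m \<F> \<E> N = 0 \<and>
        (\<forall>x. x \<notin> N \<longrightarrow> (AE \<omega> in P (Some x). \<omega> \<in> \<Lambda>)) \<and>
        (\<forall>t. 0 < t \<longrightarrow> t < \<infinity> \<longrightarrow> \<theta> t ` \<Lambda> \<subseteq> \<Lambda>) \<and>
        (\<forall>\<omega>\<in>\<Lambda>.
           A 0 \<omega> = 0 \<and>
           continuous_on UNIV (\<lambda>t. A t \<omega>) \<and>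
           (\<forall>t<lifetime X \<omega>. A t \<omega> < \<infinity>) \<and>
           (\<forall>t\<ge>lifetime X \<omega>. A t \<omega> = A (lifetime X \<omega>) \<omega>) \<and>
           (\<forall>s<\<infinity>. \<forall>t<\<infinity>. A (t + s) \<omega> = A s \<omega> + A t (\<theta> s \<omega>))))"

text \<open>The integral over \<open>[0,\<zeta>)\<close> against \<open>dA\<close>. Since \<open>A\<close> may become infinite at
  \<open>\<zeta>\<close>, it is the supremum of the integrals over \<open>[0,T]\<close> for \<open>T < \<zeta>\<close>, each of them a
  Stieltjes integral with respect to the path of \<open>A\<close> stopped at \<open>T\<close>.\<close>

definition pcaf_integral ::
    "(ennreal \<Rightarrow> 'w \<Rightarrow> 'a option) \<Rightarrow> (ennreal \<Rightarrow> 'w \<Rightarrow> ennreal) \<Rightarrow> (real \<Rightarrow> ennreal) \<Rightarrow> 'w \<Rightarrow> ennreal" where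
  "pcaf_integral X A g \<omega> =
     (SUP T\<in>{T. 0 \<le> T \<and> ennreal T < lifetime X \<omega>}.
        \<integral>\<^sup>+s. g s \<partial>interval_measure (\<lambda>s. if s \<le> 0 then 0 else enn2real (A (ennreal (min s T)) \<omega>)))"

definition revuz_correspondence ::
    "'a::topological_space measure \<Rightarrow> ('a option \<Rightarrow> 'w measure) \<Rightarrow> (ennreal \<Rightarrow> 'w \<Rightarrow> 'a option) \<Rightarrow>
     (ennreal \<Rightarrow> 'w \<Rightarrow> ennreal) \<Rightarrow> 'a measure \<Rightarrow> bool" where
  "revuz_correspondence m P X A \<mu> \<longleftrightarrow>
     (\<forall>\<alpha>>0. \<forall>f\<in>borel_measurable borel. \<forall>h\<in>borel_measurable borel.
        (\<integral>\<^sup>+x. h x *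
            (\<integral>\<^sup>+\<omega>. pcaf_integral X A (\<lambda>s. ennreal (exp (- \<alpha> * s)) * ext_cem f (X (ennreal s) \<omega>)) \<omega>
              \<partial>P (Some x)) \<partial>m) =
        (\<integral>\<^sup>+x. f x * resolvent P X \<alpha> h x \<partial>\<mu>))"

definition pcaf_potential ::
    "('a option \<Rightarrow> 'w measure) \<Rightarrow> (ennreal \<Rightarrow> 'w \<Rightarrow> 'a option) \<Rightarrow> (ennreal \<Rightarrow> 'w \<Rightarrow> ennreal) \<Rightarrow> 'a \<Rightarrow> ennreal" where
  "pcaf_potential P X A x = (\<integral>\<^sup>+\<omega>. A (lifetime X \<omega>) \<omega> \<partial>P (Some x))"

text \<open>The completion is needed because expectations of functionals measurable with respect to the
  completed filtration are universally measurable, but in general not Borel measurable, functions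
  of the starting point, while \<open>esssup\<close> is infinite for non-measurable functions.\<close>

definition Linf_norm :: "'a measure \<Rightarrow> ('a \<Rightarrow> ennreal) \<Rightarrow> ennreal" where
  "Linf_norm m f = esssup (completion m) f"

end

theory Submission
  imports Defs
begin

text \<open>
  Let \<open>\<nu> = 1\<^sub>K\<^sub>\<inter>\<^sub>F\<^sub>l \<mu>\<close>, let \<open>U\<close> be its potential and \<open>c\<close> the essential supremum of \<open>R\<mu>\<close>; write \<open>E\<close> for the state
  space.

  The first inequality is the Cauchy-Schwarz inequality. If \<open>u\<close> in the extended Dirichlet space is at least
  1 almost everywhere on an open neighbourhood of \<open>K\<close>, then a quasi-continuous version of \<open>u\<close> is at least 1
  there up to capacity zero, and its integral against \<open>\<nu>\<close> is \<open>\<E>(u, U)\<close>. So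
  \<open>\<nu>(E)\<^sup>2 \<le> \<E>(u, u) \<E>(U, U)\<close> (\<open>mass_le_potential_energy\<close>).

  For the second inequality, the Revuz formula for \<open>f = 1\<^sub>K\<^sub>\<inter>\<^sub>F\<^sub>l\<close> yields \<open>\<integral>R\<^sub>\<alpha> h d\<nu> \<le> c \<integral>h dm\<close>, because the
  functionals in it do not exceed \<open>A\<^sub>\<zeta>\<close>. Thus the measure \<open>\<nu> R\<^sub>\<alpha>\<close> has a density \<open>v \<le> c\<close> with respect to \<open>m\<close>. By
  the resolvent equation the function \<open>w = \<gamma> R\<^sub>\<gamma> v\<close>, which also takes values in \<open>[0, c]\<close>, satisfies
  \<open>\<E>\<^sub>\<alpha>(w, g) = \<gamma> \<integral>R\<^sub>\<gamma> g d\<nu>\<close> for \<open>g \<ge> 0\<close> in the domain. Hence \<open>\<E>\<^sub>\<alpha>(w, w) \<le> c \<nu>(E)\<close>, and the square of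
  \<open>\<gamma> \<integral>R\<^sub>\<gamma> \<phi> d\<nu>\<close> is at most \<open>c \<nu>(E) \<E>\<^sub>\<alpha>(\<phi>, \<phi>)\<close>. For continuous \<open>\<phi>\<close> with compact support, \<open>\<gamma> R\<^sub>\<gamma> \<phi>\<close> tends to \<open>\<phi>\<close>
  at every point, since paths are right continuous. Letting \<open>\<gamma> \<rightarrow> \<infinity>\<close> and \<open>\<alpha> \<rightarrow> 0\<close> gives
  \<open>(\<integral>\<phi> d\<nu>)\<^sup>2 \<le> c \<nu>(E) \<E>(\<phi>, \<phi>)\<close> on the core (\<open>core_integral_le_energy\<close>), which says that \<open>\<E>(U, U) \<le> c \<nu>(E)\<close>
  (\<open>potential_energy_le\<close>).

  The two inequalities together give \<open>\<nu>(E) \<le> Cap\<^sub>0(K) c\<close>. As \<open>l \<rightarrow> \<infinity>\<close> the left side tends to \<open>\<mu>(K)\<close>, because the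
  nest exhausts \<open>K\<close> up to capacity zero.

  Three facts about transient forms support this: the form is closable for convergence almost everywhere
  (\<open>form_closable\<close>), so that it extends to the extended Dirichlet space; elements of that space have
  quasi-continuous versions, which are limits of core functions up to capacity zero
  (\<open>core_quasi_limit\<close>); and measures of finite energy have potentials (\<open>potential_exists\<close>). Behind all three is
  the same elementary substitute for weak compactness, \<open>tail_midpoints_Cauchy\<close>.
\<close>

section \<open>Semi-inner products on spaces of functions\<close>

text \<open>The elements are functions and not equivalence classes, so \<open>Q\<close> may be degenerate. The form, the
  forms with an added multiple of the \<open>L\<^sup>2\<close>-product and that product itself all live on sets of functions
  on the same space, which is why the carrier is explicit.\<close>

locale semi_inner =
  fixes V :: "('a \<Rightarrow> real) set" and Q :: "('a \<Rightarrow> real) \<Rightarrow> ('a \<Rightarrow> real) \<Rightarrow> real"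
  assumes zero_mem: "(\<lambda>_. 0) \<in> V"
    and add_mem: "\<lbrakk>f \<in> V; g \<in> V\<rbrakk> \<Longrightarrow> (\<lambda>x. f x + g x) \<in> V"
    and scale_mem: "f \<in> V \<Longrightarrow> (\<lambda>x. c * f x) \<in> V"
    and sym: "\<lbrakk>f \<in> V; g \<in> V\<rbrakk> \<Longrightarrow> Q f g = Q g f"
    and add_left: "\<lbrakk>f \<in> V; g \<in> V; h \<in> V\<rbrakk> \<Longrightarrow> Q (\<lambda>x. f x + g x) h = Q f h + Q g h"
    and scale_left: "\<lbrakk>f \<in> V; g \<in> V\<rbrakk> \<Longrightarrow> Q (\<lambda>x. c * f x) g = c * Q f g"
    and nonneg: "f \<in> V \<Longrightarrow> 0 \<le> Q f f"
begin

abbreviation normsq :: "('a \<Rightarrow> real) \<Rightarrow> real" where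
  "normsq f \<equiv> Q f f"

lemma add_right: "\<lbrakk>f \<in> V; g \<in> V; h \<in> V\<rbrakk> \<Longrightarrow> Q h (\<lambda>x. f x + g x) = Q h f + Q h g"
  using add_left[of f g h] add_mem[of f g] by (simp add: sym[of h])

lemma scale_right: "\<lbrakk>f \<in> V; g \<in> V\<rbrakk> \<Longrightarrow> Q g (\<lambda>x. c * f x) = c * Q g f"
  using scale_left[of f g c] scale_mem[of f c] by (simp add: sym[of g])

lemma diff_mem: "\<lbrakk>f \<in> V; g \<in> V\<rbrakk> \<Longrightarrow> (\<lambda>x. f x - g x) \<in> V"
  using add_mem[of f "\<lambda>x. -1 * g x"] scale_mem[of g "-1"] by simp

lemma uminus_mem: "f \<in> V \<Longrightarrow> (\<lambda>x. - f x) \<in> V"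
  using scale_mem[of f "-1"] by simp

lemma sum_mem: "(\<And>i. i \<in> I \<Longrightarrow> f i \<in> V) \<Longrightarrow> (\<lambda>x. \<Sum>i\<in>I. f i x) \<in> V"
  by (induction I rule: infinite_finite_induct) (auto intro: zero_mem add_mem)

lemma diff_left: "\<lbrakk>f \<in> V; g \<in> V; h \<in> V\<rbrakk> \<Longrightarrow> Q (\<lambda>x. f x - g x) h = Q f h - Q g h"
  using add_left[of f "\<lambda>x. -1 * g x" h] scale_mem[of g "-1"] scale_left[of g h "-1"] by simp

lemma diff_right: "\<lbrakk>f \<in> V; g \<in> V; h \<in> V\<rbrakk> \<Longrightarrow> Q h (\<lambda>x. f x - g x) = Q h f - Q h g"
  using diff_left[of f g h] diff_mem[of f g] by (simp add: sym[of h])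

lemma zero_left: "f \<in> V \<Longrightarrow> Q (\<lambda>x. 0) f = 0"
  using scale_left[of f f 0] by simp

lemma diff_square:
  assumes "f \<in> V" "g \<in> V"
  shows "normsq (\<lambda>x. f x - g x) = normsq f - 2 * Q f g + normsq g"
  using assms by (simp add: diff_left diff_right diff_mem sym[of g f])

lemma add_square:
  assumes "f \<in> V" "g \<in> V"
  shows "normsq (\<lambda>x. f x + g x) = normsq f + 2 * Q f g + normsq g"
  using assms by (simp add: add_left add_right add_mem sym[of g f])

lemma diff_square_commute:
  assumes "f \<in> V" "g \<in> V"
  shows "normsq (\<lambda>x. f x - g x) = normsq (\<lambda>x. g x - f x)"
  using assms by (simp add: diff_square sym[of g f])

lemma Cauchy_Schwarz_square:
  assumes f: "f \<in> V" and g: "g \<in> V"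
  shows "(Q f g)\<^sup>2 \<le> normsq f * normsq g"
proof -
  have *: "0 \<le> normsq f - 2 * t * Q f g + t\<^sup>2 * normsq g" for t
  proof -
    have "0 \<le> normsq (\<lambda>x. f x - t * g x)"
      using f g by (intro nonneg diff_mem scale_mem)
    also have "\<dots> = normsq f - 2 * t * Q f g + t\<^sup>2 * normsq g"
      using f g scale_mem[OF g, of t]
      by (simp add: diff_square scale_left scale_right power2_eq_square)
    finally show ?thesis .
  qed
  show ?thesis
  proof (cases "normsq g = 0")
    case True
    have "Q f g = 0"
    proof (rule ccontr)
      assume "Q f g \<noteq> 0"
      then show False
        using *[of "(normsq f + 1) / (2 * Q f g)"] True by simp
    qed
    then show ?thesis by (simp add: True)
  next
    case False
    then have "0 < normsq g" using nonneg[OF g] by simp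
    have "0 \<le> normsq f - 2 * (Q f g / normsq g) * Q f g + (Q f g / normsq g)\<^sup>2 * normsq g" by (rule *)
    also have "\<dots> = normsq f - (Q f g)\<^sup>2 / normsq g"
      using False by (simp add: power2_eq_square field_simps)
    finally show ?thesis using \<open>0 < Q g g\<close> by (simp add: field_simps)
  qed
qed

lemma Cauchy_Schwarz:
  assumes "f \<in> V" "g \<in> V"
  shows "\<bar>Q f g\<bar> \<le> sqrt (normsq f) * sqrt (normsq g)"
  using Cauchy_Schwarz_square[OF assms]
  by (metis real_sqrt_abs real_sqrt_le_mono real_sqrt_mult)

lemma sqrt_triangle:
  assumes f: "f \<in> V" and g: "g \<in> V"
  shows "sqrt (normsq (\<lambda>x. f x + g x)) \<le> sqrt (normsq f) + sqrt (normsq g)"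
proof (rule real_le_lsqrt)
  show "0 \<le> sqrt (normsq f) + sqrt (normsq g)" using nonneg f g by simp
  have "Q f g \<le> sqrt (normsq f) * sqrt (normsq g)" using Cauchy_Schwarz[OF f g] by linarith
  then show "normsq (\<lambda>x. f x + g x) \<le> (sqrt (normsq f) + sqrt (normsq g))\<^sup>2"
    using nonneg[OF f] nonneg[OF g] by (simp add: add_square[OF f g] power2_sum)
qed

lemma sqrt_scale: "f \<in> V \<Longrightarrow> sqrt (normsq (\<lambda>x. c * f x)) = \<bar>c\<bar> * sqrt (normsq f)"
  using scale_mem[of f c] by (simp add: scale_left scale_right real_sqrt_mult)

lemma sqrt_sum:
  assumes "\<And>i. i \<in> I \<Longrightarrow> f i \<in> V"
  shows "sqrt (normsq (\<lambda>x. \<Sum>i\<in>I. f i x)) \<le> (\<Sum>i\<in>I. sqrt (normsq (f i)))"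
  using assms
proof (induction I rule: infinite_finite_induct)
  case (insert i I)
  then show ?case
    using sqrt_triangle[of "f i" "\<lambda>x. \<Sum>i\<in>I. f i x"] sum_mem[of I f] by simp
qed (auto simp: zero_left zero_mem)

lemma sqrt_triangle_diff:
  assumes f: "f \<in> V" and g: "g \<in> V"
  shows "sqrt (normsq f) \<le> sqrt (normsq (\<lambda>x. f x - g x)) + sqrt (normsq g)"
  using sqrt_triangle[OF diff_mem[OF f g] g] by simp

lemma sqrt_triangle_dist:
  assumes f: "f \<in> V" and g: "g \<in> V" and h: "h \<in> V"
  shows "sqrt (normsq (\<lambda>x. f x - h x))
    \<le> sqrt (normsq (\<lambda>x. f x - g x)) + sqrt (normsq (\<lambda>x. g x - h x))"
  using sqrt_triangle[OF diff_mem[OF f g] diff_mem[OF g h]] by simp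

lemma half_sum_square:
  assumes f: "f \<in> V" and g: "g \<in> V"
  shows "normsq (\<lambda>x. (f x + g x) / 2) = (normsq f + 2 * Q f g + normsq g) / 4"
proof -
  have "normsq (\<lambda>x. 1/2 * (f x + g x)) = (normsq f + 2 * Q f g + normsq g) / 4"
    using add_mem[OF f g] scale_mem[OF add_mem[OF f g], of "1/2"]
    by (simp only: scale_left scale_right add_square[OF f g])
  then show ?thesis by simp
qed

lemma half_sum_mem: "\<lbrakk>f \<in> V; g \<in> V\<rbrakk> \<Longrightarrow> (\<lambda>x. (f x + g x) / 2) \<in> V"
  using scale_mem[OF add_mem, of f g "1/2"] by simp

lemma parallelogram:
  assumes f: "f \<in> V" and g: "g \<in> V"
  shows "normsq (\<lambda>x. f x - g x)
    = 2 * normsq f + 2 * normsq g - 4 * normsq (\<lambda>x. (f x + g x) / 2)"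
  using f g by (simp add: half_sum_square diff_square field_simps)

end

lemma form_Cauchy_iff_sqrt:
  assumes "\<And>i j. 0 \<le> Q (\<lambda>x. u i x - u j x) (\<lambda>x. u i x - u j x)"
  shows "form_Cauchy Q u \<longleftrightarrow>
     (\<forall>e>0. \<exists>N. \<forall>i\<ge>N. \<forall>j\<ge>N. sqrt (Q (\<lambda>x. u i x - u j x) (\<lambda>x. u i x - u j x)) < e)"
proof safe
  fix e :: real assume "form_Cauchy Q u" "e > 0"
  then obtain N where "\<forall>i\<ge>N. \<forall>j\<ge>N. Q (\<lambda>x. u i x - u j x) (\<lambda>x. u i x - u j x) < e\<^sup>2"
    unfolding form_Cauchy_def by (meson zero_less_power)
  then have "\<forall>i\<ge>N. \<forall>j\<ge>N. sqrt (Q (\<lambda>x. u i x - u j x) (\<lambda>x. u i x - u j x)) < e"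
    using \<open>e > 0\<close> real_less_lsqrt by simp
  then show "\<exists>N. \<forall>i\<ge>N. \<forall>j\<ge>N. sqrt (Q (\<lambda>x. u i x - u j x) (\<lambda>x. u i x - u j x)) < e" by blast
next
  assume *: "\<forall>e>0. \<exists>N. \<forall>i\<ge>N. \<forall>j\<ge>N. sqrt (Q (\<lambda>x. u i x - u j x) (\<lambda>x. u i x - u j x)) < e"
  show "form_Cauchy Q u" unfolding form_Cauchy_def
  proof safe
    fix e :: real assume "e > 0"
    then obtain N where "\<forall>i\<ge>N. \<forall>j\<ge>N. sqrt (Q (\<lambda>x. u i x - u j x) (\<lambda>x. u i x - u j x)) < sqrt e"
      using *[rule_format, of "sqrt e"] by auto
    then show "\<exists>N. \<forall>i\<ge>N. \<forall>j\<ge>N. Q (\<lambda>x. u i x - u j x) (\<lambda>x. u i x - u j x) < e" by auto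
  qed
qed

section \<open>Midpoints of tails\<close>

text \<open>Convex combinations with dyadic coefficients: the parallelogram law speaks about midpoints only, and
  an inductively defined set lets a property pass from the generators to all combinations.\<close>

inductive_set mid_hull :: "('a \<Rightarrow> real) set \<Rightarrow> ('a \<Rightarrow> real) set" for S where
  mid_base: "f \<in> S \<Longrightarrow> f \<in> mid_hull S"
| mid_step: "\<lbrakk>f \<in> mid_hull S; g \<in> mid_hull S\<rbrakk> \<Longrightarrow> (\<lambda>x. (f x + g x) / 2) \<in> mid_hull S"

lemma mid_hull_mono: "S \<subseteq> T \<Longrightarrow> mid_hull S \<subseteq> mid_hull T"
proof
  fix f assume "S \<subseteq> T" "f \<in> mid_hull S"
  show "f \<in> mid_hull T" using \<open>f \<in> mid_hull S\<close>
    by induction (use \<open>S \<subseteq> T\<close> in \<open>auto intro: mid_hull.intros\<close>)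
qed

context semi_inner begin

lemma mid_hull_subset: "S \<subseteq> V \<Longrightarrow> mid_hull S \<subseteq> V"
proof
  fix f assume "S \<subseteq> V" "f \<in> mid_hull S"
  show "f \<in> V" using \<open>f \<in> mid_hull S\<close>
    by induction (use \<open>S \<subseteq> V\<close> in \<open>auto intro: half_sum_mem\<close>)
qed

lemma half_sum_le:
  assumes f: "f \<in> V" and g: "g \<in> V" and "normsq f \<le> C" "normsq g \<le> C"
  shows "normsq (\<lambda>x. (f x + g x) / 2) \<le> C"
  using parallelogram[OF f g] nonneg[OF diff_mem[OF f g]] assms by simp

lemma mid_hull_le:
  assumes "S \<subseteq> V" "\<And>f. f \<in> S \<Longrightarrow> normsq f \<le> C" "f \<in> mid_hull S"
  shows "normsq f \<le> C"
  using assms(3) by induction (use assms mid_hull_subset[OF assms(1)] in \<open>auto intro!: half_sum_le\<close>)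

text \<open>A version of Mazur's lemma that bypasses weak compactness. Let \<open>d n\<close> be the infimum of \<open>Q f f\<close> over
  the midpoint hull of the \<open>n\<close>-th tail. These numbers increase and stay below \<open>C\<close>, so they converge.
  Almost minimal elements are then close to each other by the parallelogram law, because their
  midpoint lies in the hull of the earlier tail and cannot fall below the infimum there.\<close>

lemma tail_midpoints_Cauchy:
  assumes u: "\<And>n. u n \<in> V" and C: "\<And>n. normsq (u n) \<le> C"
  obtains q where "\<And>n::nat. q n \<in> mid_hull (u ` {n..})" "form_Cauchy Q q"
proof -
  define D where "D n = (\<lambda>f. normsq f) ` mid_hull (u ` {n..})" for n :: nat
  define d where "d n = Inf (D n)" for n
  have sub: "mid_hull (u ` {n..}) \<subseteq> V" for n using u by (intro mid_hull_subset) auto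
  have ne: "D n \<noteq> {}" for n unfolding D_def by (auto intro: mid_base)
  have bdd: "bdd_below (D n)" for n
    unfolding D_def using sub nonneg by (intro bdd_belowI[of _ 0]) auto
  have D_mono: "D n \<subseteq> D k" if "k \<le> n" for k n
    unfolding D_def using that by (intro image_mono mid_hull_mono) auto
  have d_mono: "incseq d"
    unfolding incseq_def d_def by (auto intro!: cInf_superset_mono ne bdd D_mono)
  have d_le: "d n \<le> C" for n
  proof -
    have "normsq (u n) \<in> D n" unfolding D_def by (auto intro!: mid_base)
    then show ?thesis unfolding d_def using cInf_lower[OF _ bdd] C order_trans by blast
  qed
  obtain L where L: "d \<longlonglongrightarrow> L" "\<And>n. d n \<le> L"
    using incseq_convergent[OF d_mono] d_le by metis
  have "\<exists>f. f \<in> mid_hull (u ` {n..}) \<and> normsq f < d n + 1 / real (Suc n)" for n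
    using cInf_lessD[OF ne, of n "d n + 1 / real (Suc n)"] unfolding d_def D_def by auto
  then obtain q where q: "\<And>n. q n \<in> mid_hull (u ` {n..})"
      "\<And>n. normsq (q n) < d n + 1 / real (Suc n)" by metis
  have qV: "q n \<in> V" for n using q sub by blast
  have est: "normsq (\<lambda>x. q i x - q j x) \<le> 4 * (L - d k) + 4 / real (Suc k)"
    if "i \<ge> k" "j \<ge> k" for i j k
  proof -
    have "q i \<in> mid_hull (u ` {k..})" "q j \<in> mid_hull (u ` {k..})"
      using q(1)[of i] q(1)[of j] mid_hull_mono[OF image_mono, of "{i..}" "{k..}" u]
        mid_hull_mono[OF image_mono, of "{j..}" "{k..}" u] that by auto
    then have "normsq (\<lambda>x. (q i x + q j x) / 2) \<in> D k"
      unfolding D_def by (auto intro: mid_step)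
    then have 1: "d k \<le> normsq (\<lambda>x. (q i x + q j x) / 2)"
      unfolding d_def using bdd by (rule cInf_lower)
    have 2: "normsq (q n) \<le> L + 1 / real (Suc k)" if "n \<ge> k" for n
    proof -
      have "1 / real (Suc n) \<le> 1 / real (Suc k)" using that by (auto simp: field_simps)
      then show ?thesis using q(2)[of n] L(2)[of n] by linarith
    qed
    show ?thesis
      using parallelogram[OF qV qV, of i j] 1 2[OF that(1)] 2[OF that(2)] by simp
  qed
  have "form_Cauchy Q q" unfolding form_Cauchy_def
  proof safe
    fix e :: real assume "e > 0"
    have "(\<lambda>k. 4 * (L - d k) + 4 / real (Suc k)) \<longlonglongrightarrow> 4 * (L - L) + 0"
      by (intro tendsto_intros L LIMSEQ_Suc[OF lim_const_over_n])
    then have "\<forall>\<^sub>F k in sequentially. 4 * (L - d k) + 4 / real (Suc k) < e"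
      using order_tendstoD(2)[of _ _ _ e] \<open>e > 0\<close> by fastforce
    then obtain k where "4 * (L - d k) + 4 / real (Suc k) < e"
      by (auto simp: eventually_sequentially)
    then show "\<exists>N. \<forall>i\<ge>N. \<forall>j\<ge>N. normsq (\<lambda>x. q i x - q j x) < e"
      using est order.strict_trans1 by blast
  qed
  with q(1) show ?thesis by (rule that)
qed

end

section \<open>Square-integrable functions\<close>

lemma L2_mult_integrable:
  assumes "f \<in> L2 m" "g \<in> L2 m" shows "integrable m (\<lambda>x. f x * g x)"
proof (rule Bochner_Integration.integrable_bound)
  show "integrable m (\<lambda>x. (f x)\<^sup>2 + (g x)\<^sup>2)" using assms by (auto simp: L2_def)
  show "(\<lambda>x. f x * g x) \<in> borel_measurable m" using assms by (auto simp: L2_def)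
  have "\<bar>a * b\<bar> \<le> a\<^sup>2 + b\<^sup>2" for a b :: real
  proof -
    have "2 * (\<bar>a\<bar> * \<bar>b\<bar>) \<le> \<bar>a\<bar>\<^sup>2 + \<bar>b\<bar>\<^sup>2" using sum_squares_bound[of "\<bar>a\<bar>" "\<bar>b\<bar>"] by simp
    moreover have "0 \<le> \<bar>a\<bar> * \<bar>b\<bar>" by simp
    ultimately show ?thesis unfolding abs_mult power2_abs by linarith
  qed
  then show "AE x in m. norm (f x * g x) \<le> norm ((f x)\<^sup>2 + (g x)\<^sup>2)" by simp
qed

lemma L2_bound:
  assumes "g \<in> L2 m" "f \<in> borel_measurable m" "AE x in m. \<bar>f x\<bar> \<le> \<bar>g x\<bar>"
  shows "f \<in> L2 m"
  unfolding L2_def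
proof safe
  show "f \<in> borel_measurable m" by fact
  show "integrable m (\<lambda>x. (f x)\<^sup>2)"
    by (rule Bochner_Integration.integrable_bound[of m "\<lambda>x. (g x)\<^sup>2"])
      (use assms in \<open>auto simp: L2_def abs_le_square_iff\<close>)
qed

lemma L2_scale: "f \<in> L2 m \<Longrightarrow> (\<lambda>x. c * f x) \<in> L2 m"
  by (auto simp: L2_def power_mult_distrib)

lemma L2_add:
  assumes "f \<in> L2 m" "g \<in> L2 m" shows "(\<lambda>x. f x + g x) \<in> L2 m"
proof -
  have "integrable m (\<lambda>x. (f x)\<^sup>2 + (g x)\<^sup>2 + 2 * (f x * g x))"
    using assms L2_mult_integrable[OF assms] by (auto simp: L2_def)
  then show ?thesis using assms by (auto simp: L2_def power2_sum mult.assoc)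
qed

lemma L2_abs: "f \<in> L2 m \<Longrightarrow> (\<lambda>x. \<bar>f x\<bar>) \<in> L2 m"
  by (auto simp: L2_def)

lemma L2_measurable: "f \<in> L2 m \<Longrightarrow> f \<in> borel_measurable m"
  by (auto simp: L2_def)

interpretation L2: semi_inner "L2 m" "\<lambda>f g. \<integral>x. f x * g x \<partial>m" for m :: "'b measure"
proof
  show "(\<lambda>_. 0) \<in> L2 m" by (simp add: L2_def)
qed (simp_all add: L2_add L2_scale mult.commute distrib_left distrib_right mult.assoc
       mult.left_commute L2_mult_integrable)

lemma L2_dominated_convergence:
  assumes u: "\<And>n. u n \<in> borel_measurable m" and v: "v \<in> borel_measurable m" and h: "h \<in> L2 m"
    and bd: "\<And>n. AE x in m. \<bar>u n x\<bar> \<le> h x" and lim: "AE x in m. (\<lambda>n. u n x) \<longlonglongrightarrow> v x"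
  shows "v \<in> L2 m" "(\<lambda>n::nat. \<integral>x. (u n x - v x)\<^sup>2 \<partial>m) \<longlonglongrightarrow> 0"
proof -
  have bd': "AE x in m. \<forall>n. \<bar>u n x\<bar> \<le> h x" using bd by (simp add: AE_all_countable)
  have vb: "AE x in m. \<bar>v x\<bar> \<le> h x" using bd' lim
  proof eventually_elim
    case (elim x)
    then show ?case by (intro LIMSEQ_le_const2[OF tendsto_rabs]) auto
  qed
  then show "v \<in> L2 m" by (intro L2_bound[OF h v]) (auto elim!: eventually_mono)
  have *: "integrable m (\<lambda>x. 4 * (h x)\<^sup>2)" using h by (auto simp: L2_def)
  have "(\<lambda>n. \<integral>x. (u n x - v x)\<^sup>2 \<partial>m) \<longlonglongrightarrow> (\<integral>x. 0 \<partial>m)"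
  proof (rule integral_dominated_convergence[OF _ _ *])
    show "AE x in m. (\<lambda>n. (u n x - v x)\<^sup>2) \<longlonglongrightarrow> 0" using lim
    proof eventually_elim
      case (elim x)
      have "(\<lambda>n. (u n x - v x)\<^sup>2) \<longlonglongrightarrow> (v x - v x)\<^sup>2" by (intro tendsto_intros elim)
      then show ?case by simp
    qed
    show "AE x in m. norm ((u n x - v x)\<^sup>2) \<le> 4 * (h x)\<^sup>2" for n using bd' vb
    proof eventually_elim
      case (elim x)
      then have "\<bar>u n x\<bar> \<le> h x" "\<bar>v x\<bar> \<le> h x" by auto
      then have "\<bar>u n x - v x\<bar> \<le> 2 * h x" by linarith
      then have "\<bar>u n x - v x\<bar>\<^sup>2 \<le> (2 * h x)\<^sup>2" by (intro power_mono) auto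
      then show ?case by (simp add: power_mult_distrib)
    qed
  qed (use u v in auto)
  then show "(\<lambda>n. \<integral>x. (u n x - v x)\<^sup>2 \<partial>m) \<longlonglongrightarrow> 0" by simp
qed

lemma L2_AE_subseq:
  assumes "\<And>n. u n \<in> L2 m" "v \<in> L2 m" "(\<lambda>n::nat. \<integral>x. (u n x - v x)\<^sup>2 \<partial>m) \<longlonglongrightarrow> 0"
  obtains r where "strict_mono (r::nat\<Rightarrow>nat)" "AE x in m. (\<lambda>n. u (r n) x) \<longlonglongrightarrow> v x"
proof -
  have *: "integrable m (\<lambda>x. (u n x - v x)\<^sup>2)" for n
    using L2.diff_mem[OF assms(1,2)] by (auto simp: L2_def)
  obtain r where r: "strict_mono r" "AE x in m. (\<lambda>n. (u (r n) x - v x)\<^sup>2) \<longlonglongrightarrow> 0"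
    using tendsto_L1_AE_subseq[of m "\<lambda>n x. (u n x - v x)\<^sup>2"] * assms(3) by auto
  have "AE x in m. (\<lambda>n. u (r n) x) \<longlonglongrightarrow> v x" using r(2)
  proof eventually_elim
    case (elim x)
    then have "(\<lambda>n. sqrt ((u (r n) x - v x)\<^sup>2)) \<longlonglongrightarrow> sqrt 0" by (rule tendsto_real_sqrt)
    then have "(\<lambda>n. u (r n) x - v x) \<longlonglongrightarrow> 0" by (simp add: tendsto_rabs_zero_iff)
    then show ?case by (simp add: LIM_zero_iff)
  qed
  with r(1) that show ?thesis by blast
qed

lemma L2_zero_AE:
  assumes "f \<in> L2 m" "(\<integral>x. (f x)\<^sup>2 \<partial>m) = 0" shows "AE x in m. f x = 0"
  using assms integral_nonneg_eq_0_iff_AE[of m "\<lambda>x. (f x)\<^sup>2"] by (auto simp: L2_def)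

lemma L2_mid_hull:
  assumes S: "S \<subseteq> L2 m" and v: "v \<in> L2 m" and e: "\<And>f. f \<in> S \<Longrightarrow> (\<integral>x. (f x - v x)\<^sup>2 \<partial>m) \<le> e"
    and f: "f \<in> mid_hull S"
  shows "(\<integral>x. (f x - v x)\<^sup>2 \<partial>m) \<le> e"
  using f
proof induction
  case (mid_step f g)
  have fg: "f \<in> L2 m" "g \<in> L2 m" using mid_step L2.mid_hull_subset[OF S] by auto
  have eq: "(f x + g x) / 2 - v x = ((f x - v x) + (g x - v x)) / 2" for x
    by (simp add: field_simps)
  have "(\<integral>x. ((f x - v x) + (g x - v x)) / 2 * (((f x - v x) + (g x - v x)) / 2) \<partial>m) \<le> e"
    by (rule L2.half_sum_le)
       (use mid_step.IH L2.diff_mem[OF fg(1) v] L2.diff_mem[OF fg(2) v] in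
         \<open>simp_all add: power2_eq_square\<close>)
  then show ?case by (simp only: eq power2_eq_square)
qed (use e in auto)

section \<open>Truncations and lattice operations on the domain of the form\<close>

context dirichlet_form
begin

abbreviation energy :: "('a \<Rightarrow> real) \<Rightarrow> real" where
  "energy f \<equiv> \<E> f f"

abbreviation energy1 :: "('a \<Rightarrow> real) \<Rightarrow> real" where
  "energy1 f \<equiv> form_alpha m \<E> 1 f f"

sublocale form: semi_inner \<F> \<E>
  by unfold_locales
    (rule dom_zero dom_add dom_scale form_sym form_add form_scale form_nonneg; assumption)+

lemma L2_dom: "f \<in> \<F> \<Longrightarrow> f \<in> L2 m"
  using dom_L2 by blast

lemma borel_dom: "f \<in> \<F> \<Longrightarrow> f \<in> borel_measurable m"
  using L2_dom L2_measurable by blast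

lemma semi_inner_alpha:
  assumes "0 \<le> \<alpha>" shows "semi_inner \<F> (form_alpha m \<E> \<alpha>)"
proof
  fix f assume f: "f \<in> \<F>"
  show "0 \<le> form_alpha m \<E> \<alpha> f f"
    unfolding form_alpha_def using form_nonneg[OF f] L2.nonneg[OF L2_dom[OF f]] assms by simp
next
  fix f g assume fg: "f \<in> \<F>" "g \<in> \<F>"
  show "form_alpha m \<E> \<alpha> f g = form_alpha m \<E> \<alpha> g f"
    unfolding form_alpha_def using form_sym[OF fg] by (simp add: mult.commute)
  show "form_alpha m \<E> \<alpha> (\<lambda>x. c * f x) g = c * form_alpha m \<E> \<alpha> f g" for c
    unfolding form_alpha_def using form_scale[OF fg] L2.scale_left[OF L2_dom L2_dom, OF fg]
    by (simp add: distrib_left)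
next
  fix f g h assume fgh: "f \<in> \<F>" "g \<in> \<F>" "h \<in> \<F>"
  show "form_alpha m \<E> \<alpha> (\<lambda>x. f x + g x) h = form_alpha m \<E> \<alpha> f h + form_alpha m \<E> \<alpha> g h"
    unfolding form_alpha_def using form_add[OF fgh] L2.add_left[OF L2_dom L2_dom L2_dom, OF fgh]
    by (simp add: distrib_left)
qed (simp_all add: dom_zero dom_add dom_scale)

sublocale form1: semi_inner \<F> "form_alpha m \<E> 1"
  by (rule semi_inner_alpha) simp

lemma form1_square: "energy1 f = energy f + (\<integral>x. (f x)\<^sup>2 \<partial>m)"
  by (simp add: form_alpha_def power2_eq_square)

lemma form_le_form1: "f \<in> \<F> \<Longrightarrow> energy f \<le> energy1 f"
  by (simp add: form1_square)

lemma norm2_le_form1: "f \<in> \<F> \<Longrightarrow> (\<integral>x. (f x)\<^sup>2 \<partial>m) \<le> energy1 f"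
  using form_nonneg by (simp add: form1_square)

lemma energy_cong_AE:
  assumes "f \<in> \<F>" "g \<in> \<F>" "AE x in m. f x = g x" shows "energy f = energy g"
  by (metis assms form_AE form_sym)

lemma energy1_cong_AE:
  assumes "f \<in> \<F>" "g \<in> \<F>" "AE x in m. f x = g x"
  shows "energy1 f = energy1 g"
proof -
  have "(\<integral>x. (f x)\<^sup>2 \<partial>m) = (\<integral>x. (g x)\<^sup>2 \<partial>m)"
    by (rule integral_cong_AE) (use assms borel_dom in auto)
  then show ?thesis using energy_cong_AE[OF assms] by (simp add: form1_square)
qed

text \<open>Lower semicontinuity of the energy along convergence in \<open>L\<^sup>2\<close>. The midpoints provided by
  \<open>tail_midpoints_Cauchy\<close> converge in the norm of \<open>energy1\<close> because the form is closed. Their limit can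
  only be \<open>v\<close>: midpoints of a tail are as close to \<open>v\<close> in \<open>L\<^sup>2\<close> as the tail itself.\<close>

lemma L2_limit_of_bounded_energy:
  assumes u: "\<And>n::nat. u n \<in> \<F>" and C: "\<And>n. energy (u n) \<le> C"
    and v: "v \<in> L2 m" and lim: "(\<lambda>n. \<integral>x. (u n x - v x)\<^sup>2 \<partial>m) \<longlonglongrightarrow> 0"
  obtains q where "v \<in> \<F>" "energy v \<le> C" "\<And>n. q n \<in> mid_hull (u ` {n..})" "\<And>n. q n \<in> \<F>"
    "(\<lambda>n. energy1 (\<lambda>x. q n x - v x)) \<longlonglongrightarrow> 0"
proof -
  have uL: "u n \<in> L2 m" for n using u L2_dom by blast
  obtain B where B: "\<And>n. (\<integral>x. (u n x - v x)\<^sup>2 \<partial>m) \<le> B"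
    using convergent_imp_Bseq[OF convergentI[OF lim]] unfolding Bseq_def
    by (metis abs_le_D1 real_norm_def)
  have bd: "energy1 (u n) \<le> C + (sqrt B + sqrt (\<integral>x. v x * v x \<partial>m))\<^sup>2" for n
  proof -
    have "sqrt (\<integral>x. u n x * u n x \<partial>m)
      \<le> sqrt (\<integral>x. (u n x - v x) * (u n x - v x) \<partial>m) + sqrt (\<integral>x. v x * v x \<partial>m)"
      by (rule L2.sqrt_triangle_diff[OF uL v])
    also have "\<dots> \<le> sqrt B + sqrt (\<integral>x. v x * v x \<partial>m)"
      using B[of n] by (simp add: power2_eq_square)
    finally have "(\<integral>x. u n x * u n x \<partial>m) \<le> (sqrt B + sqrt (\<integral>x. v x * v x \<partial>m))\<^sup>2"
      by (rule sqrt_le_D)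
    then show ?thesis using C[of n] unfolding form_alpha_def by simp
  qed
  obtain q where q: "\<And>n. q n \<in> mid_hull (u ` {n..})" and qC: "form_Cauchy (form_alpha m \<E> 1) q"
    using form1.tail_midpoints_Cauchy[of u, OF u bd] by metis
  have sub: "u ` {n..} \<subseteq> \<F>" for n using u by auto
  have qF: "q n \<in> \<F>" for n using q form.mid_hull_subset[OF sub] by blast
  have qE: "energy (q n) \<le> C" for n
    by (rule form.mid_hull_le[OF sub _ q]) (use C in auto)
  obtain w where w: "w \<in> \<F>"
      "(\<lambda>n. energy1 (\<lambda>x. q n x - w x)) \<longlonglongrightarrow> 0"
    using form_closed[OF qF qC] by blast
  have qw: "(\<lambda>n. \<integral>x. (q n x - w x)\<^sup>2 \<partial>m) \<longlonglongrightarrow> 0"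
    by (rule real_tendsto_sandwich[OF _ _ tendsto_const w(2)])
       (auto intro!: always_eventually norm2_le_form1 form.diff_mem qF w)
  have qv: "(\<lambda>n. \<integral>x. (q n x - v x)\<^sup>2 \<partial>m) \<longlonglongrightarrow> 0"
  proof (rule LIMSEQ_I)
    fix e :: real assume "0 < e"
    then obtain N where N: "\<And>n. n \<ge> N \<Longrightarrow> (\<integral>x. (u n x - v x)\<^sup>2 \<partial>m) < e / 2"
      using LIMSEQ_D[OF lim, of "e / 2"] by (auto simp: abs_less_iff)
    have "(\<integral>x. (q n x - v x)\<^sup>2 \<partial>m) \<le> e / 2" if "n \<ge> N" for n
      by (rule L2_mid_hull[OF _ v _ q]) (use N that uL in \<open>auto intro: less_imp_le\<close>)
    then show "\<exists>no. \<forall>n\<ge>no. norm ((\<integral>x. (q n x - v x)\<^sup>2 \<partial>m) - 0) < e"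
      using \<open>0 < e\<close> by (intro exI[of _ N] allI impI) fastforce
  qed
  have "sqrt (\<integral>x. (w x - v x) * (w x - v x) \<partial>m) \<le> 0"
  proof (rule LIMSEQ_le_const)
    show "(\<lambda>n. sqrt (\<integral>x. (q n x - w x)\<^sup>2 \<partial>m) + sqrt (\<integral>x. (q n x - v x)\<^sup>2 \<partial>m)) \<longlonglongrightarrow> 0"
      using tendsto_add[OF tendsto_real_sqrt[OF qw] tendsto_real_sqrt[OF qv]] by simp
    show "\<exists>N. \<forall>n\<ge>N. sqrt (\<integral>x. (w x - v x) * (w x - v x) \<partial>m)
        \<le> sqrt (\<integral>x. (q n x - w x)\<^sup>2 \<partial>m) + sqrt (\<integral>x. (q n x - v x)\<^sup>2 \<partial>m)"
      using L2.sqrt_triangle_dist[OF L2_dom[OF w(1)] L2_dom[OF qF] v]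
        L2.diff_square_commute[OF L2_dom[OF w(1)] L2_dom[OF qF]]
      by (simp add: power2_eq_square)
  qed
  then have "(\<integral>x. (w x - v x)\<^sup>2 \<partial>m) = 0"
    using L2.nonneg[OF L2.diff_mem[OF L2_dom[OF w(1)] v]] by (simp add: power2_eq_square)
  then have eq: "AE x in m. w x = v x"
    using L2_zero_AE[OF L2.diff_mem[OF L2_dom[OF w(1)] v]] by simp
  have vF: "v \<in> \<F>" by (rule dom_AE[OF w(1) _ eq]) (use v L2_measurable in blast)
  have "energy1 (\<lambda>x. q n x - v x)
      = energy1 (\<lambda>x. q n x - w x)" for n
    by (rule energy1_cong_AE) (use eq qF w vF in \<open>auto intro: form.diff_mem\<close>)
  then have lim1: "(\<lambda>n. energy1 (\<lambda>x. q n x - v x)) \<longlonglongrightarrow> 0"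
    using w(2) by simp
  have "sqrt (energy v) \<le> 0 + sqrt C"
  proof (rule LIMSEQ_le_const)
    show "(\<lambda>n. sqrt (energy1 (\<lambda>x. q n x - v x)) + sqrt C) \<longlonglongrightarrow> 0 + sqrt C"
      using tendsto_real_sqrt[OF lim1] by (intro tendsto_add tendsto_const) simp
    show "\<exists>N. \<forall>n\<ge>N. sqrt (energy v)
        \<le> sqrt (energy1 (\<lambda>x. q n x - v x)) + sqrt C"
    proof (intro exI allI impI)
      fix n
      have "sqrt (energy v) \<le> sqrt (energy (\<lambda>x. v x - q n x)) + sqrt (energy (q n))"
        by (rule form.sqrt_triangle_diff[OF vF qF])
      also have "energy (\<lambda>x. v x - q n x) \<le> energy1 (\<lambda>x. q n x - v x)"
        using form.diff_square_commute[OF vF qF] form_le_form1[OF form.diff_mem[OF qF vF]] by simp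
      finally show "sqrt (energy v)
        \<le> sqrt (energy1 (\<lambda>x. q n x - v x)) + sqrt C"
        using qE[of n] by (smt (verit) real_sqrt_le_mono)
    qed
  qed
  then have "energy v \<le> C" by simp
  with vF show ?thesis using q qF lim1 by (rule that)
qed

lemma clip_mem:
  assumes f: "f \<in> \<F>" and c: "0 < c"
  shows "(\<lambda>x. min c (max 0 (f x))) \<in> \<F>"
    and "energy (\<lambda>x. min c (max 0 (f x))) \<le> energy f"
proof -
  define g where "g = (\<lambda>x. min 1 (max 0 (1 / c * f x)))"
  have eq: "(\<lambda>x. min c (max 0 (f x))) = (\<lambda>x. c * g x)"
    using c by (auto simp: g_def min_def max_def field_simps)
  have sf: "(\<lambda>x. 1 / c * f x) \<in> \<F>" by (rule dom_scale[OF f])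
  have g: "g \<in> \<F>" "energy g \<le> energy (\<lambda>x. 1 / c * f x)"
    using unit_contraction[OF sf] unfolding g_def by auto
  then show "(\<lambda>x. min c (max 0 (f x))) \<in> \<F>" unfolding eq by (intro dom_scale)
  have "sqrt (energy (\<lambda>x. c * g x)) = c * sqrt (energy g)"
    using form.sqrt_scale[OF g(1), of c] c by simp
  also have "\<dots> \<le> c * sqrt (energy (\<lambda>x. 1 / c * f x))"
    using g(2) c by simp
  also have "\<dots> = sqrt (energy f)"
    using form.sqrt_scale[OF f, of "1 / c"] c by simp
  finally show "energy (\<lambda>x. min c (max 0 (f x))) \<le> energy f"
    unfolding eq by simp
qed

text \<open>The unit contraction gives truncations at finite heights only; the positive part is their limit
  in \<open>L\<^sup>2\<close>.\<close>

lemma pos_part_mem: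
  assumes f: "f \<in> \<F>"
  shows "(\<lambda>x. max 0 (f x)) \<in> \<F>" "energy (\<lambda>x. max 0 (f x)) \<le> energy f"
proof -
  define u where "u n = (\<lambda>x. min (real (Suc n)) (max 0 (f x)))" for n
  have u: "u n \<in> \<F>" "energy (u n) \<le> energy f" for n
    unfolding u_def by (intro clip_mem f; simp)+
  have lim: "(\<lambda>n. u n x) \<longlonglongrightarrow> max 0 (f x)" for x
  proof (rule tendsto_eventually)
    obtain N where "max 0 (f x) < real N" using reals_Archimedean2 by blast
    then show "\<forall>\<^sub>F n in sequentially. u n x = max 0 (f x)"
      unfolding u_def eventually_sequentially by (intro exI[of _ N]) auto
  qed
  have b: "f \<in> borel_measurable m" using borel_dom f by blast
  have c1: "(\<lambda>x. max 0 (f x)) \<in> borel_measurable m" using b by measurable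
  have c2: "AE x in m. \<bar>u n x\<bar> \<le> \<bar>f x\<bar>" for n by (auto simp: u_def)
  note conv = L2_dominated_convergence[OF borel_dom[OF u(1)] c1 L2_abs[OF L2_dom[OF f]] c2 AE_I2[OF lim]]
  show "(\<lambda>x. max 0 (f x)) \<in> \<F>" "energy (\<lambda>x. max 0 (f x)) \<le> energy f"
    using L2_limit_of_bounded_energy[OF u conv] by metis+
qed

lemma neg_part_mem: "f \<in> \<F> \<Longrightarrow> (\<lambda>x. max 0 (- f x)) \<in> \<F>"
  using pos_part_mem(1)[OF form.uminus_mem] .

text \<open>For every \<open>t > 0\<close> the function \<open>u\<^sup>+ - t u\<^sup>-\<close> has positive part \<open>u\<^sup>+\<close>. Comparing energies gives
  \<open>0 \<le> - 2 t \<E>(u\<^sup>+, u\<^sup>-) + t\<^sup>2 \<E>(u\<^sup>-, u\<^sup>-)\<close>, and small \<open>t\<close> forces the sign of the cross term.\<close>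

lemma form_pos_neg_le:
  assumes f: "f \<in> \<F>"
  shows "\<E> (\<lambda>x. max 0 (f x)) (\<lambda>x. max 0 (- f x)) \<le> 0"
proof (rule ccontr)
  define p n where "p = (\<lambda>x. max 0 (f x))" and "n = (\<lambda>x. max 0 (- f x))"
  have p: "p \<in> \<F>" unfolding p_def by (rule pos_part_mem[OF f])
  have n: "n \<in> \<F>" unfolding n_def by (rule neg_part_mem[OF f])
  have *: "2 * t * \<E> p n \<le> t\<^sup>2 * energy n" if "t > 0" for t
  proof -
    have tn: "(\<lambda>x. t * n x) \<in> \<F>" by (rule dom_scale[OF n])
    have "p = (\<lambda>x. max 0 (p x - t * n x))"
      using that by (auto simp: p_def n_def max_def fun_eq_iff mult_le_0_iff zero_le_mult_iff)
    then have "energy p \<le> energy (\<lambda>x. p x - t * n x)"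
      using pos_part_mem(2)[OF form.diff_mem[OF p tn]] by simp
    also have "\<dots> = energy p - 2 * t * \<E> p n + t\<^sup>2 * energy n"
      using p n tn by (simp add: form.diff_square form.scale_left form.scale_right power2_eq_square)
    finally show ?thesis by simp
  qed
  assume "\<not> \<E> (\<lambda>x. max 0 (f x)) (\<lambda>x. max 0 (- f x)) \<le> 0"
  then have pos: "\<E> p n > 0" by (simp add: p_def n_def)
  \<comment> \<open>the minimiser of the quadratic polynomial, with a summand 1 that keeps the denominator positive\<close>
  define t where "t = \<E> p n / (energy n + 1)"
  have d: "energy n + 1 > 0" using form_nonneg[OF n] by simp
  have t: "t > 0" using pos d by (simp add: t_def)
  have "2 * t * \<E> p n \<le> t * (t * energy n)" using *[OF t] by (simp add: power2_eq_square)
  then have "2 * \<E> p n \<le> t * energy n" using t by simp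
  also have "\<dots> \<le> t * (energy n + 1)" using t by simp
  also have "\<dots> = \<E> p n" using d by (simp add: t_def)
  finally show False using pos by simp
qed

lemma abs_mem:
  assumes f: "f \<in> \<F>"
  shows "(\<lambda>x. \<bar>f x\<bar>) \<in> \<F>" "energy (\<lambda>x. \<bar>f x\<bar>) \<le> energy f"
proof -
  define p n where "p = (\<lambda>x. max 0 (f x))" and "n = (\<lambda>x. max 0 (- f x))"
  have p: "p \<in> \<F>" unfolding p_def by (rule pos_part_mem[OF f])
  have n: "n \<in> \<F>" unfolding n_def by (rule neg_part_mem[OF f])
  have e1: "(\<lambda>x. \<bar>f x\<bar>) = (\<lambda>x. p x + n x)" and e2: "f = (\<lambda>x. p x - n x)"
    by (auto simp: p_def n_def fun_eq_iff max_def)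
  show "(\<lambda>x. \<bar>f x\<bar>) \<in> \<F>" unfolding e1 by (rule dom_add[OF p n])
  have "\<E> p n \<le> 0" using form_pos_neg_le[OF f] by (simp add: p_def n_def)
  then show "energy (\<lambda>x. \<bar>f x\<bar>) \<le> energy f"
    unfolding e1 using form.diff_square[OF p n] unfolding e2[symmetric]
    by (simp add: form.add_square p n)
qed

text \<open>Twice the minimum is \<open>f + g - \<bar>f - g\<bar>\<close>; the parallelogram law turns the energies of \<open>f + g\<close> and of
  \<open>f - g\<close>, which bounds that of \<open>\<bar>f - g\<bar>\<close>, into those of \<open>f\<close> and \<open>g\<close>.\<close>

lemma min_mem:
  assumes f: "f \<in> \<F>" and g: "g \<in> \<F>"
  shows "(\<lambda>x. min (f x) (g x)) \<in> \<F>"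
    "energy (\<lambda>x. min (f x) (g x)) \<le> energy f + energy g"
proof -
  have d: "(\<lambda>x. f x - g x) \<in> \<F>" by (rule form.diff_mem[OF f g])
  have s: "(\<lambda>x. f x + g x) \<in> \<F>" by (rule dom_add[OF f g])
  note a = abs_mem[OF d]
  have eq: "(\<lambda>x. min (f x) (g x)) = (\<lambda>x. ((f x + g x) - \<bar>f x - g x\<bar>) / 2)"
    by (auto simp: fun_eq_iff min_def field_simps)
  have n: "(\<lambda>x. - \<bar>f x - g x\<bar>) \<in> \<F>" by (rule form.uminus_mem[OF a(1)])
  show "(\<lambda>x. min (f x) (g x)) \<in> \<F>"
    unfolding eq using form.half_sum_mem[OF s n] by simp
  have "energy (\<lambda>x. - \<bar>f x - g x\<bar>) = energy (\<lambda>x. \<bar>f x - g x\<bar>)"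
    using form.sqrt_scale[OF a(1), of "-1"] by simp
  then have "energy (\<lambda>x. ((f x + g x) - \<bar>f x - g x\<bar>) / 2)
     \<le> (energy (\<lambda>x. f x + g x) + energy (\<lambda>x. \<bar>f x - g x\<bar>)) / 2"
    using form.parallelogram[OF s n] form_nonneg[OF form.diff_mem[OF s n]] by simp
  also have "\<dots> \<le> (energy (\<lambda>x. f x + g x) + energy (\<lambda>x. f x - g x)) / 2"
    using a(2) by simp
  also have "\<dots> = energy f + energy g" by (simp add: form.add_square form.diff_square f g)
  finally show "energy (\<lambda>x. min (f x) (g x)) \<le> energy f + energy g"
    unfolding eq .
qed

section \<open>Capacity and quasi-continuity\<close>

lemma Cap_upper:
  assumes "open A" "B \<subseteq> A" "u \<in> \<F>" "AE x in m. x \<in> A \<longrightarrow> 1 \<le> u x"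
  shows "Cap m \<F> \<E> B \<le> ennreal (energy1 u)"
  unfolding Cap_def capacity_def using assms by (auto intro!: INF_lower2)

lemma Cap_mono: "B \<subseteq> B' \<Longrightarrow> Cap m \<F> \<E> B \<le> Cap m \<F> \<E> B'"
  unfolding Cap_def capacity_def by (auto intro!: INF_superset_mono)

lemma Cap_empty: "Cap m \<F> \<E> {} = 0"
  using Cap_upper[of "{}" "{}" "\<lambda>_. 0"] dom_zero form1.zero_left[OF dom_zero] by simp

text \<open>The unit contraction makes the competitor nonnegative, so that sums of competitors are competitors
  for unions.\<close>

lemma Cap_lessE:
  assumes "Cap m \<F> \<E> B < ennreal e"
  obtains A u where "open A" "B \<subseteq> A" "u \<in> \<F>" "AE x in m. x \<in> A \<longrightarrow> 1 \<le> u x"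
    "\<And>x. 0 \<le> u x" "energy1 u < e"
proof -
  obtain A u where A: "open A" "B \<subseteq> A" "u \<in> \<F>" "AE x in m. x \<in> A \<longrightarrow> 1 \<le> u x"
     "ennreal (energy1 u) < ennreal e"
    using assms unfolding Cap_def capacity_def by (auto simp: INF_less_iff)
  define v where "v = (\<lambda>x. min 1 (max 0 (u x)))"
  have v: "v \<in> \<F>" "energy v \<le> energy u" unfolding v_def using unit_contraction[OF A(3)] by auto
  have "(v x)\<^sup>2 \<le> (u x)\<^sup>2" for x unfolding v_def abs_le_square_iff[symmetric] by auto
  then have "(\<integral>x. (v x)\<^sup>2 \<partial>m) \<le> (\<integral>x. (u x)\<^sup>2 \<partial>m)"
    using L2_dom[OF A(3)] L2_dom[OF v(1)] by (intro integral_mono) (auto simp: L2_def)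
  then have "energy1 v < e"
    using A(5) v(2) form1.nonneg[OF A(3)] by (auto simp: form1_square ennreal_less_iff)
  then show ?thesis using A v by (intro that[of A v]) (auto simp: v_def min_def max_def elim!: eventually_mono)
qed

lemma Cap_Un:
  assumes "Cap m \<F> \<E> A < ennreal e" "Cap m \<F> \<E> B < ennreal d"
  shows "Cap m \<F> \<E> (A \<union> B) \<le> ennreal ((sqrt e + sqrt d)\<^sup>2)"
proof -
  obtain A' u where u: "open A'" "A \<subseteq> A'" "u \<in> \<F>" "AE x in m. x \<in> A' \<longrightarrow> 1 \<le> u x"
    "\<And>x. 0 \<le> u x" "energy1 u < e" using Cap_lessE[OF assms(1)] by blast
  obtain B' v where v: "open B'" "B \<subseteq> B'" "v \<in> \<F>" "AE x in m. x \<in> B' \<longrightarrow> 1 \<le> v x"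
    "\<And>x. 0 \<le> v x" "energy1 v < d" using Cap_lessE[OF assms(2)] by blast
  have "AE x in m. x \<in> A' \<union> B' \<longrightarrow> 1 \<le> u x + v x" using u(4) v(4)
    by eventually_elim (use u(5) v(5) in \<open>auto intro: add_increasing add_increasing2\<close>)
  then have "Cap m \<F> \<E> (A \<union> B) \<le> ennreal (energy1 (\<lambda>x. u x + v x))"
    using u v by (intro Cap_upper[of "A' \<union> B'"] dom_add) auto
  also have "sqrt (energy1 (\<lambda>x. u x + v x))
      \<le> sqrt (energy1 u) + sqrt (energy1 v)"
    by (rule form1.sqrt_triangle[OF u(3) v(3)])
  then have "sqrt (energy1 (\<lambda>x. u x + v x)) \<le> sqrt e + sqrt d"
    using u(6) v(6) by (smt (verit) real_sqrt_less_mono)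
  then have "energy1 (\<lambda>x. u x + v x) \<le> (sqrt e + sqrt d)\<^sup>2"
    by (rule sqrt_le_D)
  finally show ?thesis by (simp add: ennreal_leI)
qed

text \<open>Square roots of capacities are countably subadditive: if \<open>u j\<close> competes for \<open>G j\<close>, then the sum of
  the \<open>u j\<close> converges in the norm of \<open>energy1\<close> and competes for the union.\<close>

lemma Cap_UN:
  assumes G: "\<And>j::nat. Cap m \<F> \<E> (G j) < ennreal ((d j)\<^sup>2)" and d: "\<And>j. 0 \<le> d j" and sd: "summable d"
  shows "Cap m \<F> \<E> (\<Union>j. G j) \<le> ennreal ((suminf d)\<^sup>2)"
proof -
  define \<Phi> where "\<Phi> j A u \<longleftrightarrow> open A \<and> G j \<subseteq> A \<and> u \<in> \<F> \<and> (AE x in m. x \<in> A \<longrightarrow> 1 \<le> u x) \<and>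
      (\<forall>x. 0 \<le> u x) \<and> energy1 u < (d j)\<^sup>2" for j A u
  have "\<forall>j. \<exists>A u. \<Phi> j A u"
    unfolding \<Phi>_def by (rule allI, rule Cap_lessE[OF G]) blast
  then obtain A where "\<forall>j. \<exists>u. \<Phi> j (A j) u" by (rule choice[THEN exE])
  then obtain u where \<Phi>: "\<forall>j. \<Phi> j (A j) (u j)" by (rule choice[THEN exE])
  have A: "\<And>j. open (A j)" "\<And>j. G j \<subseteq> A j" and u: "\<And>j. u j \<in> \<F>"
    "\<And>j. AE x in m. x \<in> A j \<longrightarrow> 1 \<le> u j x" "\<And>j x. 0 \<le> u j x"
    "\<And>j. energy1 (u j) < (d j)\<^sup>2"
    using \<Phi> by (simp_all add: \<Phi>_def)
  let ?N = "\<lambda>f. sqrt (energy1 f)"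
  define S where "S n = (\<lambda>x. \<Sum>j<n. u j x)" for n
  have S: "S n \<in> \<F>" for n unfolding S_def by (intro form.sum_mem u)
  have ud: "?N (u j) \<le> d j" for j
    using u(4)[of j] d[of j] real_le_lsqrt by simp
  have part: "?N (\<lambda>x. \<Sum>j\<in>I. u j x) \<le> sum d I" for I
    using form1.sqrt_sum[of I u] u(1) sum_mono[of I "\<lambda>j. ?N (u j)" d] ud by force
  have SN: "?N (S n) \<le> suminf d" for n
    using part[of "{..<n}"] sum_le_suminf[OF sd, of "{..<n}"] d unfolding S_def by force
  have diff: "?N (\<lambda>x. S i x - S j x) \<le> sum d {j..<i}" if "j \<le> i" for i j
  proof -
    have "(\<lambda>x. S i x - S j x) = (\<lambda>x. \<Sum>k\<in>{j..<i}. u k x)"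
      unfolding S_def by (rule ext) (use that sum_diff_nat_ivl[of 0 j i] in \<open>simp add: atLeast0LessThan\<close>)
    then show ?thesis using part by simp
  qed
  have "form_Cauchy (form_alpha m \<E> 1) S"
  proof (subst form_Cauchy_iff_sqrt)
    show "0 \<le> energy1 (\<lambda>x. S i x - S j x)" for i j
      by (intro form1.nonneg form.diff_mem S)
    show "\<forall>e>0. \<exists>N. \<forall>i\<ge>N. \<forall>j\<ge>N. ?N (\<lambda>x. S i x - S j x) < e"
    proof safe
      fix e :: real assume "e > 0"
      then obtain N where N: "\<And>m n. m \<ge> N \<Longrightarrow> norm (sum d {m..<n}) < e"
        using sd unfolding summable_Cauchy by blast
      have 1: "?N (\<lambda>x. S i x - S j x) < e" if "j \<ge> N" "j \<le> i" for i j
        using diff[OF that(2)] N[OF that(1), of i] by auto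
      have "?N (\<lambda>x. S i x - S j x) < e" if "i \<ge> N" "j \<ge> N" for i j
        using 1[of j i] 1[of i j] that form1.diff_square_commute[OF S S, of i j] by (cases "j \<le> i") auto
      then show "\<exists>N. \<forall>i\<ge>N. \<forall>j\<ge>N. ?N (\<lambda>x. S i x - S j x) < e" by blast
    qed
  qed
  then obtain v where v: "v \<in> \<F>"
    "(\<lambda>n. energy1 (\<lambda>x. S n x - v x)) \<longlonglongrightarrow> 0"
    using form_closed[of S, OF S] by blast
  have "?N v \<le> 0 + suminf d"
  proof (rule LIMSEQ_le_const)
    show "(\<lambda>n. ?N (\<lambda>x. S n x - v x) + suminf d) \<longlonglongrightarrow> 0 + suminf d"
      using tendsto_real_sqrt[OF v(2)] by (intro tendsto_add tendsto_const) simp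
    show "\<exists>N. \<forall>n\<ge>N. ?N v \<le> ?N (\<lambda>x. S n x - v x) + suminf d"
    proof (intro exI allI impI)
      fix n
      show "?N v \<le> ?N (\<lambda>x. S n x - v x) + suminf d"
        using form1.sqrt_triangle_diff[OF v(1) S, of n] form1.diff_square_commute[OF v(1) S, of n] SN[of n]
        by simp
    qed
  qed
  then have vd: "energy1 v \<le> (suminf d)\<^sup>2" by (intro sqrt_le_D) simp
  have "(\<lambda>n. \<integral>x. (S n x - v x)\<^sup>2 \<partial>m) \<longlonglongrightarrow> 0"
    by (rule real_tendsto_sandwich[OF _ _ tendsto_const v(2)])
       (auto intro!: always_eventually norm2_le_form1 form.diff_mem S v)
  then obtain r where r: "strict_mono (r::nat\<Rightarrow>nat)" "AE x in m. (\<lambda>n. S (r n) x) \<longlonglongrightarrow> v x"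
    using L2_AE_subseq[of S m v] L2_dom[OF S] L2_dom[OF v(1)] by metis
  have "AE x in m. \<forall>j. x \<in> A j \<longrightarrow> 1 \<le> u j x" using u(2) by (simp add: AE_all_countable)
  then have "AE x in m. x \<in> (\<Union>j. A j) \<longrightarrow> 1 \<le> v x" using r(2)
  proof eventually_elim
    case (elim x)
    show ?case
    proof
      assume "x \<in> (\<Union>j. A j)"
      then obtain j where j: "1 \<le> u j x" using elim by auto
      have "1 \<le> S (r n) x" if "n \<ge> Suc j" for n
      proof -
        have "n \<le> r n" by (rule seq_suble[OF r(1)])
        then have "u j x \<le> S (r n) x" unfolding S_def
          using that u(3) by (intro member_le_sum) auto
        then show ?thesis using j by simp
      qed
      then show "1 \<le> v x" by (intro LIMSEQ_le_const[OF elim(2)]) blast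
    qed
  qed
  then have "Cap m \<F> \<E> (\<Union>j. G j) \<le> ennreal (energy1 v)"
    using A v(1) by (intro Cap_upper[of "\<Union>j. A j"]) auto
  also have "\<dots> \<le> ennreal ((suminf d)\<^sup>2)" using vd by (rule ennreal_leI)
  finally show ?thesis .
qed

text \<open>The capacity of an open set sees functions only up to null sets. If \<open>g\<close> is continuous off an open set
  \<open>G\<close> of small capacity, then the union of \<open>G\<close> with the set in question is open and differs from \<open>G\<close> by a
  null set, so that a competitor for \<open>G\<close> competes for this union as well.\<close>

lemma quasi_continuous_nonneg:
  assumes g: "quasi_continuous m \<F> \<E> g" and A: "open A" and pos: "AE x in m. x \<in> A \<longrightarrow> 0 \<le> g x"
  shows "Cap m \<F> \<E> {x \<in> A. g x < 0} = 0"
proof -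
  have "Cap m \<F> \<E> {x \<in> A. g x < 0} \<le> ennreal e" if "e > 0" for e
  proof -
    obtain G where G: "open G" "Cap m \<F> \<E> G < ennreal e" "continuous_on (- G) g"
      using g \<open>e > 0\<close> unfolding quasi_continuous_def by blast
    obtain A' u where u: "open A'" "G \<subseteq> A'" "u \<in> \<F>" "AE x in m. x \<in> A' \<longrightarrow> 1 \<le> u x"
      "\<And>x. 0 \<le> u x" "energy1 u < e" using Cap_lessE[OF G(2)] by blast
    obtain T where T: "open T" "T \<inter> - G = g -` {..<0} \<inter> - G"
      using continuous_on_open_invariant[of "- G" g] G(3) open_lessThan by blast
    have "AE x in m. x \<in> (A \<inter> T) \<union> A' \<longrightarrow> 1 \<le> u x" using u(4) pos
    proof eventually_elim
      case (elim x)
      have "g x < 0" if "x \<in> T" "x \<notin> G"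
        using that equalityD1[OF T(2)] by auto
      then show ?case using elim u(2) by force
    qed
    then have "Cap m \<F> \<E> {x \<in> A. g x < 0} \<le> ennreal (energy1 u)"
      using T u A by (intro Cap_upper[of "(A \<inter> T) \<union> A'"]) auto
    also have "\<dots> \<le> ennreal e" using u(6) by (intro ennreal_leI) simp
    finally show ?thesis .
  qed
  then have "Cap m \<F> \<E> {x \<in> A. g x < 0} \<le> 0" by - (rule ennreal_le_epsilon, auto)
  then show ?thesis by simp
qed

lemma quasi_continuous_diff:
  assumes f: "quasi_continuous m \<F> \<E> f" and g: "quasi_continuous m \<F> \<E> g"
  shows "quasi_continuous m \<F> \<E> (\<lambda>x. f x - g x)"
  unfolding quasi_continuous_def
proof safe
  fix e :: real assume e: "e > 0"
  then have e': "e / 16 > 0" by simp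
  obtain G where G: "open G" "Cap m \<F> \<E> G < ennreal (e / 16)" "continuous_on (- G) f"
    using f e' unfolding quasi_continuous_def by blast
  obtain H where H: "open H" "Cap m \<F> \<E> H < ennreal (e / 16)" "continuous_on (- H) g"
    using g e' unfolding quasi_continuous_def by blast
  have "Cap m \<F> \<E> (G \<union> H) \<le> ennreal ((sqrt (e / 16) + sqrt (e / 16))\<^sup>2)"
    by (rule Cap_Un[OF G(2) H(2)])
  also have "(sqrt (e / 16) + sqrt (e / 16))\<^sup>2 = e / 4"
    using e by (simp add: power2_eq_square real_sqrt_divide)
  also have "ennreal (e / 4) < ennreal e" using e by (simp add: ennreal_less_iff)
  finally have "Cap m \<F> \<E> (G \<union> H) < ennreal e" .
  moreover have "continuous_on (- (G \<union> H)) (\<lambda>x. f x - g x)"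
    by (intro continuous_on_diff continuous_on_subset[OF G(3)] continuous_on_subset[OF H(3)]) auto
  ultimately show "\<exists>G. open G \<and> Cap m \<F> \<E> G < ennreal e \<and> continuous_on (- G) (\<lambda>x. f x - g x)"
    using G H by (intro exI[of _ "G \<union> H"]) auto
qed

lemma quasi_continuous_continuous: "continuous_on UNIV f \<Longrightarrow> quasi_continuous m \<F> \<E> f"
  unfolding quasi_continuous_def
  by (auto intro!: exI[of _ "{}"] simp: Cap_empty)

end

section \<open>Continuous functions with compact support\<close>

text \<open>Lindeloef's theorem, applied to the interiors of the compact subsets of \<open>U\<close>.\<close>

lemma open_sigma_compact:
  fixes U :: "'a::{metric_space, second_countable_topology} set"
  assumes lc: "locally compact (UNIV :: 'a set)" and U: "open U"
  obtains K :: "nat \<Rightarrow> 'a set" where "\<And>i. compact (K i)" "\<And>i. K i \<subseteq> U" "U = (\<Union>i. interior (K i))"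
proof -
  define \<K> where "\<K> = {K. compact K \<and> K \<subseteq> U}"
  have cover: "\<exists>K\<in>\<K>. x \<in> interior K" if "x \<in> U" for x
  proof -
    have "\<exists>u. open u \<and> (\<exists>v. compact v \<and> x \<in> u \<and> u \<subseteq> v \<and> v \<subseteq> U)"
      using lc[unfolded locally_def, rule_format, of U x] U that by simp
    then obtain u v where "open u" "compact v" "x \<in> u" "u \<subseteq> v" "v \<subseteq> U"
      by blast
    then show ?thesis unfolding \<K>_def using interior_maximal by blast
  qed
  obtain \<G> where G: "\<G> \<subseteq> interior ` \<K>" "countable \<G>" "\<Union>\<G> = \<Union>(interior ` \<K>)"
    using Lindelof[of "interior ` \<K>"] by auto
  have "\<Union>(interior ` \<K>) = U"
    using cover interior_subset unfolding \<K>_def by blast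
  then have GU: "\<Union>\<G> = U" using G by simp
  obtain \<C> where C: "\<C> \<subseteq> \<K>" "countable \<C>" "\<G> = interior ` \<C>"
    using G(1,2) countable_subset_image by metis
  show ?thesis
  proof (rule that)
    let ?K = "\<lambda>i. from_nat_into (insert {} \<C>) i"
    have mem: "?K i \<in> insert {} \<C>" for i by (rule from_nat_into) simp
    have sub: "insert {} \<C> \<subseteq> \<K>" using C by (auto simp: \<K>_def)
    show "compact (?K i)" "?K i \<subseteq> U" for i using mem[of i] sub by (auto simp: \<K>_def)
    have "range ?K = insert {} \<C>" using C(2) by (intro range_from_nat_into) auto
    then have "(\<Union>i. interior (?K i)) = \<Union>(interior ` (insert {} \<C>))" by (metis image_image)
    also have "\<dots> = U" using GU C(3) by simp
    finally show "U = (\<Union>i. interior (?K i))" by simp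
  qed
qed

lemma Cc_continuous: "f \<in> Cc \<Longrightarrow> continuous_on UNIV f"
  by (simp add: Cc_def)

lemma Cc_borel: "f \<in> Cc \<Longrightarrow> f \<in> borel_measurable borel"
  by (intro borel_measurable_continuous_onI Cc_continuous)

lemma Cc_I:
  assumes "continuous_on UNIV f" "compact (K :: 'a::t2_space set)" "\<And>x. x \<notin> K \<Longrightarrow> f x = 0"
  shows "f \<in> Cc"
proof -
  have "closure {x. f x \<noteq> 0} \<subseteq> K"
    using assms by (intro closure_minimal compact_imp_closed) auto
  then have "compact (K \<inter> closure {x. f x \<noteq> 0})" using assms(2) by (intro compact_Int_closed) auto
  then show ?thesis using assms(1) \<open>closure {x. f x \<noteq> 0} \<subseteq> K\<close> by (simp add: Cc_def Int_absorb1)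
qed

lemma Cc_E:
  assumes "f \<in> Cc" obtains K where "compact K" "\<And>x. x \<notin> K \<Longrightarrow> f x = 0"
  using assms closure_subset[of "{x. f x \<noteq> 0}"] unfolding Cc_def by blast

lemma Cc_bounded:
  assumes "f \<in> Cc" obtains B where "0 < B" "\<And>x. \<bar>f x\<bar> \<le> B"
proof -
  obtain K where K: "compact K" "\<And>x. x \<notin> K \<Longrightarrow> f x = 0" using Cc_E[OF assms] by blast
  have "compact (f ` K)"
    using assms K(1) by (intro compact_continuous_image continuous_on_subset[OF Cc_continuous]) auto
  then obtain B where B: "0 < B" "\<And>y. y \<in> f ` K \<Longrightarrow> norm y \<le> B"
    using bounded_pos[of "f ` K"] compact_imp_bounded by auto
  then show ?thesis by (intro that[of B]) (use K in force)+
qed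

lemma Cc_comp2:
  fixes f g :: "'a::t2_space \<Rightarrow> real"
  assumes f: "f \<in> Cc" and g: "g \<in> Cc" and h: "h 0 0 = 0"
    and cont: "continuous_on UNIV (\<lambda>x. h (f x) (g x))"
  shows "(\<lambda>x. h (f x) (g x)) \<in> Cc"
proof -
  obtain K where K: "compact K" "\<And>x. x \<notin> K \<Longrightarrow> f x = 0" using Cc_E[OF f] by blast
  obtain L where L: "compact L" "\<And>x. x \<notin> L \<Longrightarrow> g x = 0" using Cc_E[OF g] by blast
  show ?thesis
    by (rule Cc_I[OF cont, of "K \<union> L"]) (use K L h in \<open>auto intro: compact_Un\<close>)
qed

lemma Cc_diff: "\<lbrakk>f \<in> Cc; g \<in> Cc\<rbrakk> \<Longrightarrow> (\<lambda>x. f x - g x) \<in> Cc" for f :: "'a::t2_space \<Rightarrow> real"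
  by (rule Cc_comp2[of f g "\<lambda>a b. a - b"]) (auto intro!: continuous_intros dest: Cc_continuous)

lemma Cc_add: "\<lbrakk>f \<in> Cc; g \<in> Cc\<rbrakk> \<Longrightarrow> (\<lambda>x. f x + g x) \<in> Cc" for f :: "'a::t2_space \<Rightarrow> real"
  by (rule Cc_comp2[of f g "\<lambda>a b. a + b"]) (auto intro!: continuous_intros dest: Cc_continuous)

lemma Cc_scale: "f \<in> Cc \<Longrightarrow> (\<lambda>x. c * f x) \<in> Cc" for f :: "'a::t2_space \<Rightarrow> real"
  by (rule Cc_comp2[of f f "\<lambda>a b. c * a"]) (auto intro!: continuous_intros dest: Cc_continuous)

lemma Cc_max: "\<lbrakk>f \<in> Cc; g \<in> Cc\<rbrakk> \<Longrightarrow> (\<lambda>x. max (f x) (g x)) \<in> Cc" for f :: "'a::t2_space \<Rightarrow> real"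
  by (rule Cc_comp2[of f g "\<lambda>a b. max a b"]) (auto intro!: continuous_intros dest: Cc_continuous)

lemma Cc_pos_part: "f \<in> Cc \<Longrightarrow> (\<lambda>x. max 0 (f x)) \<in> Cc" for f :: "'a::t2_space \<Rightarrow> real"
  by (rule Cc_comp2[of f f "\<lambda>a b. max 0 a"]) (auto intro!: continuous_intros dest: Cc_continuous)

lemma Cc_abs: "f \<in> Cc \<Longrightarrow> (\<lambda>x. \<bar>f x\<bar>) \<in> Cc" for f :: "'a::t2_space \<Rightarrow> real"
  by (rule Cc_comp2[of f f "\<lambda>a b. \<bar>a\<bar>"]) (auto intro!: continuous_intros dest: Cc_continuous)

lemma Cc_clip: "f \<in> Cc \<Longrightarrow> (\<lambda>x. min 1 (max 0 (f x))) \<in> Cc" for f :: "'a::t2_space \<Rightarrow> real"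
  by (rule Cc_comp2[of f f "\<lambda>a b. min 1 (max 0 a)"]) (auto intro!: continuous_intros dest: Cc_continuous)

lemma Cc_Urysohn:
  fixes K U :: "'a::{metric_space, second_countable_topology} set"
  assumes lc: "locally compact (UNIV :: 'a set)" and K: "compact K" and U: "open U" "K \<subseteq> U"
  obtains c V where "c \<in> Cc" "\<And>x. 0 \<le> c x" "\<And>x. c x \<le> 1" "\<And>x. x \<notin> U \<Longrightarrow> c x = 0"
    "open V" "K \<subseteq> V" "\<And>x. x \<in> V \<Longrightarrow> c x = (1::real)"
proof (cases "K = {}")
  case True
  show ?thesis
    by (rule that[of "\<lambda>_. 0" "{}"]) (use True in \<open>auto intro: Cc_I[of _ "{}"]\<close>)
next
  case False
  obtain L where L: "\<And>i::nat. compact (L i)" "\<And>i. L i \<subseteq> U" "U = (\<Union>i. interior (L i))"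
    using open_sigma_compact[OF lc U(1)] by metis
  obtain I where I: "finite I" "K \<subseteq> (\<Union>i\<in>I. interior (L i))"
    using compactE_image[OF K, of UNIV "\<lambda>i. interior (L i)"] U(2) L(3) by auto
  define W C where "W = (\<Union>i\<in>I. interior (L i))" and "C = (\<Union>i\<in>I. L i)"
  have W: "open W" "K \<subseteq> W" "W \<subseteq> C" "C \<subseteq> U" "compact C"
    unfolding W_def C_def using I(2) interior_subset L(2) compact_UN[OF I(1), of L] L(1) by blast+
  obtain e where e: "0 < e" "(\<Union>x\<in>K. ball x e) \<subseteq> W"
    using compact_subset_open_imp_ball_epsilon_subset[OF K W(1,2)] by auto
  have in_W: "x \<in> W" if near: "infdist x K < e" for x
  proof -
    obtain y where "y \<in> K" "dist x y < e"
      using near cINF_less_iff[OF False bdd_below_image_dist, of x e] infdist_notempty[OF False, of x]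
      by auto
    then have "x \<in> (\<Union>y\<in>K. ball y e)" by (auto simp: dist_commute)
    then show ?thesis using e(2) by blast
  qed
  define c where "c x = max 0 (min 1 (2 - 3 * infdist x K / e))" for x
  have cont: "continuous_on UNIV c"
    unfolding c_def by (intro continuous_intros) (use e in auto)
  have zero: "c x = 0" if "x \<notin> W" for x
  proof -
    have "e \<le> infdist x K" using in_W[of x] that by force
    then have "3 \<le> 3 * infdist x K / e" using e by (simp add: field_simps)
    then show ?thesis by (simp add: c_def)
  qed
  show ?thesis
  proof (rule that[of c "{x. infdist x K < e / 3}"])
    show "c \<in> Cc" by (rule Cc_I[OF cont W(5)]) (use zero W(3) in auto)
    show "open {x. infdist x K < e / 3}" by (intro open_Collect_less continuous_intros)
    show "K \<subseteq> {x. infdist x K < e / 3}" using e by (auto simp: infdist_zero)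
    show "c x = 1" if "x \<in> {x. infdist x K < e / 3}" for x
    proof -
      have "3 * infdist x K / e < 1" using that e by (simp add: field_simps)
      then show ?thesis by (simp add: c_def)
    qed
  qed (use zero W in \<open>auto simp: c_def\<close>)
qed

lemma open_indicator_approx:
  fixes U :: "'a::{metric_space, second_countable_topology} set"
  assumes lc: "locally compact (UNIV :: 'a set)" and U: "open U"
  obtains \<phi> :: "nat \<Rightarrow> 'a \<Rightarrow> real" where "\<And>n. \<phi> n \<in> Cc" "\<And>n x. 0 \<le> \<phi> n x" "\<And>n x. \<phi> n x \<le> 1"
    "\<And>n x. \<phi> n x \<le> \<phi> (Suc n) x" "\<And>x. (\<lambda>n. \<phi> n x) \<longlonglongrightarrow> indicator U x"
proof -
  obtain K where K: "\<And>i::nat. compact (K i)" "\<And>i. K i \<subseteq> U" "U = (\<Union>i. interior (K i))"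
    using open_sigma_compact[OF lc U(1)] by metis
  have "\<exists>c. c \<in> Cc \<and> (\<forall>x. 0 \<le> c x) \<and> (\<forall>x. c x \<le> 1) \<and> (\<forall>x. x \<notin> U \<longrightarrow> c x = 0) \<and>
     (\<forall>x\<in>K i. c x = (1::real))" for i
    by (rule Cc_Urysohn[OF lc K(1) U K(2), of i]) blast
  then obtain c where c: "\<And>i. c i \<in> Cc" "\<And>i x. 0 \<le> c i x" "\<And>i x. c i x \<le> 1"
     "\<And>i x. x \<notin> U \<Longrightarrow> c i x = 0" "\<And>i x. x \<in> K i \<Longrightarrow> c i x = (1::real)"
    by metis
  define \<phi> where "\<phi> n = rec_nat (c 0) (\<lambda>n f x. max (f x) (c (Suc n) x)) n" for n
  have s: "\<phi> 0 = c 0" "\<And>n. \<phi> (Suc n) = (\<lambda>x. max (\<phi> n x) (c (Suc n) x))" by (simp_all add: \<phi>_def)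
  have ge: "c i x \<le> \<phi> n x" if "i \<le> n" for i n x
    using that by (induction n) (auto simp: s le_Suc_eq le_max_iff_disj)
  have b: "0 \<le> \<phi> n x" "\<phi> n x \<le> 1" for n x
    by (induction n) (auto simp: s c le_max_iff_disj)
  have z: "\<phi> n x = 0" if "x \<notin> U" for n x
    by (induction n) (auto simp: s c that)
  show ?thesis
  proof (rule that[of \<phi>])
    show "\<phi> n \<in> Cc" for n by (induction n) (auto simp: s c intro: Cc_max)
    show "(\<lambda>n. \<phi> n x) \<longlonglongrightarrow> indicator U x" for x
    proof (cases "x \<in> U")
      case True
      then obtain i where "x \<in> K i" using K(3) interior_subset by blast
      then have "\<phi> n x = 1" if "n \<ge> i" for n using ge[OF that, of x] b(2)[of n x] c(5) by force
      then show ?thesis using True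
        by (intro tendsto_eventually) (auto simp: eventually_sequentially)
    qed (use z in simp)
  qed (use b s in auto)
qed

section \<open>Closability\<close>

lemma form_Cauchy_subseq:
  assumes "form_Cauchy Q u" "strict_mono (r :: nat \<Rightarrow> nat)"
  shows "form_Cauchy Q (\<lambda>n. u (r n))"
  unfolding form_Cauchy_def
proof safe
  fix e :: real assume "e > 0"
  then obtain N where "\<forall>i\<ge>N. \<forall>j\<ge>N. Q (\<lambda>x. u i x - u j x) (\<lambda>x. u i x - u j x) < e"
    using assms(1) unfolding form_Cauchy_def by blast
  then show "\<exists>N. \<forall>i\<ge>N. \<forall>j\<ge>N. Q (\<lambda>x. u (r i) x - u (r j) x) (\<lambda>x. u (r i) x - u (r j) x) < e"
    using seq_suble[OF assms(2)] order_trans by (intro exI[of _ N]) blast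
qed

text \<open>With the ratio \<open>1/16\<close> the square roots of the increments remain summable after multiplication
  by \<open>2 ^ n\<close>.\<close>

lemma form_Cauchy_fast_subseq:
  assumes "form_Cauchy Q u"
  obtains r :: "nat \<Rightarrow> nat" where "strict_mono r"
    "\<And>n. Q (\<lambda>x. u (r (Suc n)) x - u (r n) x) (\<lambda>x. u (r (Suc n)) x - u (r n) x) < (1/16) ^ n"
proof -
  have "\<forall>n. \<exists>N. \<forall>i\<ge>N. \<forall>j\<ge>N. Q (\<lambda>x. u i x - u j x) (\<lambda>x. u i x - u j x) < (1/16) ^ n"
    using assms unfolding form_Cauchy_def by simp
  then obtain N where N: "\<forall>n. \<forall>i\<ge>N n. \<forall>j\<ge>N n. Q (\<lambda>x. u i x - u j x) (\<lambda>x. u i x - u j x) < (1/16::real) ^ n"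
    by (rule choice[THEN exE])
  define r where "r n = n + (\<Sum>k\<le>n. N k)" for n
  have r: "strict_mono r" unfolding r_def by (rule strict_monoI_Suc) simp
  have rN: "N n \<le> r n" for n
    unfolding r_def using member_le_sum[of n "{..n}" N] by simp
  have "N n \<le> r (Suc n)" for n
    using rN[of n] strict_monoD[OF r, of n "Suc n"] by simp
  then show ?thesis using N rN by (intro that[OF r]) blast
qed

context semi_inner
begin

lemma Cauchy_bounded:
  assumes u: "\<And>n::nat. u n \<in> V" and C: "form_Cauchy Q u"
  obtains B where "0 \<le> B" "\<And>n. normsq (u n) \<le> B"
proof -
  obtain N where N: "\<forall>i\<ge>N. \<forall>j\<ge>N. normsq (\<lambda>x. u i x - u j x) < 1"
    using C unfolding form_Cauchy_def by (metis zero_less_one)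
  define B where "B = (1 + sqrt (normsq (u N)))\<^sup>2 + (\<Sum>k\<le>N. normsq (u k))"
  have s: "0 \<le> (\<Sum>k\<le>N. normsq (u k))" by (intro sum_nonneg nonneg u)
  have "normsq (u n) \<le> B" for n
  proof (cases "n \<le> N")
    case True
    then have "normsq (u n) \<le> (\<Sum>k\<le>N. normsq (u k))"
      by (intro member_le_sum nonneg u) auto
    then show ?thesis by (simp add: B_def add_increasing)
  next
    case False
    have "sqrt (normsq (u n)) \<le> sqrt (normsq (\<lambda>x. u n x - u N x)) + sqrt (normsq (u N))"
      by (rule sqrt_triangle_diff[OF u u])
    also have "\<dots> \<le> 1 + sqrt (normsq (u N))"
      using N False by (intro add_right_mono) (auto intro: less_imp_le)
    finally have "normsq (u n) \<le> (1 + sqrt (normsq (u N)))\<^sup>2" by (rule sqrt_le_D)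
    then show ?thesis using s by (simp add: B_def)
  qed
  moreover have "0 \<le> B" unfolding B_def using s by simp
  ultimately show ?thesis by (rule that[rotated])
qed

lemma Cauchy_diff:
  assumes u: "\<And>n::nat. u n \<in> V" and v: "\<And>n. v n \<in> V" and "form_Cauchy Q u" "form_Cauchy Q v"
  shows "form_Cauchy Q (\<lambda>n x. u n x - v n x)"
proof (subst form_Cauchy_iff_sqrt)
  let ?N = "\<lambda>f. sqrt (normsq f)"
  show "0 \<le> normsq (\<lambda>x. u i x - v i x - (u j x - v j x))" for i j
    by (intro nonneg diff_mem u v)
  have U: "\<forall>e>0. \<exists>N. \<forall>i\<ge>N. \<forall>j\<ge>N. ?N (\<lambda>x. u i x - u j x) < e"
    using assms(3) by (subst (asm) form_Cauchy_iff_sqrt) (auto intro: nonneg diff_mem u)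
  have W: "\<forall>e>0. \<exists>N. \<forall>i\<ge>N. \<forall>j\<ge>N. ?N (\<lambda>x. v i x - v j x) < e"
    using assms(4) by (subst (asm) form_Cauchy_iff_sqrt) (auto intro: nonneg diff_mem v)
  have *: "?N (\<lambda>x. u i x - v i x - (u j x - v j x)) \<le> ?N (\<lambda>x. u i x - u j x) + ?N (\<lambda>x. v i x - v j x)" for i j
  proof -
    have "(\<lambda>x. u i x - v i x - (u j x - v j x)) = (\<lambda>x. (u i x - u j x) + (v j x - v i x))" by auto
    then show ?thesis
      using sqrt_triangle[OF diff_mem[OF u u] diff_mem[OF v v], of i j j i] diff_square_commute[OF v v, of i j]
      by simp
  qed
  show "\<forall>e>0. \<exists>N. \<forall>i\<ge>N. \<forall>j\<ge>N. ?N (\<lambda>x. u i x - v i x - (u j x - v j x)) < e"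
  proof safe
    fix e :: real assume "e > 0"
    then obtain N1 N2 where N: "\<forall>i\<ge>N1. \<forall>j\<ge>N1. ?N (\<lambda>x. u i x - u j x) < e / 2"
      "\<forall>i\<ge>N2. \<forall>j\<ge>N2. ?N (\<lambda>x. v i x - v j x) < e / 2"
      using U W by (meson half_gt_zero)
    have "?N (\<lambda>x. u i x - v i x - (u j x - v j x)) < e" if "i \<ge> max N1 N2" "j \<ge> max N1 N2" for i j
    proof -
      have "?N (\<lambda>x. u i x - u j x) < e / 2" "?N (\<lambda>x. v i x - v j x) < e / 2" using N that by auto
      then show ?thesis using *[of i j] by linarith
    qed
    then show "\<exists>N. \<forall>i\<ge>N. \<forall>j\<ge>N. ?N (\<lambda>x. u i x - v i x - (u j x - v j x)) < e" by blast
  qed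
qed

end

text \<open>The assumption \<open>Markovian\<close> says that \<open>\<alpha> G\<^sub>\<alpha>\<close>, for the resolvent \<open>G\<^sub>\<alpha>\<close> of the form, preserves the
  bounds \<open>0 \<le> f \<le> c\<close>. For a form with an associated process it holds because transition
  probabilities have mass at most one.\<close>

locale transient_dirichlet_form = regular_dirichlet_form m \<F> \<E>
  for m :: "'a::{metric_space, second_countable_topology} measure" and \<F> \<E> +
  assumes loc_compact: "locally compact (UNIV :: 'a set)"
    and radon: "radon_measure m"
    and transient: "transient_form m \<F> \<E>"
    and Markovian: "\<lbrakk>0 < \<alpha>; f \<in> L2 m; \<And>x. 0 \<le> f x; \<And>x. f x \<le> c\<rbrakk> \<Longrightarrow>
       \<exists>u\<in>\<F>. (\<forall>g\<in>\<F>. form_alpha m \<E> \<alpha> u g = (\<integral>x. f x * g x \<partial>m)) \<and>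
         (AE x in m. 0 \<le> u x \<and> \<alpha> * u x \<le> c)"
begin

lemma sets_m [measurable_cong, simp]: "sets m = sets borel"
  using radon by (simp add: radon_measure_def)

lemma space_m [simp]: "space m = UNIV"
  using sets_eq_imp_space_eq[OF sets_m] by simp

lemma borel_m [simp]: "borel_measurable m = borel_measurable borel"
  by (rule measurable_cong_sets) simp_all

lemma compact_finite: "compact K \<Longrightarrow> emeasure m K < \<infinity>"
  using radon by (simp add: radon_measure_def)

lemma compact_cover:
  obtains K :: "nat \<Rightarrow> 'a set" where "\<And>i. compact (K i)" "incseq K" "(\<Union>i. K i) = UNIV"
proof -
  obtain L where L: "\<And>i::nat. compact (L i)" "(UNIV::'a set) = (\<Union>i. interior (L i))"
    using open_sigma_compact[OF loc_compact open_UNIV] by metis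
  show ?thesis
  proof (rule that[of "\<lambda>i. \<Union>j\<le>i. L j"])
    show "compact (\<Union>j\<le>i. L j)" for i using L(1) by (intro compact_UN) auto
    have "(\<Union>j\<le>k. L j) \<subseteq> (\<Union>j\<le>i. L j)" if "k \<le> i" for k i
      by (rule Union_mono, rule image_mono) (use that in simp)
    then show "incseq (\<lambda>i. \<Union>j\<le>i. L j)" by (rule monoI)
    have "x \<in> (\<Union>i. \<Union>j\<le>i. L j)" for x
    proof -
      have "x \<in> (\<Union>i. interior (L i))" unfolding L(2)[symmetric] by simp
      then obtain i where "x \<in> interior (L i)" by (rule UN_E)
      then have "x \<in> L i" using interior_subset[of "L i"] by (rule subsetD[rotated])
      then show ?thesis by auto
    qed
    then show "(\<Union>i. \<Union>j\<le>i. L j) = UNIV" by (intro equalityI subsetI UNIV_I)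
  qed
qed

lemma Cc_integrable:
  assumes "f \<in> Cc" shows "integrable m f" "f \<in> L2 m"
proof -
  obtain K where K: "compact K" "\<And>x. x \<notin> K \<Longrightarrow> f x = 0" using Cc_E[OF assms] by blast
  obtain B where B: "0 < B" "\<And>x. \<bar>f x\<bar> \<le> B" using Cc_bounded[OF assms] by blast
  have b: "f \<in> borel_measurable borel" by (rule Cc_borel[OF assms])
  have Kb: "K \<in> sets borel" using K(1) by (simp add: borel_compact)
  have i: "integrable m (\<lambda>x. c * indicator K x)" for c :: real
    using compact_finite[OF K(1)] Kb
    by (intro integrable_mult_right integrable_real_indicator) auto
  show "integrable m f"
    by (rule Bochner_Integration.integrable_bound[OF i[of B]]) (use b B K in \<open>auto simp: indicator_def\<close>)
  have "integrable m (\<lambda>x. (f x)\<^sup>2)"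
  proof (rule Bochner_Integration.integrable_bound[OF i[of "B\<^sup>2"]])
    have "(f x)\<^sup>2 \<le> B\<^sup>2" for x using B by (intro power2_le_iff_abs_le[THEN iffD2]) auto
    then show "AE x in m. norm ((f x)\<^sup>2) \<le> norm (B\<^sup>2 * indicator K x)"
      using K by (auto simp: indicator_def)
  qed (use b in auto)
  then show "f \<in> L2 m" using b by (simp add: L2_def)
qed

text \<open>By symmetry the integral of \<open>u = G\<^sub>\<alpha> f\<close> over a compact set \<open>K\<close> is the integral of \<open>f G\<^sub>\<alpha> 1\<^sub>K\<close>, and
  \<open>\<alpha> G\<^sub>\<alpha> 1\<^sub>K \<le> 1\<close>. So \<open>\<alpha> G\<^sub>\<alpha>\<close> is a contraction in \<open>L\<^sup>1\<close>.\<close>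

lemma resolvent_integrable:
  assumes \<alpha>: "0 < \<alpha>" and f: "f \<in> L2 m" "integrable m f" "\<And>x. 0 \<le> f x"
    and u: "u \<in> \<F>" "\<And>g. g \<in> \<F> \<Longrightarrow> form_alpha m \<E> \<alpha> u g = (\<integral>x. f x * g x \<partial>m)"
    and pos: "AE x in m. 0 \<le> u x"
  shows "integrable m u"
proof -
  obtain K :: "nat \<Rightarrow> 'a set" where K: "\<And>i. compact (K i)" "incseq K" "(\<Union>i. K i) = UNIV"
    using compact_cover by metis
  have Kb: "K i \<in> sets borel" for i using K(1) by (simp add: borel_compact)
  have ub: "u \<in> borel_measurable borel" using borel_dom[OF u(1)] by simp
  have ui: "integrable m (\<lambda>x. indicator (K i) x * u x)" for i
  proof (rule L2_mult_integrable[OF _ L2_dom[OF u(1)]])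
    have "(\<lambda>x. (indicator (K i) x)\<^sup>2) = (indicator (K i) :: 'a \<Rightarrow> real)" by (auto simp: indicator_def)
    moreover have "integrable m (indicator (K i) :: 'a \<Rightarrow> real)"
      using Kb[of i] compact_finite[OF K(1)] by (intro integrable_real_indicator) auto
    ultimately show "indicator (K i) \<in> L2 m" using Kb[of i] by (simp add: L2_def)
  qed
  have le: "(\<integral>x. indicator (K i) x * u x \<partial>m) \<le> (\<integral>x. f x \<partial>m) / \<alpha>" for i
  proof -
    have "(\<lambda>x. (indicator (K i) x)\<^sup>2) = (indicator (K i) :: 'a \<Rightarrow> real)" by (auto simp: indicator_def)
    then have L: "indicator (K i) \<in> L2 m"
      using Kb[of i] compact_finite[OF K(1)] by (auto simp: L2_def intro!: integrable_real_indicator)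
    obtain w where w: "w \<in> \<F>" "\<And>g. g \<in> \<F> \<Longrightarrow> form_alpha m \<E> \<alpha> w g = (\<integral>x. indicator (K i) x * g x \<partial>m)"
      "AE x in m. 0 \<le> w x \<and> \<alpha> * w x \<le> 1"
      using Markovian[OF \<alpha> L, of 1] by (auto simp: indicator_def)
    have "(\<integral>x. indicator (K i) x * u x \<partial>m) = form_alpha m \<E> \<alpha> w u" using w u by simp
    also have "\<dots> = form_alpha m \<E> \<alpha> u w"
      using semi_inner.sym[OF semi_inner_alpha w(1) u(1)] \<alpha> by simp
    also have "\<dots> = (\<integral>x. f x * w x \<partial>m)" using w u by simp
    also have "\<dots> \<le> (\<integral>x. f x / \<alpha> \<partial>m)"
    proof (rule integral_mono_AE)
      show "integrable m (\<lambda>x. f x * w x)" by (rule L2_mult_integrable[OF f(1) L2_dom[OF w(1)]])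
      show "integrable m (\<lambda>x. f x / \<alpha>)" using f(2) by simp
      show "AE x in m. f x * w x \<le> f x / \<alpha>" using w(3)
      proof eventually_elim
        case (elim x)
        then have "f x * (\<alpha> * w x) \<le> f x * 1" using f(3) by (intro mult_left_mono) auto
        then show ?case using \<alpha> by (simp add: field_simps)
      qed
    qed
    finally show ?thesis by simp
  qed
  have "(\<integral>\<^sup>+x. ennreal (u x) \<partial>m) = (\<integral>\<^sup>+x. (SUP i. ennreal (indicator (K i) x * u x)) \<partial>m)"
  proof (rule nn_integral_cong_AE)
    show "AE x in m. ennreal (u x) = (SUP i. ennreal (indicator (K i) x * u x))" using pos
    proof eventually_elim
      case (elim x)
      obtain i where "x \<in> K i" using K(3) by blast
      then show ?case using elim
        by (intro antisym SUP_least SUP_upper2[of i]) (auto simp: indicator_def)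
    qed
  qed
  also have "\<dots> = (SUP i. \<integral>\<^sup>+x. ennreal (indicator (K i) x * u x) \<partial>m)"
  proof (rule nn_integral_monotone_convergence_SUP_AE)
    show "AE x in m. ennreal (indicator (K i) x * u x) \<le> ennreal (indicator (K (Suc i)) x * u x)" for i
      using pos by eventually_elim (use incseq_SucD[OF K(2), of i] in \<open>auto simp: indicator_def intro!: ennreal_leI\<close>)
    show "(\<lambda>x. ennreal (indicator (K i) x * u x)) \<in> borel_measurable m" for i
      using Kb[of i] ub by simp
  qed
  also have "\<dots> \<le> ennreal ((\<integral>x. f x \<partial>m) / \<alpha>)"
  proof (rule SUP_least)
    fix i
    have "(\<integral>\<^sup>+x. ennreal (indicator (K i) x * u x) \<partial>m) = ennreal (\<integral>x. indicator (K i) x * u x \<partial>m)"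
      by (rule nn_integral_eq_integral[OF ui]) (use pos in \<open>auto simp: indicator_def\<close>)
    then show "(\<integral>\<^sup>+x. ennreal (indicator (K i) x * u x) \<partial>m) \<le> ennreal ((\<integral>x. f x \<partial>m) / \<alpha>)"
      using le[of i] by (simp add: ennreal_leI)
  qed
  finally have "(\<integral>\<^sup>+x. ennreal (u x) \<partial>m) < \<infinity>" by (simp add: le_less_trans)
  then show ?thesis using ub pos by (intro integrableI_nonneg) auto
qed

text \<open>Here \<open>z = \<alpha> G\<^sub>\<alpha> \<psi>\<close>. Against such a \<open>z\<close> the form is an integral with the integrable weight \<open>\<psi> - z\<close>, and
  \<open>z\<close> tends to \<open>\<psi>\<close> in \<open>L\<^sup>2\<close> with bounded energy as \<open>\<alpha> \<rightarrow> \<infinity>\<close>.\<close>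

lemma resolvent_approx:
  assumes \<psi>: "\<psi> \<in> \<F>" "\<psi> \<in> Cc" "\<And>x. 0 \<le> \<psi> x" and \<alpha>: "0 < \<alpha>"
  obtains z where "z \<in> \<F>" "integrable m z" "\<And>v. v \<in> \<F> \<Longrightarrow> \<E> z v = \<alpha> * (\<integral>x. (\<psi> x - z x) * v x \<partial>m)"
    "energy z \<le> energy \<psi>" "(\<integral>x. (z x - \<psi> x)\<^sup>2 \<partial>m) \<le> energy \<psi> / \<alpha>"
proof -
  obtain B where B: "0 < B" "\<And>x. \<bar>\<psi> x\<bar> \<le> B" using Cc_bounded[OF \<psi>(2)] by blast
  have L: "\<psi> \<in> L2 m" using L2_dom \<psi> by blast
  obtain u where u: "u \<in> \<F>" "\<And>g. g \<in> \<F> \<Longrightarrow> form_alpha m \<E> \<alpha> u g = (\<integral>x. \<psi> x * g x \<partial>m)"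
      "AE x in m. 0 \<le> u x \<and> \<alpha> * u x \<le> B"
    using Markovian[OF \<alpha> L \<psi>(3), of B] B(2) by (metis abs_le_D1)
  define z where "z = (\<lambda>x. \<alpha> * u x)"
  have z: "z \<in> \<F>" unfolding z_def by (rule dom_scale[OF u(1)])
  have zL: "z \<in> L2 m" using L2_dom z by blast
  have Ez: "\<E> z v = \<alpha> * (\<integral>x. (\<psi> x - z x) * v x \<partial>m)" if v: "v \<in> \<F>" for v
  proof -
    have "\<E> u v + \<alpha> * (\<integral>x. u x * v x \<partial>m) = (\<integral>x. \<psi> x * v x \<partial>m)"
      using u(2)[OF v] by (simp add: form_alpha_def)
    moreover have "\<E> z v = \<alpha> * \<E> u v" unfolding z_def by (rule form_scale[OF u(1) v])
    moreover have "(\<integral>x. (\<psi> x - z x) * v x \<partial>m) = (\<integral>x. \<psi> x * v x \<partial>m) - (\<integral>x. z x * v x \<partial>m)"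
      by (rule L2.diff_left[OF L zL L2_dom[OF v]])
    moreover have "(\<integral>x. z x * v x \<partial>m) = \<alpha> * (\<integral>x. u x * v x \<partial>m)"
      unfolding z_def by (rule L2.scale_left[OF L2_dom[OF u(1)] L2_dom[OF v]])
    ultimately show ?thesis by (simp add: algebra_simps)
  qed
  have "\<E> z (\<lambda>x. \<psi> x - z x) = \<alpha> * (\<integral>x. (\<psi> x - z x) * (\<psi> x - z x) \<partial>m)"
    by (rule Ez[OF form.diff_mem[OF \<psi>(1) z]])
  also have "(\<integral>x. (\<psi> x - z x) * (\<psi> x - z x) \<partial>m) = (\<integral>x. (z x - \<psi> x)\<^sup>2 \<partial>m)"
    using L2.diff_square_commute[OF L zL] by (simp add: power2_eq_square)
  finally have eq: "\<E> z \<psi> - energy z = \<alpha> * (\<integral>x. (z x - \<psi> x)\<^sup>2 \<partial>m)"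
    by (simp add: form.diff_right \<psi> z)
  have n0: "0 \<le> (\<integral>x. (z x - \<psi> x)\<^sup>2 \<partial>m)" by simp
  have "0 \<le> energy (\<lambda>x. \<psi> x - z x)" by (intro form_nonneg form.diff_mem \<psi> z)
  then have "2 * \<E> z \<psi> \<le> energy \<psi> + energy z"
    by (simp add: form.diff_square \<psi> z form.sym[OF \<psi>(1) z])
  then have E: "energy z + 2 * (\<alpha> * (\<integral>x. (z x - \<psi> x)\<^sup>2 \<partial>m)) \<le> energy \<psi>" using eq by linarith
  have an0: "0 \<le> \<alpha> * (\<integral>x. (z x - \<psi> x)\<^sup>2 \<partial>m)" using \<alpha> n0 by simp
  have E1: "energy z \<le> energy \<psi>" using E an0 by linarith
  have "(\<integral>x. (z x - \<psi> x)\<^sup>2 \<partial>m) * \<alpha> \<le> energy \<psi>" using E an0 form_nonneg[OF z] by (simp add: mult.commute)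
  then have E2: "(\<integral>x. (z x - \<psi> x)\<^sup>2 \<partial>m) \<le> energy \<psi> / \<alpha>" using \<alpha> by (simp add: field_simps)
  have "integrable m u"
    by (rule resolvent_integrable[OF \<alpha> L Cc_integrable(1)[OF \<psi>(2)] \<psi>(3) u(1,2)]) (use u(3) in auto)
  then have "integrable m z" by (simp add: z_def)
  then show ?thesis using z Ez E1 E2 by (intro that) auto
qed

text \<open>For \<open>z\<close> as in \<open>resolvent_approx\<close> this is dominated convergence. Midpoints of such functions approximate
  nonnegative core functions in the norm of \<open>energy1\<close>, differences of these form the core, and the core
  is dense; the bound on the energies of the \<open>v n\<close> carries the convergence along.\<close>

lemma bounded_weakly_null:
  assumes v: "\<And>n::nat. v n \<in> \<F>" and M: "\<And>n x. \<bar>v n x\<bar> \<le> M" and C: "\<And>n. energy (v n) \<le> C"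
    and lim: "AE x in m. (\<lambda>n. v n x) \<longlonglongrightarrow> 0" and z: "z \<in> \<F>"
  shows "(\<lambda>n. \<E> z (v n)) \<longlonglongrightarrow> 0"
proof -
  define S where "S = {z \<in> \<F>. (\<lambda>n. \<E> z (v n)) \<longlonglongrightarrow> 0}"
  have C0: "0 \<le> C" using C[of 0] form_nonneg[OF v[of 0]] by linarith
  have closed: "z \<in> S" if z: "z \<in> \<F>" and ap: "\<And>e. e > 0 \<Longrightarrow> \<exists>y\<in>S. energy (\<lambda>x. z x - y x) < e" for z
  proof -
    have "(\<lambda>n. \<E> z (v n)) \<longlonglongrightarrow> 0"
    proof (rule LIMSEQ_I)
      fix e :: real assume e: "0 < e"
      define d where "d = (e / 2 / (sqrt C + 1))\<^sup>2"
      have sC: "0 < sqrt C + 1" using C0 by (simp add: add_nonneg_pos)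
      then have "d > 0" using e by (simp add: d_def)
      then obtain y where y: "y \<in> S" "energy (\<lambda>x. z x - y x) < d" using ap by blast
      have yF: "y \<in> \<F>" using y by (simp add: S_def)
      obtain N where N: "\<And>n. n \<ge> N \<Longrightarrow> \<bar>\<E> y (v n)\<bar> < e / 2"
        using LIMSEQ_D[of "\<lambda>n. \<E> y (v n)" 0 "e/2"] y(1) e by (auto simp: S_def)
      have "\<bar>\<E> z (v n)\<bar> < e" if "n \<ge> N" for n
      proof -
        have "\<bar>\<E> (\<lambda>x. z x - y x) (v n)\<bar>
            \<le> sqrt (energy (\<lambda>x. z x - y x)) * sqrt (energy (v n))"
          by (rule form.Cauchy_Schwarz[OF form.diff_mem[OF z yF] v])
        also have "\<dots> \<le> sqrt d * sqrt C"
          using y(2) C[of n] by (intro mult_mono) (auto simp: form_nonneg v \<open>0 < d\<close> less_imp_le)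
        also have "\<dots> = e / 2 * (sqrt C / (sqrt C + 1))" using e sC by (simp add: d_def)
        also have "\<dots> \<le> e / 2 * 1" using e sC by (intro mult_left_mono) auto
        finally show ?thesis using N[OF that] form.diff_left[OF z yF v, of n] by linarith
      qed
      then show "\<exists>no. \<forall>n\<ge>no. norm (\<E> z (v n) - 0) < e" by auto
    qed
    then show ?thesis using z by (simp add: S_def)
  qed
  have lin: "(\<lambda>x. a * f x + b * g x) \<in> S" if f: "f \<in> S" and g: "g \<in> S" for a b f g
  proof -
    have fF: "f \<in> \<F>" "g \<in> \<F>" using f g by (auto simp: S_def)
    have "(\<lambda>n. a * \<E> f (v n) + b * \<E> g (v n)) \<longlonglongrightarrow> a * 0 + b * 0"
      by (intro tendsto_intros) (use f g in \<open>auto simp: S_def\<close>)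
    moreover have "\<E> (\<lambda>x. a * f x + b * g x) (v n) = a * \<E> f (v n) + b * \<E> g (v n)" for n
      using fF v by (simp add: form_add form_scale dom_scale)
    ultimately show ?thesis using fF by (simp add: S_def dom_add dom_scale)
  qed
  have hull: "f \<in> S" if "A \<subseteq> S" "f \<in> mid_hull A" for A f
    using that(2)
  proof induction
    case (mid_step f g)
    then show ?case using lin[of f g "1/2" "1/2"] by (simp add: add_divide_distrib)
  qed (use that in auto)
  have core_pos: "\<psi> \<in> S" if \<psi>: "\<psi> \<in> \<F>" "\<psi> \<in> Cc" "\<And>x. 0 \<le> \<psi> x" for \<psi>
  proof -
    have "\<exists>w. w \<in> \<F> \<and> integrable m w \<and> (\<forall>y\<in>\<F>. \<E> w y = real (Suc k) * (\<integral>x. (\<psi> x - w x) * y x \<partial>m)) \<and>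
      energy w \<le> energy \<psi> \<and> (\<integral>x. (w x - \<psi> x)\<^sup>2 \<partial>m) \<le> energy \<psi> / real (Suc k)" for k
      by (rule resolvent_approx[OF \<psi>, of "real (Suc k)"]) (simp, blast)
    then have "\<forall>k. \<exists>w. w \<in> \<F> \<and> integrable m w \<and> (\<forall>y\<in>\<F>. \<E> w y = real (Suc k) * (\<integral>x. (\<psi> x - w x) * y x \<partial>m)) \<and>
      energy w \<le> energy \<psi> \<and> (\<integral>x. (w x - \<psi> x)\<^sup>2 \<partial>m) \<le> energy \<psi> / real (Suc k)" ..
    then obtain w where w: "\<forall>k. w k \<in> \<F> \<and> integrable m (w k) \<and>
       (\<forall>y\<in>\<F>. \<E> (w k) y = real (Suc k) * (\<integral>x. (\<psi> x - w k x) * y x \<partial>m)) \<and>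
      energy (w k) \<le> energy \<psi> \<and> (\<integral>x. (w k x - \<psi> x)\<^sup>2 \<partial>m) \<le> energy \<psi> / real (Suc k)"
      by (rule choice[THEN exE])
    have wS: "w k \<in> S" for k
    proof -
      have i: "integrable m (\<lambda>x. \<psi> x - w k x)" using w Cc_integrable(1)[OF \<psi>(2)] by simp
      have b: "\<psi> \<in> borel_measurable borel" "w k \<in> borel_measurable borel" "\<And>n. v n \<in> borel_measurable borel"
        using borel_dom \<psi>(1) w v by auto
      have "(\<lambda>n. \<integral>x. (\<psi> x - w k x) * v n x \<partial>m) \<longlonglongrightarrow> (\<integral>x. 0 \<partial>m)"
      proof (rule integral_dominated_convergence[where w = "\<lambda>x. \<bar>\<psi> x - w k x\<bar> * M"])
        show "AE x in m. (\<lambda>n. (\<psi> x - w k x) * v n x) \<longlonglongrightarrow> 0"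
          using lim by eventually_elim (rule tendsto_mult_right_zero)
        show "AE x in m. norm ((\<psi> x - w k x) * v n x) \<le> \<bar>\<psi> x - w k x\<bar> * M" for n
          using M by (auto simp: abs_mult intro!: mult_left_mono)
        show "integrable m (\<lambda>x. \<bar>\<psi> x - w k x\<bar> * M)" using i by simp
      qed (use b in auto)
      then have "(\<lambda>n. real (Suc k) * (\<integral>x. (\<psi> x - w k x) * v n x \<partial>m)) \<longlonglongrightarrow> 0"
        by (intro tendsto_mult_right_zero) simp
      then show ?thesis using w v by (simp add: S_def)
    qed
    have wF: "w k \<in> \<F>" "energy (w k) \<le> energy \<psi>" for k
      by (rule w[THEN spec, THEN conjunct1])
         (rule w[THEN spec, THEN conjunct2, THEN conjunct2, THEN conjunct2, THEN conjunct1])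
    have "(\<lambda>k. \<integral>x. (w k x - \<psi> x)\<^sup>2 \<partial>m) \<longlonglongrightarrow> 0"
    proof (rule real_tendsto_sandwich[OF _ _ tendsto_const])
      show "(\<lambda>k. energy \<psi> / real (Suc k)) \<longlonglongrightarrow> 0" by (rule LIMSEQ_Suc[OF lim_const_over_n])
    qed (use w in \<open>auto intro!: always_eventually\<close>)
    then obtain q where "\<psi> \<in> \<F>" "energy \<psi> \<le> energy \<psi>"
      and q1: "\<And>n. q n \<in> mid_hull (w ` {n..})" and q3: "\<And>n. q n \<in> \<F>"
      and q2: "(\<lambda>n. energy1 (\<lambda>x. q n x - \<psi> x)) \<longlonglongrightarrow> 0"
      by (rule L2_limit_of_bounded_energy[OF wF L2_dom[OF \<psi>(1)]]) (rule that, assumption+)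
    note q = q1 q2 q3
    have qS: "q n \<in> S" for n by (rule hull[OF _ q(1)]) (use wS in auto)
    show ?thesis
    proof (rule closed[OF \<psi>(1)])
      fix e :: real assume "e > 0"
      then obtain n where "energy1 (\<lambda>x. q n x - \<psi> x) < e"
        using LIMSEQ_D[OF q(2), of e] by (auto simp: abs_less_iff)
      then have "energy (\<lambda>x. \<psi> x - q n x) < e"
        using form_le_form1[OF form.diff_mem[OF q(3) \<psi>(1)], of n] form.diff_square_commute[OF q(3) \<psi>(1), of n]
        by simp
      then show "\<exists>y\<in>S. energy (\<lambda>x. \<psi> x - y x) < e" using qS by blast
    qed
  qed
  have core: "\<psi> \<in> S" if \<psi>: "\<psi> \<in> \<F> \<inter> Cc" for \<psi>
  proof -
    have "(\<lambda>x. max 0 (\<psi> x)) \<in> S"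
      using \<psi> by (intro core_pos pos_part_mem Cc_pos_part) auto
    moreover have "(\<lambda>x. max 0 (- \<psi> x)) \<in> S"
      using \<psi> Cc_scale[of \<psi> "-1"] by (intro core_pos neg_part_mem Cc_pos_part) auto
    ultimately have "(\<lambda>x. 1 * max 0 (\<psi> x) + (-1) * max 0 (- \<psi> x)) \<in> S" by (rule lin)
    moreover have "(\<lambda>x. 1 * max 0 (\<psi> x) + (-1) * max 0 (- \<psi> x)) = \<psi>" by (auto simp: max_def)
    ultimately show ?thesis by simp
  qed
  have "z \<in> S"
  proof (rule closed[OF z])
    fix e :: real assume "e > 0"
    then obtain g where g: "g \<in> \<F> \<inter> Cc" "energy1 (\<lambda>x. z x - g x) < e"
      using core_dense_dom[OF z] by blast
    then have "energy (\<lambda>x. z x - g x) < e"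
      using form_le_form1[OF form.diff_mem[OF z], of g] by simp
    then show "\<exists>y\<in>S. energy (\<lambda>x. z x - y x) < e" using core[OF g(1)] by blast
  qed
  then show ?thesis by (simp add: S_def)
qed

text \<open>Lower semicontinuity of the energy along convergence almost everywhere, without any control in \<open>L\<^sup>2\<close>.
  After truncation at height \<open>M\<close> the differences form a bounded sequence to which \<open>bounded_weakly_null\<close>
  applies; then \<open>M\<close> tends to infinity.\<close>

lemma form_pos_part_lsc:
  assumes x: "\<And>n::nat. u n \<in> \<F>" "\<And>n. energy (u n) \<le> C" and f: "f \<in> \<F>"
    and lim: "AE x in m. (\<lambda>n. u n x) \<longlonglongrightarrow> f x"
  shows "energy (\<lambda>x. max 0 (f x)) \<le> C"
proof -
  have C0: "0 \<le> C" using x(2)[of 0] form_nonneg[OF x(1)[of 0]] by linarith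
  have clip: "energy (\<lambda>x. min M (max 0 (f x))) \<le> C" if M: "0 < M" for M
  proof -
    define y where "y n = (\<lambda>x. min M (max 0 (u n x)))" for n
    define z where "z = (\<lambda>x. min M (max 0 (f x)))"
    have y: "y n \<in> \<F>" "energy (y n) \<le> C" for n
      unfolding y_def using clip_mem[OF x(1)[of n] M] x(2)[of n] by auto
    have z: "z \<in> \<F>" unfolding z_def by (rule clip_mem[OF f M])
    define v where "v n = (\<lambda>x. y n x - z x)" for n
    have vF: "v n \<in> \<F>" for n unfolding v_def by (rule form.diff_mem[OF y(1) z])
    have vM: "\<bar>v n x\<bar> \<le> M" for n x using M by (auto simp: v_def y_def z_def)
    have vC: "energy (v n) \<le> 2 * C + 2 * energy z" for n
      using form.parallelogram[OF y(1) z, of n] form_nonneg[OF form.half_sum_mem[OF y(1) z], of n] y(2)[of n]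
      unfolding v_def by linarith
    have vl: "AE x in m. (\<lambda>n. v n x) \<longlonglongrightarrow> 0" using lim
    proof eventually_elim
      case (elim x)
      have "(\<lambda>n. v n x) \<longlonglongrightarrow> min M (max 0 (f x)) - z x"
        unfolding v_def y_def by (intro tendsto_intros elim)
      then show ?case by (simp add: z_def)
    qed
    have "(\<lambda>n. \<E> z (v n)) \<longlonglongrightarrow> 0" by (rule bounded_weakly_null[OF vF vM vC vl z])
    then have "(\<lambda>n. \<E> z (v n) + energy z) \<longlonglongrightarrow> 0 + energy z" by (intro tendsto_intros)
    moreover have "\<E> z (v n) + energy z = \<E> z (y n)" for n
      unfolding v_def by (simp add: form.diff_right y z)
    ultimately have lim': "(\<lambda>n. \<E> z (y n)) \<longlonglongrightarrow> energy z" by simp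
    have "energy z \<le> sqrt (energy z) * sqrt C"
    proof (rule LIMSEQ_le_const2[OF lim'], intro exI allI impI)
      fix n
      have "\<E> z (y n) \<le> sqrt (energy z) * sqrt (energy (y n))"
        using form.Cauchy_Schwarz[OF z y(1), of n] by linarith
      also have "\<dots> \<le> sqrt (energy z) * sqrt C"
        using y(2)[of n] form_nonneg[OF z] by (intro mult_left_mono) auto
      finally show "\<E> z (y n) \<le> sqrt (energy z) * sqrt C" .
    qed
    then have "sqrt (energy z) * sqrt (energy z) \<le> sqrt (energy z) * sqrt C" using form_nonneg[OF z] by simp
    then have "energy z \<le> C"
    proof (cases "energy z = 0")
      case False
      then have "0 < sqrt (energy z)" using form_nonneg[OF z] by simp
      with \<open>sqrt (energy z) * sqrt (energy z) \<le> sqrt (energy z) * sqrt C\<close>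
      have "sqrt (energy z) \<le> sqrt C" by (metis mult_le_cancel_left_pos)
      then show ?thesis by simp
    qed (use C0 in simp)
    then show ?thesis by (simp add: z_def)
  qed
  define w where "w n = (\<lambda>x. min (real (Suc n)) (max 0 (f x)))" for n
  have w: "w n \<in> \<F>" "energy (w n) \<le> C" for n
    unfolding w_def using clip_mem[OF f, of "real (Suc n)"] clip[of "real (Suc n)"] by auto
  have limw: "(\<lambda>n. w n x) \<longlonglongrightarrow> max 0 (f x)" for x
  proof (rule tendsto_eventually)
    obtain N where "max 0 (f x) < real N" using reals_Archimedean2 by blast
    then show "\<forall>\<^sub>F n in sequentially. w n x = max 0 (f x)"
      unfolding w_def eventually_sequentially by (intro exI[of _ N]) auto
  qed
  have c1: "(\<lambda>x. max 0 (f x)) \<in> borel_measurable m"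
    using borel_dom[OF f] by measurable
  have c2: "AE x in m. \<bar>w n x\<bar> \<le> \<bar>f x\<bar>" for n by (auto simp: w_def)
  note conv = L2_dominated_convergence[OF borel_dom[OF w(1)] c1 L2_abs[OF L2_dom[OF f]] c2 AE_I2[OF limw]]
  show ?thesis using L2_limit_of_bounded_energy[OF w conv] by metis
qed

text \<open>Lower semicontinuity along \<open>u k - u n\<close>, which tends to \<open>u k\<close> as \<open>n \<rightarrow> \<infinity>\<close>, bounds the energy of \<open>u k\<close> by the
  tail of the Cauchy condition. This is what makes the form on the extended Dirichlet space independent
  of the approximating sequences.\<close>

lemma form_closable:
  assumes u: "\<And>n::nat. u n \<in> \<F>" and C: "form_Cauchy \<E> u" and lim: "AE x in m. (\<lambda>n. u n x) \<longlonglongrightarrow> 0"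
  shows "(\<lambda>n. energy (u n)) \<longlonglongrightarrow> 0"
proof (rule LIMSEQ_I)
  fix e :: real assume "0 < e"
  then obtain N where N: "\<And>i j. i \<ge> N \<Longrightarrow> j \<ge> N \<Longrightarrow> energy (\<lambda>x. u i x - u j x) < e / 8"
    using C unfolding form_Cauchy_def by (metis zero_less_divide_iff zero_less_numeral)
  have "energy (u k) < e" if k: "k \<ge> N" for k
  proof -
    have d: "(\<lambda>x. u k x - u (n + N) x) \<in> \<F>" "(\<lambda>x. u (n + N) x - u k x) \<in> \<F>" for n
      by (intro form.diff_mem u)+
    have E: "energy (\<lambda>x. u k x - u (n + N) x) \<le> e / 8"
       "energy (\<lambda>x. u (n + N) x - u k x) \<le> e / 8" for n
      using N[of k "n + N"] N[of "n + N" k] k by auto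
    have l: "AE x in m. (\<lambda>n. u k x - u (n + N) x) \<longlonglongrightarrow> u k x"
       "AE x in m. (\<lambda>n. u (n + N) x - u k x) \<longlonglongrightarrow> - u k x"
    proof -
      have *: "AE x in m. (\<lambda>n. u (n + N) x) \<longlonglongrightarrow> 0"
        using lim by eventually_elim (rule LIMSEQ_ignore_initial_segment)
      show "AE x in m. (\<lambda>n. u k x - u (n + N) x) \<longlonglongrightarrow> u k x" using *
      proof eventually_elim
        case (elim x)
        have "(\<lambda>n. u k x - u (n + N) x) \<longlonglongrightarrow> u k x - 0" by (intro tendsto_intros elim)
        then show ?case by simp
      qed
      show "AE x in m. (\<lambda>n. u (n + N) x - u k x) \<longlonglongrightarrow> - u k x" using *
      proof eventually_elim
        case (elim x)
        have "(\<lambda>n. u (n + N) x - u k x) \<longlonglongrightarrow> 0 - u k x" by (intro tendsto_intros elim)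
        then show ?case by simp
      qed
    qed
    let ?p = "\<lambda>x. max 0 (u k x)" and ?n = "\<lambda>x. max 0 (- u k x)"
    have p: "?p \<in> \<F>" "energy ?p \<le> e / 8"
      using pos_part_mem(1)[OF u] form_pos_part_lsc[OF d(1) E(1) u l(1)] by auto
    have n: "?n \<in> \<F>" "energy ?n \<le> e / 8"
      using neg_part_mem[OF u] form_pos_part_lsc[OF d(2) E(2) form.uminus_mem[OF u] l(2)] by auto
    have "u k = (\<lambda>x. ?p x - ?n x)" by (auto simp: max_def)
    then have "energy (u k) = energy (\<lambda>x. ?p x - ?n x)" by simp
    also have "\<dots> \<le> 2 * energy ?p + 2 * energy ?n"
      using form.parallelogram[OF p(1) n(1)] form_nonneg[OF form.half_sum_mem[OF p(1) n(1)]] by linarith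
    also have "\<dots> < e" using p(2) n(2) \<open>0 < e\<close> by linarith
    finally show ?thesis .
  qed
  then show "\<exists>no. \<forall>n\<ge>no. norm (energy (u n) - 0) < e"
    using form_nonneg[OF u] by (intro exI[of _ N]) auto
qed

end

section \<open>The extended Dirichlet space\<close>

context semi_inner
begin

lemma Cauchy_square_convergent:
  assumes u: "\<And>n::nat. u n \<in> V" and C: "form_Cauchy Q u"
  shows "convergent (\<lambda>n. normsq (u n))"
proof -
  have "Cauchy (\<lambda>n. sqrt (normsq (u n)))"
  proof (rule CauchyI)
    fix e :: real assume "0 < e"
    moreover have "\<forall>e>0. \<exists>N. \<forall>i\<ge>N. \<forall>j\<ge>N. sqrt (normsq (\<lambda>x. u i x - u j x)) < e"
      using C by (subst (asm) form_Cauchy_iff_sqrt) (auto intro: nonneg diff_mem u)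
    ultimately obtain N where N: "\<forall>i\<ge>N. \<forall>j\<ge>N. sqrt (normsq (\<lambda>x. u i x - u j x)) < e"
      by blast
    have "\<bar>sqrt (normsq (u i)) - sqrt (normsq (u j))\<bar> < e" if "i \<ge> N" "j \<ge> N" for i j
    proof -
      have "sqrt (normsq (\<lambda>x. u i x - u j x)) < e"
        "sqrt (normsq (\<lambda>x. u j x - u i x)) < e" using N that by auto
      then show ?thesis
        using sqrt_triangle_diff[OF u u, of i j] sqrt_triangle_diff[OF u u, of j i] by linarith
    qed
    then show "\<exists>M. \<forall>i\<ge>M. \<forall>j\<ge>M. norm (sqrt (normsq (u i)) - sqrt (normsq (u j))) < e" by auto
  qed
  then obtain l where "(\<lambda>n. sqrt (normsq (u n))) \<longlonglongrightarrow> l"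
    using real_Cauchy_convergent convergent_def by blast
  then have "(\<lambda>n. (sqrt (normsq (u n)))\<^sup>2) \<longlonglongrightarrow> l\<^sup>2" by (intro tendsto_intros)
  then show ?thesis using nonneg[OF u] by (auto simp: convergent_def)
qed

lemma Cauchy_product_convergent:
  assumes u: "\<And>n::nat. u n \<in> V" and v: "\<And>n. v n \<in> V" and "form_Cauchy Q u" "form_Cauchy Q v"
  shows "convergent (\<lambda>n. Q (u n) (v n))"
proof -
  have eq: "Q (u n) (v n) = (normsq (u n) + normsq (v n) - normsq (\<lambda>x. u n x - v n x)) / 2" for n
    by (simp add: diff_square u v)
  obtain a b c where "(\<lambda>n. normsq (u n)) \<longlonglongrightarrow> a" "(\<lambda>n. normsq (v n)) \<longlonglongrightarrow> b"
    "(\<lambda>n. normsq (\<lambda>x. u n x - v n x)) \<longlonglongrightarrow> c"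
    using Cauchy_square_convergent[OF u assms(3)] Cauchy_square_convergent[OF v assms(4)]
      Cauchy_square_convergent[OF diff_mem[OF u v] Cauchy_diff[OF assms]]
    unfolding convergent_def by blast
  then have "(\<lambda>n. (normsq (u n) + normsq (v n) - normsq (\<lambda>x. u n x - v n x)) / 2)
      \<longlonglongrightarrow> (a + b - c) / 2"
    by (intro tendsto_divide tendsto_diff tendsto_add tendsto_const) auto
  then show ?thesis unfolding eq convergent_def by blast
qed

lemma product_null:
  assumes u: "\<And>n::nat. u n \<in> V" and w: "\<And>n. w n \<in> V" and B: "\<And>n. normsq (u n) \<le> B"
    and lim: "(\<lambda>n. normsq (w n)) \<longlonglongrightarrow> 0"
  shows "(\<lambda>n. Q (u n) (w n)) \<longlonglongrightarrow> 0"
proof (rule Lim_null_comparison)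
  show "\<forall>\<^sub>F n in sequentially. norm (Q (u n) (w n)) \<le> sqrt B * sqrt (normsq (w n))"
  proof (intro always_eventually allI)
    fix n
    have "\<bar>Q (u n) (w n)\<bar> \<le> sqrt (normsq (u n)) * sqrt (normsq (w n))" by (rule Cauchy_Schwarz[OF u w])
    also have "\<dots> \<le> sqrt B * sqrt (normsq (w n))" using B nonneg[OF w] by (intro mult_right_mono) auto
    finally show "norm (Q (u n) (w n)) \<le> sqrt B * sqrt (normsq (w n))" by simp
  qed
  show "(\<lambda>n. sqrt B * sqrt (normsq (w n))) \<longlonglongrightarrow> 0"
    using tendsto_real_sqrt[OF lim] by (intro tendsto_mult_right_zero) simp
qed

end

context transient_dirichlet_form
begin

text \<open>If \<open>g\<close> is a reference function for transience, then the integral of \<open>\<bar>u (Suc k) - u k\<bar> g\<close> is at most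
  \<open>(1/4) ^ k\<close>.\<close>

lemma fast_increments_summable_AE:
  assumes u: "\<And>n::nat. u n \<in> \<F>"
    and fast: "\<And>n. energy (\<lambda>x. u (Suc n) x - u n x) < (1/16) ^ n"
  shows "AE x in m. summable (\<lambda>k. 2 ^ k * \<bar>u (Suc k) x - u k x\<bar>)"
proof -
  obtain g where g: "integrable m g" "AE x in m. 0 < g x"
    "\<And>v. v \<in> \<F> \<Longrightarrow> (\<integral>\<^sup>+x. ennreal (\<bar>v x\<bar> * g x) \<partial>m) \<le> ennreal (sqrt (energy v))"
    using transient unfolding transient_form_def by blast
  have gb: "g \<in> borel_measurable borel" using g(1) by (auto dest: borel_measurable_integrable)
  define d where "d k = (\<lambda>x. 2 ^ k * \<bar>u (Suc k) x - u k x\<bar>)" for k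
  have ub: "u n \<in> borel_measurable borel" for n using borel_dom[OF u] by simp
  have db: "(\<lambda>x. ennreal (d k x * g x)) \<in> borel_measurable m" for k
    unfolding d_def using ub gb by simp
  have le: "(\<integral>\<^sup>+x. ennreal (d k x * g x) \<partial>m) \<le> ennreal ((1/2) ^ k)" for k
  proof -
    let ?v = "\<lambda>x. u (Suc k) x - u k x"
    have v: "?v \<in> \<F>" by (intro form.diff_mem u)
    have "(\<integral>\<^sup>+x. ennreal (d k x * g x) \<partial>m) = (\<integral>\<^sup>+x. ennreal (2 ^ k) * ennreal (\<bar>?v x\<bar> * g x) \<partial>m)"
      unfolding d_def by (intro nn_integral_cong) (simp add: ennreal_mult'[symmetric] mult.assoc)
    also have "\<dots> = ennreal (2 ^ k) * (\<integral>\<^sup>+x. ennreal (\<bar>?v x\<bar> * g x) \<partial>m)"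
      using ub gb by (intro nn_integral_cmult) simp
    also have "\<dots> \<le> ennreal (2 ^ k) * ennreal (sqrt (energy ?v))"
      by (intro mult_left_mono g(3) v) simp
    also have "\<dots> \<le> ennreal (2 ^ k) * ennreal (sqrt ((1/16) ^ k))"
      using fast[of k] by (intro mult_left_mono ennreal_leI real_sqrt_le_mono) auto
    also have "sqrt ((1/16) ^ k) = ((1/4)^k :: real)"
    proof -
      have "((1/16)::real) ^ k = ((1/4)^k)\<^sup>2" by (simp add: power2_eq_square power_mult_distrib[symmetric])
      then show ?thesis by simp
    qed
    also have "ennreal (2 ^ k) * ennreal ((1/4)^k) = ennreal ((1/2)^k)"
      by (simp add: ennreal_mult'[symmetric] power_mult_distrib[symmetric])
    finally show ?thesis .
  qed
  have "(\<integral>\<^sup>+x. (\<Sum>k. ennreal (d k x * g x)) \<partial>m) = (\<Sum>k. \<integral>\<^sup>+x. ennreal (d k x * g x) \<partial>m)"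
    by (rule nn_integral_suminf[OF db])
  also have "\<dots> \<le> (\<Sum>k. ennreal ((1/2) ^ k))" by (intro suminf_le le) auto
  also have "\<dots> = ennreal (\<Sum>k. (1/2) ^ k)" by (rule suminf_ennreal2) auto
  finally have "(\<integral>\<^sup>+x. (\<Sum>k. ennreal (d k x * g x)) \<partial>m) \<noteq> \<infinity>"
    by (metis ennreal_neq_top infinity_ennreal_def neq_top_trans)
  then have "AE x in m. (\<Sum>k. ennreal (d k x * g x)) \<noteq> \<infinity>"
    using db by (intro nn_integral_noteq_infinite borel_measurable_suminf) auto
  then show ?thesis using g(2)
  proof eventually_elim
    case (elim x)
    have "summable (\<lambda>k. d k x * g x)"
      by (rule summable_suminf_not_top) (use elim in \<open>auto simp: d_def\<close>)
    then have "summable (\<lambda>k. d k x * g x * (1 / g x))" by (rule summable_mult2)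
    then show ?case using elim(2) by (simp add: d_def)
  qed
qed

lemma weighted_summable_convergent:
  fixes u :: "nat \<Rightarrow> real"
  assumes "summable (\<lambda>k. 2 ^ k * \<bar>u (Suc k) - u k\<bar>)"
  shows "convergent u"
proof -
  have "summable (\<lambda>k. u (Suc k) - u k)"
  proof (rule summable_comparison_test'[OF assms])
    fix k :: nat
    have "1 * \<bar>u (Suc k) - u k\<bar> \<le> 2 ^ k * \<bar>u (Suc k) - u k\<bar>" by (intro mult_right_mono) auto
    then show "norm (u (Suc k) - u k) \<le> 2 ^ k * \<bar>u (Suc k) - u k\<bar>" by simp
  qed
  then have "(\<lambda>n. (\<Sum>k<n. u (Suc k) - u k)) \<longlonglongrightarrow> (\<Sum>k. u (Suc k) - u k)" by (rule summable_LIMSEQ)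
  then have "(\<lambda>n. u n - u 0) \<longlonglongrightarrow> (\<Sum>k. u (Suc k) - u k)" by (simp add: sum_lessThan_telescope)
  then have "(\<lambda>n. (u n - u 0) + u 0) \<longlonglongrightarrow> (\<Sum>k. u (Suc k) - u k) + u 0" by (intro tendsto_intros)
  then show ?thesis by (auto simp: convergent_def)
qed

lemma Cauchy_AE_limit:
  assumes u: "\<And>n::nat. u n \<in> \<F>" and C: "form_Cauchy \<E> u"
  obtains r f where "strict_mono (r :: nat \<Rightarrow> nat)" "approximating m \<F> \<E> (\<lambda>n. u (r n)) f"
    "f \<in> borel_measurable m"
proof -
  obtain r where r: "strict_mono (r :: nat \<Rightarrow> nat)"
    "\<And>n. energy (\<lambda>x. u (r (Suc n)) x - u (r n) x) < (1/16) ^ n"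
    using form_Cauchy_fast_subseq[OF C] by metis
  define f where "f x = lim (\<lambda>n. u (r n) x)" for x
  have "AE x in m. summable (\<lambda>k. 2 ^ k * \<bar>u (r (Suc k)) x - u (r k) x\<bar>)"
    by (rule fast_increments_summable_AE[of "\<lambda>n. u (r n)", OF u r(2)])
  then have "AE x in m. (\<lambda>n. u (r n) x) \<longlonglongrightarrow> f x"
  proof eventually_elim
    case (elim x)
    then show ?case unfolding f_def
      using weighted_summable_convergent[of "\<lambda>n. u (r n) x"] by (simp add: convergent_LIMSEQ_iff)
  qed
  moreover have "f \<in> borel_measurable m"
    unfolding f_def by (rule borel_measurable_lim_metric) (rule borel_dom[OF u])
  ultimately show ?thesis
    using r(1) u form_Cauchy_subseq[OF C r(1)] by (intro that[of r f]) (auto simp: approximating_def)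
qed

lemma approximatingD:
  assumes "approximating m \<F> \<E> u f"
  shows "\<And>n. u n \<in> \<F>" "form_Cauchy \<E> u" "AE x in m. (\<lambda>n. u n x) \<longlonglongrightarrow> f x"
  using assms by (auto simp: approximating_def)

lemma approximating_const: "f \<in> \<F> \<Longrightarrow> approximating m \<F> \<E> (\<lambda>_. f) f"
  by (auto simp: approximating_def form_Cauchy_def form.zero_left dom_zero)

lemma dom_subset_ext_dom: "\<F> \<subseteq> ext_dom m \<F> \<E>"
  using approximating_const borel_dom by (auto simp: ext_dom_def)

lemma approximating_diff_null:
  assumes "approximating m \<F> \<E> u f" "approximating m \<F> \<E> v f"
  shows "(\<lambda>n. energy (\<lambda>x. u n x - v n x)) \<longlonglongrightarrow> 0"
proof (rule form_closable)
  show "(\<lambda>x. u n x - v n x) \<in> \<F>" for n by (intro form.diff_mem approximatingD[OF assms(1)] approximatingD[OF assms(2)])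
  show "form_Cauchy \<E> (\<lambda>n x. u n x - v n x)"
    by (intro form.Cauchy_diff approximatingD[OF assms(1)] approximatingD[OF assms(2)])
  show "AE x in m. (\<lambda>n. u n x - v n x) \<longlonglongrightarrow> 0"
    using approximatingD(3)[OF assms(1)] approximatingD(3)[OF assms(2)]
  proof eventually_elim
    case (elim x)
    have "(\<lambda>n. u n x - v n x) \<longlonglongrightarrow> f x - f x" by (intro tendsto_intros elim)
    then show ?case by simp
  qed
qed

lemma approximating_change:
  assumes u: "approximating m \<F> \<E> u f" and u': "approximating m \<F> \<E> u' f" and v: "approximating m \<F> \<E> v g"
  shows "(\<lambda>n. \<E> (u n) (v n) - \<E> (u' n) (v n)) \<longlonglongrightarrow> 0"
proof -
  obtain B where B: "\<And>n. energy (v n) \<le> B"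
    using form.Cauchy_bounded[of v] approximatingD(1,2)[OF v] by metis
  have d: "(\<lambda>x. u n x - u' n x) \<in> \<F>" for n by (intro form.diff_mem approximatingD[OF u] approximatingD[OF u'])
  have "(\<lambda>n. \<E> (v n) (\<lambda>x. u n x - u' n x)) \<longlonglongrightarrow> 0"
    by (rule form.product_null[OF approximatingD(1)[OF v] d B approximating_diff_null[OF u u']])
  moreover have "\<E> (v n) (\<lambda>x. u n x - u' n x) = \<E> (u n) (v n) - \<E> (u' n) (v n)" for n
    using approximatingD(1)[OF v, of n] approximatingD(1)[OF u, of n] approximatingD(1)[OF u', of n]
    by (simp add: form.diff_right form_sym[of "v n"])
  ultimately show ?thesis by simp
qed

lemma approximating_limit_unique:
  assumes u: "approximating m \<F> \<E> u f" and u': "approximating m \<F> \<E> u' f"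
    and v: "approximating m \<F> \<E> v g" and v': "approximating m \<F> \<E> v' g"
    and c: "(\<lambda>n. \<E> (u n) (v n)) \<longlonglongrightarrow> c"
  shows "(\<lambda>n. \<E> (u' n) (v' n)) \<longlonglongrightarrow> c"
proof -
  have 1: "(\<lambda>n. \<E> (u n) (v n) - (\<E> (u n) (v n) - \<E> (u' n) (v n))) \<longlonglongrightarrow> c - 0"
    by (intro tendsto_diff c approximating_change[OF u u' v])
  then have 2: "(\<lambda>n. \<E> (u' n) (v n)) \<longlonglongrightarrow> c" by simp
  have "(\<lambda>n. \<E> (u' n) (v n) - (\<E> (v n) (u' n) - \<E> (v' n) (u' n))) \<longlonglongrightarrow> c - 0"
    by (intro tendsto_diff 2 approximating_change[OF v v' u'])
  moreover have "\<E> (v n) (u' n) = \<E> (u' n) (v n)" "\<E> (v' n) (u' n) = \<E> (u' n) (v' n)" for n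
    by (auto intro!: form_sym approximatingD(1)[OF v] approximatingD(1)[OF v'] approximatingD(1)[OF u'])
  ultimately show ?thesis by simp
qed

lemma ext_form_lim:
  assumes u: "approximating m \<F> \<E> u f" and v: "approximating m \<F> \<E> v g"
  shows "(\<lambda>n. \<E> (u n) (v n)) \<longlonglongrightarrow> ext_form m \<F> \<E> f g"
proof -
  obtain c where c: "(\<lambda>n. \<E> (u n) (v n)) \<longlonglongrightarrow> c"
    using form.Cauchy_product_convergent[of u v] approximatingD(1,2)[OF u] approximatingD(1,2)[OF v]
    unfolding convergent_def by blast
  have "ext_form m \<F> \<E> f g = c" unfolding ext_form_def
  proof (rule the_equality)
    show "\<forall>u v. approximating m \<F> \<E> u f \<longrightarrow> approximating m \<F> \<E> v g \<longrightarrow> (\<lambda>n. \<E> (u n) (v n)) \<longlonglongrightarrow> c"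
      using approximating_limit_unique[OF u _ v _ c] by blast
    fix c' assume "\<forall>u v. approximating m \<F> \<E> u f \<longrightarrow> approximating m \<F> \<E> v g \<longrightarrow> (\<lambda>n. \<E> (u n) (v n)) \<longlonglongrightarrow> c'"
    then have "(\<lambda>n. \<E> (u n) (v n)) \<longlonglongrightarrow> c'" using u v by blast
    then show "c' = c" using c LIMSEQ_unique by blast
  qed
  with c show ?thesis by simp
qed

lemma ext_form_nonneg: "f \<in> ext_dom m \<F> \<E> \<Longrightarrow> 0 \<le> ext_form m \<F> \<E> f f"
proof -
  assume "f \<in> ext_dom m \<F> \<E>"
  then obtain u where u: "approximating m \<F> \<E> u f" by (auto simp: ext_dom_def)
  show ?thesis
    by (rule LIMSEQ_le_const[OF ext_form_lim[OF u u]]) (use form_nonneg approximatingD(1)[OF u] in auto)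
qed

lemma ext_form_Cauchy_Schwarz:
  assumes "f \<in> ext_dom m \<F> \<E>" "g \<in> ext_dom m \<F> \<E>"
  shows "\<bar>ext_form m \<F> \<E> f g\<bar> \<le> sqrt (ext_form m \<F> \<E> f f) * sqrt (ext_form m \<F> \<E> g g)"
proof -
  obtain u v where u: "approximating m \<F> \<E> u f" and v: "approximating m \<F> \<E> v g"
    using assms by (auto simp: ext_dom_def)
  show ?thesis
  proof (rule LIMSEQ_le)
    show "(\<lambda>n. \<bar>\<E> (u n) (v n)\<bar>) \<longlonglongrightarrow> \<bar>ext_form m \<F> \<E> f g\<bar>"
      by (intro tendsto_rabs ext_form_lim u v)
    show "(\<lambda>n. sqrt (energy (u n)) * sqrt (energy (v n)))
        \<longlonglongrightarrow> sqrt (ext_form m \<F> \<E> f f) * sqrt (ext_form m \<F> \<E> g g)"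
      by (intro tendsto_mult tendsto_real_sqrt ext_form_lim u v)
    show "\<exists>N. \<forall>n\<ge>N. \<bar>\<E> (u n) (v n)\<bar> \<le> sqrt (energy (u n)) * sqrt (energy (v n))"
      using form.Cauchy_Schwarz approximatingD(1)[OF u] approximatingD(1)[OF v] by blast
  qed
qed

lemma approximating_subseq:
  assumes u: "approximating m \<F> \<E> u f" and r: "strict_mono (r :: nat \<Rightarrow> nat)"
  shows "approximating m \<F> \<E> (\<lambda>n. u (r n)) f"
  unfolding approximating_def
proof (intro conjI allI)
  show "u (r n) \<in> \<F>" for n by (rule approximatingD(1)[OF u])
  show "form_Cauchy \<E> (\<lambda>n. u (r n))" by (rule form_Cauchy_subseq[OF approximatingD(2)[OF u] r])
  show "AE x in m. (\<lambda>n. u (r n) x) \<longlonglongrightarrow> f x"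
    using approximatingD(3)[OF u]
    by eventually_elim (use LIMSEQ_subseq_LIMSEQ[OF _ r] in \<open>auto simp: comp_def\<close>)
qed

text \<open>Each \<open>u n\<close> is replaced by a core function at small distance in the norm of \<open>energy1\<close>. Since the squared
  \<open>L\<^sup>2\<close>-distances are summable, the limit almost everywhere stays the same.\<close>

lemma core_approximation:
  assumes "f \<in> ext_dom m \<F> \<E>"
  obtains c where "approximating m \<F> \<E> c f" "\<And>n. c n \<in> Cc"
    "\<And>n. energy (\<lambda>x. c (Suc n) x - c n x) < (1/16) ^ n"
proof -
  obtain u where u: "approximating m \<F> \<E> u f" using assms by (auto simp: ext_dom_def)
  note uF = approximatingD(1)[OF u]
  have "\<forall>n. \<exists>g. g \<in> \<F> \<inter> Cc \<and> energy1 (\<lambda>x. u n x - g x) < (1/2)^n"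
    using core_dense_dom[OF uF] by (meson zero_less_divide_1_iff zero_less_numeral zero_less_power)
  then obtain g where g: "\<forall>n. g n \<in> \<F> \<inter> Cc \<and> energy1 (\<lambda>x. u n x - g n x) < (1/2)^n"
    by (rule choice[THEN exE])
  have gF: "g n \<in> \<F>" and gC: "g n \<in> Cc" for n using g by auto
  have dF: "(\<lambda>x. u n x - g n x) \<in> \<F>" for n by (rule form.diff_mem[OF uF gF])
  have dE: "energy (\<lambda>x. u n x - g n x) < (1/2)^n" for n
    using form_le_form1[OF dF, of n] g[rule_format, of n] by simp
  have dL: "(\<integral>x. (u n x - g n x)\<^sup>2 \<partial>m) < (1/2)^n" for n
    using norm2_le_form1[OF dF, of n] g[rule_format, of n] by simp
  have "(\<lambda>n. energy (\<lambda>x. u n x - g n x)) \<longlonglongrightarrow> 0"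
  proof (rule real_tendsto_sandwich[OF _ _ tendsto_const])
    show "(\<lambda>n. (1/2::real)^n) \<longlonglongrightarrow> 0" by (rule LIMSEQ_power_zero) simp
  qed (auto intro!: always_eventually form_nonneg dF less_imp_le[OF dE])
  have dC: "form_Cauchy \<E> (\<lambda>n x. u n x - g n x)"
    unfolding form_Cauchy_def
  proof safe
    fix e :: real assume "e > 0"
    then have "e / 4 > 0" by simp
    then obtain N where N: "\<forall>n\<ge>N. \<bar>energy (\<lambda>x. u n x - g n x)\<bar> < e / 4"
      using LIMSEQ_D[OF \<open>(\<lambda>n. energy (\<lambda>x. u n x - g n x)) \<longlonglongrightarrow> 0\<close>, of "e / 4"] by auto
    have "energy (\<lambda>x. u i x - g i x - (u j x - g j x)) < e"
      if "i \<ge> N" "j \<ge> N" for i j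
    proof -
      have "energy (\<lambda>x. u i x - g i x) < e / 4" "energy (\<lambda>x. u j x - g j x) < e / 4"
        using N that by (auto simp: abs_less_iff)
      then show ?thesis
        using form.parallelogram[OF dF dF, of i j] form_nonneg[OF form.half_sum_mem[OF dF dF], of i j]
        by linarith
    qed
    then show "\<exists>N. \<forall>i\<ge>N. \<forall>j\<ge>N. energy (\<lambda>x. u i x - g i x - (u j x - g j x)) < e"
      by blast
  qed
  have gCauchy: "form_Cauchy \<E> g"
    using form.Cauchy_diff[OF uF dF approximatingD(2)[OF u] dC] by simp
  have "AE x in m. summable (\<lambda>n. (u n x - g n x)\<^sup>2)"
  proof -
    have i: "integrable m (\<lambda>x. (u n x - g n x)\<^sup>2)" for n using L2_dom[OF dF, of n] by (simp add: L2_def)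
    have "(\<integral>\<^sup>+x. (\<Sum>n. ennreal ((u n x - g n x)\<^sup>2)) \<partial>m) = (\<Sum>n. \<integral>\<^sup>+x. ennreal ((u n x - g n x)\<^sup>2) \<partial>m)"
      using i by (intro nn_integral_suminf) (auto dest!: borel_measurable_integrable)
    also have "\<dots> = (\<Sum>n. ennreal (\<integral>x. (u n x - g n x)\<^sup>2 \<partial>m))"
      using i by (intro suminf_cong nn_integral_eq_integral) auto
    also have "\<dots> \<le> (\<Sum>n. ennreal ((1/2)^n))"
      using dL by (intro suminf_le ennreal_leI less_imp_le) auto
    also have "\<dots> = ennreal (\<Sum>k. (1/2) ^ k)" by (rule suminf_ennreal2) auto
    finally have "(\<integral>\<^sup>+x. (\<Sum>n. ennreal ((u n x - g n x)\<^sup>2)) \<partial>m) \<noteq> \<infinity>"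
      by (metis ennreal_neq_top infinity_ennreal_def neq_top_trans)
    then have "AE x in m. (\<Sum>n. ennreal ((u n x - g n x)\<^sup>2)) \<noteq> \<infinity>"
      using i by (intro nn_integral_noteq_infinite borel_measurable_suminf) (auto dest!: borel_measurable_integrable)
    then show ?thesis
      by eventually_elim (rule summable_suminf_not_top, auto)
  qed
  then have "AE x in m. (\<lambda>n. g n x) \<longlonglongrightarrow> f x" using approximatingD(3)[OF u]
  proof eventually_elim
    case (elim x)
    have "(\<lambda>n. sqrt ((u n x - g n x)\<^sup>2)) \<longlonglongrightarrow> sqrt 0"
      by (intro tendsto_real_sqrt summable_LIMSEQ_zero elim)
    then have "(\<lambda>n. u n x - g n x) \<longlonglongrightarrow> 0" by (simp add: tendsto_rabs_zero_iff)
    then have "(\<lambda>n. u n x - (u n x - g n x)) \<longlonglongrightarrow> f x - 0" by (intro tendsto_diff elim)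
    then show ?case by simp
  qed
  then have ga: "approximating m \<F> \<E> g f" using gF gCauchy by (simp add: approximating_def)
  obtain r where r: "strict_mono (r :: nat \<Rightarrow> nat)"
    "\<And>n. energy (\<lambda>x. g (r (Suc n)) x - g (r n) x) < (1/16) ^ n"
    using form_Cauchy_fast_subseq[OF gCauchy] by metis
  show ?thesis by (rule that[OF approximating_subseq[OF ga r(1)] gC r(2)])
qed

lemma core_cutoff:
  assumes K: "compact K"
  obtains w V where "w \<in> \<F>" "w \<in> Cc" "\<And>x. 0 \<le> w x" "\<And>x. w x \<le> 1" "open V" "K \<subseteq> V" "\<And>x. x \<in> V \<Longrightarrow> w x = 1"
proof -
  obtain c V where c: "c \<in> Cc" "open V" "K \<subseteq> V" "\<And>x. x \<in> V \<Longrightarrow> c x = (1::real)"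
    using Cc_Urysohn[OF loc_compact K open_UNIV subset_UNIV] by metis
  obtain g where g: "g \<in> \<F> \<inter> Cc" "\<forall>x. \<bar>2 * c x - g x\<bar> < 1"
    \<comment> \<open>the factor 2 leaves room for an error of size 1\<close>
    using core_dense_Cc[OF Cc_scale[OF c(1), of 2], of 1] by auto
  show ?thesis
  proof (rule that[of "\<lambda>x. min 1 (max 0 (g x))" V])
    show "(\<lambda>x. min 1 (max 0 (g x))) \<in> \<F>" using unit_contraction g by auto
    show "(\<lambda>x. min 1 (max 0 (g x))) \<in> Cc" using Cc_clip g by auto
    show "min 1 (max 0 (g x)) = 1" if "x \<in> V" for x
    proof -
      have "\<bar>2 - g x\<bar> < 1" using g(2)[rule_format, of x] c(4)[OF that] by simp
      then have "1 < g x" by linarith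
      then show ?thesis by simp
    qed
  qed (use c in auto)
qed

section \<open>Quasi-continuous versions\<close>

context
  fixes c :: "nat \<Rightarrow> 'a \<Rightarrow> real"
  assumes cF: "\<And>n. c n \<in> \<F>" and cC: "\<And>n. c n \<in> Cc"
    and fast: "\<And>n. energy (\<lambda>x. c (Suc n) x - c n x) < (1/16) ^ n"
begin

text \<open>Off \<open>jump_set n\<close> the increments are dominated by a geometric series, so the sequence converges
  uniformly there.\<close>

definition jump_set :: "nat \<Rightarrow> 'a set" where
  "jump_set n = (\<Union>k\<in>{n..}. {x. (1/2) ^ k < \<bar>c (Suc k) x - c k x\<bar>})"

lemma open_jump_set: "open (jump_set n)"
  unfolding jump_set_def
  by (intro open_UN ballI open_Collect_less continuous_intros Cc_continuous cC)

lemma jump_set_antimono: "n \<le> k \<Longrightarrow> jump_set k \<subseteq> jump_set n"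
  unfolding jump_set_def by (intro UN_mono) auto

text \<open>The sequence is Cauchy for \<open>\<E>\<close> only, not for \<open>energy1\<close>, so the estimate has to be local: it
  concerns a set \<open>V\<close> on which some \<open>w\<close> in the domain is at least 1. Let \<open>P n\<close> be the minimum of \<open>w\<close> and
  \<open>\<Sum>k\<ge>n. 2 ^ k * \<bar>c (Suc k) - c k\<bar>\<close>, which is at least 1 on \<open>jump_set n \<inter> V\<close>. The \<open>P n\<close> have bounded
  energy, are dominated by \<open>w\<close> and tend to 0 almost everywhere. So midpoints of them tend to 0 in the
  norm of \<open>energy1\<close>. As the jump sets decrease, each such midpoint competes for
  \<open>jump_set N \<inter> V\<close> once \<open>N\<close> is large.\<close>

lemma Cap_jump_set:
  assumes w: "w \<in> \<F>" "\<And>x. 0 \<le> w x" and V: "open V" "\<And>x. x \<in> V \<Longrightarrow> 1 \<le> w x" and e: "0 < e"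
  obtains n where "Cap m \<F> \<E> (jump_set n \<inter> V) < ennreal e"
proof -
  define d where "d k = (\<lambda>x. 2 ^ k * \<bar>c (Suc k) x - c k x\<bar>)" for k
  have d0: "0 \<le> d k x" for k x by (simp add: d_def)
  have sumd: "AE x in m. summable (\<lambda>k. d k x)"
    unfolding d_def by (rule fast_increments_summable_AE[of c, OF cF fast])
  have absF: "(\<lambda>x. \<bar>c (Suc k) x - c k x\<bar>) \<in> \<F>" for k by (intro abs_mem form.diff_mem cF)
  have dF: "d k \<in> \<F>" for k unfolding d_def by (intro dom_scale absF)
  have dE: "sqrt (energy (d k)) \<le> (1/2)^k" for k
  proof -
    let ?v = "\<lambda>x. c (Suc k) x - c k x"
    have "sqrt (energy (d k)) = 2 ^ k * sqrt (energy (\<lambda>x. \<bar>?v x\<bar>))"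
      unfolding d_def using form.sqrt_scale[OF absF, of "2 ^ k" k] by simp
    also have "\<dots> \<le> 2 ^ k * sqrt ((1/16) ^ k)"
      using abs_mem(2)[OF form.diff_mem[OF cF cF], of "Suc k" k] fast[of k]
      by (intro mult_left_mono real_sqrt_le_mono) auto
    also have "sqrt ((1/16) ^ k) = ((1/4)^k :: real)"
    proof -
      have "((1/16)::real) ^ k = ((1/4)^k)\<^sup>2" by (simp add: power2_eq_square power_mult_distrib[symmetric])
      then show ?thesis by simp
    qed
    also have "2 ^ k * (1/4)^k = ((1/2)^k :: real)" by (simp add: power_mult_distrib[symmetric])
    finally show ?thesis .
  qed
  define s where "s n N = (\<lambda>x. \<Sum>k<N. d (k + n) x)" for n N
  define p where "p n N = (\<lambda>x. min (w x) (s n N x))" for n N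
  define P where "P n = (\<lambda>x. min (w x) (\<Sum>k. d (k + n) x))" for n
  have sF: "s n N \<in> \<F>" for n N unfolding s_def by (intro form.sum_mem dF)
  have sE: "energy (s n N) \<le> 4" for n N
  proof -
    have "sqrt (energy (s n N)) \<le> (\<Sum>k<N. sqrt (energy (d (k + n))))"
      unfolding s_def by (rule form.sqrt_sum) (rule dF)
    also have "\<dots> \<le> (\<Sum>k<N. (1/2)^k)"
    proof (rule sum_mono)
      fix k
      have "((1/2)::real) ^ (k + n) \<le> (1/2) ^ k" by (intro power_decreasing) auto
      then show "sqrt (energy (d (k + n))) \<le> (1/2)^k" using dE[of "k + n"] by linarith
    qed
    also have "\<dots> \<le> (\<Sum>k. (1/2)^k)" by (intro sum_le_suminf) auto
    also have "\<dots> = 2" by (simp add: suminf_geometric)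
    finally have "energy (s n N) \<le> 2\<^sup>2" by (rule sqrt_le_D)
    then show ?thesis by simp
  qed
  have pF: "p n N \<in> \<F>" "energy (p n N) \<le> energy w + 4" for n N
    using min_mem[OF w(1) sF[of n N]] sE[of n N] unfolding p_def by auto
  have db: "d k \<in> borel_measurable m" for k using borel_dom dF by blast
  have wb: "w \<in> borel_measurable m" using borel_dom w by blast
  have Pb: "P n \<in> borel_measurable m" for n
    unfolding P_def using db wb by (intro borel_measurable_min borel_measurable_suminf) auto
  have wL: "w \<in> L2 m" using L2_dom w by blast
  have PF: "P n \<in> \<F>" "energy (P n) \<le> energy w + 4" for n
  proof -
    have b: "AE x in m. \<bar>p n N x\<bar> \<le> w x" for N
    proof (rule AE_I2)
      fix x
      have "0 \<le> s n N x" unfolding s_def by (intro sum_nonneg d0)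
      then show "\<bar>p n N x\<bar> \<le> w x" using w(2)[of x] by (simp add: p_def)
    qed
    have l: "AE x in m. (\<lambda>N. p n N x) \<longlonglongrightarrow> P n x" using sumd
    proof eventually_elim
      case (elim x)
      have "summable (\<lambda>k. d (k + n) x)" by (rule summable_ignore_initial_segment[OF elim])
      then have "(\<lambda>N. s n N x) \<longlonglongrightarrow> (\<Sum>k. d (k + n) x)" unfolding s_def by (rule summable_LIMSEQ)
      then show ?case unfolding p_def P_def by (intro tendsto_min tendsto_const)
    qed
    note conv = L2_dominated_convergence[OF borel_dom[OF pF(1)] Pb wL b l]
    show "P n \<in> \<F>" by (rule L2_limit_of_bounded_energy[OF pF conv]) assumption
    show "energy (P n) \<le> energy w + 4" by (rule L2_limit_of_bounded_energy[OF pF conv]) assumption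
  qed
  have "AE x in m. \<forall>n. \<bar>P n x\<bar> \<le> w x" using sumd
  proof eventually_elim
    case (elim x)
    have "0 \<le> (\<Sum>k. d (k + n) x)" for n 
      by (intro suminf_nonneg summable_ignore_initial_segment[OF elim] d0)
    then show ?case using w(2)[of x] by (auto simp: P_def abs_of_nonneg)
  qed
  then have b: "AE x in m. \<bar>P n x\<bar> \<le> w x" for n by eventually_elim simp
  have l: "AE x in m. (\<lambda>n. P n x) \<longlonglongrightarrow> 0" using sumd
  proof eventually_elim
    case (elim x)
    have "(\<lambda>n. (\<Sum>k. d k x) - (\<Sum>k<n. d k x)) \<longlonglongrightarrow> (\<Sum>k. d k x) - (\<Sum>k. d k x)"
      by (intro tendsto_diff tendsto_const summable_LIMSEQ elim)
    then have "(\<lambda>n. min (w x) (\<Sum>k. d (k + n) x)) \<longlonglongrightarrow> min (w x) 0"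
      using suminf_minus_initial_segment[OF elim] by (intro tendsto_min tendsto_const) simp
    then show ?case using w(2)[of x] by (simp add: P_def)
  qed
  note conv = L2_dominated_convergence[OF borel_dom[OF PF(1)] _ wL b l]
  obtain q where q1: "\<And>n. q n \<in> mid_hull (P ` {n..})" and q2: "\<And>n. q n \<in> \<F>"
    and q3: "(\<lambda>n. energy1 (\<lambda>x. q n x - 0)) \<longlonglongrightarrow> 0"
    by (rule L2_limit_of_bounded_energy[OF PF conv]) (simp_all, blast)
  have hull: "\<exists>N. AE x in m. x \<in> jump_set N \<inter> V \<longrightarrow> 1 \<le> h x" if "h \<in> mid_hull (range P)" for h
    using that
  proof induction
    case (mid_base f)
    then obtain n where f: "f = P n" by auto
    have "AE x in m. x \<in> jump_set n \<inter> V \<longrightarrow> 1 \<le> P n x" using sumd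
    proof eventually_elim
      case (elim x)
      show ?case
      proof
        assume x: "x \<in> jump_set n \<inter> V"
        then obtain k where k: "k \<ge> n" "(1/2) ^ k < \<bar>c (Suc k) x - c k x\<bar>" by (auto simp: jump_set_def)
        have "1 = 2 ^ k * ((1/2)::real) ^ k" by (simp add: power_mult_distrib[symmetric])
        also have "\<dots> \<le> d k x" unfolding d_def using k by (intro mult_left_mono) auto
        also have "\<dots> = (\<Sum>j\<in>{k - n}. d (j + n) x)" using k by simp
        also have "\<dots> \<le> (\<Sum>j. d (j + n) x)"
          by (intro sum_le_suminf summable_ignore_initial_segment[OF elim] d0) auto
        finally show "1 \<le> P n x" using V(2)[of x] x by (simp add: P_def)
      qed
    qed
    then show ?case unfolding f by blast
  next
    case (mid_step f g)
    then obtain N N' where N: "AE x in m. x \<in> jump_set N \<inter> V \<longrightarrow> 1 \<le> f x"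
      "AE x in m. x \<in> jump_set N' \<inter> V \<longrightarrow> 1 \<le> g x" by blast
    have "AE x in m. x \<in> jump_set (max N N') \<inter> V \<longrightarrow> 1 \<le> (f x + g x) / 2" using N
    proof eventually_elim
      case (elim x)
      then show ?case
        using jump_set_antimono[of N "max N N'"] jump_set_antimono[of N' "max N N'"] by auto
    qed
    then show ?case by blast
  qed
  obtain n where n: "energy1 (q n) < e"
    using LIMSEQ_D[OF q3 e] by (auto simp: abs_less_iff)
  have "q n \<in> mid_hull (range P)"
    using q1[of n] mid_hull_mono[of "P ` {n..}" "range P"] by auto
  then obtain N where N: "AE x in m. x \<in> jump_set N \<inter> V \<longrightarrow> 1 \<le> q n x" using hull by blast
  have "Cap m \<F> \<E> (jump_set N \<inter> V) \<le> ennreal (energy1 (q n))"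
    by (rule Cap_upper[OF _ subset_refl q2 N]) (intro open_Int open_jump_set V)
  also have "\<dots> < ennreal e" using n e by (intro ennreal_lessI)
  finally show ?thesis by (rule that)
qed

lemma outside_jump_set:
  assumes x: "x \<notin> jump_set n" and k: "n \<le> k"
  shows "convergent (\<lambda>i. c i x)" "\<bar>lim (\<lambda>i. c i x) - c k x\<bar> \<le> 2 * (1/2) ^ k"
proof -
  have step: "\<bar>c (Suc i) x - c i x\<bar> \<le> (1/2) ^ i" if "n \<le> i" for i
    using x that by (auto simp: jump_set_def not_less)
  have est: "\<bar>c i x - c j x\<bar> \<le> 2 * (1/2) ^ j - 2 * (1/2) ^ i" if "n \<le> j" "j \<le> i" for i j
    using that(2)
  proof (induction i rule: dec_induct)
    case (step i)
    then show ?case using \<open>n \<le> i \<Longrightarrow> \<bar>c (Suc i) x - c i x\<bar> \<le> (1/2) ^ i\<close> \<open>n \<le> j\<close> by simp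
  qed simp
  have est': "\<bar>c i x - c j x\<bar> \<le> 2 * (1/2) ^ j" if "n \<le> j" "j \<le> i" for i j
    using est[OF that] by (smt (verit) zero_le_power divide_nonneg_nonneg)
  have "Cauchy (\<lambda>i. c i x)"
  proof (rule CauchyI')
    fix e :: real assume e: "0 < e"
    have "(\<lambda>j. 2 * (1/2::real) ^ j) \<longlonglongrightarrow> 2 * 0" by (intro tendsto_intros LIMSEQ_power_zero) simp
    then obtain N where N: "\<And>j. j \<ge> N \<Longrightarrow> 2 * (1/2::real) ^ j < e"
      using LIMSEQ_D[of "\<lambda>j. 2 * (1/2::real) ^ j" 0 e] e by auto
    show "\<exists>M. \<forall>j\<ge>M. \<forall>i>j. dist (c j x) (c i x) < e"
    proof (intro exI[of _ "max N n"] allI impI)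
      fix j i assume "j \<ge> max N n" "i > j"
      then show "dist (c j x) (c i x) < e"
        using est'[of j i] N[of j] by (simp add: dist_real_def abs_minus_commute)
    qed
  qed
  then show conv: "convergent (\<lambda>i. c i x)" by (rule real_Cauchy_convergent)
  then have "(\<lambda>i. c i x) \<longlonglongrightarrow> lim (\<lambda>i. c i x)" by (simp add: convergent_LIMSEQ_iff)
  then have "(\<lambda>i. \<bar>c i x - c k x\<bar>) \<longlonglongrightarrow> \<bar>lim (\<lambda>i. c i x) - c k x\<bar>" by (intro tendsto_intros)
  then show "\<bar>lim (\<lambda>i. c i x) - c k x\<bar> \<le> 2 * (1/2) ^ k"
    by (rule LIMSEQ_le_const2) (use est' k in blast)
qed

text \<open>Countably many sets \<open>V j\<close> cover the space. Since continuity is a local property, the union of the pieces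
  \<open>jump_set (n j) \<inter> V j\<close> can be removed, and its capacity is controlled by \<open>Cap_UN\<close>.\<close>

lemma exceptional_open_set:
  assumes e: "0 < e"
  obtains G where "open G" "Cap m \<F> \<E> G < ennreal e" "continuous_on (- G) (\<lambda>x. lim (\<lambda>i. c i x))"
    "\<And>x. x \<notin> G \<Longrightarrow> convergent (\<lambda>i. c i x)"
proof -
  obtain K :: "nat \<Rightarrow> 'a set" where K: "\<And>i. compact (K i)" "(\<Union>i. K i) = UNIV"
    using compact_cover by metis
  \<comment> \<open>the square of the sum of these numbers is \<open>e / 4\<close>\<close>
  define \<delta> where "\<delta> j = sqrt e / 4 * (1/2)^j" for j :: nat
  have \<delta>: "0 < \<delta> j" for j using e by (simp add: \<delta>_def)
  have "(\<lambda>j. \<delta> j) sums (sqrt e / 4 * 2)" unfolding \<delta>_def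
    by (intro sums_mult) (use geometric_sums[of "1/2::real"] in simp)
  then have sd: "summable \<delta>" "suminf \<delta> = sqrt e / 2" by (auto simp: sums_iff)
  have "\<exists>V n. open V \<and> K j \<subseteq> V \<and> Cap m \<F> \<E> (jump_set n \<inter> V) < ennreal ((\<delta> j)\<^sup>2)" for j
  proof -
    obtain w V where w: "w \<in> \<F>" "\<And>x. 0 \<le> w x" "open V" "K j \<subseteq> V" "\<And>x. x \<in> V \<Longrightarrow> w x = 1"
      using core_cutoff[OF K(1), of j] by metis
    obtain n where "Cap m \<F> \<E> (jump_set n \<inter> V) < ennreal ((\<delta> j)\<^sup>2)"
      using Cap_jump_set[OF w(1,2,3), of "(\<delta> j)\<^sup>2"] w(5) \<delta>[of j] by auto
    then show ?thesis using w by blast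
  qed
  then obtain V n where V: "\<And>j. open (V j)" "\<And>j. K j \<subseteq> V j"
     "\<And>j. Cap m \<F> \<E> (jump_set (n j) \<inter> V j) < ennreal ((\<delta> j)\<^sup>2)" by metis
  define G where "G = (\<Union>j. jump_set (n j) \<inter> V j)"
  have G: "open G" unfolding G_def by (intro open_UN ballI open_Int open_jump_set V)
  have "Cap m \<F> \<E> G \<le> ennreal ((suminf \<delta>)\<^sup>2)"
    unfolding G_def by (rule Cap_UN[OF V(3) less_imp_le[OF \<delta>] sd(1)])
  also have "(suminf \<delta>)\<^sup>2 = e / 4" unfolding sd(2) using e by (simp add: power_divide)
  also have "ennreal (e / 4) < ennreal e" using e by (simp add: ennreal_less_iff)
  finally have CG: "Cap m \<F> \<E> G < ennreal e" .
  have inV: "\<exists>j. x \<in> V j" for x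
  proof -
    have "x \<in> (\<Union>i. K i)" unfolding K(2) by simp
    then show ?thesis using V(2) by blast
  qed
  have notG: "x \<notin> jump_set (n j)" if "x \<notin> G" "x \<in> V j" for x j using that by (auto simp: G_def)
  have cont: "continuous_on (- jump_set k) (\<lambda>x. lim (\<lambda>i. c i x))" for k
  proof (rule uniform_limit_theorem)
    show "\<forall>\<^sub>F i in sequentially. continuous_on (- jump_set k) (c i)"
      using continuous_on_subset[OF Cc_continuous[OF cC]] by auto
    show "uniform_limit (- jump_set k) c (\<lambda>x. lim (\<lambda>i. c i x)) sequentially"
    proof (rule uniform_limitI)
      fix e :: real assume e: "0 < e"
      have "(\<lambda>j. 2 * (1/2::real) ^ j) \<longlonglongrightarrow> 2 * 0" by (intro tendsto_intros LIMSEQ_power_zero) simp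
      then obtain N where N: "\<And>j. j \<ge> N \<Longrightarrow> 2 * (1/2::real) ^ j < e"
        using LIMSEQ_D[of "\<lambda>j. 2 * (1/2::real) ^ j" 0 e] e by auto
      show "\<forall>\<^sub>F i in sequentially. \<forall>x\<in>- jump_set k. dist (c i x) (lim (\<lambda>i. c i x)) < e"
        unfolding eventually_sequentially
      proof (intro exI[of _ "max N k"] allI impI ballI)
        fix i x assume "i \<ge> max N k" "x \<in> - jump_set k"
        then show "dist (c i x) (lim (\<lambda>i. c i x)) < e"
          using outside_jump_set(2)[of x k i] N[of i] by (simp add: dist_real_def abs_minus_commute)
      qed
    qed
  qed simp
  have "continuous_on (- G) (\<lambda>x. lim (\<lambda>i. c i x))"
    unfolding continuous_on_eq_continuous_within
  proof
    fix x assume x: "x \<in> - G"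
    obtain j where j: "x \<in> V j" using inV by blast
    have sub: "- G \<inter> V j \<subseteq> - jump_set (n j)" using notG by blast
    have "continuous (at x within - G \<inter> V j) (\<lambda>x. lim (\<lambda>i. c i x))"
      using continuous_on_subset[OF cont sub] x j unfolding continuous_on_eq_continuous_within by blast
    moreover have "at x within - G \<inter> V j = at x within - G"
      by (rule at_within_nhd[OF j V(1)]) auto
    ultimately show "continuous (at x within - G) (\<lambda>x. lim (\<lambda>i. c i x))" by simp
  qed
  moreover have "convergent (\<lambda>i. c i x)" if x: "x \<notin> G" for x
  proof -
    obtain j where "x \<in> V j" using inV by blast
    then show ?thesis using outside_jump_set(1)[OF notG[OF x] order_refl] by blast
  qed
  ultimately show ?thesis using that G CG by blast
qed

lemma core_quasi_limit:
  shows "quasi_continuous m \<F> \<E> (\<lambda>x. lim (\<lambda>i. c i x))"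
    "Cap m \<F> \<E> {x. \<not> convergent (\<lambda>i. c i x)} = 0"
    "(\<lambda>x. lim (\<lambda>i. c i x)) \<in> borel_measurable borel"
proof -
  show "quasi_continuous m \<F> \<E> (\<lambda>x. lim (\<lambda>i. c i x))"
    unfolding quasi_continuous_def using exceptional_open_set by metis
  have "Cap m \<F> \<E> {x. \<not> convergent (\<lambda>i. c i x)} \<le> ennreal e" if "0 < e" for e
  proof -
    obtain G where G: "Cap m \<F> \<E> G < ennreal e" "\<And>x. x \<notin> G \<Longrightarrow> convergent (\<lambda>i. c i x)"
      using exceptional_open_set[OF \<open>0 < e\<close>] by metis
    have "Cap m \<F> \<E> {x. \<not> convergent (\<lambda>i. c i x)} \<le> Cap m \<F> \<E> G"
      by (rule Cap_mono) (use G(2) in blast)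
    then show ?thesis using G(1) by simp
  qed
  then have "Cap m \<F> \<E> {x. \<not> convergent (\<lambda>i. c i x)} \<le> 0"
    by - (rule ennreal_le_epsilon, auto)
  then show "Cap m \<F> \<E> {x. \<not> convergent (\<lambda>i. c i x)} = 0" by simp
  show "(\<lambda>x. lim (\<lambda>i. c i x)) \<in> borel_measurable borel"
    by (rule borel_measurable_lim_metric) (rule Cc_borel[OF cC])
qed

end

lemma qc_version_exists:
  assumes "f \<in> ext_dom m \<F> \<E>" obtains g where "qc_version m \<F> \<E> f g"
proof -
  obtain c where c: "approximating m \<F> \<E> c f" "\<And>n. c n \<in> Cc"
    "\<And>n. energy (\<lambda>x. c (Suc n) x - c n x) < (1/16) ^ n"
    using core_approximation[OF assms] by blast
  note q = core_quasi_limit[of c, OF approximatingD(1)[OF c(1)] c(2,3)]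
  have "AE x in m. lim (\<lambda>i. c i x) = f x"
    using approximatingD(3)[OF c(1)] by eventually_elim (rule limI)
  then show ?thesis using q by (intro that[of "\<lambda>x. lim (\<lambda>i. c i x)"]) (simp add: qc_version_def)
qed

section \<open>Potentials of measures of finite energy\<close>

context
  fixes \<nu> :: "'a measure" and C :: real
  assumes sets_\<nu> [measurable_cong]: "sets \<nu> = sets borel"
    and Cap_null: "\<And>B. \<lbrakk>B \<in> sets borel; Cap m \<F> \<E> B = 0\<rbrakk> \<Longrightarrow> emeasure \<nu> B = 0"
    and C: "0 \<le> C"
    and energy: "\<And>\<phi>. \<lbrakk>\<phi> \<in> \<F>; \<phi> \<in> Cc\<rbrakk> \<Longrightarrow> (\<integral>\<^sup>+x. ennreal \<bar>\<phi> x\<bar> \<partial>\<nu>) \<le> ennreal (C * sqrt (energy \<phi>))"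
begin

lemma space_\<nu> [simp]: "space \<nu> = UNIV"
  using sets_eq_imp_space_eq[OF sets_\<nu>] by simp

lemma borel_\<nu>: "borel_measurable \<nu> = borel_measurable borel"
  by (rule measurable_cong_sets) (simp_all add: sets_\<nu>)

lemma AE_not_in: "B \<in> sets borel \<Longrightarrow> Cap m \<F> \<E> B = 0 \<Longrightarrow> AE x in \<nu>. x \<notin> B"
  by (rule AE_not_in) (simp add: null_sets_def sets_\<nu> Cap_null)

lemma AE_qc_nonneg:
  assumes g: "quasi_continuous m \<F> \<E> g" "g \<in> borel_measurable borel" and A: "open A"
    and pos: "AE x in m. x \<in> A \<longrightarrow> 0 \<le> g x"
  shows "AE x in \<nu>. x \<in> A \<longrightarrow> 0 \<le> g x"
proof -
  have "{x \<in> A. g x < 0} = A \<inter> g -` {..<0}" by auto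
  then have "{x \<in> A. g x < 0} \<in> sets borel" using g(2) A measurable_sets_borel[OF g(2), of "{..<0}"] by auto
  from AE_not_in[OF this quasi_continuous_nonneg[OF g(1) A pos]] show ?thesis
    by eventually_elim auto
qed

text \<open>Quasi-continuous versions of the same function agree up to capacity zero, and \<open>\<nu>\<close> charges no set of
  capacity zero.\<close>

lemma core_AE_limit:
  assumes c: "approximating m \<F> \<E> c f" "\<And>n. c n \<in> Cc"
    "\<And>n. energy (\<lambda>x. c (Suc n) x - c n x) < (1/16) ^ n"
    and g: "qc_version m \<F> \<E> f g"
  shows "AE x in \<nu>. (\<lambda>n. c n x) \<longlonglongrightarrow> g x"
proof -
  note q = core_quasi_limit[of c, OF approximatingD(1)[OF c(1)] c(2,3)]
  let ?l = "\<lambda>x. lim (\<lambda>i. c i x)"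
  have gq: "g \<in> borel_measurable borel" "quasi_continuous m \<F> \<E> g" "AE x in m. g x = f x"
    using g by (auto simp: qc_version_def)
  have lf: "AE x in m. ?l x = f x"
    using approximatingD(3)[OF c(1)] by eventually_elim (rule limI)
  have 1: "AE x in \<nu>. x \<in> UNIV \<longrightarrow> 0 \<le> ?l x - g x"
    by (rule AE_qc_nonneg[OF quasi_continuous_diff[OF q(1) gq(2)]])
       (use q(3) gq lf in \<open>auto elim!: eventually_elim2\<close>)
  have 2: "AE x in \<nu>. x \<in> UNIV \<longrightarrow> 0 \<le> g x - ?l x"
    by (rule AE_qc_nonneg[OF quasi_continuous_diff[OF gq(2) q(1)]])
       (use q(3) gq lf in \<open>auto elim!: eventually_elim2\<close>)
  have "{x \<in> space borel. Cauchy (\<lambda>i. c i x)} \<in> sets borel"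
    by (rule sets_Collect_Cauchy) (rule Cc_borel[OF c(2)])
  then have "{x. convergent (\<lambda>i. c i x)} \<in> sets borel" by (simp add: Cauchy_convergent_iff)
  then have "- {x. convergent (\<lambda>i. c i x)} \<in> sets borel" by (rule borel_comp)
  then have "{x. \<not> convergent (\<lambda>i. c i x)} \<in> sets borel" by (simp add: Collect_neg_eq)
  from AE_not_in[OF this q(2)] 1 2 show ?thesis
  proof eventually_elim
    case (elim x)
    then have "?l x = g x" by simp
    then show ?case using elim(1) convergent_LIMSEQ_iff[of "\<lambda>i. c i x"] by simp
  qed
qed

lemma core_integrable:
  assumes "\<phi> \<in> \<F>" "\<phi> \<in> Cc" shows "integrable \<nu> \<phi>" "\<bar>\<integral>x. \<phi> x \<partial>\<nu>\<bar> \<le> C * sqrt (energy \<phi>)"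
proof -
  have b: "\<phi> \<in> borel_measurable \<nu>" unfolding borel_\<nu> by (rule Cc_borel[OF assms(2)])
  have "(\<integral>\<^sup>+x. ennreal (norm (\<phi> x)) \<partial>\<nu>) < \<infinity>"
    using energy[OF assms] by (simp add: le_less_trans)
  then show i: "integrable \<nu> \<phi>" by (rule integrableI_bounded[OF b])
  have "ennreal \<bar>\<integral>x. \<phi> x \<partial>\<nu>\<bar> \<le> (\<integral>\<^sup>+x. ennreal \<bar>\<phi> x\<bar> \<partial>\<nu>)"
    using integral_norm_bound_ennreal[OF i] by simp
  also have "\<dots> \<le> ennreal (C * sqrt (energy \<phi>))" by (rule energy[OF assms])
  finally show "\<bar>\<integral>x. \<phi> x \<partial>\<nu>\<bar> \<le> C * sqrt (energy \<phi>)"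
    using C form_nonneg[OF assms(1)] by (simp add: ennreal_le_iff)
qed

text \<open>The energy inequality makes \<open>c\<close> a Cauchy sequence in \<open>L\<^sup>1(\<nu>)\<close>, and \<open>core_AE_limit\<close> identifies its limit;
  Fatou's lemma combines both.\<close>

lemma core_integral_limit:
  assumes c: "approximating m \<F> \<E> c f" "\<And>n. c n \<in> Cc"
    "\<And>n. energy (\<lambda>x. c (Suc n) x - c n x) < (1/16) ^ n"
    and g: "qc_version m \<F> \<E> f g"
  shows "integrable \<nu> g" "(\<lambda>n. \<integral>x. c n x \<partial>\<nu>) \<longlonglongrightarrow> (\<integral>x. g x \<partial>\<nu>)"
proof -
  note cF = approximatingD(1)[OF c(1)]
  have cb: "c n \<in> borel_measurable \<nu>" for n unfolding borel_\<nu> by (rule Cc_borel[OF c(2)])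
  have gb: "g \<in> borel_measurable \<nu>" unfolding borel_\<nu> using g by (simp add: qc_version_def)
  have key: "\<exists>N. \<forall>n\<ge>N. (\<integral>\<^sup>+x. ennreal \<bar>c n x - g x\<bar> \<partial>\<nu>) \<le> ennreal e" if e: "0 < e" for e
  proof -
    have "0 < e / (C + 1)" using e C by simp
    moreover have "\<forall>e>0. \<exists>N. \<forall>i\<ge>N. \<forall>j\<ge>N. sqrt (energy (\<lambda>x. c i x - c j x)) < e"
      using approximatingD(2)[OF c(1)]
      by (subst (asm) form_Cauchy_iff_sqrt) (auto intro: form_nonneg form.diff_mem cF)
    ultimately obtain N where N: "\<forall>i\<ge>N. \<forall>j\<ge>N. sqrt (energy (\<lambda>x. c i x - c j x)) < e / (C + 1)"
      by blast
    have "(\<integral>\<^sup>+x. ennreal \<bar>c n x - g x\<bar> \<partial>\<nu>) \<le> ennreal e" if n: "n \<ge> N" for n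
    proof -
      have "(\<integral>\<^sup>+x. ennreal \<bar>c n x - g x\<bar> \<partial>\<nu>) = (\<integral>\<^sup>+x. liminf (\<lambda>k. ennreal \<bar>c n x - c k x\<bar>) \<partial>\<nu>)"
      proof (rule nn_integral_cong_AE)
        show "AE x in \<nu>. ennreal \<bar>c n x - g x\<bar> = liminf (\<lambda>k. ennreal \<bar>c n x - c k x\<bar>)"
          using core_AE_limit[OF c g]
        proof eventually_elim
          case (elim x)
          have "(\<lambda>k. ennreal \<bar>c n x - c k x\<bar>) \<longlonglongrightarrow> ennreal \<bar>c n x - g x\<bar>"
            by (intro tendsto_ennrealI tendsto_rabs tendsto_diff tendsto_const elim)
          then show ?case by (intro lim_imp_Liminf[symmetric]) auto
        qed
      qed
      also have "\<dots> \<le> liminf (\<lambda>k. \<integral>\<^sup>+x. ennreal \<bar>c n x - c k x\<bar> \<partial>\<nu>)"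
        using cb by (intro nn_integral_liminf) simp
      also have "\<dots> \<le> liminf (\<lambda>k. ennreal e)"
      proof (rule Liminf_mono)
        show "\<forall>\<^sub>F k in sequentially. (\<integral>\<^sup>+x. ennreal \<bar>c n x - c k x\<bar> \<partial>\<nu>) \<le> ennreal e"
          unfolding eventually_sequentially
        proof (intro exI[of _ N] allI impI)
          fix k assume k: "k \<ge> N"
          have "(\<integral>\<^sup>+x. ennreal \<bar>c n x - c k x\<bar> \<partial>\<nu>)
              \<le> ennreal (C * sqrt (energy (\<lambda>x. c n x - c k x)))"
            by (rule energy[OF form.diff_mem[OF cF cF] Cc_diff[OF c(2) c(2)]])
          also have "\<dots> \<le> ennreal e"
          proof (rule ennreal_leI)
            have "C * sqrt (energy (\<lambda>x. c n x - c k x)) \<le> C * (e / (C + 1))"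
              using N n k C by (intro mult_left_mono) (auto intro: less_imp_le)
            also have "\<dots> \<le> (C + 1) * (e / (C + 1))" using C e by (intro mult_right_mono) auto
            finally show "C * sqrt (energy (\<lambda>x. c n x - c k x)) \<le> e" using C by simp
          qed
          finally show "(\<integral>\<^sup>+x. ennreal \<bar>c n x - c k x\<bar> \<partial>\<nu>) \<le> ennreal e" .
        qed
      qed
      also have "\<dots> = ennreal e" by (simp add: Liminf_const)
      finally show ?thesis .
    qed
    then show ?thesis by blast
  qed
  have int: "\<exists>N. \<forall>n\<ge>N. integrable \<nu> (\<lambda>x. c n x - g x) \<and> (\<integral>x. \<bar>c n x - g x\<bar> \<partial>\<nu>) \<le> e" if "0 < e" for e
  proof -
    obtain N where N: "\<forall>n\<ge>N. (\<integral>\<^sup>+x. ennreal \<bar>c n x - g x\<bar> \<partial>\<nu>) \<le> ennreal e" using key[OF \<open>0 < e\<close>] by blast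
    have "integrable \<nu> (\<lambda>x. c n x - g x) \<and> (\<integral>x. \<bar>c n x - g x\<bar> \<partial>\<nu>) \<le> e" if "n \<ge> N" for n
    proof
      have le: "(\<integral>\<^sup>+x. ennreal \<bar>c n x - g x\<bar> \<partial>\<nu>) \<le> ennreal e" using N that by blast
      show i: "integrable \<nu> (\<lambda>x. c n x - g x)"
        by (rule integrableI_bounded) (use cb gb le in \<open>auto simp: le_less_trans\<close>)
      have "ennreal (\<integral>x. \<bar>c n x - g x\<bar> \<partial>\<nu>) \<le> ennreal e"
        using nn_integral_eq_integral[OF integrable_abs[OF i]] le by simp
      then show "(\<integral>x. \<bar>c n x - g x\<bar> \<partial>\<nu>) \<le> e" using \<open>0 < e\<close> by (simp add: ennreal_le_iff)
    qed
    then show ?thesis by blast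
  qed
  obtain N where "integrable \<nu> (\<lambda>x. c N x - g x)" using int[of 1] by auto
  from Bochner_Integration.integrable_diff[OF core_integrable(1)[OF cF c(2)] this, of N]
  have "integrable \<nu> (\<lambda>x. c N x - (c N x - g x))" .
  then show gi: "integrable \<nu> g" by simp
  show "(\<lambda>n. \<integral>x. c n x \<partial>\<nu>) \<longlonglongrightarrow> (\<integral>x. g x \<partial>\<nu>)"
  proof (rule LIMSEQ_I)
    fix e :: real assume "0 < e"
    then obtain N where N: "\<forall>n\<ge>N. integrable \<nu> (\<lambda>x. c n x - g x) \<and> (\<integral>x. \<bar>c n x - g x\<bar> \<partial>\<nu>) \<le> e / 2"
      using int[of "e / 2"] by auto
    have "norm ((\<integral>x. c n x \<partial>\<nu>) - (\<integral>x. g x \<partial>\<nu>)) < e" if "n \<ge> N" for n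
    proof -
      have "(\<integral>x. c n x \<partial>\<nu>) - (\<integral>x. g x \<partial>\<nu>) = (\<integral>x. c n x - g x \<partial>\<nu>)"
        by (rule Bochner_Integration.integral_diff[symmetric]) (intro core_integrable cF c(2) gi)+
      also have "\<bar>\<dots>\<bar> \<le> (\<integral>x. \<bar>c n x - g x\<bar> \<partial>\<nu>)" by (rule integral_abs_bound)
      finally show ?thesis using N that \<open>0 < e\<close> by fastforce
    qed
    then show "\<exists>no. \<forall>n\<ge>no. norm ((\<integral>x. c n x \<partial>\<nu>) - (\<integral>x. g x \<partial>\<nu>)) < e" by blast
  qed
qed

text \<open>The Riesz representation by minimising \<open>\<E>(\<phi>, \<phi>) - 2 \<integral>\<phi> d\<nu>\<close> over the core: the parallelogram law makes
  minimising sequences Cauchy, and the first variation vanishes in the limit.\<close>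

lemma minimizing_sequence:
  obtains \<phi> :: "nat \<Rightarrow> 'a \<Rightarrow> real" where "\<And>n. \<phi> n \<in> \<F>" "\<And>n. \<phi> n \<in> Cc" "form_Cauchy \<E> \<phi>"
    "\<And>\<psi>. \<lbrakk>\<psi> \<in> \<F>; \<psi> \<in> Cc\<rbrakk> \<Longrightarrow> (\<lambda>n. \<E> (\<phi> n) \<psi>) \<longlonglongrightarrow> (\<integral>x. \<psi> x \<partial>\<nu>)"
proof -
  define J where "J \<phi> = energy \<phi> - 2 * (\<integral>x. \<phi> x \<partial>\<nu>)" for \<phi>
  define D where "D = \<F> \<inter> Cc"
  have D0: "(\<lambda>_. 0) \<in> D" unfolding D_def using dom_zero Cc_I[of "\<lambda>_. 0" "{}"] by simp
  have DF: "\<phi> \<in> \<F>" "\<phi> \<in> Cc" "integrable \<nu> \<phi>" if "\<phi> \<in> D" for \<phi>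
    using that core_integrable(1) by (auto simp: D_def)
  have Dlin: "(\<lambda>x. \<phi> x + t * \<psi> x) \<in> D" if "\<phi> \<in> D" "\<psi> \<in> D" for \<phi> \<psi> t
    unfolding D_def using DF[OF that(1)] DF[OF that(2)] by (auto intro: dom_add dom_scale Cc_add Cc_scale)
  have Dmid: "(\<lambda>x. (\<phi> x + \<psi> x) / 2) \<in> D" if "\<phi> \<in> D" "\<psi> \<in> D" for \<phi> \<psi>
  proof -
    have "(\<lambda>x. (\<lambda>_. 0) x + 1/2 * (\<phi> x + 1 * \<psi> x)) \<in> D" by (intro Dlin D0 that)
    then show ?thesis by simp
  qed
  have low: "- C\<^sup>2 \<le> J \<phi>" if "\<phi> \<in> D" for \<phi>
  proof -
    have "(\<integral>x. \<phi> x \<partial>\<nu>) \<le> C * sqrt (energy \<phi>)"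
      using core_integrable(2)[OF DF(1,2)[OF that]] by linarith
    moreover have "0 \<le> (sqrt (energy \<phi>) - C)\<^sup>2" by simp
    then have "2 * (C * sqrt (energy \<phi>)) \<le> energy \<phi> + C\<^sup>2"
      using form_nonneg[OF DF(1)[OF that]] by (simp add: power2_diff mult.commute)
    ultimately show ?thesis unfolding J_def by linarith
  qed
  define I where "I = Inf (J ` D)"
  have bdd: "bdd_below (J ` D)" using low by (intro bdd_belowI[of _ "- C\<^sup>2"]) auto
  have I: "I \<le> J \<phi>" if "\<phi> \<in> D" for \<phi> unfolding I_def using that bdd by (intro cInf_lower) auto
  have "\<exists>\<phi>. \<phi> \<in> D \<and> J \<phi> < I + 1 / real (Suc n)" for n
    using cInf_lessD[of "J ` D" "I + 1 / real (Suc n)"] D0 unfolding I_def by auto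
  then obtain \<phi> where \<phi>: "\<And>n. \<phi> n \<in> D" "\<And>n. J (\<phi> n) < I + 1 / real (Suc n)" by metis
  have \<phi>F: "\<phi> n \<in> \<F>" "\<phi> n \<in> Cc" for n using \<phi>(1) by (auto simp: D_def)
  have est: "energy (\<lambda>x. \<phi> i x - \<phi> j x) \<le> 4 / real (Suc k)" if "i \<ge> k" "j \<ge> k" for i j k
  proof -
    let ?h = "\<lambda>x. (\<phi> i x + \<phi> j x) / 2"
    have "(\<integral>x. ?h x \<partial>\<nu>) = ((\<integral>x. \<phi> i x \<partial>\<nu>) + (\<integral>x. \<phi> j x \<partial>\<nu>)) / 2"
      using DF(3)[OF \<phi>(1)] by simp
    then have "energy (\<lambda>x. \<phi> i x - \<phi> j x) = 2 * J (\<phi> i) + 2 * J (\<phi> j) - 4 * J ?h"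
      using form.parallelogram[OF \<phi>F(1) \<phi>F(1), of i j] by (simp add: J_def field_simps)
    moreover have "I \<le> J ?h" by (intro I Dmid \<phi>)
    moreover have "J (\<phi> n) \<le> I + 1 / real (Suc k)" if "n \<ge> k" for n
    proof -
      have "1 / real (Suc n) \<le> 1 / real (Suc k)" using that by (auto simp: field_simps)
      then show ?thesis using \<phi>(2)[of n] by linarith
    qed
    ultimately show ?thesis using that by (smt (verit) add_divide_distrib)
  qed
  have Cauchy: "form_Cauchy \<E> \<phi>" unfolding form_Cauchy_def
  proof safe
    fix e :: real assume "e > 0"
    have "(\<lambda>k. 4 / real (Suc k)) \<longlonglongrightarrow> 0" by (rule LIMSEQ_Suc[OF lim_const_over_n])
    then obtain k where "4 / real (Suc k) < e"
      using LIMSEQ_D[of "\<lambda>k. 4 / real (Suc k)" 0 e] \<open>e > 0\<close> by auto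
    then show "\<exists>N. \<forall>i\<ge>N. \<forall>j\<ge>N. energy (\<lambda>x. \<phi> i x - \<phi> j x) < e"
      using est order.strict_trans1 by blast
  qed
  have lim: "(\<lambda>n. \<E> (\<phi> n) \<psi>) \<longlonglongrightarrow> (\<integral>x. \<psi> x \<partial>\<nu>)" if \<psi>: "\<psi> \<in> \<F>" "\<psi> \<in> Cc" for \<psi>
  proof -
    have \<psi>D: "\<psi> \<in> D" using \<psi> by (simp add: D_def)
    have q: "- (1 / real (Suc n)) \<le> 2 * t * (\<E> (\<phi> n) \<psi> - (\<integral>x. \<psi> x \<partial>\<nu>)) + t\<^sup>2 * energy \<psi>" for t n
    proof -
      have t: "(\<lambda>x. t * \<psi> x) \<in> \<F>" by (rule dom_scale[OF \<psi>(1)])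
      have "I \<le> J (\<lambda>x. \<phi> n x + t * \<psi> x)" by (intro I Dlin \<phi> \<psi>D)
      also have "\<dots> = J (\<phi> n) + 2 * t * (\<E> (\<phi> n) \<psi> - (\<integral>x. \<psi> x \<partial>\<nu>)) + t\<^sup>2 * energy \<psi>"
        using DF(3)[OF \<phi>(1), of n] DF(3)[OF \<psi>D] form.add_square[OF \<phi>F(1) t, of n]
          form.scale_right[OF \<psi>(1) \<phi>F(1), of n t] form.scale_left[OF \<psi>(1) t, of t]
          form.scale_right[OF \<psi>(1) \<psi>(1), of t]
        by (simp add: J_def power2_eq_square algebra_simps)
      finally show ?thesis using \<phi>(2)[of n] by linarith
    qed
    have bound: "\<bar>\<E> (\<phi> n) \<psi> - (\<integral>x. \<psi> x \<partial>\<nu>)\<bar> \<le> (1 + energy \<psi>) * sqrt (1 / real (Suc n))" for n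
    proof -
      \<comment> \<open>a step of this size in the directions \<open>\<psi>\<close> and \<open>- \<psi>\<close> balances the two error terms\<close>
      define s where "s = sqrt (1 / real (Suc n))"
      have s: "0 < s" "s\<^sup>2 = 1 / real (Suc n)" by (auto simp: s_def)
      define X where "X = \<E> (\<phi> n) \<psi> - (\<integral>x. \<psi> x \<partial>\<nu>)"
      have "- s\<^sup>2 \<le> 2 * s * X + s\<^sup>2 * energy \<psi>" "- s\<^sup>2 \<le> 2 * (- s) * X + (- s)\<^sup>2 * energy \<psi>"
        unfolding X_def using q[of n s] q[of n "- s"] s by auto
      then have "s * (2 * \<bar>X\<bar>) \<le> s * (s * (1 + energy \<psi>))"
        by (auto simp: power2_eq_square algebra_simps abs_if)
      then have "2 * \<bar>X\<bar> \<le> s * (1 + energy \<psi>)" using s(1) by simp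
      then show ?thesis unfolding X_def[symmetric] s_def[symmetric] by (simp add: mult.commute)
    qed
    have "(\<lambda>n. (1 + energy \<psi>) * sqrt (1 / real (Suc n))) \<longlonglongrightarrow> (1 + energy \<psi>) * sqrt 0"
      by (intro tendsto_mult tendsto_const tendsto_real_sqrt LIMSEQ_Suc[OF lim_const_over_n])
    then have l0: "(\<lambda>n. (1 + energy \<psi>) * sqrt (1 / real (Suc n))) \<longlonglongrightarrow> 0" by simp
    have "norm (\<E> (\<phi> n) \<psi> - (\<integral>x. \<psi> x \<partial>\<nu>)) \<le> (1 + energy \<psi>) * sqrt (1 / real (Suc n))" for n
      using bound[of n] by simp
    then have "(\<lambda>n. \<E> (\<phi> n) \<psi> - (\<integral>x. \<psi> x \<partial>\<nu>)) \<longlonglongrightarrow> 0"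
      by (intro Lim_null_comparison[OF always_eventually[OF allI] l0])
    then show ?thesis by (rule LIM_zero_cancel)
  qed
  show ?thesis by (rule that[OF \<phi>F Cauchy lim])
qed

text \<open>Transience lets the minimising sequence converge almost everywhere along a subsequence, so its
  limit is an element of the extended Dirichlet space.\<close>

lemma potential_exists:
  "\<exists>u. u \<in> ext_dom m \<F> \<E> \<and> (\<forall>f\<in>ext_dom m \<F> \<E>. \<forall>g. qc_version m \<F> \<E> f g \<longrightarrow>
           integrable \<nu> g \<and> ext_form m \<F> \<E> f u = (\<integral>x. g x \<partial>\<nu>))"
proof -
  obtain \<phi> :: "nat \<Rightarrow> 'a \<Rightarrow> real" where \<phi>: "\<And>n. \<phi> n \<in> \<F>" "\<And>n. \<phi> n \<in> Cc" "form_Cauchy \<E> \<phi>"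
    "\<And>\<psi>. \<lbrakk>\<psi> \<in> \<F>; \<psi> \<in> Cc\<rbrakk> \<Longrightarrow> (\<lambda>n. \<E> (\<phi> n) \<psi>) \<longlonglongrightarrow> (\<integral>x. \<psi> x \<partial>\<nu>)"
    using minimizing_sequence by blast
  obtain r U where r: "strict_mono (r :: nat \<Rightarrow> nat)" "approximating m \<F> \<E> (\<lambda>n. \<phi> (r n)) U"
    "U \<in> borel_measurable m" by (rule Cauchy_AE_limit[OF \<phi>(1,3)])
  have U: "U \<in> ext_dom m \<F> \<E>" using r by (auto simp: ext_dom_def)
  obtain B where B: "0 \<le> B" "\<And>n. energy (\<phi> (r n)) \<le> B"
    using form.Cauchy_bounded[OF approximatingD(1,2)[OF r(2)]] by metis
  have "integrable \<nu> g \<and> ext_form m \<F> \<E> f U = (\<integral>x. g x \<partial>\<nu>)"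
    if f: "f \<in> ext_dom m \<F> \<E>" and g: "qc_version m \<F> \<E> f g" for f g
  proof
    obtain c where c: "approximating m \<F> \<E> c f" "\<And>n. c n \<in> Cc"
      "\<And>n. energy (\<lambda>x. c (Suc n) x - c n x) < (1/16) ^ n"
      using core_approximation[OF f] by blast
    note cF = approximatingD(1)[OF c(1)]
    show "integrable \<nu> g" by (rule core_integral_limit[OF c g])
    have "(\<lambda>k. \<integral>x. c k x \<partial>\<nu>) \<longlonglongrightarrow> ext_form m \<F> \<E> f U"
    proof (rule LIMSEQ_I)
      fix e :: real assume e: "0 < e"
      have sB: "0 < sqrt B + 1" using B by (simp add: add_nonneg_pos)
      then have e': "0 < e / 2 / (sqrt B + 1)" using e by simp
      moreover have "\<forall>e>0. \<exists>N. \<forall>i\<ge>N. \<forall>j\<ge>N. sqrt (energy (\<lambda>x. c i x - c j x)) < e"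
        using approximatingD(2)[OF c(1)]
        by (subst (asm) form_Cauchy_iff_sqrt) (auto intro: form_nonneg form.diff_mem cF)
      ultimately obtain N where N: "\<forall>i\<ge>N. \<forall>j\<ge>N. sqrt (energy (\<lambda>x. c i x - c j x)) < e / 2 / (sqrt B + 1)"
        by blast
      have "\<bar>(\<integral>x. c k x \<partial>\<nu>) - ext_form m \<F> \<E> f U\<bar> \<le> e / 2" if k: "k \<ge> N" for k
      proof (rule LIMSEQ_le_const2)
        have 1: "(\<lambda>n. \<E> (\<phi> (r n)) (c k)) \<longlonglongrightarrow> (\<integral>x. c k x \<partial>\<nu>)"
          using LIMSEQ_subseq_LIMSEQ[OF \<phi>(4)[OF cF c(2)] r(1), of k] by (simp add: comp_def)
        have 2: "(\<lambda>n. \<E> (c n) (\<phi> (r n))) \<longlonglongrightarrow> ext_form m \<F> \<E> f U" by (rule ext_form_lim[OF c(1) r(2)])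
        show "(\<lambda>n. \<bar>\<E> (\<phi> (r n)) (c k) - \<E> (c n) (\<phi> (r n))\<bar>) \<longlonglongrightarrow> \<bar>(\<integral>x. c k x \<partial>\<nu>) - ext_form m \<F> \<E> f U\<bar>"
          by (intro tendsto_rabs tendsto_diff 1 2)
        show "\<exists>N. \<forall>n\<ge>N. \<bar>\<E> (\<phi> (r n)) (c k) - \<E> (c n) (\<phi> (r n))\<bar> \<le> e / 2"
        proof (intro exI[of _ N] allI impI)
          fix n assume n: "n \<ge> N"
          have "\<E> (\<phi> (r n)) (c k) - \<E> (c n) (\<phi> (r n)) = \<E> (\<lambda>x. c k x - c n x) (\<phi> (r n))"
            using form.diff_left[OF cF cF \<phi>(1), of k n "r n"] form_sym[OF \<phi>(1) cF, of "r n" k] by simp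
          also have "\<bar>\<dots>\<bar> \<le> sqrt (energy (\<lambda>x. c k x - c n x)) * sqrt (energy (\<phi> (r n)))"
            by (rule form.Cauchy_Schwarz[OF form.diff_mem[OF cF cF] \<phi>(1)])
          also have "\<dots> \<le> e / 2 / (sqrt B + 1) * (sqrt B + 1)"
          proof (rule mult_mono)
            show "sqrt (energy (\<phi> (r n))) \<le> sqrt B + 1"
              using B(2)[of n] by (simp add: add_increasing2)
          qed (use N k n e' form_nonneg[OF \<phi>(1)] in \<open>auto intro: less_imp_le\<close>)
          also have "\<dots> = e / 2"
          proof -
            have "e / 2 / s * s = e / 2" if "0 < s" for s :: real using that by simp
            from this[OF sB] show ?thesis .
          qed
          finally show "\<bar>\<E> (\<phi> (r n)) (c k) - \<E> (c n) (\<phi> (r n))\<bar> \<le> e / 2" .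
        qed
      qed
      then show "\<exists>no. \<forall>n\<ge>no. norm ((\<integral>x. c n x \<partial>\<nu>) - ext_form m \<F> \<E> f U) < e"
        using e by (intro exI[of _ N]) fastforce
    qed
    then show "ext_form m \<F> \<E> f U = (\<integral>x. g x \<partial>\<nu>)"
      using core_integral_limit(2)[OF c g] LIMSEQ_unique by blast
  qed
  then show ?thesis using U by blast
qed

lemma potential0_spec:
  "potential0 m \<F> \<E> \<nu> \<in> ext_dom m \<F> \<E>"
  "\<lbrakk>f \<in> ext_dom m \<F> \<E>; qc_version m \<F> \<E> f g\<rbrakk> \<Longrightarrow> integrable \<nu> g"
  "\<lbrakk>f \<in> ext_dom m \<F> \<E>; qc_version m \<F> \<E> f g\<rbrakk> \<Longrightarrow> ext_form m \<F> \<E> f (potential0 m \<F> \<E> \<nu>) = (\<integral>x. g x \<partial>\<nu>)"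
  using someI_ex[OF potential_exists] unfolding potential0_def[symmetric] by blast+

text \<open>A quasi-continuous version \<open>g\<close> of \<open>u\<close> is at least 1 \<open>\<nu>\<close>-almost everywhere. Hence the mass of \<open>\<nu>\<close> is at
  most \<open>\<integral>g d\<nu> = \<E>(u, U)\<close>.\<close>

lemma mass_le_potential_energy:
  assumes A: "open A" "AE x in \<nu>. x \<in> A" and u: "u \<in> ext_dom m \<F> \<E>" "AE x in m. x \<in> A \<longrightarrow> 1 \<le> u x"
  defines "U \<equiv> potential0 m \<F> \<E> \<nu>"
  shows "emeasure \<nu> UNIV \<le> ennreal (sqrt (ext_form m \<F> \<E> u u) * sqrt (ext_form m \<F> \<E> U U))"
proof -
  obtain g where g: "qc_version m \<F> \<E> u g" using qc_version_exists[OF u(1)] by blast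
  have gq: "g \<in> borel_measurable borel" "quasi_continuous m \<F> \<E> g" "AE x in m. g x = u x"
    using g by (auto simp: qc_version_def)
  have "AE x in \<nu>. x \<in> A \<longrightarrow> 0 \<le> g x - 1"
  proof (rule AE_qc_nonneg[OF _ _ A(1)])
    show "quasi_continuous m \<F> \<E> (\<lambda>x. g x - 1)"
      by (rule quasi_continuous_diff[OF gq(2) quasi_continuous_continuous]) simp
    show "AE x in m. x \<in> A \<longrightarrow> 0 \<le> g x - 1" using gq(3) u(2) by eventually_elim simp
  qed (use gq(1) in simp)
  then have g1: "AE x in \<nu>. 1 \<le> g x" using A(2) by eventually_elim simp
  have gi: "integrable \<nu> g" by (rule potential0_spec(2)[OF u(1) g])
  have "emeasure \<nu> UNIV = (\<integral>\<^sup>+x. 1 \<partial>\<nu>)" by simp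
  also have "\<dots> \<le> (\<integral>\<^sup>+x. ennreal (g x) \<partial>\<nu>)"
    using g1 by (intro nn_integral_mono_AE) (auto elim!: eventually_mono)
  also have "\<dots> = ennreal (\<integral>x. g x \<partial>\<nu>)"
    using g1 by (intro nn_integral_eq_integral gi) (auto elim!: eventually_mono)
  also have "(\<integral>x. g x \<partial>\<nu>) = ext_form m \<F> \<E> u U" unfolding U_def by (rule potential0_spec(3)[OF u(1) g, symmetric])
  also have "ennreal \<dots> \<le> ennreal (sqrt (ext_form m \<F> \<E> u u) * sqrt (ext_form m \<F> \<E> U U))"
    using ext_form_Cauchy_Schwarz[OF u(1) potential0_spec(1)] unfolding U_def by (intro ennreal_leI) linarith
  finally show ?thesis .
qed

text \<open>If core functions \<open>c n\<close> approximate \<open>U\<close>, then \<open>\<integral>c n d\<nu>\<close> tends to \<open>\<E>(U, U)\<close>, while the hypothesis for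
  \<open>\<bar>c n\<bar>\<close> bounds it by a sequence that tends to \<open>D\<close> times the square root of \<open>\<E>(U, U)\<close>.\<close>

lemma potential_energy_le:
  assumes D: "0 \<le> D" "\<And>\<phi>. \<lbrakk>\<phi> \<in> \<F>; \<phi> \<in> Cc; \<And>x. 0 \<le> \<phi> x\<rbrakk> \<Longrightarrow> (\<integral>\<^sup>+x. ennreal (\<phi> x) \<partial>\<nu>) \<le> ennreal (D * sqrt (energy \<phi>))"
  defines "U \<equiv> potential0 m \<F> \<E> \<nu>"
  shows "ext_form m \<F> \<E> U U \<le> D\<^sup>2"
proof -
  have U: "U \<in> ext_dom m \<F> \<E>" unfolding U_def by (rule potential0_spec(1))
  obtain c where c: "approximating m \<F> \<E> c U" "\<And>n. c n \<in> Cc"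
    "\<And>n. energy (\<lambda>x. c (Suc n) x - c n x) < (1/16) ^ n"
    using core_approximation[OF U] by blast
  note cF = approximatingD(1)[OF c(1)]
  obtain g where g: "qc_version m \<F> \<E> U g" using qc_version_exists[OF U] by blast
  define E where "E = ext_form m \<F> \<E> U U"
  have E0: "0 \<le> E" unfolding E_def by (rule ext_form_nonneg[OF U])
  have "(\<lambda>n. \<integral>x. c n x \<partial>\<nu>) \<longlonglongrightarrow> (\<integral>x. g x \<partial>\<nu>)" by (rule core_integral_limit(2)[OF c g])
  also have "(\<integral>x. g x \<partial>\<nu>) = E" unfolding E_def using potential0_spec(3)[OF U g] by (simp add: U_def)
  finally have l1: "(\<lambda>n. \<integral>x. c n x \<partial>\<nu>) \<longlonglongrightarrow> E" .
  have l2: "(\<lambda>n. D * sqrt (energy (c n))) \<longlonglongrightarrow> D * sqrt E"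
    unfolding E_def by (intro tendsto_mult tendsto_const tendsto_real_sqrt ext_form_lim c(1))
  have "E \<le> D * sqrt E"
  proof (rule LIMSEQ_le[OF l1 l2], intro exI allI impI)
    fix n
    let ?a = "\<lambda>x. \<bar>c n x\<bar>"
    have "ennreal (\<integral>x. \<bar>c n x\<bar> \<partial>\<nu>) = (\<integral>\<^sup>+x. ennreal \<bar>c n x\<bar> \<partial>\<nu>)"
      by (rule nn_integral_eq_integral[symmetric, OF integrable_abs[OF core_integrable(1)[OF cF c(2)]]]) simp
    also have "\<dots> \<le> ennreal (D * sqrt (energy ?a))"
      by (rule D(2)) (auto intro: abs_mem cF Cc_abs c)
    also have "\<dots> \<le> ennreal (D * sqrt (energy (c n)))"
      using abs_mem(2)[OF cF, of n] D(1) by (intro ennreal_leI mult_left_mono) auto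
    finally have "(\<integral>x. \<bar>c n x\<bar> \<partial>\<nu>) \<le> D * sqrt (energy (c n))"
      using D(1) form_nonneg[OF cF] by (simp add: ennreal_le_iff)
    then show "(\<integral>x. c n x \<partial>\<nu>) \<le> D * sqrt (energy (c n))"
      using integral_abs_bound[of \<nu> "c n"] by linarith
  qed
  then have "sqrt E * sqrt E \<le> D * sqrt E" using E0 by simp
  then have "sqrt E \<le> D"
  proof (cases "E = 0")
    case False
    then have "0 < sqrt E" using E0 by simp
    with \<open>sqrt E * sqrt E \<le> D * sqrt E\<close> show ?thesis by (metis mult_le_cancel_right_pos)
  qed (use D(1) in simp)
  then show ?thesis unfolding E_def[symmetric] by (rule sqrt_le_D)
qed

end

end

section \<open>Paths and the transition function\<close>

text \<open>A functional form of the monotone class theorem. Right continuity of the paths says something about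
  continuous functions only; indicators of open sets are increasing limits of these, and the open
  sets are a generator of the Borel sets that is stable under intersections.\<close>

lemma borel_functional_induct:
  fixes \<Phi> :: "('a::{metric_space, second_countable_topology} \<Rightarrow> ennreal) \<Rightarrow> 'c \<Rightarrow> ennreal"
  assumes lc: "locally compact (UNIV :: 'a set)"
    and Cc: "\<And>\<phi>. \<lbrakk>\<phi> \<in> Cc; \<And>x. 0 \<le> \<phi> x\<rbrakk> \<Longrightarrow> \<Phi> (\<lambda>x. ennreal (\<phi> x)) \<in> borel_measurable N"
    and add: "\<And>f g y. \<lbrakk>f \<in> borel_measurable borel; g \<in> borel_measurable borel\<rbrakk> \<Longrightarrow>
        \<Phi> (\<lambda>x. f x + g x) y = \<Phi> f y + \<Phi> g y"
    and mult: "\<And>c f y. f \<in> borel_measurable borel \<Longrightarrow> \<Phi> (\<lambda>x. c * f x) y = c * \<Phi> f y"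
    and SUP: "\<And>f y. \<lbrakk>\<And>i::nat. f i \<in> borel_measurable borel; incseq f\<rbrakk> \<Longrightarrow>
        \<Phi> (\<lambda>x. SUP i. f i x) y = (SUP i. \<Phi> (f i) y)"
    and one: "\<And>y. \<Phi> (\<lambda>_. 1) y < \<infinity>"
    and h: "h \<in> borel_measurable borel"
  shows "\<Phi> h \<in> borel_measurable N"
proof -
  have op: "\<Phi> (indicator U) \<in> borel_measurable N" if U: "open U" for U
  proof -
    obtain \<phi> :: "nat \<Rightarrow> 'a \<Rightarrow> real" where \<phi>: "\<And>n. \<phi> n \<in> Cc" "\<And>n x. 0 \<le> \<phi> n x" "\<And>n x. \<phi> n x \<le> 1"
      "\<And>n x. \<phi> n x \<le> \<phi> (Suc n) x" "\<And>x. (\<lambda>n. \<phi> n x) \<longlonglongrightarrow> indicator U x"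
      using open_indicator_approx[OF lc U] by metis
    have inc: "incseq (\<lambda>n x. ennreal (\<phi> n x))"
      by (intro incseq_SucI le_funI ennreal_leI \<phi>)
    have "indicator U x = (SUP n. ennreal (\<phi> n x))" for x
    proof (rule LIMSEQ_unique)
      show "(\<lambda>n. ennreal (\<phi> n x)) \<longlonglongrightarrow> (SUP n. ennreal (\<phi> n x))"
        by (rule LIMSEQ_SUP) (intro incseq_SucI ennreal_leI \<phi>)
      show "(\<lambda>n. ennreal (\<phi> n x)) \<longlonglongrightarrow> indicator U x"
        using tendsto_ennrealI[OF \<phi>(5)[of x]] by (auto simp: indicator_def split: if_splits)
    qed
    then have "\<Phi> (indicator U) = \<Phi> (\<lambda>x. SUP n. ennreal (\<phi> n x))" by (intro arg_cong[where f = \<Phi>] ext)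
    also have "\<dots> = (\<lambda>y. SUP n. \<Phi> (\<lambda>x. ennreal (\<phi> n x)) y)"
      by (rule ext, rule SUP[OF _ inc]) (use Cc_borel[OF \<phi>(1)] in measurable)
    finally show ?thesis
      using Cc[OF \<phi>(1,2)] by (simp add: borel_measurable_SUP)
  qed
  have zero: "\<Phi> (\<lambda>_. 0) y = 0" for y using mult[of "\<lambda>_. 0" 0 y] by simp
  have ind: "\<Phi> (indicator B) \<in> borel_measurable N" if "B \<in> sets borel" for B
  proof -
    have "Int_stable {U :: 'a set. open U}" "{U :: 'a set. open U} \<subseteq> Pow UNIV"
      "B \<in> sigma_sets UNIV {U :: 'a set. open U}"
      using that by (auto simp: Int_stable_def borel_def)
    then show ?thesis
    proof (induction rule: sigma_sets_induct_disjoint)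
      case (basic A)
      then show ?case using op by simp
    next
      case empty
      have "indicator {} = (\<lambda>_ :: 'a. 0 :: ennreal)" by auto
      then have eq: "\<Phi> (indicator {}) = (\<lambda>_. 0)" using zero by auto
      show ?case unfolding eq by simp
    next
      case (compl A)
      have A: "A \<in> sets borel" using compl(1) by (simp add: borel_def)
      have U1: "\<Phi> (\<lambda>_. 1) \<in> borel_measurable N" using op[OF open_UNIV] by simp
      have "\<Phi> (indicator (UNIV - A)) y = \<Phi> (\<lambda>_. 1) y - \<Phi> (indicator A) y" for y
      proof -
        have "\<Phi> (\<lambda>_. 1) y = \<Phi> (\<lambda>x. indicator A x + indicator (UNIV - A) x) y"
          by (intro arg_cong[where f = "\<lambda>g. \<Phi> g y"] ext) (auto simp: indicator_def)
        also have "\<dots> = \<Phi> (indicator A) y + \<Phi> (indicator (UNIV - A)) y"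
          using A by (intro add) auto
        finally have eq: "\<Phi> (\<lambda>_. 1) y = \<Phi> (indicator A) y + \<Phi> (indicator (UNIV - A)) y" .
        moreover have "\<Phi> (indicator A) y \<noteq> \<top>" using one[of y] eq by (auto simp: top_unique)
        ultimately show ?thesis by (simp add: ennreal_add_diff_cancel_left)
      qed
      then have "\<Phi> (indicator (UNIV - A)) = (\<lambda>y. \<Phi> (\<lambda>_. 1) y - \<Phi> (indicator A) y)" by auto
      then show ?case using U1 compl(2) by simp
    next
      case (union A)
      have A: "A i \<in> sets borel" for i using union(2) by (auto simp: borel_def)
      have fin: "\<Phi> (\<lambda>x. \<Sum>i<n. indicator (A i) x) y = (\<Sum>i<n. \<Phi> (indicator (A i)) y)" for n y
      proof (induction n)
        case (Suc n)
        have "\<Phi> (\<lambda>x. \<Sum>i<Suc n. indicator (A i) x) y = \<Phi> (\<lambda>x. (\<Sum>i<n. indicator (A i) x) + indicator (A n) x) y"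
          by simp
        also have "\<dots> = \<Phi> (\<lambda>x. \<Sum>i<n. indicator (A i) x) y + \<Phi> (indicator (A n)) y"
          using A by (intro add) auto
        finally show ?case using Suc by simp
      qed (simp add: zero)
      have "indicator (\<Union>i. A i) x = (SUP n. \<Sum>i<n. (indicator (A i) x :: ennreal))" for x
        using suminf_indicator[OF union(1), of x] by (simp add: suminf_eq_SUP)
      then have "\<Phi> (indicator (\<Union>i. A i)) = \<Phi> (\<lambda>x. SUP n. \<Sum>i<n. indicator (A i) x)"
        by (intro arg_cong[where f = \<Phi>] ext)
      also have "\<dots> = (\<lambda>y. SUP n. \<Phi> (\<lambda>x. \<Sum>i<n. indicator (A i) x) y)"
      proof (rule ext, rule SUP)
        show "(\<lambda>x. \<Sum>i<n. (indicator (A i) x :: ennreal)) \<in> borel_measurable borel" for n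
          by (intro borel_measurable_sum borel_measurable_indicator A)
        show "incseq (\<lambda>n x. \<Sum>i<n. (indicator (A i) x :: ennreal))"
          by (intro incseq_SucI le_funI) simp
      qed
      finally show ?case using union(3) by (simp add: fin borel_measurable_SUP)
    qed
  qed
  show ?thesis using h
  proof (induction h rule: borel_measurable_induct)
    case (cong f g)
    then have "f = g" by (simp add: fun_eq_iff)
    then show ?case using cong by simp
  next
    case (set A)
    then show ?case by (rule ind)
  next
    case (mult f c)
    have "\<Phi> (\<lambda>x. c * f x) = (\<lambda>y. c * \<Phi> f y)" by (rule ext, rule assms(4)) (use mult in auto)
    then show ?case using mult by simp
  next
    case (add f g)
    have "\<Phi> (\<lambda>x. g x + f x) = (\<lambda>y. \<Phi> g y + \<Phi> f y)" by (rule ext, rule assms(3)) (use add in auto)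
    then show ?case using add by simp
  next
    case (seq U)
    have "\<Phi> (SUP i. U i) = \<Phi> (\<lambda>x. SUP i. U i x)" by (intro arg_cong[where f = \<Phi>] ext) (simp add: image_comp)
    also have "\<dots> = (\<lambda>y. SUP i. \<Phi> (U i) y)" by (rule ext, rule SUP) (use seq in auto)
    finally have eq: "\<Phi> (SUP i. U i) = (\<lambda>y. SUP i. \<Phi> (U i) y)" .
    show ?case unfolding eq by (rule borel_measurable_SUP) (use seq in auto)
  qed
qed

lemma sets_borel_cem: "sets borel_cem = {B. Some -` B \<in> sets borel}"
proof -
  have "sigma_algebra (UNIV :: 'a option set) {B. Some -` B \<in> sets (borel :: 'a::topological_space measure)}"
    unfolding sigma_algebra_iff2
  proof (intro conjI ballI allI impI)
    fix s :: "'a option set" assume "s \<in> {B. Some -` B \<in> sets borel}"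
    then have "- (Some -` s) \<in> sets borel" by (simp add: borel_comp)
    moreover have "Some -` (UNIV - s) = - (Some -` s)" by auto
    ultimately show "UNIV - s \<in> {B. Some -` B \<in> sets borel}" by simp
  next
    fix A :: "nat \<Rightarrow> 'a option set" assume "range A \<subseteq> {B. Some -` B \<in> sets borel}"
    then have "(\<Union>i. Some -` A i) \<in> sets borel" by (intro sets.countable_UN) auto
    then show "(\<Union>i. A i) \<in> {B. Some -` B \<in> sets borel}" by (simp add: vimage_UN)
  qed auto
  then show ?thesis unfolding borel_cem_def
    by (simp add: sets_measure_of_conv sigma_algebra.sigma_sets_eq)
qed

lemma space_borel_cem [simp]: "space borel_cem = UNIV"
  by (simp add: borel_cem_def space_measure_of_conv)

lemma measurable_Some [measurable]: "Some \<in> borel \<rightarrow>\<^sub>M borel_cem"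
  by (rule measurableI) (auto simp: sets_borel_cem)

lemma ext_cem_simps [simp]: "ext_cem h None = 0" "ext_cem h (Some x) = h x"
  by (simp_all add: ext_cem_def)

lemma measurable_ext_cem [measurable]:
  assumes "h \<in> borel_measurable borel" shows "ext_cem h \<in> borel_measurable borel_cem"
proof (rule measurableI)
  fix B :: "ennreal set" assume "B \<in> sets borel"
  then have "h -` B \<in> sets borel" using measurable_sets_borel[OF assms] by simp
  moreover have "Some -` (ext_cem h -` B) = h -` B" by auto
  ultimately show "ext_cem h -` B \<inter> space borel_cem \<in> sets borel_cem" by (simp add: sets_borel_cem)
qed simp

lemma measurable_the_cem: "(\<lambda>z. case z of None \<Rightarrow> x0 | Some x \<Rightarrow> x) \<in> borel_cem \<rightarrow>\<^sub>M borel"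
proof (rule measurableI)
  fix B :: "'a set" assume "B \<in> sets borel"
  moreover have "Some -` ((\<lambda>z. case z of None \<Rightarrow> x0 | Some x \<Rightarrow> x) -` B) = B" by auto
  ultimately show "(\<lambda>z. case z of None \<Rightarrow> x0 | Some x \<Rightarrow> x) -` B \<inter> space borel_cem \<in> sets borel_cem"
    by (simp add: sets_borel_cem)
qed simp

lemma ext_cem_add: "ext_cem (\<lambda>x. f x + g x) z = ext_cem f z + ext_cem g z"
  by (cases z) auto

lemma ext_cem_mult: "ext_cem (\<lambda>x. c * f x) z = c * ext_cem f z"
  by (cases z) auto

lemma ext_cem_SUP: "ext_cem (\<lambda>x. SUP i::nat. f i x) z = (SUP i. ext_cem (f i) z)"
  by (cases z) auto

lemma ext_cem_mono: "(\<And>x. f x \<le> g x) \<Longrightarrow> ext_cem f z \<le> ext_cem g z"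
  by (cases z) auto

text \<open>A function in \<open>Cc\<close>, extended by 0 to the cemetery, is continuous on the one-point compactification.\<close>

lemma Cc_ext_limit:
  fixes \<phi> :: "'a::t2_space \<Rightarrow> real"
  assumes \<phi>: "\<phi> \<in> Cc" and l: "limitin (Alexandroff_compactification euclidean) f z F"
  shows "((\<lambda>s. ext_cem (\<lambda>x. ennreal (\<phi> x)) (f s)) \<longlongrightarrow> ext_cem (\<lambda>x. ennreal (\<phi> x)) z) F"
proof (rule topological_tendstoI)
  let ?e = "ext_cem (\<lambda>x. ennreal (\<phi> x))"
  fix V :: "ennreal set" assume V: "open V" "?e z \<in> V"
  obtain K where K: "compact K" "\<And>x. x \<notin> K \<Longrightarrow> \<phi> x = 0" using Cc_E[OF \<phi>] by blast
  have "continuous_on UNIV (\<lambda>x. ennreal (\<phi> x))" by (intro continuous_on_ennreal Cc_continuous \<phi>)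
  then have o: "open ((\<lambda>x. ennreal (\<phi> x)) -` V)" using V(1) by (rule open_vimage[rotated])
  have "openin (Alexandroff_compactification euclidean) (?e -` V)"
  proof (cases "0 \<in> V")
    case False
    have "?e -` V = Some ` ((\<lambda>x. ennreal (\<phi> x)) -` V)"
    proof (intro set_eqI)
      fix y show "y \<in> ?e -` V \<longleftrightarrow> y \<in> Some ` ((\<lambda>x. ennreal (\<phi> x)) -` V)" using False by (cases y) auto
    qed
    then show ?thesis using o by (auto simp: openin_Alexandroff_compactification)
  next
    case True
    define C where "C = - ((\<lambda>x. ennreal (\<phi> x)) -` V)"
    have "closed C" unfolding C_def using o by (simp add: closed_Compl)
    moreover have "C \<subseteq> K" unfolding C_def using K(2) True by force
    ultimately have "compact C" using K(1) by (metis compact_Int_closed inf.absorb2)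
    moreover have "?e -` V = insert None (Some ` (UNIV - C))"
    proof (intro set_eqI)
      fix y show "y \<in> ?e -` V \<longleftrightarrow> y \<in> insert None (Some ` (UNIV - C))" using True by (cases y) (auto simp: C_def)
    qed
    ultimately show ?thesis using \<open>closed C\<close>
      unfolding openin_Alexandroff_compactification by (intro disjI2 exI[of _ C]) simp
  qed
  moreover have "z \<in> ?e -` V" using V by simp
  ultimately have "\<forall>\<^sub>F s in F. f s \<in> ?e -` V" using l unfolding limitin_def by blast
  then show "\<forall>\<^sub>F s in F. ?e (f s) \<in> V" by simp
qed

text \<open>The index of the point of the grid with mesh \<open>1 / Suc j\<close> that follows \<open>t\<close>. It lies strictly above \<open>t\<close>
  because a limit at \<open>at_right t\<close> does not see \<open>t\<close> itself.\<close>

definition grid_above :: "nat \<Rightarrow> real \<Rightarrow> nat" where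
  "grid_above j t = Suc (nat \<lfloor>real (Suc j) * max 0 t\<rfloor>)"

lemma measurable_grid_above: "grid_above j \<in> borel \<rightarrow>\<^sub>M count_space UNIV"
proof -
  have "(\<lambda>t. \<lfloor>real (Suc j) * max 0 t\<rfloor>) \<in> borel \<rightarrow>\<^sub>M count_space UNIV" by measurable
  then show ?thesis unfolding grid_above_def
    by (rule measurable_compose[where g = "\<lambda>k. Suc (nat k)"]) simp
qed

lemma grid_above_gt: "max 0 t < real (grid_above j t) / real (Suc j)"
proof -
  have "real (Suc j) * max 0 t < real_of_int \<lfloor>real (Suc j) * max 0 t\<rfloor> + 1" by linarith
  also have "\<dots> = real (grid_above j t)" by (simp add: grid_above_def)
  finally show ?thesis by (simp only: pos_less_divide_eq of_nat_0_less_iff zero_less_Suc mult.commute)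
qed

lemma grid_above_le: "real (grid_above j t) / real (Suc j) \<le> max 0 t + 1 / real (Suc j)"
proof -
  have "real (grid_above j t) = real_of_int \<lfloor>real (Suc j) * max 0 t\<rfloor> + 1" by (simp add: grid_above_def)
  also have "\<dots> \<le> real (Suc j) * max 0 t + 1" by simp
  finally have "real (grid_above j t) / real (Suc j) \<le> (real (Suc j) * max 0 t + 1) / real (Suc j)"
    by (rule divide_right_mono) simp
  then show ?thesis by (simp add: add_divide_distrib)
qed

lemma grid_above_tendsto:
  "filterlim (\<lambda>j. ennreal (real (grid_above j t) / real (Suc j))) (at_right (ennreal t)) sequentially"
proof (rule tendsto_imp_filterlim_at_right)
  have "(\<lambda>j. real (grid_above j t) / real (Suc j)) \<longlonglongrightarrow> max 0 t"
  proof (rule real_tendsto_sandwich[where f = "\<lambda>_. max 0 t" and h = "\<lambda>j. max 0 t + 1 / real (Suc j)"])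
    show "(\<lambda>j. max 0 t + 1 / real (Suc j)) \<longlonglongrightarrow> max 0 t"
      using tendsto_add[OF tendsto_const LIMSEQ_Suc[OF lim_const_over_n[of 1]], of "max 0 t"] by simp
    show "\<forall>\<^sub>F j in sequentially. max 0 t \<le> real (grid_above j t) / real (Suc j)"
      using less_imp_le[OF grid_above_gt] by (intro always_eventually allI)
    show "\<forall>\<^sub>F j in sequentially. real (grid_above j t) / real (Suc j) \<le> max 0 t + 1 / real (Suc j)"
      using grid_above_le by (intro always_eventually allI)
  qed simp
  then have "(\<lambda>j. ennreal (real (grid_above j t) / real (Suc j))) \<longlonglongrightarrow> ennreal (max 0 t)"
    by (rule tendsto_ennrealI)
  then show "(\<lambda>j. ennreal (real (grid_above j t) / real (Suc j))) \<longlonglongrightarrow> ennreal t" by simp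
  have "ennreal t < ennreal (real (grid_above j t) / real (Suc j))" for j
  proof -
    have "ennreal (max 0 t) < ennreal (real (grid_above j t) / real (Suc j))"
      using grid_above_gt[of t j] by (intro ennreal_lessI) (auto simp: max_def split: if_splits)
    then show ?thesis by simp
  qed
  then show "\<forall>\<^sub>F j in sequentially. ennreal t < ennreal (real (grid_above j t) / real (Suc j))"
    by (intro always_eventually allI)
qed

locale lc_hunt_process = hunt_process M P X \<theta>
  for M :: "'w measure" and P :: "'a::{metric_space, second_countable_topology} option \<Rightarrow> 'w measure"
    and X :: "ennreal \<Rightarrow> 'w \<Rightarrow> 'a option" and \<theta> :: "ennreal \<Rightarrow> 'w \<Rightarrow> 'w" +
  assumes loc_compact: "locally compact (UNIV :: 'a set)"
begin

lemma space_P [simp]: "space (P z) = space M"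
  by (rule sets_eq_imp_space_eq[OF sets_P])

lemma measurable_X_P [measurable]: "X t \<in> P z \<rightarrow>\<^sub>M borel_cem"
  using measurable_X by (simp add: measurable_cong_sets[OF sets_P refl])

lemma emeasure_P: "emeasure (P z) (space M) = 1"
  using prob_space.emeasure_space_1[OF prob_P, of z] by simp

lemma right_limit:
  assumes "\<phi> \<in> Cc" "\<omega> \<in> space M" "filterlim s (at_right (ennreal t)) sequentially"
  shows "(\<lambda>j. ext_cem (\<lambda>x. ennreal (\<phi> x)) (X (s j) \<omega>)) \<longlonglongrightarrow> ext_cem (\<lambda>x. ennreal (\<phi> x)) (X (ennreal t) \<omega>)"
  using filterlim_compose[OF Cc_ext_limit[OF assms(1) right_continuous[OF assms(2)]] assms(3)] by simp

text \<open>Evaluation at grid points is jointly measurable since it involves countably many times, and right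
  continuity recovers the path from its values there.\<close>

lemma measurable_path:
  assumes h: "h \<in> borel_measurable borel"
  shows "(\<lambda>(t, \<omega>). ext_cem h (X (ennreal t) \<omega>)) \<in> borel_measurable (borel \<Otimes>\<^sub>M M)"
proof -
  define \<Phi> where "\<Phi> h y = (if snd y \<in> space M then ext_cem h (X (ennreal (fst y)) (snd y)) else 0)"
    for h :: "'a \<Rightarrow> ennreal" and y :: "real \<times> 'w"
  have "\<Phi> h \<in> borel_measurable (borel \<Otimes>\<^sub>M M)"
  proof (rule borel_functional_induct[OF loc_compact _ _ _ _ _ h])
    fix \<phi> :: "'a \<Rightarrow> real" assume \<phi>: "\<phi> \<in> Cc" "\<And>x. 0 \<le> \<phi> x"
    let ?e = "ext_cem (\<lambda>x. ennreal (\<phi> x))"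
    have eb: "?e \<in> borel_measurable borel_cem"
      using Cc_borel[OF \<phi>(1)] by (intro measurable_ext_cem) measurable
    show "\<Phi> (\<lambda>x. ennreal (\<phi> x)) \<in> borel_measurable (borel \<Otimes>\<^sub>M M)"
    proof (rule borel_measurable_LIMSEQ_order)
      fix j
      have m1: "(\<lambda>y. ?e (X (ennreal (real k / real (Suc j))) (snd y))) \<in> borel_measurable (borel \<Otimes>\<^sub>M M)" for k :: nat
        using measurable_compose[OF measurable_snd measurable_compose[OF measurable_X eb]] by simp
      have m2: "(\<lambda>y. grid_above j (fst y)) \<in> (borel \<Otimes>\<^sub>M M) \<rightarrow>\<^sub>M count_space UNIV"
        by (rule measurable_compose[OF measurable_fst measurable_grid_above])
      show "(\<lambda>y. ?e (X (ennreal (real (grid_above j (fst y)) / real (Suc j))) (snd y))) \<in> borel_measurable (borel \<Otimes>\<^sub>M M)"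
        by (rule measurable_compose_countable[OF m1 m2])
    next
      fix y assume y: "y \<in> space ((borel :: real measure) \<Otimes>\<^sub>M M)"
      then have "snd y \<in> space M" by (auto simp: space_pair_measure)
      then show "(\<lambda>j. ?e (X (ennreal (real (grid_above j (fst y)) / real (Suc j))) (snd y))) \<longlonglongrightarrow> \<Phi> (\<lambda>x. ennreal (\<phi> x)) y"
        unfolding \<Phi>_def using right_limit[OF \<phi>(1) _ grid_above_tendsto] by simp
    qed
  next
    show "\<Phi> (\<lambda>_. 1) y < \<infinity>" for y
      unfolding \<Phi>_def by (cases "X (ennreal (fst y)) (snd y)") auto
  qed (auto simp: \<Phi>_def ext_cem_add ext_cem_mult ext_cem_SUP)
  then show ?thesis
    by (rule measurable_cong[THEN iffD1, rotated]) (auto simp: \<Phi>_def space_pair_measure)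
qed

lemma measurable_ext_X:
  assumes "h \<in> borel_measurable borel" shows "(\<lambda>\<omega>. ext_cem h (X t \<omega>)) \<in> borel_measurable (P z)"
  by (rule measurable_compose[OF measurable_X_P measurable_ext_cem[OF assms]])

lemma transition_add:
  assumes "f \<in> borel_measurable borel" "g \<in> borel_measurable borel"
  shows "transition P X t (\<lambda>x. f x + g x) x = transition P X t f x + transition P X t g x"
  unfolding transition_def ext_cem_add by (intro nn_integral_add measurable_ext_X assms)

lemma transition_mult:
  assumes "f \<in> borel_measurable borel"
  shows "transition P X t (\<lambda>x. c * f x) x = c * transition P X t f x"
  unfolding transition_def ext_cem_mult by (intro nn_integral_cmult measurable_ext_X assms)

lemma transition_SUP:
  assumes "\<And>i::nat. f i \<in> borel_measurable borel" "incseq f"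
  shows "transition P X t (\<lambda>x. SUP i. f i x) x = (SUP i. transition P X t (f i) x)"
  unfolding transition_def ext_cem_SUP
proof (rule nn_integral_monotone_convergence_SUP)
  show "incseq (\<lambda>i \<omega>. ext_cem (f i) (X t \<omega>))"
    using assms(2) by (intro incseq_SucI le_funI ext_cem_mono) (auto simp: incseq_Suc_iff le_fun_def)
qed (rule measurable_ext_X[OF assms(1)])

lemma transition_mono: "(\<And>x. f x \<le> g x) \<Longrightarrow> transition P X t f x \<le> transition P X t g x"
  unfolding transition_def by (intro nn_integral_mono ext_cem_mono)

lemma transition_le: "(\<And>x. f x \<le> c) \<Longrightarrow> transition P X t f x \<le> c"
proof -
  assume *: "\<And>x. f x \<le> c"
  have "transition P X t f x \<le> (\<integral>\<^sup>+\<omega>. c \<partial>P (Some x))"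
    unfolding transition_def
  proof (rule nn_integral_mono)
    fix \<omega> show "ext_cem f (X t \<omega>) \<le> c" using * by (cases "X t \<omega>") auto
  qed
  also have "\<dots> = c" by (simp add: emeasure_P)
  finally show ?thesis .
qed

lemma transition_indicator:
  assumes "B \<in> sets borel"
  shows "transition P X t (indicator B) x = emeasure (P (Some x)) (X t -` (Some ` B) \<inter> space M)"
proof -
  have B: "Some ` B \<in> sets borel_cem" using assms by (simp add: sets_borel_cem inj_vimage_image_eq)
  have "transition P X t (indicator B) x = (\<integral>\<^sup>+\<omega>. indicator (X t -` (Some ` B) \<inter> space M) \<omega> \<partial>P (Some x))"
    unfolding transition_def
  proof (rule nn_integral_cong)
    fix \<omega> assume "\<omega> \<in> space (P (Some x))"
    then show "ext_cem (indicator B) (X t \<omega>) = indicator (X t -` (Some ` B) \<inter> space M) \<omega>"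
      by (cases "X t \<omega>") (auto simp: indicator_def)
  qed
  also have "\<dots> = emeasure (P (Some x)) (X t -` (Some ` B) \<inter> space M)"
    using measurable_sets[OF measurable_X_P B, of t "Some x"] by (intro nn_integral_indicator) simp
  finally show ?thesis .
qed

lemma transition_SUP_fun:
  assumes "\<And>i::nat. f i \<in> borel_measurable borel" "incseq f"
  shows "transition P X t (SUP i. f i) x = (SUP i. transition P X t (f i) x)"
proof -
  have "(SUP i. f i) = (\<lambda>x. SUP i. f i x)" by (simp add: fun_eq_iff image_comp)
  then show ?thesis using transition_SUP[OF assms] by simp
qed

lemma measurable_transition_space:
  assumes h: "h \<in> borel_measurable borel"
  shows "transition P X t h \<in> borel_measurable borel"
  using h
proof (induction h rule: borel_measurable_induct)
  case (cong f g)
  then have "f = g" by (simp add: fun_eq_iff)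
  then show ?case using cong by simp
next
  case (set B)
  then have B: "Some ` B \<in> sets borel_cem" by (simp add: sets_borel_cem inj_vimage_image_eq)
  have "transition P X t (indicator B) = (\<lambda>x. emeasure (P (Some x)) (X t -` (Some ` B) \<inter> space M))"
    using set by (intro ext transition_indicator) simp
  then show ?case using measurable_compose[OF measurable_Some kernel[OF B, of t]] by simp
next
  case (mult f c)
  have "transition P X t (\<lambda>x. c * f x) = (\<lambda>x. c * transition P X t f x)" 
    by (rule ext, rule transition_mult) (use mult in auto)
  then show ?case using mult by simp
next
  case (add f g)
  have "transition P X t (\<lambda>x. g x + f x) = (\<lambda>x. transition P X t g x + transition P X t f x)"
    by (rule ext, rule transition_add) (use add in auto)
  then show ?case using add by simp
next
  case (seq U)
  have eq: "transition P X t (SUP i. U i) = (\<lambda>x. SUP i. transition P X t (U i) x)"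
    by (rule ext, rule transition_SUP_fun) (use seq in auto)
  show ?case unfolding eq by (rule borel_measurable_SUP) (use seq in auto)
qed

lemma transition_right_limit:
  assumes \<phi>: "\<phi> \<in> Cc" "\<And>x. 0 \<le> \<phi> x" and s: "filterlim s (at_right (ennreal t)) sequentially"
  shows "(\<lambda>j. transition P X (s j) (\<lambda>x. ennreal (\<phi> x)) x) \<longlonglongrightarrow> transition P X (ennreal t) (\<lambda>x. ennreal (\<phi> x)) x"
proof -
  obtain B where B: "0 < B" "\<And>x. \<bar>\<phi> x\<bar> \<le> B" using Cc_bounded[OF \<phi>(1)] by blast
  have b: "(\<lambda>x. ennreal (\<phi> x)) \<in> borel_measurable borel" using Cc_borel[OF \<phi>(1)] by measurable
  have le: "ext_cem (\<lambda>x. ennreal (\<phi> x)) z \<le> ennreal B" for z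
  proof (cases z)
    case (Some y)
    then show ?thesis using B(2)[of y] by (auto intro!: ennreal_leI)
  qed simp
  show ?thesis unfolding transition_def
  proof (rule nn_integral_dominated_convergence[where w = "\<lambda>_. ennreal B"])
    show "(\<integral>\<^sup>+\<omega>. ennreal B \<partial>P (Some x)) < \<infinity>" by (simp add: emeasure_P)
    show "AE \<omega> in P (Some x). (\<lambda>j. ext_cem (\<lambda>x. ennreal (\<phi> x)) (X (s j) \<omega>)) \<longlonglongrightarrow> ext_cem (\<lambda>x. ennreal (\<phi> x)) (X (ennreal t) \<omega>)"
      by (rule AE_I2) (simp add: right_limit[OF \<phi>(1) _ s])
  qed (use le b in \<open>auto intro!: measurable_compose[OF measurable_X_P measurable_ext_cem]\<close>)
qed

lemma measurable_transition:
  assumes h: "h \<in> borel_measurable borel"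
  shows "(\<lambda>(t, x). transition P X (ennreal t) h x) \<in> borel_measurable (borel \<Otimes>\<^sub>M borel)"
proof -
  define \<Phi> where "\<Phi> h y = transition P X (ennreal (fst y)) h (snd y)" for h y
  have "\<Phi> h \<in> borel_measurable (borel \<Otimes>\<^sub>M borel)"
  proof (rule borel_functional_induct[OF loc_compact _ _ _ _ _ h])
    fix \<phi> :: "'a \<Rightarrow> real" assume \<phi>: "\<phi> \<in> Cc" "\<And>x. 0 \<le> \<phi> x"
    let ?e = "\<lambda>x. ennreal (\<phi> x)"
    have eb: "?e \<in> borel_measurable borel" using Cc_borel[OF \<phi>(1)] by measurable
    show "\<Phi> ?e \<in> borel_measurable (borel \<Otimes>\<^sub>M borel)"
    proof (rule borel_measurable_LIMSEQ_order)
      fix j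
      have m1: "(\<lambda>y. transition P X (ennreal (real k / real (Suc j))) ?e (snd y)) \<in> borel_measurable ((borel :: real measure) \<Otimes>\<^sub>M borel)" for k :: nat
        by (rule measurable_compose[OF measurable_snd measurable_transition_space[OF eb]])
      have m2: "(\<lambda>y. grid_above j (fst y)) \<in> (borel \<Otimes>\<^sub>M (borel :: 'a measure)) \<rightarrow>\<^sub>M count_space UNIV"
        by (rule measurable_compose[OF measurable_fst measurable_grid_above])
      show "(\<lambda>y. transition P X (ennreal (real (grid_above j (fst y)) / real (Suc j))) ?e (snd y))
          \<in> borel_measurable (borel \<Otimes>\<^sub>M borel)"
        by (rule measurable_compose_countable[OF m1 m2])
    next
      fix y :: "real \<times> 'a"
      show "(\<lambda>j. transition P X (ennreal (real (grid_above j (fst y)) / real (Suc j))) ?e (snd y)) \<longlonglongrightarrow> \<Phi> ?e y"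
        unfolding \<Phi>_def by (rule transition_right_limit[OF \<phi> grid_above_tendsto])
    qed
  next
    show "\<Phi> (\<lambda>_. 1) y < \<infinity>" for y
      unfolding \<Phi>_def by (rule le_less_trans[OF transition_le[of _ 1]]) simp_all
  qed (simp_all add: \<Phi>_def transition_add transition_mult transition_SUP)
  moreover have "\<Phi> h = (\<lambda>(t, x). transition P X (ennreal t) h x)" by (auto simp: \<Phi>_def)
  ultimately show ?thesis by simp
qed

end

section \<open>Laplace transforms\<close>

definition exp_weight :: "real \<Rightarrow> real \<Rightarrow> ennreal" where
  "exp_weight \<alpha> t = ennreal (exp (- \<alpha> * t)) * indicator {0..} t"

lemma measurable_exp_weight [measurable]: "exp_weight \<alpha> \<in> borel_measurable borel"
  unfolding exp_weight_def[abs_def] by measurable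

lemma exp_weight_integral:
  assumes "0 < \<alpha>" shows "(\<integral>\<^sup>+t. exp_weight \<alpha> t \<partial>lborel) = ennreal (1 / \<alpha>)"
proof -
  have "(\<integral>\<^sup>+t. ennreal (exp (- \<alpha> * t)) * indicator {0..} t \<partial>lborel) = ennreal (0 - (- exp (- \<alpha> * 0) / \<alpha>))"
  proof (rule nn_integral_FTC_atLeast)
    show "((\<lambda>t. - exp (- \<alpha> * t) / \<alpha>) has_real_derivative exp (- \<alpha> * t)) (at t)" for t
      using assms by (auto intro!: derivative_eq_intros)
    have "((\<lambda>t. exp (- (\<alpha> * t))) \<longlongrightarrow> 0) at_top"
      by (rule filterlim_compose[OF exp_at_bot])
         (rule filterlim_compose[OF filterlim_uminus_at_bot_at_top filterlim_tendsto_pos_mult_at_top[OF tendsto_const assms filterlim_ident]])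
    then have "((\<lambda>t. - exp (- (\<alpha> * t)) / \<alpha>) \<longlongrightarrow> - 0 / \<alpha>) at_top"
      using assms by (intro tendsto_divide tendsto_minus tendsto_const) auto
    then show "((\<lambda>t. - exp (- \<alpha> * t) / \<alpha>) \<longlongrightarrow> 0) at_top" by simp
  qed auto
  then show ?thesis by (simp add: exp_weight_def)
qed

text \<open>The convolution of \<open>exp (- \<alpha> t)\<close> and \<open>exp (- \<gamma> t)\<close> on the half-line is the difference of the two,
  divided by \<open>\<gamma> - \<alpha>\<close>. This is the resolvent equation for the translation semigroup.\<close>

lemma exp_weight_convolution:
  assumes "\<alpha> < \<gamma>"
  shows "ennreal (\<gamma> - \<alpha>) * (\<integral>\<^sup>+t. exp_weight \<alpha> t * exp_weight \<gamma> (u - t) \<partial>lborel) + exp_weight \<gamma> u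
    = exp_weight \<alpha> u"
proof (cases "0 \<le> u")
  case False
  then have "exp_weight \<alpha> t * exp_weight \<gamma> (u - t) = 0" for t
    by (auto simp: exp_weight_def indicator_def)
  then have "(\<integral>\<^sup>+t. exp_weight \<alpha> t * exp_weight \<gamma> (u - t) \<partial>lborel) = 0"
    by (simp only: nn_integral_const mult_zero_left)
  then show ?thesis using False by (simp only: mult_zero_right) (simp add: exp_weight_def)
next
  case True
  have d: "0 < \<gamma> - \<alpha>" using assms by simp
  have "(\<integral>\<^sup>+t. exp_weight \<alpha> t * exp_weight \<gamma> (u - t) \<partial>lborel)
     = (\<integral>\<^sup>+t. ennreal (exp (- \<gamma> * u) * exp ((\<gamma> - \<alpha>) * t)) * indicator {0..u} t \<partial>lborel)"
  proof (rule nn_integral_cong)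
    fix t
    have "exp (- \<alpha> * t) * exp (- \<gamma> * (u - t)) = exp (- \<gamma> * u) * exp ((\<gamma> - \<alpha>) * t)"
      by (simp add: exp_add[symmetric] algebra_simps)
    then show "exp_weight \<alpha> t * exp_weight \<gamma> (u - t) = ennreal (exp (- \<gamma> * u) * exp ((\<gamma> - \<alpha>) * t)) * indicator {0..u} t"
      by (auto simp: exp_weight_def indicator_def ennreal_mult'[symmetric])
  qed
  also have "\<dots> = ennreal (exp (- \<gamma> * u) * exp ((\<gamma> - \<alpha>) * u) / (\<gamma> - \<alpha>) - exp (- \<gamma> * u) * exp ((\<gamma> - \<alpha>) * 0) / (\<gamma> - \<alpha>))"
  proof (rule nn_integral_FTC_Icc)
    show "((\<lambda>t. exp (- \<gamma> * u) * exp ((\<gamma> - \<alpha>) * t) / (\<gamma> - \<alpha>)) has_real_derivative exp (- \<gamma> * u) * exp ((\<gamma> - \<alpha>) * t)) (at t)" for t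
      using d by (auto intro!: derivative_eq_intros)
  qed (use True in auto)
  also have "exp (- \<gamma> * u) * exp ((\<gamma> - \<alpha>) * u) = exp (- \<alpha> * u)"
    by (simp add: exp_add[symmetric] algebra_simps)
  finally have "(\<integral>\<^sup>+t. exp_weight \<alpha> t * exp_weight \<gamma> (u - t) \<partial>lborel)
     = ennreal ((exp (- \<alpha> * u) - exp (- \<gamma> * u)) / (\<gamma> - \<alpha>))" by (simp add: diff_divide_distrib)
  then have "ennreal (\<gamma> - \<alpha>) * (\<integral>\<^sup>+t. exp_weight \<alpha> t * exp_weight \<gamma> (u - t) \<partial>lborel) + exp_weight \<gamma> u
     = ennreal (\<gamma> - \<alpha>) * ennreal ((exp (- \<alpha> * u) - exp (- \<gamma> * u)) / (\<gamma> - \<alpha>)) + ennreal (exp (- \<gamma> * u))"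
    using True by (simp add: exp_weight_def)
  also have "\<dots> = ennreal (exp (- \<alpha> * u) - exp (- \<gamma> * u)) + ennreal (exp (- \<gamma> * u))"
    using d by (simp add: ennreal_mult'[symmetric])
  also have "\<dots> = ennreal (exp (- \<alpha> * u))"
  proof -
    have "\<alpha> * u \<le> \<gamma> * u" using True assms by (intro mult_right_mono) auto
    then show ?thesis by (subst ennreal_plus[symmetric]) auto
  qed
  finally show ?thesis using True by (simp add: exp_weight_def)
qed

lemma Laplace_resolvent_equation:
  assumes p: "p \<in> borel_measurable borel" and "\<alpha> < \<gamma>"
  shows "ennreal (\<gamma> - \<alpha>) * (\<integral>\<^sup>+t. exp_weight \<alpha> t * (\<integral>\<^sup>+s. exp_weight \<gamma> s * p (t + s) \<partial>lborel) \<partial>lborel)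
      + (\<integral>\<^sup>+u. exp_weight \<gamma> u * p u \<partial>lborel) = (\<integral>\<^sup>+u. exp_weight \<alpha> u * p u \<partial>lborel)"
proof -
  note [measurable] = p
  have "(\<integral>\<^sup>+t. exp_weight \<alpha> t * (\<integral>\<^sup>+s. exp_weight \<gamma> s * p (t + s) \<partial>lborel) \<partial>lborel)
    = (\<integral>\<^sup>+t. (\<integral>\<^sup>+u. exp_weight \<alpha> t * exp_weight \<gamma> (u - t) * p u \<partial>lborel) \<partial>lborel)"
  proof (rule nn_integral_cong)
    fix t
    have "(\<integral>\<^sup>+s. exp_weight \<gamma> s * p (t + s) \<partial>lborel) = (\<integral>\<^sup>+u. exp_weight \<gamma> (u - t) * p u \<partial>lborel)"
      using nn_integral_real_affine[of "\<lambda>s. exp_weight \<gamma> s * p (t + s)" 1 "- t"] by (simp add: algebra_simps)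
    then show "exp_weight \<alpha> t * (\<integral>\<^sup>+s. exp_weight \<gamma> s * p (t + s) \<partial>lborel)
      = (\<integral>\<^sup>+u. exp_weight \<alpha> t * exp_weight \<gamma> (u - t) * p u \<partial>lborel)"
      by (simp add: nn_integral_cmult[symmetric] mult.assoc)
  qed
  also have "\<dots> = (\<integral>\<^sup>+u. (\<integral>\<^sup>+t. exp_weight \<alpha> t * exp_weight \<gamma> (u - t) * p u \<partial>lborel) \<partial>lborel)"
    by (rule lborel_pair.Fubini') measurable
  also have "\<dots> = (\<integral>\<^sup>+u. (\<integral>\<^sup>+t. exp_weight \<alpha> t * exp_weight \<gamma> (u - t) \<partial>lborel) * p u \<partial>lborel)"
    by (intro nn_integral_cong nn_integral_multc) measurable
  finally have "ennreal (\<gamma> - \<alpha>) * (\<integral>\<^sup>+t. exp_weight \<alpha> t * (\<integral>\<^sup>+s. exp_weight \<gamma> s * p (t + s) \<partial>lborel) \<partial>lborel)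
      + (\<integral>\<^sup>+u. exp_weight \<gamma> u * p u \<partial>lborel)
    = (\<integral>\<^sup>+u. ennreal (\<gamma> - \<alpha>) * ((\<integral>\<^sup>+t. exp_weight \<alpha> t * exp_weight \<gamma> (u - t) \<partial>lborel) * p u) + exp_weight \<gamma> u * p u \<partial>lborel)"
    by (simp add: nn_integral_cmult nn_integral_add)
  also have "\<dots> = (\<integral>\<^sup>+u. (ennreal (\<gamma> - \<alpha>) * (\<integral>\<^sup>+t. exp_weight \<alpha> t * exp_weight \<gamma> (u - t) \<partial>lborel) + exp_weight \<gamma> u) * p u \<partial>lborel)"
    by (simp add: distrib_right mult.assoc)
  also have "\<dots> = (\<integral>\<^sup>+u. exp_weight \<alpha> u * p u \<partial>lborel)"
    by (simp only: exp_weight_convolution[OF assms(2)])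
  finally show ?thesis .
qed

context lc_hunt_process
begin

section \<open>Markov property and resolvent equation\<close>

lemma history_gen_sub:
  "{X s -` B \<inter> space M | s B. s \<le> t \<and> B \<in> sets borel_cem} \<subseteq> sets M"
  using measurable_sets[OF measurable_X] by auto

lemma sets_history:
  "sets (history M X t) = sigma_sets (space M) {X s -` B \<inter> space M | s B. s \<le> t \<and> B \<in> sets borel_cem}"
  unfolding history_def by (rule sets_measure_of) auto

lemma space_history [simp]: "space (history M X t) = space M"
  by (simp add: history_def space_measure_of_conv)

lemma subalgebra_history: "subalgebra (P z) (history M X t)"
  unfolding subalgebra_def
proof
  have "sigma_sets (space M) {X s -` B \<inter> space M | s B. s \<le> t \<and> B \<in> sets borel_cem} \<subseteq> sets M"
    by (rule sets.sigma_sets_subset[OF history_gen_sub])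
  then show "sets (history M X t) \<subseteq> sets (P z)" by (simp add: sets_history sets_P)
qed simp

lemma measurable_X_history: "s \<le> t \<Longrightarrow> X s \<in> history M X t \<rightarrow>\<^sub>M borel_cem"
  by (rule measurableI) (auto simp: sets_history intro!: sigma_sets.Basic)

text \<open>Singletons are measurable, so integration against a point mass is evaluation, even for functions
  of the starting point that are not known to be measurable.\<close>

lemma law_return: "law M P X (return borel_cem z) = restr_to_subalg (P z) (history M X \<infinity>)"
proof -
  have "Some -` {z} = (case z of None \<Rightarrow> {} | Some x \<Rightarrow> {x})" by (cases z) auto
  then have "{z} \<in> sets borel_cem" by (cases z) (auto simp: sets_borel_cem)
  then have "Measurable.pred borel_cem (\<lambda>y. y = z)" by (simp add: pred_def)
  then have AE: "AE y in return borel_cem z. y = z" by (subst AE_return) auto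
  have "(\<integral>\<^sup>+y. emeasure (P y) \<Lambda> \<partial>return borel_cem z) = emeasure (P z) \<Lambda>" for \<Lambda>
  proof -
    have "(\<integral>\<^sup>+y. emeasure (P y) \<Lambda> \<partial>return borel_cem z) = (\<integral>\<^sup>+y. emeasure (P z) \<Lambda> \<partial>return borel_cem z)"
      by (rule nn_integral_cong_AE) (use AE in eventually_elim, simp)
    also have "\<dots> = emeasure (P z) \<Lambda>"
      using prob_space.emeasure_space_1[OF prob_space_return, of z borel_cem] by simp
    finally show ?thesis .
  qed
  then show ?thesis by (simp add: law_def restr_to_subalg_def)
qed

lemma return_initial_law: "return borel_cem z \<in> initial_laws"
  unfolding initial_laws_def using prob_space_return[of z borel_cem] by simp

lemma filtration_completed: "filtration (space M) (completed_filtration M P X)"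
proof
  show "space (completed_filtration M P X t) = space M" for t
    by (simp add: completed_filtration_def space_measure_of_conv)
  fix s t :: ennreal assume "s \<le> t"
  have sub: "sets (history M X s) \<subseteq> sets (history M X t)"
    unfolding sets_history by (rule sigma_sets_mono') (use \<open>s \<le> t\<close> order_trans in blast)
  have "{\<Lambda>. \<Lambda> \<subseteq> space M \<and> (\<forall>\<nu>\<in>initial_laws. \<exists>\<Lambda>'\<in>sets (history M X s). \<exists>N\<in>null_sets (law M P X \<nu>). (\<Lambda> - \<Lambda>') \<union> (\<Lambda>' - \<Lambda>) \<subseteq> N)}
    \<subseteq> {\<Lambda>. \<Lambda> \<subseteq> space M \<and> (\<forall>\<nu>\<in>initial_laws. \<exists>\<Lambda>'\<in>sets (history M X t). \<exists>N\<in>null_sets (law M P X \<nu>). (\<Lambda> - \<Lambda>') \<union> (\<Lambda>' - \<Lambda>) \<subseteq> N)}"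
    using sub by (intro Collect_mono) blast
  then show "sets (completed_filtration M P X s) \<subseteq> sets (completed_filtration M P X t)"
    unfolding completed_filtration_def
    by (subst (1 2) sets_measure_of) (auto intro!: sigma_sets_mono')
qed

text \<open>The strong Markov property at a constant time, for the initial law concentrated at \<open>z\<close>.\<close>

lemma Markov:
  assumes B: "B \<in> sets borel_cem"
  shows "emeasure (P z) (X (s + t) -` B \<inter> space M) = (\<integral>\<^sup>+\<omega>. emeasure (P (X s \<omega>)) (X t -` B \<inter> space M) \<partial>P z)"
proof -
  let ?L = "law M P X (return borel_cem z)" and ?H = "history M X \<infinity>"
  have st: "stopping_time (completed_filtration M P X) (\<lambda>_. s)" by (simp add: stopping_time_def)
  have top: "space M \<in> sets (filtration.pre_sigma (space M) (completed_filtration M P X) (\<lambda>_. s))"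
    using sets.top[of "filtration.pre_sigma (space M) (completed_filtration M P X) (\<lambda>_. s)"]
    by (simp add: filtration.space_pre_sigma[OF filtration_completed])
  have sets_L: "sets ?L = sets ?H"
    unfolding law_return by (rule sets_restr_to_subalg[OF subalgebra_history])
  have eq: "{\<omega> \<in> space M. X (s + t) \<omega> \<in> B} = X (s + t) -` B \<inter> space M" by auto
  have inH: "X (s + t) -` B \<inter> space M \<in> sets ?H"
    using measurable_sets[OF measurable_X_history B, of "s + t" \<infinity>] by simp
  have "emeasure (P z) (X (s + t) -` B \<inter> space M) = emeasure ?L (X (s + t) -` B \<inter> space M)"
    unfolding law_return by (rule emeasure_restr_to_subalg[OF subalgebra_history inH, symmetric])
  also have "\<dots> = emeasure (completion ?L) {\<omega> \<in> space M. X (s + t) \<omega> \<in> B}"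
    using inH by (simp add: eq sets_L)
  also have "\<dots> = (\<integral>\<^sup>+\<omega>\<in>space M. emeasure (P (X s \<omega>)) (X t -` B \<inter> space M) \<partial>completion ?L)"
    by (rule strong_Markov[OF return_initial_law st top B])
  also have "\<dots> = (\<integral>\<^sup>+\<omega>\<in>space M. emeasure (P (X s \<omega>)) (X t -` B \<inter> space M) \<partial>?L)"
    by (rule nn_integral_completion)
  also have "\<dots> = (\<integral>\<^sup>+\<omega>\<in>space M. emeasure (P (X s \<omega>)) (X t -` B \<inter> space M) \<partial>P z)"
    unfolding law_return
  proof (rule nn_integral_subalgebra2[OF subalgebra_history])
    have "(\<lambda>\<omega>. emeasure (P (X s \<omega>)) (X t -` B \<inter> space M)) \<in> borel_measurable ?H"
      by (rule measurable_compose[OF measurable_X_history kernel[OF B]]) simp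
    then show "(\<lambda>\<omega>. emeasure (P (X s \<omega>)) (X t -` B \<inter> space M) * indicator (space M) \<omega>) \<in> borel_measurable ?H"
      using sets.top[of ?H] by (intro borel_measurable_times_ennreal) auto
  qed
  also have "\<dots> = (\<integral>\<^sup>+\<omega>. emeasure (P (X s \<omega>)) (X t -` B \<inter> space M) \<partial>P z)"
    by (rule nn_integral_cong) simp
  finally show ?thesis .
qed

lemma emeasure_P_eq_transition:
  assumes "B \<in> sets borel"
  shows "emeasure (P z) (X t -` (Some ` B) \<inter> space M) = ext_cem (transition P X t (indicator B)) z"
proof (cases z)
  case None
  have "emeasure (P None) {\<omega> \<in> space (P None). X t \<omega> \<in> Some ` B} = 0"
    by (rule emeasure_eq_0_AE) (use cemetery[of t] in eventually_elim, auto)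
  moreover have "{\<omega> \<in> space (P None). X t \<omega> \<in> Some ` B} = X t -` (Some ` B) \<inter> space M" by auto
  ultimately show ?thesis using None by simp
next
  case (Some x)
  then show ?thesis using transition_indicator[OF assms] by simp
qed

lemma Chapman_Kolmogorov:
  assumes h: "h \<in> borel_measurable borel"
  shows "transition P X (s + t) h x = transition P X s (transition P X t h) x"
  using h
proof (induction h rule: borel_measurable_induct)
  case (cong f g)
  then have "f = g" by (simp add: fun_eq_iff)
  then show ?case using cong by simp
next
  case (set B)
  then have B: "B \<in> sets borel" and B': "Some ` B \<in> sets borel_cem"
    by (auto simp: sets_borel_cem inj_vimage_image_eq)
  have "transition P X (s + t) (indicator B) x = emeasure (P (Some x)) (X (s + t) -` (Some ` B) \<inter> space M)"
    by (rule transition_indicator[OF B])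
  also have "\<dots> = (\<integral>\<^sup>+\<omega>. emeasure (P (X s \<omega>)) (X t -` (Some ` B) \<inter> space M) \<partial>P (Some x))"
    by (rule Markov[OF B'])
  also have "\<dots> = transition P X s (transition P X t (indicator B)) x"
    by (simp only: emeasure_P_eq_transition[OF B] transition_def[of P X s])
  finally show ?case .
next
  case (mult f c)
  have "transition P X t (\<lambda>x. c * f x) = (\<lambda>x. c * transition P X t f x)"
    by (rule ext, rule transition_mult) (use mult in auto)
  then show ?case using mult by (simp add: transition_mult measurable_transition_space)
next
  case (add f g)
  have "transition P X t (\<lambda>x. g x + f x) = (\<lambda>x. transition P X t g x + transition P X t f x)"
    by (rule ext, rule transition_add) (use add in auto)
  then show ?case using add by (simp add: transition_add measurable_transition_space)
next
  case (seq U)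
  have U: "\<And>i. U i \<in> borel_measurable borel" "incseq U" using seq by auto
  have eq: "transition P X t (SUP i. U i) = (\<lambda>x. SUP i. transition P X t (U i) x)"
    by (rule ext, rule transition_SUP_fun[OF U])
  have inc: "incseq (\<lambda>i. transition P X t (U i))"
    using U(2) by (intro incseq_SucI le_funI transition_mono) (auto simp: incseq_Suc_iff le_fun_def)
  have "transition P X (s + t) (SUP i. U i) x = (SUP i. transition P X (s + t) (U i) x)"
    by (rule transition_SUP_fun[OF U])
  also have "\<dots> = (SUP i. transition P X s (transition P X t (U i)) x)" by (simp only: seq.IH)
  also have "\<dots> = transition P X s (\<lambda>x. SUP i. transition P X t (U i) x) x"
    by (rule transition_SUP[symmetric, OF measurable_transition_space[OF U(1)] inc])
  finally show ?case by (simp only: eq)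
qed

lemma prob_P_sigma_finite: "sigma_finite_measure (P z)"
  using prob_space_imp_sigma_finite[OF prob_P] .

lemma pair_lborel_P: "pair_sigma_finite lborel (P z)"
  by (intro pair_sigma_finite.intro prob_P_sigma_finite) unfold_locales

lemma resolvent_eq:
  assumes h: "h \<in> borel_measurable borel"
  shows "resolvent P X \<alpha> h x = (\<integral>\<^sup>+t. exp_weight \<alpha> t * transition P X (ennreal t) h x \<partial>lborel)"
proof -
  interpret pair_sigma_finite lborel "P (Some x)" by (rule pair_lborel_P)
  have "(\<lambda>(t, \<omega>). ext_cem h (X (ennreal t) \<omega>)) \<in> borel_measurable (lborel \<Otimes>\<^sub>M P (Some x))"
    using measurable_path[OF h]
    by (subst measurable_cong_sets[OF sets_pair_measure_cong[OF sets_lborel sets_P] refl])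
  then have m: "(\<lambda>(t, \<omega>). exp_weight \<alpha> t * ext_cem h (X (ennreal t) \<omega>)) \<in> borel_measurable (lborel \<Otimes>\<^sub>M P (Some x))"
    using measurable_compose[OF measurable_fst, of "exp_weight \<alpha>" lborel borel "P (Some x)"]
    by (simp add: case_prod_beta')
  have "resolvent P X \<alpha> h x = (\<integral>\<^sup>+\<omega>. (\<integral>\<^sup>+t. exp_weight \<alpha> t * ext_cem h (X (ennreal t) \<omega>) \<partial>lborel) \<partial>P (Some x))"
    unfolding resolvent_def exp_weight_def by (simp add: mult_ac)
  also have "\<dots> = (\<integral>\<^sup>+t. (\<integral>\<^sup>+\<omega>. exp_weight \<alpha> t * ext_cem h (X (ennreal t) \<omega>) \<partial>P (Some x)) \<partial>lborel)"
    by (rule Fubini'[OF m])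
  also have "\<dots> = (\<integral>\<^sup>+t. exp_weight \<alpha> t * transition P X (ennreal t) h x \<partial>lborel)"
    unfolding transition_def by (intro nn_integral_cong nn_integral_cmult measurable_ext_X h)
  finally show ?thesis .
qed

lemma measurable_transition_time:
  "h \<in> borel_measurable borel \<Longrightarrow> (\<lambda>t. transition P X (ennreal t) h x) \<in> borel_measurable borel"
  by (rule measurable_compose[OF _ measurable_transition[of h], of "\<lambda>t. (t, x)", simplified]) simp_all

lemma measurable_resolvent:
  assumes h: "h \<in> borel_measurable borel" shows "resolvent P X \<alpha> h \<in> borel_measurable borel"
proof -
  have "(\<lambda>(x, t). transition P X (ennreal t) h x) \<in> borel_measurable (borel \<Otimes>\<^sub>M lborel)"
    using measurable_compose[OF measurable_Pair[OF measurable_snd measurable_fst] measurable_transition[OF h]]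
    by (simp add: case_prod_beta' measurable_cong_sets[OF sets_pair_measure_cong[OF refl sets_lborel] refl])
  then have "(\<lambda>(x, t). exp_weight \<alpha> t * transition P X (ennreal t) h x) \<in> borel_measurable (borel \<Otimes>\<^sub>M lborel)"
    by (simp add: case_prod_beta')
  then have "(\<lambda>x. \<integral>\<^sup>+t. exp_weight \<alpha> t * transition P X (ennreal t) h x \<partial>lborel) \<in> borel_measurable borel"
    by (rule lborel.borel_measurable_nn_integral)
  then show ?thesis using resolvent_eq[OF h] by (simp add: fun_eq_iff[symmetric] cong: measurable_cong)
qed

lemma resolvent_le:
  assumes "0 < \<alpha>" "h \<in> borel_measurable borel" "\<And>x. h x \<le> c"
  shows "ennreal \<alpha> * resolvent P X \<alpha> h x \<le> c"
proof -
  have "resolvent P X \<alpha> h x \<le> (\<integral>\<^sup>+t. exp_weight \<alpha> t * c \<partial>lborel)"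
    unfolding resolvent_eq[OF assms(2)] by (intro nn_integral_mono mult_left_mono transition_le assms) simp
  also have "\<dots> = ennreal (1 / \<alpha>) * c" by (simp add: nn_integral_multc exp_weight_integral[OF assms(1)])
  finally have "ennreal \<alpha> * resolvent P X \<alpha> h x \<le> ennreal \<alpha> * (ennreal (1 / \<alpha>) * c)" by (rule mult_left_mono) simp
  also have "\<dots> = c" using assms(1) by (simp add: mult.assoc[symmetric] ennreal_mult'[symmetric])
  finally show ?thesis .
qed

lemma resolvent_add:
  assumes "f \<in> borel_measurable borel" "g \<in> borel_measurable borel"
  shows "resolvent P X \<alpha> (\<lambda>x. f x + g x) x = resolvent P X \<alpha> f x + resolvent P X \<alpha> g x"
proof -
  have "resolvent P X \<alpha> (\<lambda>x. f x + g x) x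
      = (\<integral>\<^sup>+t. exp_weight \<alpha> t * transition P X (ennreal t) f x + exp_weight \<alpha> t * transition P X (ennreal t) g x \<partial>lborel)"
    using assms by (subst resolvent_eq) (simp_all add: transition_add distrib_left)
  also have "\<dots> = resolvent P X \<alpha> f x + resolvent P X \<alpha> g x"
    unfolding resolvent_eq[OF assms(1)] resolvent_eq[OF assms(2)]
    using measurable_transition_time[OF assms(1)] measurable_transition_time[OF assms(2)]
    by (intro nn_integral_add) auto
  finally show ?thesis .
qed

lemma resolvent_mult:
  assumes "f \<in> borel_measurable borel"
  shows "resolvent P X \<alpha> (\<lambda>x. c * f x) x = c * resolvent P X \<alpha> f x"
proof -
  have "resolvent P X \<alpha> (\<lambda>x. c * f x) x = (\<integral>\<^sup>+t. c * (exp_weight \<alpha> t * transition P X (ennreal t) f x) \<partial>lborel)"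
    using assms by (subst resolvent_eq) (simp_all add: transition_mult mult_ac)
  also have "\<dots> = c * resolvent P X \<alpha> f x"
    unfolding resolvent_eq[OF assms] using measurable_transition_time[OF assms] by (intro nn_integral_cmult) auto
  finally show ?thesis .
qed

lemma resolvent_SUP:
  assumes f: "\<And>i::nat. f i \<in> borel_measurable borel" "incseq f"
  shows "resolvent P X \<alpha> (\<lambda>x. SUP i. f i x) x = (SUP i. resolvent P X \<alpha> (f i) x)"
proof -
  have "resolvent P X \<alpha> (\<lambda>x. SUP i. f i x) x = (\<integral>\<^sup>+t. (SUP i. exp_weight \<alpha> t * transition P X (ennreal t) (f i) x) \<partial>lborel)"
    using f by (subst resolvent_eq) (simp_all add: transition_SUP SUP_mult_left_ennreal)
  also have "\<dots> = (SUP i. resolvent P X \<alpha> (f i) x)"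
    unfolding resolvent_eq[OF f(1)]
  proof (rule nn_integral_monotone_convergence_SUP)
    show "incseq (\<lambda>i t. exp_weight \<alpha> t * transition P X (ennreal t) (f i) x)"
      using f(2) by (intro incseq_SucI le_funI mult_left_mono transition_mono) (auto simp: incseq_Suc_iff le_fun_def)
  qed (use measurable_transition_time[OF f(1)] in auto)
  finally show ?thesis .
qed

lemma transition_resolvent:
  assumes h: "h \<in> borel_measurable borel" and t: "0 \<le> t"
  shows "transition P X (ennreal t) (resolvent P X \<gamma> h) x
    = (\<integral>\<^sup>+s. exp_weight \<gamma> s * transition P X (ennreal (t + s)) h x \<partial>lborel)"
proof -
  interpret pair_sigma_finite lborel "P (Some x)" by (rule pair_lborel_P)
  define Y where "Y = X (ennreal t)"
  have Y: "Y \<in> P (Some x) \<rightarrow>\<^sub>M borel_cem" unfolding Y_def by measurable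
  define d where "d z = (case z of None \<Rightarrow> x | Some y \<Rightarrow> y)" for z
  have d: "d \<in> borel_cem \<rightarrow>\<^sub>M borel" unfolding d_def[abs_def] by (rule measurable_the_cem)
  have i: "(\<lambda>z. indicator (range Some) z :: ennreal) \<in> borel_measurable borel_cem"
    by (intro borel_measurable_indicator) (simp add: sets_borel_cem inj_vimage_image_eq)
  have ext: "ext_cem g z = indicator (range Some) z * g (d z)" for g :: "'a \<Rightarrow> ennreal" and z
    by (cases z) (auto simp: d_def)
  have "(\<lambda>y. (fst y, d (Y (snd y)))) \<in> (lborel \<Otimes>\<^sub>M P (Some x)) \<rightarrow>\<^sub>M (borel \<Otimes>\<^sub>M borel)"
    by (intro measurable_Pair measurable_compose[OF measurable_snd measurable_compose[OF Y d]])
       (simp add: measurable_fst'')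
  from measurable_compose[OF this measurable_transition[OF h]]
  have m1: "(\<lambda>y. transition P X (ennreal (fst y)) h (d (Y (snd y)))) \<in> borel_measurable (lborel \<Otimes>\<^sub>M P (Some x))"
    by simp
  have m2: "(\<lambda>y. indicator (range Some) (Y (snd y)) :: ennreal) \<in> borel_measurable (lborel \<Otimes>\<^sub>M P (Some x))"
    by (rule measurable_compose[OF measurable_snd measurable_compose[OF Y i]])
  have m3: "(\<lambda>y. exp_weight \<gamma> (fst y)) \<in> borel_measurable (lborel \<Otimes>\<^sub>M P (Some x))"
    by (rule measurable_compose[OF measurable_fst]) simp
  have m: "(\<lambda>(s, \<omega>). exp_weight \<gamma> s * ext_cem (transition P X (ennreal s) h) (Y \<omega>)) \<in> borel_measurable (lborel \<Otimes>\<^sub>M P (Some x))"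
    unfolding ext case_prod_beta' by (intro borel_measurable_times_ennreal m1 m2 m3)
  have "transition P X (ennreal t) (resolvent P X \<gamma> h) x
      = (\<integral>\<^sup>+\<omega>. (\<integral>\<^sup>+s. exp_weight \<gamma> s * ext_cem (transition P X (ennreal s) h) (Y \<omega>) \<partial>lborel) \<partial>P (Some x))"
    unfolding transition_def[of P X "ennreal t"] Y_def[symmetric]
  proof (rule nn_integral_cong)
    fix \<omega>
    show "ext_cem (resolvent P X \<gamma> h) (Y \<omega>) = (\<integral>\<^sup>+s. exp_weight \<gamma> s * ext_cem (transition P X (ennreal s) h) (Y \<omega>) \<partial>lborel)"
      by (cases "Y \<omega>") (simp_all add: resolvent_eq[OF h])
  qed
  also have "\<dots> = (\<integral>\<^sup>+s. (\<integral>\<^sup>+\<omega>. exp_weight \<gamma> s * ext_cem (transition P X (ennreal s) h) (Y \<omega>) \<partial>P (Some x)) \<partial>lborel)"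
    by (rule Fubini'[OF m])
  also have "\<dots> = (\<integral>\<^sup>+s. exp_weight \<gamma> s * transition P X (ennreal (t + s)) h x \<partial>lborel)"
  proof (rule nn_integral_cong)
    fix s :: real
    have "(\<integral>\<^sup>+\<omega>. exp_weight \<gamma> s * ext_cem (transition P X (ennreal s) h) (Y \<omega>) \<partial>P (Some x))
        = exp_weight \<gamma> s * transition P X (ennreal t) (transition P X (ennreal s) h) x"
      unfolding Y_def transition_def[of P X "ennreal t"]
      by (intro nn_integral_cmult measurable_ext_X measurable_transition_space h)
    also have "\<dots> = exp_weight \<gamma> s * transition P X (ennreal (t + s)) h x"
    proof (cases "0 \<le> s")
      case True
      then show ?thesis using Chapman_Kolmogorov[OF h, of "ennreal t" "ennreal s" x] t by (simp add: ennreal_plus)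
    qed (simp add: exp_weight_def)
    finally show "(\<integral>\<^sup>+\<omega>. exp_weight \<gamma> s * ext_cem (transition P X (ennreal s) h) (Y \<omega>) \<partial>P (Some x))
      = exp_weight \<gamma> s * transition P X (ennreal (t + s)) h x" .
  qed
  finally show ?thesis .
qed

lemma resolvent_equation:
  assumes h: "h \<in> borel_measurable borel" and "\<alpha> < \<gamma>"
  shows "resolvent P X \<alpha> h x = resolvent P X \<gamma> h x + ennreal (\<gamma> - \<alpha>) * resolvent P X \<alpha> (resolvent P X \<gamma> h) x"
proof -
  let ?p = "\<lambda>u. transition P X (ennreal u) h x"
  have "resolvent P X \<alpha> (resolvent P X \<gamma> h) x
      = (\<integral>\<^sup>+t. exp_weight \<alpha> t * (\<integral>\<^sup>+s. exp_weight \<gamma> s * ?p (t + s) \<partial>lborel) \<partial>lborel)"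
    unfolding resolvent_eq[OF measurable_resolvent[OF h]]
  proof (rule nn_integral_cong)
    fix t
    show "exp_weight \<alpha> t * transition P X (ennreal t) (resolvent P X \<gamma> h) x
        = exp_weight \<alpha> t * (\<integral>\<^sup>+s. exp_weight \<gamma> s * ?p (t + s) \<partial>lborel)"
      using transition_resolvent[OF h, of t \<gamma> x] by (cases "0 \<le> t") (simp_all add: exp_weight_def)
  qed
  then show ?thesis
    using Laplace_resolvent_equation[OF measurable_transition_time[OF h] assms(2), of x]
    by (simp add: resolvent_eq[OF h] add.commute)
qed

text \<open>The substitution \<open>t = u / n\<close> turns \<open>n R\<^sub>n \<phi>(x)\<close> into the integral of \<open>exp (- u) P\<^sub>u\<^sub>/\<^sub>n \<phi>(x)\<close> over the
  half-line. The integrand tends to \<open>exp (- u) \<phi>(x)\<close> by right continuity at time 0, and Fatou's lemma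
  applies. The bound holds at every \<open>x\<close>, which matters for measures that are singular to \<open>m\<close>.\<close>

lemma resolvent_liminf:
  assumes \<phi>: "\<phi> \<in> Cc" "\<And>x. 0 \<le> \<phi> x"
  shows "ennreal (\<phi> x) \<le> liminf (\<lambda>n. ennreal (real (Suc n)) * resolvent P X (real (Suc n)) (\<lambda>x. ennreal (\<phi> x)) x)"
proof -
  let ?h = "\<lambda>x. ennreal (\<phi> x)"
  let ?p = "\<lambda>u. transition P X (ennreal u) ?h x"
  have h: "?h \<in> borel_measurable borel" using Cc_borel[OF \<phi>(1)] by measurable
  have p: "?p \<in> borel_measurable borel" by (rule measurable_transition_time[OF h])
  have pm: "(\<lambda>u. exp_weight 1 u * ?p (u / real (Suc n))) \<in> borel_measurable borel" for n
    by (intro borel_measurable_times_ennreal measurable_exp_weight measurable_compose[OF _ p]) simp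
  have eq: "ennreal (real (Suc n)) * resolvent P X (real (Suc n)) ?h x
      = (\<integral>\<^sup>+u. exp_weight 1 u * ?p (u / real (Suc n)) \<partial>lborel)" for n
  proof -
    let ?N = "real (Suc n)"
    have "(\<integral>\<^sup>+u. exp_weight 1 u * ?p (u / ?N) \<partial>lborel)
        = ennreal \<bar>?N\<bar> * (\<integral>\<^sup>+t. exp_weight 1 (0 + ?N * t) * ?p ((0 + ?N * t) / ?N) \<partial>lborel)"
      by (rule nn_integral_real_affine[OF pm]) simp
    also have "\<bar>?N\<bar> = ?N" by simp
    also have "(\<lambda>t. exp_weight 1 (0 + ?N * t) * ?p ((0 + ?N * t) / ?N)) = (\<lambda>t. exp_weight ?N t * ?p t)"
    proof
      fix t
      have "exp_weight 1 (0 + c * t) * ?p ((0 + c * t) / c) = exp_weight c t * ?p t" if "0 < c" for c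
        using that by (simp add: exp_weight_def indicator_def zero_le_mult_iff)
      from this[of ?N] show "exp_weight 1 (0 + ?N * t) * ?p ((0 + ?N * t) / ?N) = exp_weight ?N t * ?p t"
        by simp
    qed
    finally show ?thesis by (simp only: resolvent_eq[OF h])
  qed
  have p0: "?p 0 = ennreal (\<phi> x)"
  proof -
    have "?p 0 = (\<integral>\<^sup>+\<omega>. ennreal (\<phi> x) \<partial>P (Some x))"
      unfolding transition_def by (rule nn_integral_cong_AE) (use normal[of "Some x"] in eventually_elim, simp)
    then show ?thesis by (simp add: emeasure_P)
  qed
  have lim: "(\<lambda>n. ?p (u / real (Suc n))) \<longlonglongrightarrow> ennreal (\<phi> x)" if u: "0 < u" for u
  proof -
    have "filterlim (\<lambda>n. ennreal (u / real (Suc n))) (at_right (ennreal 0)) sequentially"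
    proof (rule tendsto_imp_filterlim_at_right)
      show "(\<lambda>n. ennreal (u / real (Suc n))) \<longlonglongrightarrow> ennreal 0"
        by (rule tendsto_ennrealI[OF LIMSEQ_Suc[OF lim_const_over_n]])
      show "\<forall>\<^sub>F n in sequentially. ennreal 0 < ennreal (u / real (Suc n))"
        using u by (intro always_eventually allI ennreal_lessI) auto
    qed
    from transition_right_limit[OF \<phi> this, of x] show ?thesis using p0 by simp
  qed
  have "ennreal (\<phi> x) = (\<integral>\<^sup>+u. exp_weight 1 u * ennreal (\<phi> x) \<partial>lborel)"
    by (simp add: nn_integral_multc exp_weight_integral)
  also have "\<dots> = (\<integral>\<^sup>+u. liminf (\<lambda>n. exp_weight 1 u * ?p (u / real (Suc n))) \<partial>lborel)"
  proof (rule nn_integral_cong_AE)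
    have "AE u in lborel. u \<noteq> (0::real)" by (rule AE_lborel_singleton)
    then show "AE u in lborel. exp_weight 1 u * ennreal (\<phi> x) = liminf (\<lambda>n. exp_weight 1 u * ?p (u / real (Suc n)))"
    proof eventually_elim
      case (elim u)
      show ?case
      proof (cases "0 < u")
        case True
        have "(\<lambda>n. exp_weight 1 u * ?p (u / real (Suc n))) \<longlonglongrightarrow> exp_weight 1 u * ennreal (\<phi> x)"
          by (intro ennreal_tendsto_cmult lim True) (simp add: exp_weight_def ennreal_mult_less_top indicator_def)
        then show ?thesis by (intro lim_imp_Liminf[symmetric]) auto
      next
        case False
        then show ?thesis using elim by (simp add: exp_weight_def Liminf_const)
      qed
    qed
  qed
  also have "\<dots> \<le> liminf (\<lambda>n. \<integral>\<^sup>+u. exp_weight 1 u * ?p (u / real (Suc n)) \<partial>lborel)"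
    using pm by (intro nn_integral_liminf) simp
  finally show ?thesis by (simp only: eq)
qed

end

section \<open>Additive functionals\<close>

lemma emeasure_interval_measure_UNIV_le:
  fixes G :: "real \<Rightarrow> real"
  assumes mono: "\<And>x y. x \<le> y \<Longrightarrow> G x \<le> G y" and cont: "continuous_on UNIV G"
    and zero: "\<And>x. x \<le> 0 \<Longrightarrow> G x = 0" and le: "\<And>x. G x \<le> b"
  shows "emeasure (interval_measure G) UNIV \<le> ennreal b" "AE s in interval_measure G. 0 \<le> s"
proof -
  have rc: "continuous (at_right a) G" for a
    using cont by (simp add: continuous_on_eq_continuous_within continuous_at_imp_continuous_at_within)
  have Ioc: "emeasure (interval_measure G) {x<..y} = ennreal (G y - G x)" if "x \<le> y" for x y
    using emeasure_interval_measure_Ioc[OF that mono rc] by simp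
  have "emeasure (interval_measure G) (\<Union>n. {- real n<..real n}) = (SUP n. emeasure (interval_measure G) {- real n<..real n})"
    by (rule SUP_emeasure_incseq[symmetric]) (auto simp: incseq_def)
  also have "\<dots> \<le> ennreal b"
  proof (rule SUP_least)
    fix n
    have "emeasure (interval_measure G) {- real n<..real n} = ennreal (G (real n) - G (- real n))" by (rule Ioc) simp
    also have "\<dots> \<le> ennreal b" using zero[of "- real n"] le[of "real n"] by (intro ennreal_leI) simp
    finally show "emeasure (interval_measure G) {- real n<..real n} \<le> ennreal b" .
  qed
  also have "(\<Union>n. {- real n<..real n}) = UNIV"
  proof (intro equalityI subsetI UNIV_I)
    fix x :: real
    obtain n where "\<bar>x\<bar> < real n" using reals_Archimedean2 by blast
    then show "x \<in> (\<Union>n. {- real n<..real n})" by (intro UN_I[of n]) auto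
  qed
  finally show "emeasure (interval_measure G) UNIV \<le> ennreal b" .
  have "emeasure (interval_measure G) (\<Union>n. {- real n<..0}) = 0"
  proof (rule emeasure_UN_eq_0)
    show "emeasure (interval_measure G) {- real n<..0} = 0" for n :: nat
      using Ioc[of "- real n" 0] zero by simp
  qed auto
  then have "(\<Union>n. {- real n<..0}) \<in> null_sets (interval_measure G)" by (intro null_setsI) auto
  then show "AE s in interval_measure G. 0 \<le> s"
  proof (rule AE_I')
    show "{x \<in> space (interval_measure G). \<not> 0 \<le> x} \<subseteq> (\<Union>n. {- real n<..0})"
    proof
      fix x assume "x \<in> {x \<in> space (interval_measure G). \<not> 0 \<le> x}"
      then have "x < 0" by simp
      moreover obtain n where "- x < real n" using reals_Archimedean2 by blast
      ultimately show "x \<in> (\<Union>n. {- real n<..0})" by (intro UN_I[of n]) auto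
    qed
  qed
qed

text \<open>Additivity makes the path of \<open>A\<close> increasing on \<open>[0,\<infinity>)\<close>, and continuity extends this to \<open>\<infinity>\<close>. The
  Stieltjes measure of the path stopped at \<open>T\<close> lives on \<open>[0,\<infinity>)\<close> and has total mass \<open>A T \<omega>\<close>.\<close>

lemma pcaf_integral_le_total:
  fixes A :: "ennreal \<Rightarrow> 'w \<Rightarrow> ennreal"
  assumes zero: "A 0 \<omega> = 0" and cont: "continuous_on UNIV (\<lambda>t. A t \<omega>)"
    and fin: "\<And>t. t < lifetime X \<omega> \<Longrightarrow> A t \<omega> < \<infinity>"
    and add: "\<And>s t. s < \<infinity> \<Longrightarrow> t < \<infinity> \<Longrightarrow> A (t + s) \<omega> = A s \<omega> + A t (\<theta> s \<omega>)"
    and g: "\<And>s. 0 \<le> s \<Longrightarrow> g s \<le> 1"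
  shows "pcaf_integral X A g \<omega> \<le> A (lifetime X \<omega>) \<omega>"
proof -
  have mono1: "A s \<omega> \<le> A t \<omega>" if "s \<le> t" "t < \<infinity>" for s t
  proof -
    have "s < \<infinity>" "t - s < \<infinity>"
      using le_less_trans[OF that] le_less_trans[OF diff_le_self_ennreal that(2)] by auto
    then have "A ((t - s) + s) \<omega> = A s \<omega> + A (t - s) (\<theta> s \<omega>)" by (rule add)
    moreover have "(t - s) + s = t" using that(1) by (rule diff_add_cancel_ennreal)
    ultimately show ?thesis by simp
  qed
  have mono: "A s \<omega> \<le> A t \<omega>" if st: "s \<le> t" for s t
  proof (cases "t < \<infinity> \<or> s = t")
    case True
    then show ?thesis using mono1[OF st] by auto
  next
    case False
    then have t: "t = \<infinity>" by (metis infinity_ennreal_def top.not_eq_extremum)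
    have s: "s < \<infinity>" using st False t by (metis order.not_eq_order_implies_strict)
    have "isCont (\<lambda>t. A t \<omega>) \<infinity>" using cont by (simp add: continuous_on_eq_continuous_at)
    then have "(\<lambda>n. A (of_nat n) \<omega>) \<longlonglongrightarrow> A \<infinity> \<omega>"
      using isCont_tendsto_compose[OF _ of_nat_tendsto_top_ennreal, of "\<lambda>t. A t \<omega>"] by simp
    moreover obtain N where N: "s \<le> of_nat N"
    proof -
      obtain r where r: "s = ennreal r" "0 \<le> r" using s by (cases s) auto
      obtain N where "r < real N" using reals_Archimedean2 by blast
      then have "s \<le> of_nat N" unfolding r ennreal_of_nat_eq_real_of_nat by (intro ennreal_leI) simp
      then show ?thesis by (rule that)
    qed
    have "A s \<omega> \<le> A (of_nat n) \<omega>" if "n \<ge> N" for n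
    proof (rule mono1)
      show "s \<le> of_nat n" using N that by (meson of_nat_mono order_trans)
    qed (simp add: of_nat_less_top)
    ultimately show ?thesis unfolding t by (intro LIMSEQ_le_const[of _ _ "A s \<omega>"]) auto
  qed
  show ?thesis unfolding pcaf_integral_def
  proof (rule SUP_least)
    fix T assume "T \<in> {T. 0 \<le> T \<and> ennreal T < lifetime X \<omega>}"
    then have T: "0 \<le> T" "ennreal T < lifetime X \<omega>" by auto
    define a where "a s = ennreal (min (max 0 s) T)" for s
    have a_le: "a s \<le> ennreal T" for s unfolding a_def using T by (intro ennreal_leI) auto
    have Afin: "A (a s) \<omega> < \<infinity>" for s by (rule fin[OF le_less_trans[OF a_le T(2)]])
    define G where "G s = enn2real (A (a s) \<omega>)" for s
    have G_eq: "(\<lambda>s. if s \<le> 0 then 0 else enn2real (A (ennreal (min s T)) \<omega>)) = G"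
      using T(1) by (auto simp: G_def a_def fun_eq_iff zero max_def min_def)
    have AG: "A (a s) \<omega> = ennreal (G s)" for s unfolding G_def using Afin by simp
    have G_mono: "G x \<le> G y" if "x \<le> y" for x y
      unfolding G_def using that T(1) Afin
      by (intro enn2real_mono mono) (auto simp: a_def intro!: ennreal_leI)
    have G_cont: "continuous_on UNIV G"
      unfolding continuous_on_def
    proof
      fix s
      have ac: "(a \<longlongrightarrow> a s) (at s)" unfolding a_def by (intro tendsto_intros)
      have "((\<lambda>s. A (a s) \<omega>) \<longlongrightarrow> A (a s) \<omega>) (at s)"
        by (rule isCont_tendsto_compose[OF _ ac]) (use cont in \<open>simp add: continuous_on_eq_continuous_at\<close>)
      then have "((\<lambda>s. enn2real (A (a s) \<omega>)) \<longlongrightarrow> G s) (at s)"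
        unfolding AG[of s] by (rule tendsto_enn2real) (simp add: G_def)
      then show "(G \<longlongrightarrow> G s) (at s within UNIV)" by (simp add: G_def[abs_def])
    qed
    have G_zero: "G s = 0" if "s \<le> 0" for s using that T(1) zero by (simp add: G_def a_def)
    have G_le: "G s \<le> enn2real (A (ennreal T) \<omega>)" for s
      unfolding G_def using fin[OF T(2)] by (intro enn2real_mono mono a_le) auto
    have I1: "emeasure (interval_measure G) UNIV \<le> ennreal (enn2real (A (ennreal T) \<omega>))"
      by (rule emeasure_interval_measure_UNIV_le(1)[OF _ G_cont]) (auto intro: G_mono G_zero G_le)
    have I2: "AE s in interval_measure G. 0 \<le> s"
      by (rule emeasure_interval_measure_UNIV_le(2)[OF _ G_cont _ G_le]) (auto intro: G_mono G_zero)
    have "(\<integral>\<^sup>+s. g s \<partial>interval_measure G) \<le> (\<integral>\<^sup>+s. 1 \<partial>interval_measure G)"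
      by (rule nn_integral_mono_AE) (use I2 in eventually_elim, use g in simp)
    also have "\<dots> \<le> ennreal (enn2real (A (ennreal T) \<omega>))" using I1 by simp
    also have "\<dots> = A (ennreal T) \<omega>" using fin[OF T(2)] by simp
    also have "\<dots> \<le> A (lifetime X \<omega>) \<omega>" using T(2) by (intro mono) simp
    finally show "(\<integral>\<^sup>+s. g s \<partial>interval_measure (\<lambda>s. if s \<le> 0 then 0 else enn2real (A (ennreal (min s T)) \<omega>)))
      \<le> A (lifetime X \<omega>) \<omega>" unfolding G_eq .
  qed
qed

section \<open>The energy of the potential\<close>

context dirichlet_form
begin

lemma Cap_zero_AE:
  assumes sets: "sets m = sets borel" and N: "Cap m \<F> \<E> N = 0"
  shows "AE x in m. x \<notin> N"
proof -
  have "\<exists>U. open U \<and> N \<subseteq> U \<and> emeasure m U \<le> ennreal (1 / real (Suc n))" for n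
  proof -
    have "Cap m \<F> \<E> N < ennreal (1 / real (Suc n))" using N by simp
    from Cap_lessE[OF this] obtain U u where U: "open U" "N \<subseteq> U" "u \<in> \<F>" "AE x in m. x \<in> U \<longrightarrow> 1 \<le> u x"
      "\<And>x. 0 \<le> u x" "energy1 u < 1 / real (Suc n)" by blast
    have "U \<in> sets m" using U(1) sets by simp
    then have "emeasure m U = (\<integral>\<^sup>+x. indicator U x \<partial>m)" by simp
    also have "\<dots> \<le> (\<integral>\<^sup>+x. ennreal ((u x)\<^sup>2) \<partial>m)"
    proof (rule nn_integral_mono_AE)
      show "AE x in m. indicator U x \<le> ennreal ((u x)\<^sup>2)" using U(4)
      proof eventually_elim
        case (elim x)
        then show ?case by (auto simp: indicator_def one_le_power)
      qed
    qed
    also have "\<dots> = ennreal (\<integral>x. (u x)\<^sup>2 \<partial>m)"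
      using L2_dom[OF U(3)] by (intro nn_integral_eq_integral) (auto simp: L2_def)
    also have "\<dots> \<le> ennreal (1 / real (Suc n))"
      using norm2_le_form1[OF U(3)] U(6) by (intro ennreal_leI) linarith
    finally show ?thesis using U by blast
  qed
  then obtain U where U: "\<And>n. open (U n)" "\<And>n. N \<subseteq> U n" "\<And>n. emeasure m (U n) \<le> ennreal (1 / real (Suc n))"
    by metis
  have "emeasure m (\<Inter>n. U n) \<le> 0"
  proof (rule LIMSEQ_le_const)
    show "(\<lambda>n. ennreal (1 / real (Suc n))) \<longlonglongrightarrow> 0"
      using tendsto_ennrealI[OF LIMSEQ_Suc[OF lim_const_over_n[of 1]]] by simp
    have "emeasure m (\<Inter>n. U n) \<le> ennreal (1 / real (Suc n))" for n
    proof -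
      have "emeasure m (\<Inter>n. U n) \<le> emeasure m (U n)" using U(1)[of n] sets by (intro emeasure_mono) auto
      then show ?thesis using U(3)[of n] by (rule order_trans)
    qed
    then show "\<exists>N. \<forall>n\<ge>N. emeasure m (\<Inter>n. U n) \<le> ennreal (1 / real (Suc n))" by blast
  qed
  moreover have "(\<Inter>n. U n) \<in> sets m" unfolding sets using U(1) by (intro sets.countable_INT) auto
  ultimately have "(\<Inter>n. U n) \<in> null_sets m" by auto
  then show ?thesis by (rule AE_I') (use U(2) in blast)
qed

text \<open>With the negative part \<open>u\<^sup>-\<close> as test function one gets
  \<open>\<alpha> \<integral>(u\<^sup>-)\<^sup>2 dm \<le> \<E>(u\<^sup>+, u\<^sup>-) - \<E>(u\<^sup>-, u\<^sup>-) \<le> 0\<close>. The identity of \<open>ennreal (u x)\<close> with the resolvent of a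
  process would leave negative values of \<open>u\<close> possible.\<close>

lemma resolvent_nonneg:
  assumes \<alpha>: "0 < \<alpha>" and f: "f \<in> L2 m" "\<And>x. 0 \<le> f x"
    and u: "u \<in> \<F>" "\<And>g. g \<in> \<F> \<Longrightarrow> form_alpha m \<E> \<alpha> u g = (\<integral>x. f x * g x \<partial>m)"
  shows "AE x in m. 0 \<le> u x"
proof -
  define p n where "p = (\<lambda>x. max 0 (u x))" and "n = (\<lambda>x. max 0 (- u x))"
  have p: "p \<in> \<F>" unfolding p_def by (rule pos_part_mem[OF u(1)])
  have n: "n \<in> \<F>" unfolding n_def by (rule neg_part_mem[OF u(1)])
  have eq: "u = (\<lambda>x. p x - n x)" by (auto simp: p_def n_def max_def)
  have "0 \<le> (\<integral>x. f x * n x \<partial>m)" using f(2) by (intro integral_nonneg_AE) (auto simp: n_def)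
  also have "\<dots> = \<E> u n + \<alpha> * (\<integral>x. u x * n x \<partial>m)" using u(2)[OF n] by (simp add: form_alpha_def)
  also have "\<E> u n = \<E> p n - energy n" by (subst eq) (rule form.diff_left[OF p n n])
  also have "(\<integral>x. u x * n x \<partial>m) = - (\<integral>x. (n x)\<^sup>2 \<partial>m)"
  proof -
    have "u x * n x = - ((n x)\<^sup>2)" for x by (auto simp: n_def max_def power2_eq_square)
    then show ?thesis by simp
  qed
  finally have "\<alpha> * (\<integral>x. (n x)\<^sup>2 \<partial>m) \<le> \<E> p n - energy n" by simp
  also have "\<dots> \<le> 0" using form_pos_neg_le[OF u(1)] form_nonneg[OF n] by (simp add: p_def n_def)
  finally have "(\<integral>x. (n x)\<^sup>2 \<partial>m) \<le> 0" using \<alpha> by (simp add: mult_le_0_iff)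
  then have "(\<integral>x. (n x)\<^sup>2 \<partial>m) = 0" by (intro antisym) auto
  from L2_zero_AE[OF L2_dom[OF n] this] show ?thesis
    by eventually_elim (simp add: n_def max_def split: if_splits)
qed

end

locale dirichlet_process = regular_dirichlet_form m \<F> \<E> + lc_hunt_process M P X \<theta>
  for m :: "'a::{metric_space, second_countable_topology} measure" and \<F> \<E>
    and M :: "'w measure" and P X \<theta> +
  assumes radon: "radon_measure m" and transient: "transient_form m \<F> \<E>"
    and associated: "associated_process m \<F> \<E> P X"
begin

lemma process_resolvent:
  assumes \<alpha>: "0 < \<alpha>" and f: "f \<in> L2 m" "\<And>x. 0 \<le> f x"
  obtains u where "u \<in> \<F>" "\<And>g. g \<in> \<F> \<Longrightarrow> form_alpha m \<E> \<alpha> u g = (\<integral>x. f x * g x \<partial>m)"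
    "AE x in m. resolvent P X \<alpha> (\<lambda>y. ennreal (f y)) x = ennreal (u x)" "AE x in m. 0 \<le> u x"
proof -
  obtain u where u: "u \<in> \<F>" "\<And>g. g \<in> \<F> \<Longrightarrow> form_alpha m \<E> \<alpha> u g = (\<integral>x. f x * g x \<partial>m)"
    "AE x in m. resolvent P X \<alpha> (\<lambda>y. ennreal (f y)) x = ennreal (u x)"
    using associated \<alpha> f unfolding associated_process_def by blast
  show ?thesis by (rule that[OF u resolvent_nonneg[OF \<alpha> f u(1,2)]])
qed

sublocale transient_dirichlet_form m \<F> \<E>
proof
  show "locally compact (UNIV :: 'a set)" by (rule loc_compact)
  show "radon_measure m" by (rule radon)
  show "transient_form m \<F> \<E>" by (rule transient)
  fix \<alpha> c :: real and f :: "'a \<Rightarrow> real" assume \<alpha>: "0 < \<alpha>" and f: "f \<in> L2 m" "\<And>x. 0 \<le> f x" "\<And>x. f x \<le> c"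
  obtain u where u: "u \<in> \<F>" "\<And>g. g \<in> \<F> \<Longrightarrow> form_alpha m \<E> \<alpha> u g = (\<integral>x. f x * g x \<partial>m)"
    "AE x in m. resolvent P X \<alpha> (\<lambda>y. ennreal (f y)) x = ennreal (u x)" "AE x in m. 0 \<le> u x"
    using process_resolvent[OF \<alpha> f(1,2)] by blast
  have "(borel_measurable m :: ('a \<Rightarrow> real) set) = borel_measurable borel"
    by (rule measurable_cong_sets) (use radon in \<open>simp_all add: radon_measure_def\<close>)
  then have "f \<in> borel_measurable borel" using L2_measurable[OF f(1)] by simp
  then have b: "(\<lambda>y. ennreal (f y)) \<in> borel_measurable borel" by measurable
  have c0: "0 \<le> c" using f(2)[of undefined] f(3)[of undefined] by linarith
  have "AE x in m. 0 \<le> u x \<and> \<alpha> * u x \<le> c" using u(3,4)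
  proof eventually_elim
    case (elim x)
    have "ennreal \<alpha> * ennreal (u x) \<le> ennreal c"
      using resolvent_le[OF \<alpha> b, of "ennreal c" x] elim f(3) by (simp add: ennreal_leI)
    then have "ennreal (\<alpha> * u x) \<le> ennreal c" using \<alpha> by (simp add: ennreal_mult')
    then show ?case using elim c0 by (simp add: ennreal_le_iff)
  qed
  then show "\<exists>u\<in>\<F>. (\<forall>g\<in>\<F>. form_alpha m \<E> \<alpha> u g = (\<integral>x. f x * g x \<partial>m)) \<and> (AE x in m. 0 \<le> u x \<and> \<alpha> * u x \<le> c)"
    using u by blast
qed

lemma sigma_finite_m: "sigma_finite_measure m"
proof
  obtain K :: "nat \<Rightarrow> 'a set" where K: "\<And>i. compact (K i)" "(\<Union>i. K i) = UNIV"
    using compact_cover by metis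
  show "\<exists>A. countable A \<and> A \<subseteq> sets m \<and> \<Union>A = space m \<and> (\<forall>a\<in>A. emeasure m a \<noteq> \<infinity>)"
    using K compact_finite by (intro exI[of _ "range K"]) (auto simp: borel_compact less_top[symmetric])
qed

lemma resolvent_incseq:
  assumes "\<And>i::nat. f i \<in> borel_measurable borel" "incseq f"
  shows "incseq (\<lambda>i. resolvent P X \<alpha> (f i))"
proof (intro incseq_SucI le_funI)
  fix i x
  show "resolvent P X \<alpha> (f i) x \<le> resolvent P X \<alpha> (f (Suc i)) x"
    unfolding resolvent_eq[OF assms(1)] using assms(2)
    by (intro nn_integral_mono mult_left_mono transition_mono) (auto simp: incseq_Suc_iff le_fun_def)
qed

text \<open>In the application \<open>\<nu>\<close> is the restriction of \<open>\<mu>\<close> to a compact set, and \<open>bound\<close> comes from the Revuz formula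
  and from \<open>R\<mu> \<le> c\<close>.\<close>

context
  fixes \<nu> :: "'a measure" and c :: real
  assumes sets_\<nu>: "sets \<nu> = sets borel" and fin_\<nu>: "emeasure \<nu> UNIV < \<infinity>" and c: "0 \<le> c"
    and bound: "\<And>\<alpha> h. \<lbrakk>0 < \<alpha>; h \<in> borel_measurable borel\<rbrakk> \<Longrightarrow>
      (\<integral>\<^sup>+x. resolvent P X \<alpha> h x \<partial>\<nu>) \<le> ennreal c * (\<integral>\<^sup>+x. h x \<partial>m)"
begin

lemma borel_nu: "borel_measurable \<nu> = borel_measurable borel"
  by (rule measurable_cong_sets) (simp_all add: sets_\<nu>)

lemma space_nu [simp]: "space \<nu> = UNIV"
  using sets_eq_imp_space_eq[OF sets_\<nu>] by simp

text \<open>By \<open>bound\<close> the measure \<open>\<nu> R\<^sub>\<alpha>\<close> is at most \<open>c m\<close>, so that it has a density \<open>v \<le> c\<close> with respect to \<open>m\<close>.\<close>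

lemma resolvent_density:
  assumes \<alpha>: "0 < \<alpha>"
  obtains v where "v \<in> borel_measurable borel" "\<And>x. 0 \<le> v x" "\<And>x. v x \<le> c"
    "\<And>h. h \<in> borel_measurable borel \<Longrightarrow> (\<integral>\<^sup>+x. resolvent P X \<alpha> h x \<partial>\<nu>) = (\<integral>\<^sup>+x. ennreal (v x) * h x \<partial>m)"
proof -
  interpret m: sigma_finite_measure m by (rule sigma_finite_m)
  define \<Phi> where "\<Phi> h = (\<integral>\<^sup>+x. resolvent P X \<alpha> h x \<partial>\<nu>)" for h
  have rb: "resolvent P X \<alpha> h \<in> borel_measurable \<nu>" if "h \<in> borel_measurable borel" for h
    unfolding borel_nu by (rule measurable_resolvent[OF that])
  have add: "\<Phi> (\<lambda>x. f x + g x) = \<Phi> f + \<Phi> g"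
    if "f \<in> borel_measurable borel" "g \<in> borel_measurable borel" for f g
    unfolding \<Phi>_def resolvent_add[OF that] by (intro nn_integral_add rb that)
  have mult: "\<Phi> (\<lambda>x. k * f x) = k * \<Phi> f" if "f \<in> borel_measurable borel" for f k
    unfolding \<Phi>_def resolvent_mult[OF that] by (intro nn_integral_cmult rb that)
  have SUP: "\<Phi> (\<lambda>x. SUP i. f i x) = (SUP i. \<Phi> (f i))"
    if "\<And>i::nat. f i \<in> borel_measurable borel" "incseq f" for f
    unfolding \<Phi>_def resolvent_SUP[OF that]
    by (rule nn_integral_monotone_convergence_SUP[OF resolvent_incseq[OF that] rb[OF that(1)]])
  have zero: "\<Phi> (\<lambda>_. 0) = 0" using mult[of "\<lambda>_. 0" 0] by simp
  \<comment> \<open>the measure \<open>\<nu> R\<^sub>\<alpha>\<close>\<close>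
  define \<kappa> where "\<kappa> = measure_of UNIV (sets (borel :: 'a measure)) (\<lambda>B. \<Phi> (indicator B))"
  have sets_\<kappa>: "sets \<kappa> = sets borel"
    unfolding \<kappa>_def using sets.sigma_sets_eq[of "borel :: 'a measure"] by (simp add: sets_measure_of_conv)
  have em: "emeasure \<kappa> B = \<Phi> (indicator B)" if B: "B \<in> sets borel" for B
  proof (rule emeasure_measure_of[OF \<kappa>_def])
    have "indicator {} = (\<lambda>_ :: 'a. 0 :: ennreal)" by auto
    then show "positive (sets \<kappa>) (\<lambda>B. \<Phi> (indicator B))" by (simp add: positive_def zero)
    show "countably_additive (sets \<kappa>) (\<lambda>B. \<Phi> (indicator B))"
    proof (rule countably_additiveI)
      fix A :: "nat \<Rightarrow> 'a set" assume A: "range A \<subseteq> sets \<kappa>" "disjoint_family A"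
      then have Ab: "A i \<in> sets borel" for i by (auto simp: sets_\<kappa>)
      have fin: "\<Phi> (\<lambda>x. \<Sum>i<n. indicator (A i) x) = (\<Sum>i<n. \<Phi> (indicator (A i)))" for n
      proof (induction n)
        case (Suc n)
        have "\<Phi> (\<lambda>x. \<Sum>i<Suc n. indicator (A i) x) = \<Phi> (\<lambda>x. (\<Sum>i<n. indicator (A i) x) + indicator (A n) x)"
          by simp
        also have "\<dots> = \<Phi> (\<lambda>x. \<Sum>i<n. indicator (A i) x) + \<Phi> (indicator (A n))"
          using Ab by (intro add) auto
        finally show ?case using Suc by simp
      qed (simp add: zero)
      have "(\<Sum>i. \<Phi> (indicator (A i))) = (SUP n. \<Phi> (\<lambda>x. \<Sum>i<n. indicator (A i) x))"
        by (simp add: suminf_eq_SUP fin)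
      also have "\<dots> = \<Phi> (\<lambda>x. SUP n. \<Sum>i<n. indicator (A i) x)"
      proof (rule SUP[symmetric])
        show "(\<lambda>x. \<Sum>i<n. (indicator (A i) x :: ennreal)) \<in> borel_measurable borel" for n
          by (intro borel_measurable_sum borel_measurable_indicator Ab)
        show "incseq (\<lambda>n x. \<Sum>i<n. (indicator (A i) x :: ennreal))"
          by (intro incseq_SucI le_funI) simp
      qed
      also have "(\<lambda>x. SUP n. \<Sum>i<n. (indicator (A i) x :: ennreal)) = indicator (\<Union>i. A i)"
        using suminf_indicator[OF A(2)] by (simp add: suminf_eq_SUP fun_eq_iff)
      finally show "(\<Sum>i. \<Phi> (indicator (A i))) = \<Phi> (indicator (\<Union>i. A i))" .
    qed
  qed (use B sets_\<kappa> in auto)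
  have "absolutely_continuous m \<kappa>"
    unfolding absolutely_continuous_def
  proof
    fix B assume B: "B \<in> null_sets m"
    then have Bb: "B \<in> sets borel" by auto
    have "\<Phi> (indicator B) \<le> ennreal c * (\<integral>\<^sup>+x. indicator B x \<partial>m)"
      unfolding \<Phi>_def using Bb by (intro bound[OF \<alpha>]) auto
    then have "\<Phi> (indicator B) = 0" using null_setsD1[OF B] Bb by simp
    then show "B \<in> null_sets \<kappa>" using em[OF Bb] Bb by (simp add: null_sets_def sets_\<kappa>)
  qed
  then obtain v0 where v0: "v0 \<in> borel_measurable m" "density m v0 = \<kappa>"
    using m.Radon_Nikodym[of \<kappa>] by (auto simp: sets_\<kappa>)
  have v0b: "v0 \<in> borel_measurable borel" using v0(1) by simp
  have \<Phi>_eq: "\<Phi> h = (\<integral>\<^sup>+x. v0 x * h x \<partial>m)" if "h \<in> borel_measurable borel" for h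
    using that
  proof (induction h rule: borel_measurable_induct)
    case (cong f g)
    then have "f = g" by (simp add: fun_eq_iff)
    then show ?case using cong by simp
  next
    case (set B)
    then show ?case using em[OF set] emeasure_density[of v0 m B] v0 by simp
  next
    case (mult f k)
    have "(\<integral>\<^sup>+x. v0 x * (k * f x) \<partial>m) = k * (\<integral>\<^sup>+x. v0 x * f x \<partial>m)"
      using mult(2) v0b by (subst nn_integral_cmult[symmetric]) (auto simp: mult_ac)
    moreover have "\<Phi> (\<lambda>x. k * f x) = k * \<Phi> f" by (rule \<open>\<And>k f. f \<in> borel_measurable borel \<Longrightarrow> \<Phi> (\<lambda>x. k * f x) = k * \<Phi> f\<close>) (use mult in auto)
    ultimately show ?case using mult by simp
  next
    case (add f g)
    have "\<Phi> (\<lambda>x. g x + f x) = \<Phi> g + \<Phi> f"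
      by (rule \<open>\<And>f g. f \<in> borel_measurable borel \<Longrightarrow> g \<in> borel_measurable borel \<Longrightarrow> \<Phi> (\<lambda>x. f x + g x) = \<Phi> f + \<Phi> g\<close>)
         (use add in auto)
    moreover have "(\<integral>\<^sup>+x. v0 x * (g x + f x) \<partial>m) = (\<integral>\<^sup>+x. v0 x * g x \<partial>m) + (\<integral>\<^sup>+x. v0 x * f x \<partial>m)"
      unfolding distrib_left using add v0b by (intro nn_integral_add) auto
    ultimately show ?case using add by simp
  next
    case (seq U)
    have U: "\<And>i. U i \<in> borel_measurable borel" "incseq U" using seq by auto
    have "\<Phi> (SUP i. U i) = \<Phi> (\<lambda>x. SUP i. U i x)" by (intro arg_cong[where f = \<Phi>] ext) (simp add: image_comp)
    also have "\<dots> = (SUP i. \<Phi> (U i))" by (rule SUP[OF U])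
    also have "\<dots> = (SUP i. \<integral>\<^sup>+x. v0 x * U i x \<partial>m)" by (simp only: seq.IH)
    also have "\<dots> = (\<integral>\<^sup>+x. (SUP i. v0 x * U i x) \<partial>m)"
      by (rule nn_integral_monotone_convergence_SUP[symmetric])
         (use U v0b in \<open>auto simp: incseq_def le_fun_def intro!: mult_left_mono\<close>)
    also have "\<dots> = (\<integral>\<^sup>+x. v0 x * (SUP i. U i) x \<partial>m)"
      by (simp add: SUP_mult_left_ennreal image_comp)
    finally show ?case .
  qed
  obtain K :: "nat \<Rightarrow> 'a set" where K: "\<And>i. compact (K i)" "(\<Union>i. K i) = UNIV"
    using compact_cover by metis
  \<comment> \<open>on a set of finite measure where \<open>v0\<close> exceeds \<open>c\<close> by a fixed amount, the integral of \<open>v0\<close> would be too large\<close>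
  have v0_le: "AE x in m. v0 x \<le> ennreal c"
  proof -
    have "AE x in m. \<not> (x \<in> K i \<and> ennreal (c + 1 / real (Suc n)) \<le> v0 x)" for i n
    proof -
      define D where "D = {x \<in> K i. ennreal (c + 1 / real (Suc n)) \<le> v0 x}"
      have "D = K i \<inter> v0 -` {ennreal (c + 1 / real (Suc n))..}" by (auto simp: D_def)
      then have Db: "D \<in> sets borel"
        using borel_compact[OF K(1)] measurable_sets_borel[OF v0b] by (simp only: sets.Int atLeast_borel)
      have Dfin: "emeasure m D < \<infinity>"
        by (rule le_less_trans[OF emeasure_mono compact_finite[OF K(1), of i]])
           (use K(1)[of i] in \<open>auto simp: D_def borel_compact\<close>)
      then obtain r where r: "emeasure m D = ennreal r" "0 \<le> r" by (cases "emeasure m D") auto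
      have "ennreal (c + 1 / real (Suc n)) * emeasure m D = (\<integral>\<^sup>+x. ennreal (c + 1 / real (Suc n)) * indicator D x \<partial>m)"
        using Db by (simp add: nn_integral_cmult_indicator)
      also have "\<dots> \<le> (\<integral>\<^sup>+x. v0 x * indicator D x \<partial>m)"
        by (intro nn_integral_mono) (auto simp: D_def indicator_def)
      also have "\<dots> = \<Phi> (indicator D)" using Db by (intro \<Phi>_eq[symmetric]) simp
      also have "\<dots> \<le> ennreal c * (\<integral>\<^sup>+x. indicator D x \<partial>m)"
        unfolding \<Phi>_def using Db by (intro bound[OF \<alpha>]) auto
      also have "\<dots> = ennreal c * emeasure m D" using Db by simp
      finally have "ennreal ((c + 1 / real (Suc n)) * r) \<le> ennreal (c * r)"
        using r c by (simp add: ennreal_mult)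
      then have "(c + 1 / real (Suc n)) * r \<le> c * r" using r c by (simp add: ennreal_le_iff)
      then have "1 / real (Suc n) * r \<le> 0" by (simp add: distrib_right)
      then have "r = 0" using r(2) by (simp add: divide_le_0_iff)
      then have "D \<in> null_sets m" using r Db by (simp add: null_sets_def)
      then show ?thesis by (rule AE_I') (auto simp: D_def)
    qed
    then have "AE x in m. \<forall>i n. \<not> (x \<in> K i \<and> ennreal (c + 1 / real (Suc n)) \<le> v0 x)"
      by (intro AE_all_countable[THEN iffD2] allI)
    then show ?thesis
    proof eventually_elim
      case (elim x)
      obtain i where i: "x \<in> K i" using K(2) by blast
      have le: "v0 x \<le> ennreal (c + 1 / real (Suc n))" for n
        using elim i by (meson linear)
      show ?case
      proof (rule LIMSEQ_le_const)
        show "(\<lambda>n. ennreal (c + 1 / real (Suc n))) \<longlonglongrightarrow> ennreal c"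
          using tendsto_ennrealI[OF tendsto_add[OF tendsto_const LIMSEQ_Suc[OF lim_const_over_n[of 1]], of c]] by simp
      qed (use le in blast)
    qed
  qed
  define v where "v x = enn2real (min (v0 x) (ennreal c))" for x
  have ev: "ennreal (v x) = min (v0 x) (ennreal c)" for x
    unfolding v_def by (intro ennreal_enn2real) (auto simp: min_less_iff_disj)
  show ?thesis
  proof (rule that[of v])
    show "v \<in> borel_measurable borel" unfolding v_def[abs_def] using v0b by measurable
    show "0 \<le> v x" for x by (simp add: v_def)
    show "v x \<le> c" for x
      using ev[of x] c by (metis ennreal_le_iff min.cobounded2)
    fix h :: "'a \<Rightarrow> ennreal" assume h: "h \<in> borel_measurable borel"
    have "(\<integral>\<^sup>+x. resolvent P X \<alpha> h x \<partial>\<nu>) = (\<integral>\<^sup>+x. v0 x * h x \<partial>m)" using \<Phi>_eq[OF h] by (simp add: \<Phi>_def)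
    also have "\<dots> = (\<integral>\<^sup>+x. ennreal (v x) * h x \<partial>m)"
      by (rule nn_integral_cong_AE) (use v0_le in eventually_elim, simp add: ev min_absorb1)
    finally show "(\<integral>\<^sup>+x. resolvent P X \<alpha> h x \<partial>\<nu>) = (\<integral>\<^sup>+x. ennreal (v x) * h x \<partial>m)" .
  qed
qed

text \<open>Let \<open>v\<close> be the density of \<open>\<nu> R\<^sub>\<alpha>\<close> and \<open>w = \<gamma> R\<^sub>\<gamma> v\<close>. Since \<open>R\<^sub>\<gamma> v\<close> represents \<open>v\<close> for the form \<open>\<E>\<^sub>\<gamma>\<close>, the
  number \<open>\<E>\<^sub>\<alpha>(w, g)\<close> equals \<open>\<gamma> ((v, g) - (\<gamma> - \<alpha>) (v, R\<^sub>\<gamma> g))\<close>. The two products are the integrals of \<open>R\<^sub>\<alpha> g\<close>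
  and \<open>R\<^sub>\<alpha> R\<^sub>\<gamma> g\<close> against \<open>\<nu>\<close>, so the resolvent equation reduces the expression to \<open>\<gamma> \<integral>R\<^sub>\<gamma> g d\<nu>\<close>. In other
  words, \<open>w\<close> is the \<open>\<alpha>\<close>-potential of the measure \<open>\<gamma> \<nu> R\<^sub>\<gamma>\<close>, which approximates \<open>\<nu>\<close> for large \<open>\<gamma>\<close>.\<close>

lemma approximate_potential:
  assumes \<alpha>: "0 < \<alpha>" "\<alpha> < \<gamma>"
  obtains w where "w \<in> \<F>" "\<And>x. 0 \<le> w x" "\<And>x. w x \<le> c"
    "\<And>g. \<lbrakk>g \<in> \<F>; \<And>x. 0 \<le> g x\<rbrakk> \<Longrightarrow>
       ennreal \<gamma> * (\<integral>\<^sup>+x. resolvent P X \<gamma> (\<lambda>y. ennreal (g y)) x \<partial>\<nu>) = ennreal (form_alpha m \<E> \<alpha> w g) \<and>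
       0 \<le> form_alpha m \<E> \<alpha> w g"
proof -
  have \<gamma>: "0 < \<gamma>" using \<alpha> by simp
  obtain v where v: "v \<in> borel_measurable borel" "\<And>x. 0 \<le> v x" "\<And>x. v x \<le> c"
    "\<And>h. h \<in> borel_measurable borel \<Longrightarrow> (\<integral>\<^sup>+x. resolvent P X \<alpha> h x \<partial>\<nu>) = (\<integral>\<^sup>+x. ennreal (v x) * h x \<partial>m)"
    using resolvent_density[OF \<alpha>(1)] by blast
  have "(\<integral>\<^sup>+x. ennreal (v x) \<partial>m) = (\<integral>\<^sup>+x. resolvent P X \<alpha> (\<lambda>_. 1) x \<partial>\<nu>)" using v(4)[of "\<lambda>_. 1"] by simp
  also have "\<dots> \<le> (\<integral>\<^sup>+x. ennreal (1 / \<alpha>) \<partial>\<nu>)"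
  proof (rule nn_integral_mono)
    fix x
    have "ennreal \<alpha> * resolvent P X \<alpha> (\<lambda>_. 1) x \<le> 1" by (rule resolvent_le[OF \<alpha>(1)]) auto
    then have "ennreal (1 / \<alpha>) * (ennreal \<alpha> * resolvent P X \<alpha> (\<lambda>_. 1) x) \<le> ennreal (1 / \<alpha>) * 1"
      by (rule mult_left_mono) simp
    then show "resolvent P X \<alpha> (\<lambda>_. 1) x \<le> ennreal (1 / \<alpha>)"
      using \<alpha>(1) by (simp add: mult.assoc[symmetric] ennreal_mult'[symmetric])
  qed
  also have "\<dots> = ennreal (1 / \<alpha>) * emeasure \<nu> UNIV"
    using sets_eq_imp_space_eq[OF sets_\<nu>] by simp
  also have "\<dots> < \<infinity>" using fin_\<nu> by (simp add: ennreal_mult_less_top)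
  finally have vfin: "(\<integral>\<^sup>+x. ennreal (v x) \<partial>m) < \<infinity>" .
  have vi: "integrable m v" by (rule integrableI_nonneg) (use v vfin in auto)
  have vL: "v \<in> L2 m" unfolding L2_def
  proof safe
    show "v \<in> borel_measurable m" using v(1) by simp
    show "integrable m (\<lambda>x. (v x)\<^sup>2)"
    proof (rule Bochner_Integration.integrable_bound)
      show "integrable m (\<lambda>x. c * v x)" using vi by simp
      have "v x * v x \<le> c * v x" for x by (rule mult_right_mono[OF v(3) v(2)])
      then show "AE x in m. norm ((v x)\<^sup>2) \<le> norm (c * v x)" using c v(2) by (simp add: power2_eq_square)
    qed (use v(1) in simp)
  qed
  obtain u where u: "u \<in> \<F>" "\<And>g. g \<in> \<F> \<Longrightarrow> form_alpha m \<E> \<gamma> u g = (\<integral>x. v x * g x \<partial>m)"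
    "AE x in m. resolvent P X \<gamma> (\<lambda>y. ennreal (v y)) x = ennreal (u x)" "AE x in m. 0 \<le> u x"
    using process_resolvent[OF \<gamma> vL v(2)] by blast
  have vb: "(\<lambda>y. ennreal (v y)) \<in> borel_measurable borel" using v(1) by measurable
  have rle: "ennreal \<gamma> * resolvent P X \<gamma> (\<lambda>y. ennreal (v y)) x \<le> ennreal c" for x
    by (rule resolvent_le[OF \<gamma> vb]) (simp add: ennreal_leI v(3))
  define w where "w x = enn2real (ennreal \<gamma> * resolvent P X \<gamma> (\<lambda>y. ennreal (v y)) x)" for x
  have w0: "0 \<le> w x" for x by (simp add: w_def)
  have wc: "w x \<le> c" for x
    unfolding w_def using rle[of x] c by (metis enn2real_ennreal enn2real_mono ennreal_less_top)
  have wb: "w \<in> borel_measurable borel" unfolding w_def[abs_def] using measurable_resolvent[OF vb] by measurable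
  have wu: "AE x in m. \<gamma> * u x = w x" using u(3,4)
    by eventually_elim (use \<gamma> in \<open>simp add: w_def enn2real_mult\<close>)
  have wF: "w \<in> \<F>" by (rule dom_AE[OF dom_scale[OF u(1)] _ wu]) (use wb in simp)
  have key: "ennreal \<gamma> * (\<integral>\<^sup>+x. resolvent P X \<gamma> (\<lambda>y. ennreal (g y)) x \<partial>\<nu>) = ennreal (form_alpha m \<E> \<alpha> w g) \<and>
       0 \<le> form_alpha m \<E> \<alpha> w g" if g: "g \<in> \<F>" "\<And>x. 0 \<le> g x" for g
  proof -
    have gL: "g \<in> L2 m" using L2_dom g by blast
    have gb: "(\<lambda>y. ennreal (g y)) \<in> borel_measurable borel" using borel_dom[OF g(1)] by simp
    obtain q where q: "q \<in> \<F>" "\<And>f. f \<in> \<F> \<Longrightarrow> form_alpha m \<E> \<gamma> q f = (\<integral>x. g x * f x \<partial>m)"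
      "AE x in m. resolvent P X \<gamma> (\<lambda>y. ennreal (g y)) x = ennreal (q x)" "AE x in m. 0 \<le> q x"
      using process_resolvent[OF \<gamma> gL g(2)] by blast
    define a where "a = (\<integral>x. v x * g x \<partial>m)"
    define b where "b = (\<integral>x. u x * g x \<partial>m)"
    have b2: "b = (\<integral>x. v x * q x \<partial>m)"
    proof -
      have "b = form_alpha m \<E> \<gamma> q u" using q(2)[OF u(1)] by (simp add: b_def mult.commute)
      also have "\<dots> = form_alpha m \<E> \<gamma> u q"
        using semi_inner.sym[OF semi_inner_alpha q(1) u(1)] \<gamma> by simp
      finally show ?thesis using u(2)[OF q(1)] by simp
    qed
    have a0: "0 \<le> a" unfolding a_def by (intro integral_nonneg_AE) (simp add: v g)
    have b0: "0 \<le> b" unfolding b2 by (intro integral_nonneg_AE) (use q(4) in eventually_elim, simp add: v)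
    have Ra: "(\<integral>\<^sup>+x. resolvent P X \<alpha> (\<lambda>y. ennreal (g y)) x \<partial>\<nu>) = ennreal a"
    proof -
      have "(\<integral>\<^sup>+x. resolvent P X \<alpha> (\<lambda>y. ennreal (g y)) x \<partial>\<nu>) = (\<integral>\<^sup>+x. ennreal (v x * g x) \<partial>m)"
        using v(4)[OF gb] by (simp add: ennreal_mult' v g)
      also have "\<dots> = ennreal a" unfolding a_def
        by (rule nn_integral_eq_integral[OF L2_mult_integrable[OF vL gL]]) (simp add: v g)
      finally show ?thesis .
    qed
    have Rb: "(\<integral>\<^sup>+x. resolvent P X \<alpha> (resolvent P X \<gamma> (\<lambda>y. ennreal (g y))) x \<partial>\<nu>) = ennreal b"
    proof -
      have "(\<integral>\<^sup>+x. resolvent P X \<alpha> (resolvent P X \<gamma> (\<lambda>y. ennreal (g y))) x \<partial>\<nu>)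
          = (\<integral>\<^sup>+x. ennreal (v x) * resolvent P X \<gamma> (\<lambda>y. ennreal (g y)) x \<partial>m)"
        by (rule v(4)[OF measurable_resolvent[OF gb]])
      also have "\<dots> = (\<integral>\<^sup>+x. ennreal (v x * q x) \<partial>m)"
        by (rule nn_integral_cong_AE) (use q(3,4) in eventually_elim, simp add: ennreal_mult' v)
      also have "\<dots> = ennreal b" unfolding b2
        by (rule nn_integral_eq_integral[OF L2_mult_integrable[OF vL L2_dom[OF q(1)]]])
           (use q(4) in eventually_elim, simp add: v)
      finally show ?thesis .
    qed
    have rb: "resolvent P X \<beta> h \<in> borel_measurable \<nu>" if "h \<in> borel_measurable borel" for h \<beta>
      unfolding borel_nu by (rule measurable_resolvent[OF that])
    define R where "R = (\<integral>\<^sup>+x. resolvent P X \<gamma> (\<lambda>y. ennreal (g y)) x \<partial>\<nu>)"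
    have eq: "ennreal a = R + ennreal (\<gamma> - \<alpha>) * ennreal b"
    proof -
      have "ennreal a = (\<integral>\<^sup>+x. resolvent P X \<gamma> (\<lambda>y. ennreal (g y)) x
          + ennreal (\<gamma> - \<alpha>) * resolvent P X \<alpha> (resolvent P X \<gamma> (\<lambda>y. ennreal (g y))) x \<partial>\<nu>)"
        unfolding Ra[symmetric] by (intro nn_integral_cong resolvent_equation[OF gb \<alpha>(2)])
      also have "\<dots> = R + (\<integral>\<^sup>+x. ennreal (\<gamma> - \<alpha>) * resolvent P X \<alpha> (resolvent P X \<gamma> (\<lambda>y. ennreal (g y))) x \<partial>\<nu>)"
        unfolding R_def
        by (intro nn_integral_add borel_measurable_times_ennreal borel_measurable_const rb gb measurable_resolvent)
      also have "(\<integral>\<^sup>+x. ennreal (\<gamma> - \<alpha>) * resolvent P X \<alpha> (resolvent P X \<gamma> (\<lambda>y. ennreal (g y))) x \<partial>\<nu>)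
          = ennreal (\<gamma> - \<alpha>) * ennreal b"
        unfolding Rb[symmetric] by (intro nn_integral_cmult rb gb measurable_resolvent)
      finally show ?thesis .
    qed
    have "R \<noteq> \<top>"
    proof
      assume "R = \<top>"
      then have "ennreal a = \<top>" using eq by simp
      then show False by simp
    qed
    then obtain r where r: "R = ennreal r" "0 \<le> r" by (cases R) auto
    have "ennreal a = ennreal (r + (\<gamma> - \<alpha>) * b)"
      using eq r b0 \<alpha>(2) by (simp add: ennreal_plus ennreal_mult')
    moreover have "0 \<le> r + (\<gamma> - \<alpha>) * b" using r b0 \<alpha>(2) by simp
    ultimately have ar: "a = r + (\<gamma> - \<alpha>) * b" using a0 by simp
    have "\<E> w g = \<gamma> * \<E> u g"
      using form_AE[OF dom_scale[OF u(1)] wF g(1) wu] form_scale[OF u(1) g(1)] by simp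
    moreover have "(\<integral>x. w x * g x \<partial>m) = \<gamma> * b"
    proof -
      have "(\<integral>x. w x * g x \<partial>m) = (\<integral>x. (\<gamma> * u x) * g x \<partial>m)"
        by (rule integral_cong_AE) (use wu borel_dom[OF wF] borel_dom[OF u(1)] borel_dom[OF g(1)] in auto)
      also have "\<dots> = \<gamma> * b" unfolding b_def by (rule L2.scale_left[OF L2_dom[OF u(1)] gL])
      finally show ?thesis .
    qed
    moreover have "\<E> u g + \<gamma> * b = a" using u(2)[OF g(1)] by (simp add: form_alpha_def a_def b_def)
    ultimately have "form_alpha m \<E> \<alpha> w g = \<gamma> * (a - \<gamma> * b) + \<alpha> * (\<gamma> * b)"
      by (simp add: form_alpha_def)
    also have "\<dots> = \<gamma> * r" unfolding ar by (simp add: algebra_simps)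
    finally have fr: "form_alpha m \<E> \<alpha> w g = \<gamma> * r" .
    show ?thesis unfolding R_def[symmetric] fr r(1) using \<gamma> r(2) by (simp add: ennreal_mult')
  qed
  show ?thesis by (rule that[OF wF w0 wc key])
qed

text \<open>For \<open>g = w\<close>, where \<open>0 \<le> w \<le> c\<close>, the previous lemma gives \<open>\<E>\<^sub>\<alpha>(w, w) \<le> c \<nu>(E)\<close>. For \<open>g = \<phi>\<close> the
  Cauchy-Schwarz inequality then bounds \<open>\<gamma> \<integral>R\<^sub>\<gamma> \<phi> d\<nu>\<close> by the product of the square roots of \<open>c \<nu>(E)\<close> and
  \<open>\<E>\<^sub>\<alpha>(\<phi>, \<phi>)\<close>. It remains to let \<open>\<gamma> \<rightarrow> \<infinity>\<close>, using \<open>resolvent_liminf\<close>, and \<open>\<alpha> \<rightarrow> 0\<close>.\<close>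

lemma core_integral_le_energy:
  assumes \<phi>: "\<phi> \<in> \<F>" "\<phi> \<in> Cc" "\<And>x. 0 \<le> \<phi> x"
  shows "(\<integral>\<^sup>+x. ennreal (\<phi> x) \<partial>\<nu>) \<le> ennreal (sqrt (c * measure \<nu> UNIV) * sqrt (energy \<phi>))"
proof -
  define T where "T = c * measure \<nu> UNIV"
  have T0: "0 \<le> T" using c by (simp add: T_def)
  have sp: "space \<nu> = UNIV" using sets_eq_imp_space_eq[OF sets_\<nu>] by simp
  have emT: "ennreal c * emeasure \<nu> UNIV = ennreal T"
    unfolding T_def using fin_\<nu> c by (simp add: emeasure_eq_ennreal_measure ennreal_mult less_top[symmetric])
  have pb: "(\<lambda>y. ennreal (\<phi> y)) \<in> borel_measurable borel" using Cc_borel[OF \<phi>(2)] by measurable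
  have step: "ennreal \<gamma> * (\<integral>\<^sup>+x. resolvent P X \<gamma> (\<lambda>y. ennreal (\<phi> y)) x \<partial>\<nu>)
      \<le> ennreal (sqrt T * sqrt (form_alpha m \<E> \<alpha> \<phi> \<phi>))" if \<alpha>: "0 < \<alpha>" "\<alpha> < \<gamma>" for \<alpha> \<gamma>
  proof -
    have \<gamma>: "0 < \<gamma>" using \<alpha> by simp
    interpret fa: semi_inner \<F> "form_alpha m \<E> \<alpha>" by (rule semi_inner_alpha) (use \<alpha> in simp)
    obtain w where w: "w \<in> \<F>" "\<And>x. 0 \<le> w x" "\<And>x. w x \<le> c"
      and key: "\<And>g. \<lbrakk>g \<in> \<F>; \<And>x. 0 \<le> g x\<rbrakk> \<Longrightarrow>
       ennreal \<gamma> * (\<integral>\<^sup>+x. resolvent P X \<gamma> (\<lambda>y. ennreal (g y)) x \<partial>\<nu>) = ennreal (form_alpha m \<E> \<alpha> w g) \<and>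
       0 \<le> form_alpha m \<E> \<alpha> w g"
      using approximate_potential[OF \<alpha>] by blast
    have wb: "(\<lambda>y. ennreal (w y)) \<in> borel_measurable borel" using borel_dom[OF w(1)] by simp
    have rb: "(\<lambda>x. resolvent P X \<gamma> (\<lambda>y. ennreal (w y)) x) \<in> borel_measurable \<nu>"
      using measurable_resolvent[OF wb] by (simp add: measurable_cong_sets[OF sets_\<nu> refl])
    have "ennreal (form_alpha m \<E> \<alpha> w w) = ennreal \<gamma> * (\<integral>\<^sup>+x. resolvent P X \<gamma> (\<lambda>y. ennreal (w y)) x \<partial>\<nu>)"
      using key[OF w(1,2)] by simp
    also have "\<dots> = (\<integral>\<^sup>+x. ennreal \<gamma> * resolvent P X \<gamma> (\<lambda>y. ennreal (w y)) x \<partial>\<nu>)"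
      by (rule nn_integral_cmult[symmetric, OF rb])
    also have "\<dots> \<le> (\<integral>\<^sup>+x. ennreal c \<partial>\<nu>)"
      by (intro nn_integral_mono resolvent_le[OF \<gamma> wb] ennreal_leI w(3))
    also have "\<dots> = ennreal T" by (simp add: sp emT)
    finally have wT: "form_alpha m \<E> \<alpha> w w \<le> T" using T0 by (simp add: ennreal_le_iff)
    have "form_alpha m \<E> \<alpha> w \<phi> \<le> sqrt (form_alpha m \<E> \<alpha> w w) * sqrt (form_alpha m \<E> \<alpha> \<phi> \<phi>)"
      using fa.Cauchy_Schwarz[OF w(1) \<phi>(1)] by linarith
    also have "\<dots> \<le> sqrt T * sqrt (form_alpha m \<E> \<alpha> \<phi> \<phi>)"
      using wT fa.nonneg[OF \<phi>(1)] by (intro mult_right_mono) auto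
    finally show ?thesis using key[OF \<phi>(1,3)] by (simp add: ennreal_leI)
  qed
  have step2: "(\<integral>\<^sup>+x. ennreal (\<phi> x) \<partial>\<nu>) \<le> ennreal (sqrt T * sqrt (form_alpha m \<E> (1 / real (Suc k)) \<phi> \<phi>))" for k
  proof -
    let ?\<alpha> = "1 / real (Suc k)"
    let ?r = "\<lambda>n x. ennreal (real (Suc n)) * resolvent P X (real (Suc n)) (\<lambda>y. ennreal (\<phi> y)) x"
    have rb: "resolvent P X \<beta> (\<lambda>y. ennreal (\<phi> y)) \<in> borel_measurable \<nu>" for \<beta>
      using measurable_resolvent[OF pb] by (simp add: measurable_cong_sets[OF sets_\<nu> refl])
    have "(\<integral>\<^sup>+x. ennreal (\<phi> x) \<partial>\<nu>) \<le> (\<integral>\<^sup>+x. liminf (\<lambda>n. ?r n x) \<partial>\<nu>)"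
      by (intro nn_integral_mono resolvent_liminf \<phi>)
    also have "\<dots> \<le> liminf (\<lambda>n. \<integral>\<^sup>+x. ?r n x \<partial>\<nu>)"
      by (rule nn_integral_liminf) (intro borel_measurable_times_ennreal borel_measurable_const rb)
    also have "\<dots> \<le> liminf (\<lambda>n. ennreal (sqrt T * sqrt (form_alpha m \<E> ?\<alpha> \<phi> \<phi>)))"
    proof (rule Liminf_mono)
      show "\<forall>\<^sub>F n in sequentially. (\<integral>\<^sup>+x. ?r n x \<partial>\<nu>) \<le> ennreal (sqrt T * sqrt (form_alpha m \<E> ?\<alpha> \<phi> \<phi>))"
        unfolding eventually_sequentially
      proof (intro exI[of _ 1] allI impI)
        fix n :: nat assume "1 \<le> n"
        have "?\<alpha> \<le> 1" by simp
        also have "1 < real (Suc n)" using \<open>1 \<le> n\<close> by simp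
        finally have "?\<alpha> < real (Suc n)" .
        from step[OF _ this] show "(\<integral>\<^sup>+x. ?r n x \<partial>\<nu>) \<le> ennreal (sqrt T * sqrt (form_alpha m \<E> ?\<alpha> \<phi> \<phi>))"
          by (simp add: nn_integral_cmult[OF rb] del: of_nat_Suc)
      qed
    qed
    also have "\<dots> = ennreal (sqrt T * sqrt (form_alpha m \<E> ?\<alpha> \<phi> \<phi>))" by (simp add: Liminf_const)
    finally show ?thesis .
  qed
  have "(\<lambda>k. form_alpha m \<E> (1 / real (Suc k)) \<phi> \<phi>) \<longlonglongrightarrow> energy \<phi> + 0 * (\<integral>x. \<phi> x * \<phi> x \<partial>m)"
    unfolding form_alpha_def by (intro tendsto_intros LIMSEQ_Suc[OF lim_const_over_n])
  then have "(\<lambda>k. ennreal (sqrt T * sqrt (form_alpha m \<E> (1 / real (Suc k)) \<phi> \<phi>))) \<longlonglongrightarrow> ennreal (sqrt T * sqrt (energy \<phi>))"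
    by (intro tendsto_ennrealI tendsto_mult tendsto_const tendsto_real_sqrt) simp
  then have "(\<integral>\<^sup>+x. ennreal (\<phi> x) \<partial>\<nu>) \<le> ennreal (sqrt T * sqrt (energy \<phi>))"
    by (rule LIMSEQ_le_const) (use step2 in blast)
  then show ?thesis by (simp add: T_def)
qed

end

section \<open>The estimates and the Radon property\<close>

text \<open>For \<open>f = 1\<^sub>B\<close> the functionals in the Revuz formula are at most \<open>A\<^sub>\<zeta>\<close>, whose expectation is at most \<open>c\<close>
  for almost every starting point.\<close>

lemma Revuz_potential_bound:
  assumes sets_\<mu>: "sets \<mu> = sets borel" and A: "pcaf m \<F> \<E> M P X \<theta> A"
    and revuz: "revuz_correspondence m P X A \<mu>"
    and c: "Linf_norm m (pcaf_potential P X A) = ennreal c"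
    and B: "B \<in> sets borel" and \<alpha>: "0 < \<alpha>" and h: "h \<in> borel_measurable borel"
  shows "(\<integral>\<^sup>+x. resolvent P X \<alpha> h x \<partial>restrict_to B \<mu>) \<le> ennreal c * (\<integral>\<^sup>+x. h x \<partial>m)"
proof -
  define V where "V x = (\<integral>\<^sup>+\<omega>. pcaf_integral X A
      (\<lambda>s. ennreal (exp (- \<alpha> * s)) * ext_cem (indicator B) (X (ennreal s) \<omega>)) \<omega> \<partial>P (Some x))" for x
  define good where "good \<omega> \<longleftrightarrow> A 0 \<omega> = 0 \<and> continuous_on UNIV (\<lambda>t. A t \<omega>) \<and>
           (\<forall>t<lifetime X \<omega>. A t \<omega> < \<infinity>) \<and> (\<forall>t\<ge>lifetime X \<omega>. A t \<omega> = A (lifetime X \<omega>) \<omega>) \<and>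
           (\<forall>s<\<infinity>. \<forall>t<\<infinity>. A (t + s) \<omega> = A s \<omega> + A t (\<theta> s \<omega>))" for \<omega>
  have "\<exists>\<Lambda>\<in>sets (completed_filtration M P X \<infinity>). \<exists>N. Cap m \<F> \<E> N = 0 \<and>
        (\<forall>x. x \<notin> N \<longrightarrow> (AE \<omega> in P (Some x). \<omega> \<in> \<Lambda>)) \<and>
        (\<forall>t. 0 < t \<longrightarrow> t < \<infinity> \<longrightarrow> \<theta> t ` \<Lambda> \<subseteq> \<Lambda>) \<and> (\<forall>\<omega>\<in>\<Lambda>. good \<omega>)"
    using A unfolding pcaf_def good_def by (rule conjunct2)
  then obtain \<Lambda> N where \<Lambda>N: "Cap m \<F> \<E> N = 0 \<and>
        (\<forall>x. x \<notin> N \<longrightarrow> (AE \<omega> in P (Some x). \<omega> \<in> \<Lambda>)) \<and>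
        (\<forall>t. 0 < t \<longrightarrow> t < \<infinity> \<longrightarrow> \<theta> t ` \<Lambda> \<subseteq> \<Lambda>) \<and> (\<forall>\<omega>\<in>\<Lambda>. good \<omega>)"
    by (elim bexE exE)
  have N: "Cap m \<F> \<E> N = 0" "\<And>x. x \<notin> N \<Longrightarrow> AE \<omega> in P (Some x). \<omega> \<in> \<Lambda>"
    and \<Lambda>: "\<And>\<omega>. \<omega> \<in> \<Lambda> \<Longrightarrow> good \<omega>"
    using \<Lambda>N by simp_all
  have V1: "V x \<le> pcaf_potential P X A x" if x: "x \<notin> N" for x
    unfolding V_def pcaf_potential_def
  proof (rule nn_integral_mono_AE)
    show "AE \<omega> in P (Some x). pcaf_integral X A
      (\<lambda>s. ennreal (exp (- \<alpha> * s)) * ext_cem (indicator B) (X (ennreal s) \<omega>)) \<omega> \<le> A (lifetime X \<omega>) \<omega>"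
      using N(2)[OF x]
    proof eventually_elim
      case (elim \<omega>)
      show ?case
      proof (rule pcaf_integral_le_total[where \<theta> = \<theta>])
        fix s :: real assume "0 \<le> s"
        then have "ennreal (exp (- \<alpha> * s)) \<le> 1" using \<alpha> by simp
        moreover have "ext_cem (indicator B) (X (ennreal s) \<omega>) \<le> 1"
          by (cases "X (ennreal s) \<omega>") (auto simp: indicator_def)
        ultimately show "ennreal (exp (- \<alpha> * s)) * ext_cem (indicator B) (X (ennreal s) \<omega>) \<le> 1"
          using mult_mono[of "ennreal (exp (- \<alpha> * s))" 1 "ext_cem (indicator B) (X (ennreal s) \<omega>)" 1] by simp
      qed (use \<Lambda>[OF elim] in \<open>simp_all add: good_def\<close>)
    qed
  qed
  have "AE x in completion m. pcaf_potential P X A x \<le> esssup (completion m) (pcaf_potential P X A)"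
    by (rule esssup_AE)
  then have "AE x in m. pcaf_potential P X A x \<le> ennreal c"
    using c by (simp add: AE_completion_iff Linf_norm_def)
  then have Vc: "AE x in m. V x \<le> ennreal c" using Cap_zero_AE[OF sets_m N(1)]
    by eventually_elim (use V1 order_trans in blast)
  have b: "resolvent P X \<alpha> h \<in> borel_measurable \<mu>"
    using measurable_resolvent[OF h] by (simp add: measurable_cong_sets[OF sets_\<mu> refl])
  have "(\<integral>\<^sup>+x. resolvent P X \<alpha> h x \<partial>restrict_to B \<mu>) = (\<integral>\<^sup>+x. indicator B x * resolvent P X \<alpha> h x \<partial>\<mu>)"
    using B by (intro nn_integral_density b borel_measurable_indicator) (simp add: sets_\<mu>)
  also have "\<dots> = (\<integral>\<^sup>+x. h x * V x \<partial>m)"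
    using revuz \<alpha> B h unfolding revuz_correspondence_def V_def by simp
  also have "\<dots> \<le> (\<integral>\<^sup>+x. h x * ennreal c \<partial>m)"
    by (rule nn_integral_mono_AE) (use Vc in eventually_elim, simp add: mult_left_mono)
  also have "\<dots> = ennreal c * (\<integral>\<^sup>+x. h x \<partial>m)" 
  proof -
    have "h \<in> borel_measurable m" using h by simp
    then have "(\<integral>\<^sup>+x. h x * ennreal c \<partial>m) = (\<integral>\<^sup>+x. h x \<partial>m) * ennreal c" by (rule nn_integral_multc)
    also have "\<dots> = ennreal c * (\<integral>\<^sup>+x. h x \<partial>m)" by (rule mult.commute)
    finally show ?thesis .
  qed
  finally show ?thesis .
qed

lemma Cap0_lessE:
  assumes "Cap0 m \<F> \<E> K < e"
  obtains U u where "open U" "K \<subseteq> U" "u \<in> ext_dom m \<F> \<E>" "AE x in m. x \<in> U \<longrightarrow> 1 \<le> u x"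
    "ennreal (ext_form m \<F> \<E> u u) < e"
  using assms unfolding Cap0_def capacity_def by (auto simp: INF_less_iff)

lemma Cap0_compact_finite:
  assumes "compact K" shows "Cap0 m \<F> \<E> K < \<infinity>"
proof -
  obtain w V where w: "w \<in> \<F>" "open V" "K \<subseteq> V" "\<And>x. x \<in> V \<Longrightarrow> w x = 1"
    using core_cutoff[OF assms] by metis
  have "Cap0 m \<F> \<E> K \<le> ennreal (ext_form m \<F> \<E> w w)"
    unfolding Cap0_def capacity_def using w dom_subset_ext_dom
    by (intro INF_lower2[of V] INF_lower2[of w]) auto
  then show ?thesis by (simp add: le_less_trans)
qed

text \<open>The measure \<open>1\<^sub>K\<^sub>\<inter>\<^sub>G \<mu>\<close> inherits finite energy from \<open>1\<^sub>G \<mu>\<close>. The first inequality is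
  \<open>mass_le_potential_energy\<close>, optimised over the competitors for the capacity of \<open>K\<close>; the second is
  \<open>potential_energy_le\<close> with the constant from \<open>core_integral_le_energy\<close>.\<close>

lemma estimates_on_nest_set:
  assumes sets_\<mu>: "sets \<mu> = sets borel" and A: "pcaf m \<F> \<E> M P X \<theta> A"
    and revuz: "revuz_correspondence m P X A \<mu>"
    and c: "Linf_norm m (pcaf_potential P X A) = ennreal c" "0 \<le> c"
    and null: "\<And>D. \<lbrakk>D \<in> sets borel; Cap m \<F> \<E> D = 0\<rbrakk> \<Longrightarrow> emeasure \<mu> D = 0"
    and K: "compact K" and G: "compact G" and energy: "finite_energy0 \<F> \<E> (restrict_to G \<mu>)"
  defines "U \<equiv> potential0 m \<F> \<E> (restrict_to (K \<inter> G) \<mu>)"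
  shows "emeasure \<mu> (K \<inter> G) < \<infinity>"
    and "emeasure \<mu> (K \<inter> G) \<le> ennreal_sqrt (Cap0 m \<F> \<E> K) * ennreal (sqrt (ext_form m \<F> \<E> U U))"
    and "ennreal (ext_form m \<F> \<E> U U) \<le> ennreal c * emeasure \<mu> (K \<inter> G)"
proof -
  define \<nu> where "\<nu> = restrict_to (K \<inter> G) \<mu>"
  have Kb: "K \<in> sets borel" and Gb: "G \<in> sets borel" using K G by (auto simp: borel_compact)
  then have Bb: "K \<inter> G \<in> sets borel" by simp
  have ind: "(indicator D :: 'a \<Rightarrow> ennreal) \<in> borel_measurable \<mu>" if "D \<in> sets borel" for D
    using that by (intro borel_measurable_indicator) (simp add: sets_\<mu>)
  have sets_\<nu>: "sets \<nu> = sets borel" by (simp add: \<nu>_def sets_\<mu>)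
  have em: "emeasure (restrict_to D \<mu>) S = emeasure \<mu> (D \<inter> S)"
    if "D \<in> sets borel" "S \<in> sets borel" for D S
    using that by (intro emeasure_restricted) (simp_all add: sets_\<mu>)
  have em\<nu>: "emeasure \<nu> S = emeasure \<mu> (K \<inter> G \<inter> S)" if "S \<in> sets borel" for S
    unfolding \<nu>_def by (rule em[OF Bb that])
  have mass: "emeasure \<nu> UNIV = emeasure \<mu> (K \<inter> G)" using em\<nu>[of UNIV] by simp
  have "emeasure \<mu> (K \<inter> G) \<le> emeasure \<mu> G" using Gb by (intro emeasure_mono) (auto simp: sets_\<mu>)
  also have "\<dots> = emeasure (restrict_to G \<mu>) G" using em[OF Gb Gb] by simp
  also have "\<dots> < \<infinity>" using energy G by (simp add: finite_energy0_def radon_measure_def)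
  finally show fin: "emeasure \<mu> (K \<inter> G) < \<infinity>" .
  have null\<nu>: "emeasure \<nu> D = 0" if D: "D \<in> sets borel" "Cap m \<F> \<E> D = 0" for D
  proof -
    have "emeasure \<nu> D \<le> emeasure \<mu> D"
      unfolding em\<nu>[OF D(1)] using D(1) by (intro emeasure_mono) (auto simp: sets_\<mu>)
    then show ?thesis using null[OF D] by simp
  qed
  obtain C where C: "0 < C" "\<And>\<phi>. \<phi> \<in> \<F> \<inter> Cc \<Longrightarrow>
      (\<integral>\<^sup>+x. ennreal \<bar>\<phi> x\<bar> \<partial>restrict_to G \<mu>) \<le> ennreal (C * sqrt (energy \<phi>))"
    using energy unfolding finite_energy0_def by blast
  have energy\<nu>: "(\<integral>\<^sup>+x. ennreal \<bar>\<phi> x\<bar> \<partial>\<nu>) \<le> ennreal (C * sqrt (energy \<phi>))" if \<phi>: "\<phi> \<in> \<F>" "\<phi> \<in> Cc" for \<phi>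
  proof -
    have pb: "(\<lambda>x. ennreal \<bar>\<phi> x\<bar>) \<in> borel_measurable \<mu>"
      using Cc_borel[OF \<phi>(2)] by (simp add: measurable_cong_sets[OF sets_\<mu> refl])
    have "(\<integral>\<^sup>+x. ennreal \<bar>\<phi> x\<bar> \<partial>\<nu>) = (\<integral>\<^sup>+x. indicator (K \<inter> G) x * ennreal \<bar>\<phi> x\<bar> \<partial>\<mu>)"
      unfolding \<nu>_def by (rule nn_integral_density[OF ind[OF Bb] pb])
    also have "\<dots> \<le> (\<integral>\<^sup>+x. indicator G x * ennreal \<bar>\<phi> x\<bar> \<partial>\<mu>)"
      by (intro nn_integral_mono mult_right_mono) (auto simp: indicator_def)
    also have "\<dots> = (\<integral>\<^sup>+x. ennreal \<bar>\<phi> x\<bar> \<partial>restrict_to G \<mu>)"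
      by (rule nn_integral_density[OF ind[OF Gb] pb, symmetric])
    also have "\<dots> \<le> ennreal (C * sqrt (energy \<phi>))" using \<phi> by (intro C) simp
    finally show ?thesis .
  qed
  have C0: "0 \<le> C" using C by simp
  have U: "U \<in> ext_dom m \<F> \<E>"
    unfolding U_def \<nu>_def[symmetric] by (rule potential0_spec(1)[OF sets_\<nu> _ C0], fact null\<nu>, fact energy\<nu>)
  define E where "E = ext_form m \<F> \<E> U U"
  have E0: "0 \<le> E" unfolding E_def by (rule ext_form_nonneg[OF U])
  have "AE x in \<nu>. x \<in> K"
  proof -
    have "emeasure \<nu> (- K) = 0" using em\<nu>[of "- K"] Kb by (simp add: borel_comp Int_assoc)
    then have "- K \<in> null_sets \<nu>" using Kb by (simp add: null_sets_def sets_\<nu> borel_comp)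
    then show ?thesis by (rule AE_I') auto
  qed
  have mass_le: "emeasure \<mu> (K \<inter> G) \<le> ennreal (sqrt (ext_form m \<F> \<E> u u) * sqrt E)"
    if u: "open V" "K \<subseteq> V" "u \<in> ext_dom m \<F> \<E>" "AE x in m. x \<in> V \<longrightarrow> 1 \<le> u x" for V u
    unfolding mass[symmetric] E_def U_def \<nu>_def[symmetric]
  proof (rule mass_le_potential_energy[OF sets_\<nu> _ C0 _ u(1) _ u(3,4)], fact null\<nu>, fact energy\<nu>)
    show "AE x in \<nu>. x \<in> V" using \<open>AE x in \<nu>. x \<in> K\<close> by eventually_elim (use u(2) in blast)
  qed
  define k where "k = enn2real (Cap0 m \<F> \<E> K)"
  have k: "Cap0 m \<F> \<E> K = ennreal k" "0 \<le> k"
    using Cap0_compact_finite[OF K] by (auto simp: k_def)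
  have "emeasure \<mu> (K \<inter> G) \<le> ennreal (sqrt k * sqrt E)"
  proof (rule LIMSEQ_le_const)
    show "(\<lambda>n. ennreal (sqrt (k + 1 / real (Suc n)) * sqrt E)) \<longlonglongrightarrow> ennreal (sqrt k * sqrt E)"
      using tendsto_add[OF tendsto_const LIMSEQ_Suc[OF lim_const_over_n[of 1]], of k]
      by (intro tendsto_ennrealI tendsto_mult tendsto_const tendsto_real_sqrt) simp
    have "emeasure \<mu> (K \<inter> G) \<le> ennreal (sqrt (k + 1 / real (Suc n)) * sqrt E)" for n
    proof -
      have "Cap0 m \<F> \<E> K < ennreal (k + 1 / real (Suc n))"
        unfolding k(1) using k(2) by (intro ennreal_lessI) (auto simp: add_nonneg_pos)
      from Cap0_lessE[OF this] obtain V u where u: "open V" "K \<subseteq> V" "u \<in> ext_dom m \<F> \<E>"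
        "AE x in m. x \<in> V \<longrightarrow> 1 \<le> u x" "ennreal (ext_form m \<F> \<E> u u) < ennreal (k + 1 / real (Suc n))"
        by blast
      have "ext_form m \<F> \<E> u u \<le> k + 1 / real (Suc n)"
        using u(5) ext_form_nonneg[OF u(3)] by (simp add: ennreal_less_iff)
      then have "sqrt (ext_form m \<F> \<E> u u) * sqrt E \<le> sqrt (k + 1 / real (Suc n)) * sqrt E"
        using E0 by (intro mult_right_mono) auto
      then show ?thesis using mass_le[OF u(1-4)] by (meson ennreal_leI order_trans)
    qed
    then show "\<exists>N. \<forall>n\<ge>N. emeasure \<mu> (K \<inter> G) \<le> ennreal (sqrt (k + 1 / real (Suc n)) * sqrt E)" by blast
  qed
  then show "emeasure \<mu> (K \<inter> G) \<le> ennreal_sqrt (Cap0 m \<F> \<E> K) * ennreal (sqrt (ext_form m \<F> \<E> U U))"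
    unfolding k(1) ennreal_sqrt_def E_def[symmetric] using k(2) E0 by (simp add: ennreal_mult)
  have fin\<nu>: "emeasure \<nu> UNIV < \<infinity>" using fin mass by simp
  have bound: "(\<integral>\<^sup>+x. resolvent P X \<alpha> h x \<partial>\<nu>) \<le> ennreal c * (\<integral>\<^sup>+x. h x \<partial>m)"
    if "0 < \<alpha>" "h \<in> borel_measurable borel" for \<alpha> h
    unfolding \<nu>_def by (rule Revuz_potential_bound[OF sets_\<mu> A revuz c(1) Bb that])
  have cT: "0 \<le> c * measure \<nu> UNIV" using c(2) by simp
  have "E \<le> (sqrt (c * measure \<nu> UNIV))\<^sup>2"
    unfolding E_def U_def \<nu>_def[symmetric]
  proof (rule potential_energy_le[OF sets_\<nu> _ C0], fact null\<nu>, fact energy\<nu>)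
    show "0 \<le> sqrt (c * measure \<nu> UNIV)" using cT by simp
    show "(\<integral>\<^sup>+x. ennreal (\<phi> x) \<partial>\<nu>) \<le> ennreal (sqrt (c * measure \<nu> UNIV) * sqrt (energy \<phi>))"
      if "\<phi> \<in> \<F>" "\<phi> \<in> Cc" "\<And>x. 0 \<le> \<phi> x" for \<phi>
      by (rule core_integral_le_energy[OF sets_\<nu> fin\<nu> c(2) _ that], fact bound)
  qed
  also have "\<dots> = c * measure \<nu> UNIV" using cT by simp
  finally have "ennreal E \<le> ennreal (c * measure \<nu> UNIV)" by (rule ennreal_leI)
  also have "\<dots> = ennreal c * emeasure \<mu> (K \<inter> G)"
    unfolding mass[symmetric] using fin\<nu> c(2)
    by (simp add: ennreal_mult emeasure_eq_ennreal_measure less_top[symmetric])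
  finally show "ennreal (ext_form m \<F> \<E> U U) \<le> ennreal c * emeasure \<mu> (K \<inter> G)" by (simp add: E_def)
qed

end

theorem proposition3p7:
  fixes m \<mu> :: "'a::{metric_space, second_countable_topology} measure"
    and \<F> :: "('a \<Rightarrow> real) set"
    and \<E> :: "('a \<Rightarrow> real) \<Rightarrow> ('a \<Rightarrow> real) \<Rightarrow> real"
    and M :: "'w measure"
    and P :: "'a option \<Rightarrow> 'w measure"
    and X :: "ennreal \<Rightarrow> 'w \<Rightarrow> 'a option"
    and \<theta> :: "ennreal \<Rightarrow> 'w \<Rightarrow> 'w"
    and A :: "ennreal \<Rightarrow> 'w \<Rightarrow> ennreal"
    and F :: "nat \<Rightarrow> 'a set"
  assumes "locally compact (UNIV :: 'a set)"
    and "radon_measure m" and "full_support m"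
    and "regular_dirichlet_form m \<F> \<E>"
    and "hunt_process M P X \<theta>"
    and "symmetric_process m P X"
    and "associated_process m \<F> \<E> P X"
    and "transient_form m \<F> \<E>"
    and "smooth_measure m \<F> \<E> \<mu>"
    and "pcaf m \<F> \<E> M P X \<theta> A"
    and "revuz_correspondence m P X A \<mu>"
    and "Linf_norm m (pcaf_potential P X A) < \<infinity>"
    and "compact_nest m \<F> \<E> F"
    and "\<forall>l. finite_energy0 \<F> \<E> (restrict_to (F l) \<mu>)"
  shows "(\<forall>K l. compact K \<longrightarrow>
            (let U = potential0 m \<F> \<E> (restrict_to (K \<inter> F l) \<mu>) in
               emeasure \<mu> (K \<inter> F l)
                 \<le> ennreal_sqrt (Cap0 m \<F> \<E> K) * ennreal (sqrt (ext_form m \<F> \<E> U U)) \<and>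
               ennreal (ext_form m \<F> \<E> U U)
                 \<le> Linf_norm m (pcaf_potential P X A) * emeasure \<mu> (K \<inter> F l)))
       \<and> (\<forall>K. compact K \<longrightarrow>
            emeasure \<mu> K \<le> Cap0 m \<F> \<E> K * Linf_norm m (pcaf_potential P X A) \<and>
            Cap0 m \<F> \<E> K * Linf_norm m (pcaf_potential P X A) < \<infinity>)
       \<and> radon_measure \<mu>"
proof -
  interpret regular_dirichlet_form m \<F> \<E> by (rule assms)
  interpret hunt_process M P X \<theta> by (rule assms)
  interpret dirichlet_process m \<F> \<E> M P X \<theta>
    by unfold_locales (use assms in auto)
  define c where "c = enn2real (Linf_norm m (pcaf_potential P X A))"
  have c: "Linf_norm m (pcaf_potential P X A) = ennreal c" "0 \<le> c"
    using assms(12) by (auto simp: c_def)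
  have sets_\<mu>: "sets \<mu> = sets borel"
    and null: "\<And>D. \<lbrakk>D \<in> sets borel; Cap m \<F> \<E> D = 0\<rbrakk> \<Longrightarrow> emeasure \<mu> D = 0"
    using assms(9) by (auto simp: smooth_measure_def)
  have F: "incseq F" "\<And>l. compact (F l)" "\<And>K. compact K \<Longrightarrow> (\<lambda>l. Cap m \<F> \<E> (K - F l)) \<longlonglongrightarrow> 0"
    using assms(13) by (auto simp: compact_nest_def)
  have Fb: "F l \<in> sets borel" for l using F(2) by (simp add: borel_compact)
  have energy: "finite_energy0 \<F> \<E> (restrict_to (F l) \<mu>)" for l using assms(14) by blast
  have est: "emeasure \<mu> (K \<inter> F l) < \<infinity>"
    "emeasure \<mu> (K \<inter> F l) \<le> ennreal_sqrt (Cap0 m \<F> \<E> K)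
       * ennreal (sqrt (ext_form m \<F> \<E> (potential0 m \<F> \<E> (restrict_to (K \<inter> F l) \<mu>))
           (potential0 m \<F> \<E> (restrict_to (K \<inter> F l) \<mu>))))"
    "ennreal (ext_form m \<F> \<E> (potential0 m \<F> \<E> (restrict_to (K \<inter> F l) \<mu>))
       (potential0 m \<F> \<E> (restrict_to (K \<inter> F l) \<mu>))) \<le> ennreal c * emeasure \<mu> (K \<inter> F l)"
    if K: "compact K" for K l
    by (rule estimates_on_nest_set[OF sets_\<mu> assms(10,11) c _ K F(2) energy], fact null)+
  have exhaust: "emeasure \<mu> (K - (\<Union>l. F l)) = 0" if K: "compact K" for K
  proof (rule null)
    show "K - (\<Union>l. F l) \<in> sets borel" using K Fb by (intro sets.Diff sets.countable_UN) (auto simp: borel_compact)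
    have "Cap m \<F> \<E> (K - (\<Union>l. F l)) \<le> 0"
      by (rule LIMSEQ_le_const[OF F(3)[OF K]]) (auto intro!: Cap_mono)
    then show "Cap m \<F> \<E> (K - (\<Union>l. F l)) = 0" by simp
  qed
  have part2: "emeasure \<mu> K \<le> Cap0 m \<F> \<E> K * Linf_norm m (pcaf_potential P X A)"
    "Cap0 m \<F> \<E> K * Linf_norm m (pcaf_potential P X A) < \<infinity>" if K: "compact K" for K
  proof -
    define k where "k = enn2real (Cap0 m \<F> \<E> K)"
    have k: "Cap0 m \<F> \<E> K = ennreal k" "0 \<le> k"
      using Cap0_compact_finite[OF K] by (auto simp: k_def)
    show "Cap0 m \<F> \<E> K * Linf_norm m (pcaf_potential P X A) < \<infinity>"
      unfolding k(1) c(1) by (simp add: ennreal_mult_less_top)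
    have Kb: "K \<in> sets borel" using K by (simp add: borel_compact)
    \<comment> \<open>\<open>x \<le> sqrt (k E)\<close> and \<open>E \<le> c x\<close> give \<open>x \<le> k c\<close>, because \<open>x\<close> is finite\<close>
    have le: "emeasure \<mu> (K \<inter> F l) \<le> ennreal (k * c)" for l
    proof -
      define U where "U = potential0 m \<F> \<E> (restrict_to (K \<inter> F l) \<mu>)"
      define E where "E = ext_form m \<F> \<E> U U"
      define x where "x = enn2real (emeasure \<mu> (K \<inter> F l))"
      have x: "emeasure \<mu> (K \<inter> F l) = ennreal x" "0 \<le> x"
        using est(1)[OF K, of l] by (auto simp: x_def)
      have 1: "ennreal x \<le> ennreal_sqrt (ennreal k) * ennreal (sqrt E)"
        using est(2)[OF K, of l] by (simp add: x(1) k(1) E_def U_def)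
      have "ennreal_sqrt (ennreal k) = ennreal (sqrt k)" using k(2) by (simp add: ennreal_sqrt_def)
      then have "ennreal x \<le> ennreal (sqrt k * sqrt E)" using 1 k(2) by (simp add: ennreal_mult')
      have 2: "ennreal E \<le> ennreal (c * x)"
        using est(3)[OF K, of l] c(2) x(2) by (simp add: x(1) E_def U_def ennreal_mult)
      have "E \<le> c * x" using 2 c(2) x(2) by (simp add: ennreal_le_iff)
      then have "sqrt k * sqrt E \<le> sqrt k * sqrt (c * x)" using k(2) by (intro mult_left_mono) auto
      then have "ennreal x \<le> ennreal (sqrt k * sqrt (c * x))"
        using \<open>ennreal x \<le> ennreal (sqrt k * sqrt E)\<close> by (meson ennreal_leI order_trans)
      then have "x \<le> sqrt k * sqrt (c * x)" using k(2) c(2) x(2) by (simp add: ennreal_le_iff)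
      also have "\<dots> = sqrt (k * c) * sqrt x" by (simp add: real_sqrt_mult)
      finally have "sqrt x * sqrt x \<le> sqrt (k * c) * sqrt x" using x(2) by simp
      then have "sqrt x \<le> sqrt (k * c)"
      proof (cases "x = 0")
        case False
        then have "0 < sqrt x" using x(2) by simp
        with \<open>sqrt x * sqrt x \<le> sqrt (k * c) * sqrt x\<close> show ?thesis by (metis mult_le_cancel_right_pos)
      qed (use k(2) c(2) in simp)
      then show ?thesis unfolding x(1) by (intro ennreal_leI) simp
    qed
    have "emeasure \<mu> K = emeasure \<mu> ((\<Union>l. K \<inter> F l) \<union> (K - (\<Union>l. F l)))"
      by (intro arg_cong[where f = "emeasure \<mu>"]) auto
    also have "\<dots> \<le> emeasure \<mu> (\<Union>l. K \<inter> F l) + emeasure \<mu> (K - (\<Union>l. F l))"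
      using Kb Fb by (intro emeasure_subadditive) (auto simp: sets_\<mu>)
    also have "\<dots> = (SUP l. emeasure \<mu> (K \<inter> F l))"
      unfolding exhaust[OF K] using Kb Fb F(1)
      by (subst SUP_emeasure_incseq) (auto simp: sets_\<mu> incseq_def)
    also have "\<dots> \<le> ennreal (k * c)" by (intro SUP_least le)
    also have "\<dots> = Cap0 m \<F> \<E> K * Linf_norm m (pcaf_potential P X A)"
      unfolding k(1) c(1) using k(2) c(2) by (simp add: ennreal_mult)
    finally show "emeasure \<mu> K \<le> Cap0 m \<F> \<E> K * Linf_norm m (pcaf_potential P X A)" .
  qed
  have "radon_measure \<mu>"
    unfolding radon_measure_def
  proof (intro conjI allI impI ballI)
    show "sets \<mu> = sets borel" by (rule sets_\<mu>)
    show "emeasure \<mu> K < \<infinity>" if "compact K" for K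
      using part2[OF that] by (rule le_less_trans)
    \<comment> \<open>inner regularity passes from the restrictions to the sets of the nest, whose union has full measure\<close>
    fix B :: "'a set" assume B: "B \<in> sets borel"
    let ?S = "SUP K\<in>{K. compact K \<and> K \<subseteq> B}. emeasure \<mu> K"
    obtain L :: "nat \<Rightarrow> 'a set" where L: "\<And>i. compact (L i)" "(\<Union>i. L i) = UNIV"
      using compact_cover by metis
    have ex0: "emeasure \<mu> (- (\<Union>l. F l)) = 0"
    proof -
      have "emeasure \<mu> (\<Union>i. L i - (\<Union>l. F l)) = 0"
        using L(1) Fb exhaust[OF L(1)]
        by (intro emeasure_UN_eq_0) (auto simp: sets_\<mu> borel_compact)
      moreover have "(\<Union>i. L i - (\<Union>l. F l)) = - (\<Union>l. F l)" using L(2) by blast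
      ultimately show ?thesis by simp
    qed
    have inner: "emeasure \<mu> (B \<inter> F l) \<le> ?S" for l
    proof -
      have em: "emeasure (restrict_to (F l) \<mu>) D = emeasure \<mu> (F l \<inter> D)" if "D \<in> sets borel" for D
        using that Fb[of l] by (intro emeasure_restricted) (simp_all add: sets_\<mu>)
      have "emeasure \<mu> (B \<inter> F l) = emeasure (restrict_to (F l) \<mu>) B" using em[OF B] by (simp add: Int_commute)
      also have "\<dots> = (SUP K\<in>{K. compact K \<and> K \<subseteq> B}. emeasure (restrict_to (F l) \<mu>) K)"
        using energy[of l] B by (simp add: finite_energy0_def radon_measure_def)
      also have "\<dots> \<le> ?S"
      proof (rule SUP_least)
        fix K assume "K \<in> {K. compact K \<and> K \<subseteq> B}"
        then have K: "compact K" "K \<subseteq> B" by auto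
        then have "emeasure (restrict_to (F l) \<mu>) K = emeasure \<mu> (F l \<inter> K)" by (intro em) (simp add: borel_compact)
        also have "\<dots> \<le> ?S"
          by (rule SUP_upper) (use K F(2) in \<open>auto intro: compact_Int\<close>)
        finally show "emeasure (restrict_to (F l) \<mu>) K \<le> ?S" .
      qed
      finally show ?thesis .
    qed
    have "emeasure \<mu> B \<le> emeasure \<mu> ((\<Union>l. B \<inter> F l) \<union> (- (\<Union>l. F l)))"
      using B Fb by (intro emeasure_mono) (auto simp: sets_\<mu> borel_comp)
    also have "\<dots> \<le> emeasure \<mu> (\<Union>l. B \<inter> F l) + emeasure \<mu> (- (\<Union>l. F l))"
      using B Fb by (intro emeasure_subadditive) (auto simp: sets_\<mu> borel_comp)
    also have "\<dots> = (SUP l. emeasure \<mu> (B \<inter> F l))"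
      unfolding ex0 using B Fb F(1)
      by (subst SUP_emeasure_incseq) (auto simp: sets_\<mu> incseq_def)
    also have "\<dots> \<le> ?S" by (intro SUP_least inner)
    finally have "emeasure \<mu> B \<le> ?S" .
    moreover have "?S \<le> emeasure \<mu> B"
      using B by (intro SUP_least emeasure_mono) (auto simp: sets_\<mu>)
    ultimately show "emeasure \<mu> B = ?S" by (rule antisym)
  qed
  then show ?thesis
    unfolding Let_def
    by (intro conjI allI impI)
       (erule est(2), subst c(1), erule est(3), erule part2(1), erule part2(2))
qed

end
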